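(* Let $n\geq 2$. There exist $\kappa\in(0,1)$ and $\theta\in(0,1)$ such that the following holds. If $w\in W^{1,2}(B_1)$ is a homogeneous function of degree $\frac32$ such that $w\ge0$ on $B_1'$ and $\|w-h\|_{W^{1,2}(B_1)}\le\theta$, then there exists $\zeta\in W^{1,2}(B_1)$ such that $\zeta=w$ on $S_1$, $\zeta\ge0$ on $B_1'$, and $$W(\zeta)\le(1-\kappa)W(w).$$
   Context: Write $x=(x',x_n)\in\mathbb{R}^n$. $B_1$ and $S_1$ are the unit ball and unit sphere of $\mathbb{R}^n$ centered at $0$, and $B_1'=B_1\cap\{x_n=0\}$. The function $h$ is $h(x)=\operatorname{Re}(x_1+i|x_n|)^{3/2}$. For $w\in W^{1,2}(B_1)$ the boundary adjusted energy is $$W(w)=\int_{B_1}|\nabla w|^2-\frac32\int_{S_1}w^2 .$$ Values on $S_1$ and $B_1'$ are understood in the sense of traces. *)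

theory Defs
  imports "HOL-Analysis.Analysis"
begin

section \<open>Smooth functions and the space $W^{1,2}$\<close>

primrec Ck :: "nat \<Rightarrow> ('a::euclidean_space \<Rightarrow> real) \<Rightarrow> bool" where
  "Ck 0 f \<longleftrightarrow> continuous_on UNIV f"
| "Ck (Suc k) f \<longleftrightarrow> (\<forall>x. f differentiable (at x)) \<and>
     (\<forall>b\<in>Basis. Ck k (\<lambda>x. frechet_derivative f (at x) b))"

definition smooth :: "('a::euclidean_space \<Rightarrow> real) \<Rightarrow> bool" where
  "smooth f \<longleftrightarrow> (\<forall>k. Ck k f)"

definition test_function_on :: "'a::euclidean_space set \<Rightarrow> ('a \<Rightarrow> real) \<Rightarrow> bool" where
  "test_function_on U \<phi> \<longleftrightarrow> smooth \<phi> \<and>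
     compact (closure {x. \<phi> x \<noteq> 0}) \<and> closure {x. \<phi> x \<noteq> 0} \<subseteq> U"

definition L2 :: "'a measure \<Rightarrow> ('a \<Rightarrow> 'b::euclidean_space) set" where
  "L2 M = {f \<in> borel_measurable M. integrable M (\<lambda>x. (norm (f x))\<^sup>2)}"

text \<open>Elements of the Lebesgue and Sobolev spaces are represented by total functions; values
  outside the domain and on null sets are irrelevant.\<close>

definition has_weak_gradient ::
    "'a::euclidean_space set \<Rightarrow> ('a \<Rightarrow> real) \<Rightarrow> ('a \<Rightarrow> 'a) \<Rightarrow> bool" where
  "has_weak_gradient U w g \<longleftrightarrow> (\<forall>\<phi>. test_function_on U \<phi> \<longrightarrow> (\<forall>b\<in>Basis.
     (\<integral>x. w x * frechet_derivative \<phi> (at x) b \<partial>lebesgue_on U)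
       = - (\<integral>x. (g x \<bullet> b) * \<phi> x \<partial>lebesgue_on U)))"

definition W12 :: "'a::euclidean_space set \<Rightarrow> ('a \<Rightarrow> real) set" where
  "W12 U = {w \<in> L2 (lebesgue_on U). \<exists>g \<in> L2 (lebesgue_on U). has_weak_gradient U w g}"

text \<open>The weak gradient is determined only up to a null set; the choice is immaterial under
  integrals. The same applies to \<open>sobolev_trace\<close> below.\<close>

definition weak_gradient :: "'a::euclidean_space set \<Rightarrow> ('a \<Rightarrow> real) \<Rightarrow> 'a \<Rightarrow> 'a" where
  "weak_gradient U w = (SOME g. g \<in> L2 (lebesgue_on U) \<and> has_weak_gradient U w g)"

definition W12_norm :: "'a::euclidean_space set \<Rightarrow> ('a \<Rightarrow> real) \<Rightarrow> real" where
  "W12_norm U w = sqrt ((\<integral>x. (w x)\<^sup>2 \<partial>lebesgue_on U)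
     + (\<integral>x. (norm (weak_gradient U w x))\<^sup>2 \<partial>lebesgue_on U))"

section \<open>Traces\<close>

text \<open>A measure \<open>M\<close> on the ambient space, carried by a piece of hypersurface in the closure
  of \<open>U\<close>, plays the role of the surface measure of that piece. The trace is the
  \<open>L2 M\<close>-limit of the restrictions of smooth functions converging to \<open>w\<close> in \<open>W12 U\<close>.\<close>

definition has_trace ::
    "'a::euclidean_space set \<Rightarrow> 'a measure \<Rightarrow> ('a \<Rightarrow> real) \<Rightarrow> ('a \<Rightarrow> real) \<Rightarrow> bool" where
  "has_trace U M w g \<longleftrightarrow> g \<in> L2 M \<and>
     (\<exists>\<phi>::nat \<Rightarrow> 'a \<Rightarrow> real. (\<forall>k. smooth (\<phi> k)) \<and>
        (\<lambda>k. W12_norm U (\<lambda>x. \<phi> k x - w x)) \<longlonglongrightarrow> 0 \<and>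
        (\<lambda>k. \<integral>x. (\<phi> k x - g x)\<^sup>2 \<partial>M) \<longlonglongrightarrow> 0)"

definition sobolev_trace :: "'a::euclidean_space set \<Rightarrow> 'a measure \<Rightarrow> ('a \<Rightarrow> real) \<Rightarrow> 'a \<Rightarrow> real" where
  "sobolev_trace U M w = (SOME g. has_trace U M w g)"

text \<open>Surface measure on the unit sphere of a space of dimension \<open>d\<close>: the measure of \<open>A\<close> is
  \<open>d\<close> times the volume of the cone \<open>{x \<in> ball 0 1. x / norm x \<in> A}\<close>.\<close>

definition unit_sphere_measure :: "'a::euclidean_space measure" where
  "unit_sphere_measure =
     scale_measure (of_nat DIM('a)) (distr (restrict_space lborel (ball 0 1)) borel sgn)"

section \<open>The thin obstacle setting\<close>

text \<open>Points $x = (x', x_n)$ of $\mathbb{R}^n$ are elements of \<open>(real^'m) \<times> real\<close>, where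
  \<open>n = CARD('m) + 1\<close>. Since index types are nonempty, this covers precisely \<open>n \<ge> 2\<close>.
  The norm of the product type is the Euclidean one.\<close>

abbreviation B1 :: "((real^'m) \<times> real) set" where
  "B1 \<equiv> ball 0 1"

abbreviation S1_measure :: "((real^'m) \<times> real) measure" where
  "S1_measure \<equiv> unit_sphere_measure"

text \<open>The $(n-1)$-dimensional Lebesgue measure on the thin ball $B_1 \cap \{x_n = 0\}$, as a
  measure on the ambient space.\<close>

definition thin_ball_measure :: "((real^'m) \<times> real) measure" where
  "thin_ball_measure = distr (restrict_space lborel (ball 0 1)) borel (\<lambda>x'. (x', 0))"

text \<open>Homogeneity on the unit ball, for a function defined up to null sets.\<close>

definition homogeneous_on_B1 :: "real \<Rightarrow> ((real^'m) \<times> real \<Rightarrow> real) \<Rightarrow> bool" where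
  "homogeneous_on_B1 d w \<longleftrightarrow> (\<forall>t>0. AE x in lebesgue.
     x \<in> B1 \<longrightarrow> t *\<^sub>R x \<in> B1 \<longrightarrow> w (t *\<^sub>R x) = t powr d * w x)"

text \<open>The index \<open>i\<close> selects the coordinate $x_1$ of $x'$.\<close>

definition h_fun :: "'m::finite \<Rightarrow> (real^'m) \<times> real \<Rightarrow> real" where
  "h_fun i x = Re (Complex (fst x $ i) \<bar>snd x\<bar> powr (3/2))"

definition W_energy :: "((real^'m) \<times> real \<Rightarrow> real) \<Rightarrow> real" where
  "W_energy w = (\<integral>x. (norm (weak_gradient B1 w x))\<^sup>2 \<partial>lebesgue_on B1)
     - 3/2 * (\<integral>x. (sobolev_trace B1 S1_measure w x)\<^sup>2 \<partial>S1_measure)"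

end

(* The competitor is zeta = w - eps (1 - |x|^2) (w - H), where H >= 0 on the thin ball is a combination
  of Re (x.e + i|x_n|)^(3/2) and the functions (+-x_n)_+^(3/2), chosen such that v = w - H is
  orthogonal to all affine functions. On 3/2-homogeneous functions, W is the quadratic form of
  B(u, v) = int_B grad u . grad v - 3/2 (n + 3) int_B u v, and testing with (1 - |x|^2) v reproduces B:
  int_B grad u . grad ((1 - |x|^2) v) = 2/(n + 3) B(u, v). Hence
  W(zeta) = (1 - kappa) W(w) + kappa W(H) - kappa W(v) + O(eps^2) int |grad v|^2 with
  kappa = 2 eps/(n + 3). Here W(H) <= 0 by Green's formula, and W(v) >= 1/4 int |grad v|^2 by the
  spectral gap for functions orthogonal to affine ones, which is derived from that of the Gaussian
  measure. So the inequality holds with an eps depending only on n. *)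
theory Submission
 imports Defs "HOL-Probability.Probability" "HOL-Real_Asymp.Real_Asymp"
begin

text \<open>On 3/2-homogeneous functions W is diagonal in spherical harmonics, with the sign of l(l
  + n - 2) - 3/2 (n - 1/2) on degree l: negative for l = 0 and l = 1, positive from l = 2 on. Hence
  exactly the affine moments have to be removed before W controls the gradient. The obstacle is the
  sign on the thin ball: H must match n + 1 moments of w, have W(H) <= 0 and stay nonnegative where
  x_n = 0. The functions (+-x_n)_+^(3/2) vanish there, so their coefficients may have any sign; they
  fit the mean and the x_n moment. The tangential moment is a single vector, so one copy of h
  rotated into its direction fits it with a nonnegative coefficient. The gap for l >= 2 is proved
  without spherical harmonics. Ball and Gaussian integrals of a homogeneous function are
  proportional, affine functions span the first two levels of the Ornstein-Uhlenbeck operator, and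
  the next eigenvalue, 4, becomes 2 (n + 3) after comparing radial moments. The weight 1 - |x|^2
  vanishes on the sphere: it keeps the trace, and as a test weight it replaces boundary integrals by
  volume integrals.\<close>

section \<open>Calculus of smooth functions\<close>

definition pd :: "'a::euclidean_space => ('a => real) => 'a => real" where
 "pd b f x = frechet_derivative f (at x) b"

lemma Ck_Suc: "Ck (Suc k) f \<longleftrightarrow> (\<forall>x. f differentiable (at x)) \<and> (\<forall>b\<in>Basis. Ck k (pd b f))"
 by (simp add: pd_def[abs_def])

declare Ck.simps(2) [simp del]

lemma pd_eqI: "(f has_derivative f') (at x) ==> pd b f x = f' b"
 unfolding pd_def using frechet_derivative_at by metis

lemma Ck_imp_continuous: "Ck k f ==> continuous_on UNIV f"
 by (cases k) (auto simp: Ck_Suc intro!: continuous_at_imp_continuous_on differentiable_imp_continuous_within)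

lemma Ck_SucD: "Ck (Suc k) f ==> Ck k f"
proof (induction k arbitrary: f)
 case 0 then show ?case using Ck_imp_continuous by fastforce
next
 case (Suc k) then show ?case unfolding Ck_Suc[of "Suc k"] Ck_Suc[of k] by blast
qed

lemma differentiable_has_pd:
 assumes "f differentiable (at x)"
 shows "(f has_derivative (%h. frechet_derivative f (at x) h)) (at x)"
 using assms frechet_derivative_works by blast

lemma pd_const [simp]: "pd b (%x. c) = (%x. 0)"
 by (rule ext, subst pd_eqI[OF has_derivative_const]) simp

lemma pd_add:
 assumes "\<forall>x. f differentiable (at x)" "\<forall>x. g differentiable (at x)"
 shows "pd b (%x. f x + g x) = (%x. pd b f x + pd b g x)"
 by (rule ext, subst pd_eqI[OF has_derivative_add[OF differentiable_has_pd differentiable_has_pd]])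
   (use assms in \<open>auto simp: pd_def\<close>)

lemma pd_mult:
 assumes "\<forall>x. f differentiable (at x)" "\<forall>x. g differentiable (at x)"
 shows "pd b (%x. f x * g x) = (%x. f x * pd b g x + pd b f x * g x)"
 by (rule ext, subst pd_eqI[OF has_derivative_mult[OF differentiable_has_pd differentiable_has_pd]])
   (use assms in \<open>auto simp: pd_def\<close>)

lemma Ck_const: "Ck k (%x. c)"
 by (induction k arbitrary: c) (auto simp: Ck_Suc simp del: Ck.simps(2))

lemma Ck_add: "Ck k f ==> Ck k g ==> Ck k (%x. f x + g x)"
proof (induction k arbitrary: f g)
 case 0 then show ?case by (simp add: continuous_on_add)
next
 case (Suc k)
 then show ?case unfolding Ck_Suc by (auto simp: pd_add)
qed

lemma Ck_mult: "Ck k f ==> Ck k g ==> Ck k (%x. f x * g x)"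
proof (induction k arbitrary: f g)
 case 0 then show ?case by (simp add: continuous_on_mult)
next
 case (Suc k)
 have "Ck k f" "Ck k g" using Suc.prems by (auto dest: Ck_SucD)
 with Suc show ?case unfolding Ck_Suc by (auto simp: pd_mult intro!: Ck_add differentiable_mult)
qed

lemma Ck_linear:
 assumes "bounded_linear l" shows "Ck k l"
proof (cases k)
 case 0 then show ?thesis using assms by (simp add: linear_continuous_on)
next
 case (Suc j)
 have "pd b l = (%x. l b)" for b
  using pd_eqI[OF bounded_linear_imp_has_derivative[OF assms]] by auto
 then show ?thesis using Suc assms
  by (auto simp: Ck_Suc bounded_linear_imp_differentiable intro: Ck_const simp del: Ck.simps)
qed

lemma pd_compose:
 fixes F :: "real => real"
 assumes "\<forall>x. F differentiable (at x)" "\<forall>x. g differentiable (at x)"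
 shows "pd b (%x. F (g x)) = (%x. pd 1 F (g x) * pd b g x)"
proof (rule ext)
 fix x
 have F: "(F has_derivative frechet_derivative F (at (g x))) (at (g x))"
  using assms by (auto intro: differentiable_has_pd)
 then have lin: "linear (frechet_derivative F (at (g x)))"
  by (simp add: has_derivative_linear)
 have "((%x. F (g x)) has_derivative (%h. frechet_derivative F (at (g x)) (frechet_derivative g (at x) h))) (at x)"
  using has_derivative_compose[of g "frechet_derivative g (at x)", OF differentiable_has_pd F] assms by auto
 then have "pd b (%x. F (g x)) x = frechet_derivative F (at (g x)) (pd b g x *\<^sub>R 1)"
  by (subst pd_eqI) (auto simp: pd_def)
 also have "... = pd b g x * pd 1 F (g x)"
  using linear_scale[OF lin, of "pd b g x" 1] by (simp add: pd_def)
 finally show "pd b (%x. F (g x)) x = pd 1 F (g x) * pd b g x" by simp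
qed

text \<open>By the chain rule a partial derivative is a product whose first factor is again a
  composition, with the outer function replaced by its derivative; so both functions vary in the
  induction.\<close>

lemma Ck_compose:
 fixes F :: "real => real"
 shows "Ck k F ==> Ck k g ==> Ck k (%x. F (g x))"
proof (induction k arbitrary: F g)
 case 0 then show ?case by (auto intro: continuous_on_compose2)
next
 case (Suc k)
 have g: "Ck k g" using Suc.prems by (auto dest: Ck_SucD)
 have d: "\<forall>x. F differentiable (at x)" "\<forall>x. g differentiable (at x)" and
  c: "Ck k (pd 1 F)" "\<forall>b\<in>Basis. Ck k (pd b g)" using Suc.prems by (auto simp: Ck_Suc simp del: Ck.simps)
 have "Ck k (pd b (%x. F (g x)))" if "b \<in> Basis" for b
  unfolding pd_compose[OF d] using Suc.IH[OF c(1) g] c(2) that by (auto intro: Ck_mult)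
 moreover have "(%x. F (g x)) differentiable (at x)" for x
  using differentiable_chain_at[of g x F] d by (auto simp: o_def)
 ultimately show ?case by (auto simp: Ck_Suc simp del: Ck.simps)
qed

lemma smooth_const [simp]: "smooth (%x. c)" by (simp add: smooth_def Ck_const)
lemma smooth_add: "smooth f ==> smooth g ==> smooth (%x. f x + g x)" by (simp add: smooth_def Ck_add)
lemma smooth_mult: "smooth f ==> smooth g ==> smooth (%x. f x * g x)" by (simp add: smooth_def Ck_mult)
lemma smooth_linear: "bounded_linear f ==> smooth f" by (simp add: smooth_def Ck_linear)
lemma smooth_compose: "smooth (F::real => real) ==> smooth g ==> smooth (%x. F (g x))"
 by (simp add: smooth_def Ck_compose)
lemma smooth_minus: "smooth f ==> smooth (%x. - f x)"
 using smooth_mult[of "%x. -1" f] by simp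
lemma smooth_diff: "smooth f ==> smooth g ==> smooth (%x. f x - g x)"
 using smooth_add[of f "%x. - g x"] smooth_minus by auto
lemma smooth_sum: "finite I ==> (!!i. i \<in> I ==> smooth (f i)) ==> smooth (%x. \<Sum>i\<in>I. f i x)"
 by (induction I rule: finite_induct) (auto intro: smooth_add)
lemma smooth_inner: "smooth (%x. x \<bullet> b)"
 by (intro smooth_linear bounded_linear_inner_left)
lemma smooth_norm2: "smooth (%x::'a::euclidean_space. (norm x)^2)"
proof -
 have "(%x::'a. (norm x)^2) = (%x. \<Sum>b\<in>Basis. (x \<bullet> b) * (x \<bullet> b))"
  unfolding power2_norm_eq_inner by (rule ext, rule euclidean_inner)
 then show ?thesis by (auto intro!: smooth_sum smooth_mult smooth_inner)
qed

lemma smooth_pd: "smooth f ==> b \<in> Basis ==> smooth (pd b f)"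
 unfolding smooth_def by (metis Ck_Suc)
lemma smooth_differentiable: "smooth f ==> f differentiable (at x)"
 unfolding smooth_def by (metis Ck_Suc)
lemma smooth_continuous: "smooth f ==> continuous_on S f"
 unfolding smooth_def using Ck_imp_continuous continuous_on_subset by blast
lemma smooth_borel [measurable_dest]: "smooth f ==> f \<in> borel_measurable borel"
 using smooth_continuous borel_measurable_continuous_onI by blast

text \<open>Assembled from partial derivatives so that its components are smooth whenever
  \<open>f\<close> is, and so that it can be compared with a weak gradient coordinate by
  coordinate.\<close>

definition grad :: "('a::euclidean_space => real) => 'a => 'a" where
 "grad f x = (\<Sum>b\<in>Basis. pd b f x *\<^sub>R b)"

lemma grad_inner [simp]: "b \<in> Basis ==> grad f x \<bullet> b = pd b f x"
 by (simp add: grad_def inner_sum_left inner_Basis if_distrib sum.delta cong: if_cong)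

lemma smooth_has_derivative:
 assumes "smooth f" shows "(f has_derivative (%h. grad f x \<bullet> h)) (at x)"
proof -
 let ?D = "frechet_derivative f (at x)"
 have D: "(f has_derivative ?D) (at x)" using assms by (intro differentiable_has_pd smooth_differentiable)
 have "?D h = grad f x \<bullet> h" for h
 proof -
  have "?D h = ?D (\<Sum>b\<in>Basis. (h \<bullet> b) *\<^sub>R b)" by (simp add: euclidean_representation)
  also have "... = (\<Sum>b\<in>Basis. (h \<bullet> b) * ?D b)"
   using has_derivative_linear[OF D] by (simp add: linear_sum linear_scale)
  also have "... = grad f x \<bullet> h"
   unfolding grad_def inner_sum_left by (intro sum.cong) (auto simp: pd_def inner_commute)
  finally show ?thesis .
 qed
 then have "?D = (%h. grad f x \<bullet> h)" by blast
 with D show ?thesis by simp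
qed

lemma smooth_grad_continuous: "smooth f ==> continuous_on S (grad f)"
 unfolding grad_def[abs_def] by (intro continuous_intros smooth_continuous smooth_pd)

lemma grad_borel [measurable_dest]: "smooth f ==> grad f \<in> borel_measurable borel"
 using smooth_grad_continuous borel_measurable_continuous_onI by blast

lemma gradI: "(f has_derivative (%h. v \<bullet> h)) (at x) ==> grad f x = v"
 by (rule euclidean_eqI) (simp add: pd_eqI)

lemma grad_mult:
 assumes "smooth f" "smooth g"
 shows "grad (%x. f x * g x) x = f x *\<^sub>R grad g x + g x *\<^sub>R grad f x"
 by (rule gradI, rule has_derivative_eq_rhs[OF has_derivative_mult[OF smooth_has_derivative smooth_has_derivative]])
   (use assms in \<open>auto simp: inner_add_left algebra_simps\<close>)

lemma grad_add:
 assumes "smooth f" "smooth g"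
 shows "grad (%x. f x + g x) x = grad f x + grad g x"
 by (rule gradI, rule has_derivative_eq_rhs[OF has_derivative_add[OF smooth_has_derivative smooth_has_derivative]])
   (use assms in \<open>auto simp: inner_add_left algebra_simps\<close>)

lemma grad_scale:
 assumes "smooth f"
 shows "grad (%x. c * f x) x = c *\<^sub>R grad f x"
 by (rule gradI, rule has_derivative_eq_rhs[OF has_derivative_mult_right[OF smooth_has_derivative]])
   (use assms in auto)

lemma grad_diff:
 assumes "smooth f" "smooth g"
 shows "grad (%x. f x - g x) x = grad f x - grad g x"
 by (rule gradI, rule has_derivative_eq_rhs[OF has_derivative_diff[OF smooth_has_derivative smooth_has_derivative]])
   (use assms in \<open>auto simp: inner_diff_left algebra_simps\<close>)

lemma grad_const [simp]: "grad (%x. c) x = 0"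
 by (simp add: grad_def)

lemma grad_norm2: "grad (%x. (norm x)^2) x = 2 *\<^sub>R x"
 by (rule gradI) (auto intro!: derivative_eq_intros simp: power2_norm_eq_inner inner_commute)

text \<open>A partial derivative of the composition is \<open>c\<close> times an affine composition
  of a partial derivative, so the induction on the order has to range over all functions at
  once.\<close>

lemma smooth_affine:
 assumes "smooth f" shows "smooth (%x. f (a + c *\<^sub>R x))"
proof -
 have "Ck k f ==> Ck k (%x. f (a + c *\<^sub>R x))" for k and f :: "'a => real"
 proof (induction k arbitrary: f)
  case 0 then show ?case by (auto intro!: continuous_on_compose2[of UNIV f] continuous_intros)
 next
  case (Suc k)
  have d: "\<forall>x. f differentiable (at x)" and c: "\<forall>b\<in>Basis. Ck k (pd b f)"
   using Suc.prems by (auto simp: Ck_Suc simp del: Ck.simps)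
  have D: "((%x. f (a + c *\<^sub>R x)) has_derivative (%h. frechet_derivative f (at (a + c *\<^sub>R x)) (c *\<^sub>R h))) (at x)" for x
   by (rule has_derivative_compose[of "%x. a + c *\<^sub>R x" "%h. c *\<^sub>R h"])
     (use d in \<open>auto intro!: derivative_eq_intros differentiable_has_pd\<close>)
  have "pd b (%x. f (a + c *\<^sub>R x)) = (%x. c * pd b f (a + c *\<^sub>R x))" for b
   using pd_eqI[OF D, of b] d has_derivative_linear[OF differentiable_has_pd]
   by (subst (asm) linear_scale[of "frechet_derivative f (at (a + c *\<^sub>R x))" for x]) (auto simp: pd_def fun_eq_iff)
  then show ?case using Suc.IH c D unfolding Ck_Suc
   by (auto intro!: Ck_mult Ck_const exI simp: differentiable_def)
 qed
 then show ?thesis using assms by (auto simp: smooth_def)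
qed

lemma pd_affine:
 assumes "smooth f"
 shows "pd b (%x. f (a + c *\<^sub>R x)) x = c * pd b f (a + c *\<^sub>R x)"
proof -
 have D: "((%x. f (a + c *\<^sub>R x)) has_derivative (%h. grad f (a + c *\<^sub>R x) \<bullet> (c *\<^sub>R h))) (at x)"
  by (rule has_derivative_compose[of "%x. a + c *\<^sub>R x" "%h. c *\<^sub>R h"])
    (use assms in \<open>auto intro!: derivative_eq_intros smooth_has_derivative\<close>)
 show ?thesis
  using pd_eqI[OF D, of b] pd_eqI[OF smooth_has_derivative[OF assms, of "a + c *\<^sub>R x"], of b] by simp
qed

subsection \<open>Bump functions\<close>

text \<open>The family \<open>t\<^sup>-\<^sup>n exp (-1/t)\<close> is closed under derivatives up to linear combinations.\<close>

definition bumpe :: "nat => real => real" where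
 "bumpe n t = (if t > 0 then (1/t)^n * exp (- (1/t)) else 0)"

lemma bumpe_lim0: "((%t. (1/t)^n * exp (-(1/t))) \<longlongrightarrow> 0) (at_right (0::real))"
proof -
 have "((%s::real. s^n / exp s) \<longlongrightarrow> 0) at_top" by (rule tendsto_power_div_exp_0)
 then have "((%t::real. (inverse t)^n / exp (inverse t)) \<longlongrightarrow> 0) (at_right 0)"
  using filterlim_compose[OF _ filterlim_inverse_at_top_right] by blast
 then show ?thesis by (simp add: exp_minus divide_inverse)
qed

text \<open>For t > 0 the substitution s = 1/t reduces the claim to the derivative of s^n exp(-s).
  Only t = 0 is delicate, and there both one-sided difference quotients tend to 0.\<close>

lemma bumpe_deriv: "(bumpe n has_real_derivative (bumpe (n+2) t - real n * bumpe (n+1) t)) (at t)"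
proof -
 consider "t > 0" | "t < 0" | "t = 0" by linarith
 then show ?thesis
 proof cases
  case 1
  have "((%x. (1/x)^n * exp (- (1/x))) has_real_derivative
    (1/t)^(n+2) * exp (-(1/t)) - n * ((1/t)^(n+1) * exp (-(1/t)))) (at t)"
  proof -
   have A: "((%s. s^n * exp (- s)) has_real_derivative (real n * s^(n-1) - s^n) * exp (- s)) (at s)" for s
    by (auto intro!: derivative_eq_intros simp: algebra_simps)
   have B: "((%x. 1/x) has_real_derivative (- ((1/t)^2))) (at t)"
    using 1 by (auto intro!: derivative_eq_intros simp: power2_eq_square)
   have "(real n * s^(n-1) - s^n) * exp (- s) * (- (s^2)) = s^(n+2) * exp (- s) - n * (s^(n+1) * exp (- s))" for s :: real
    by (cases n) (auto simp: algebra_simps power2_eq_square)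
   with DERIV_chain2[OF A B] show ?thesis by simp
  qed
  from has_field_derivative_transform_within_open[OF this open_greaterThan[of 0], of "bumpe n"]
  show ?thesis using 1 by (simp add: bumpe_def)
 next
  case 2
  have "((%x. 0) has_real_derivative 0) (at t)" by simp
  from has_field_derivative_transform_within_open[OF this open_lessThan[of 0], of "bumpe n"]
  show ?thesis using 2 by (simp add: bumpe_def)
 next
  case 3
  \<comment> \<open>The quotient at 0 is again a member of the family, with the index raised by one,
    so \<open>bumpe_lim0\<close> applies to it.\<close>
  have r: "((%h. bumpe n h / h) \<longlongrightarrow> 0) (at_right 0)"
   using bumpe_lim0[of "Suc n"]
   by (rule Lim_transform_eventually) (auto simp: eventually_at_filter bumpe_def field_simps)
  have l: "((%h. bumpe n h / h) \<longlongrightarrow> 0) (at_left 0)"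
   by (rule Lim_transform_eventually[OF tendsto_const]) (auto simp: eventually_at_filter bumpe_def)
  have "((%h. bumpe n h / h) \<longlongrightarrow> 0) (at 0)" using r l filterlim_split_at by blast
  then show ?thesis using 3 unfolding DERIV_def by (simp add: bumpe_def)
 qed
qed

lemma smooth_bumpe: "smooth (bumpe n)"
proof -
 have "Ck k (bumpe n)" for k n
 proof (induction k arbitrary: n)
  case 0 show ?case by (simp, rule DERIV_continuous_on, rule bumpe_deriv)
 next
  case (Suc k)
  have "pd 1 (bumpe n) = (%t. bumpe (n+2) t + (- real n) * bumpe (n+1) t)"
   by (rule ext, subst pd_eqI[OF bumpe_deriv[unfolded has_field_derivative_def]]) auto
  then show ?case using Suc bumpe_deriv[of n] unfolding Ck_Suc
   using Ck_add[OF Suc[of "n+2"] Ck_mult[OF Ck_const[of k "- real n"] Suc[of "n+1"]]]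
   by (auto simp: real_differentiable_def)
 qed
 then show ?thesis by (simp add: smooth_def)
qed

lemma bumpe_nonneg: "bumpe n t >= 0" by (simp add: bumpe_def)
lemma bumpe_pos: "bumpe n t > 0 \<longleftrightarrow> t > 0" by (simp add: bumpe_def)

definition bump :: "'a::euclidean_space => real" where
 "bump x = bumpe 0 (1 - (norm x)^2)"

lemma smooth_bump: "smooth bump"
 unfolding bump_def[abs_def] by (intro smooth_compose[OF smooth_bumpe] smooth_diff smooth_const smooth_norm2)
lemma bump_nonneg: "bump x >= 0" by (simp add: bump_def bumpe_nonneg)
lemma bump_pos: "bump x > 0 \<longleftrightarrow> norm x < 1"
 by (simp add: bump_def bumpe_pos power_less_one_iff abs_square_less_1)
lemma bump_zero: "norm x >= 1 ==> bump x = 0"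
 using bump_pos[of x] bump_nonneg[of x] by linarith

section \<open>Test functions: supports, closure properties, bounds\<close>

lemma test_functionI:
 assumes "smooth f" "!!x. norm x >= r ==> f x = 0" "cball 0 r \<subseteq> U"
 shows "test_function_on U f"
proof -
 have s: "closure {x. f x ~= 0} \<subseteq> cball 0 r"
  by (rule closure_minimal[OF _ closed_cball]) (use assms(2) in \<open>force simp: not_le intro: less_imp_le\<close>)
 then have "compact (closure {x. f x ~= 0})"
  by (metis closed_closure compact_Int_closed compact_cball inf.absorb_iff2)
 with s assms show ?thesis by (auto simp: test_function_on_def)
qed

lemma test_functionD:
 assumes "test_function_on U f"
 shows "smooth f" "\<exists>r>0. \<forall>x. norm x >= r --> f x = 0" "!!x. x \<notin> U ==> f x = 0" 
proof -
 show "smooth f" using assms by (simp add: test_function_on_def)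
 have "bounded {x. f x ~= 0}"
  using assms unfolding test_function_on_def using bounded_subset[OF compact_imp_bounded closure_subset] by blast
 then obtain r where "r > 0" "\<forall>x\<in>{x. f x ~= 0}. norm x < r" using bounded_pos_less by blast
 then show "\<exists>r>0. \<forall>x. norm x >= r --> f x = 0" by force
 show "f x = 0" if "x \<notin> U" for x
  using assms that closure_subset[of "{x. f x ~= 0}"] by (auto simp: test_function_on_def)
qed

lemma test_pd_support:
 assumes "smooth f" "x \<notin> closure {x. f x ~= 0}"
 shows "pd b f x = 0"
proof -
 have "open (- closure {x. f x ~= 0})" by auto
 then have "eventually (%y. y \<in> - closure {x. f x ~= 0}) (nhds x)"
  using assms by (intro eventually_nhds_in_open) auto
 then have e: "eventually (%y. 0 = f y) (nhds x)"
  by (rule eventually_mono) (use closure_subset[of "{x. f x ~= 0}"] in auto)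
 have "((%x. 0) has_derivative (%h. 0)) (at x)" by simp
 then have "(f has_derivative (%h. 0)) (at x)"
  by (rule has_derivative_transform_eventually) (use e in \<open>auto simp: eventually_nhds_conv_at\<close>)
 then show ?thesis using pd_eqI by fastforce
qed

lemma closure_pd_support:
 assumes "smooth f" shows "closure {x. pd b f x ~= 0} \<subseteq> closure {x. f x ~= 0}"
 by (rule closure_minimal) (use test_pd_support[OF assms] in auto)

lemma compact_closure_mono: "compact (closure A) ==> closure B \<subseteq> closure A ==> compact (closure B)"
 using compact_Int_closed[of "closure A" "closure B"] by (simp add: inf_absorb2)

lemma test_function_pd:
 assumes "test_function_on U f" "b \<in> Basis" shows "test_function_on U (pd b f)"
 using assms closure_pd_support[of f b] compact_closure_mono[of "{x. f x ~= 0}" "{x. pd b f x ~= 0}"]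
 unfolding test_function_on_def by (auto intro: smooth_pd)

lemma test_function_mult:
 assumes "test_function_on U f" "smooth g" shows "test_function_on U (%x. f x * g x)"
proof -
 have "closure {x. f x * g x ~= 0} \<subseteq> closure {x. f x ~= 0}" by (rule closure_mono) auto
 then show ?thesis using assms compact_closure_mono[of "{x. f x ~= 0}" "{x. f x * g x ~= 0}"]
  unfolding test_function_on_def by (auto intro: smooth_mult)
qed

lemma test_function_mono: "test_function_on U f ==> U \<subseteq> V ==> test_function_on V f"
 by (auto simp: test_function_on_def)

lemma continuous_bounded_support:
 fixes f :: "'a::euclidean_space => 'b::real_normed_vector"
 assumes "continuous_on UNIV f" "!!x. norm x >= r ==> f x = 0"
 shows "\<exists>K>0. \<forall>x. norm (f x) <= K"
proof -
 have "bounded (f ` cball 0 r)"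
  using assms by (intro compact_imp_bounded compact_continuous_image) (auto intro: continuous_on_subset)
 then obtain K where "K > 0" "\<forall>x\<in>cball 0 r. norm (f x) <= K" by (auto simp: bounded_pos)
 then show ?thesis using assms(2) by (intro exI[of _ K]) (force simp: not_le)
qed

lemma test_function_bounded:
 assumes "test_function_on U f" shows "\<exists>K>0. \<forall>x. abs (f x) <= K"
proof -
 obtain r where "\<forall>x. norm x >= r --> f x = 0" using test_functionD[OF assms] by blast
 then show ?thesis
  using continuous_bounded_support[of f r] smooth_continuous[OF test_functionD(1)[OF assms]] by auto
qed

lemma test_function_grad_bounded:
 assumes "test_function_on U f" shows "\<exists>K>0. \<forall>x. norm (grad f x) <= K"
proof -
 obtain r where r: "r > 0" "\<forall>x. norm x >= r --> f x = 0" using test_functionD[OF assms] by blast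
 have "closure {x. f x ~= 0} \<subseteq> cball 0 r" by (rule closure_minimal[OF _ closed_cball]) (use r in \<open>force simp: not_le intro: less_imp_le\<close>)
 then have "pd b f x = 0" if "norm x >= r + 1" for b x
  by (rule_tac test_pd_support) (use that test_functionD[OF assms] in auto)
 then have "grad f x = 0" if "norm x >= r + 1" for x using that by (simp add: grad_def)
 then show ?thesis
  using continuous_bounded_support[of "grad f" "r+1"] smooth_grad_continuous test_functionD(1)[OF assms] by blast
qed

lemma smooth_lipschitz:
 assumes "smooth f" "convex S" "!!x. x \<in> S ==> norm (grad f x) <= K" "x \<in> S" "y \<in> S"
 shows "abs (f x - f y) <= K * norm (x - y)"
proof -
 have o: "onorm (%h. grad f z \<bullet> h) <= K" if "z \<in> S" for z
 proof (rule onorm_le)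
  fix h
  have "abs (grad f z \<bullet> h) <= norm (grad f z) * norm h" by (rule Cauchy_Schwarz_ineq2)
  also have "... <= K * norm h" using assms(3)[OF that] by (intro mult_right_mono) auto
  finally show "norm (grad f z \<bullet> h) <= K * norm h" by simp
 qed
 have "norm (f x - f y) <= K * norm (x - y)"
  by (rule differentiable_bound[OF assms(2) _ o])
    (use assms in \<open>auto intro: has_derivative_at_withinI smooth_has_derivative\<close>)
 then show ?thesis by simp
qed

subsection \<open>Affine changes of variables and translations\<close>

lemma lborel_nn_integral_affine:
 fixes t :: "'a::euclidean_space"
 assumes [measurable]: "f \<in> borel_measurable borel" and c: "c ~= 0"
 shows "(\<integral>\<^sup>+x. f x \<partial>lborel) = ennreal (abs c^DIM('a)) * (\<integral>\<^sup>+x. f (t + c *\<^sub>R x) \<partial>lborel)"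
proof -
 have "(\<integral>\<^sup>+x. f x \<partial>lborel) = (\<integral>\<^sup>+x. f x \<partial>density (distr lborel borel (%x. t + c *\<^sub>R x)) (%_. abs c^DIM('a)))"
  using lborel_affine[OF c, of t] by simp
 also have "... = (\<integral>\<^sup>+x. ennreal (abs c^DIM('a)) * f x \<partial>distr lborel borel (%x. t + c *\<^sub>R x))"
  by (subst nn_integral_density) auto
 also have "... = (\<integral>\<^sup>+x. ennreal (abs c^DIM('a)) * f (t + c *\<^sub>R x) \<partial>lborel)"
  by (subst nn_integral_distr) auto
 also have "... = ennreal (abs c^DIM('a)) * (\<integral>\<^sup>+x. f (t + c *\<^sub>R x) \<partial>lborel)"
  by (subst nn_integral_cmult) auto
 finally show ?thesis .
qed

lemma lborel_integrable_affine:
 fixes t :: "'a::euclidean_space" and f :: "'a => 'b::{banach,second_countable_topology}"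
 assumes [measurable]: "f \<in> borel_measurable borel" and c: "c ~= 0"
 shows "integrable lborel (%x. f (t + c *\<^sub>R x)) \<longleftrightarrow> integrable lborel f"
 unfolding integrable_iff_bounded
 using lborel_nn_integral_affine[of "%x. ennreal (norm (f x))" c t] c
 by (auto simp: ennreal_mult_less_top ennreal_zero_less_mult_iff less_top ennreal_mult_eq_top_iff)

lemma lborel_integral_affine:
 fixes t :: "'a::euclidean_space" and f :: "'a => 'b::{banach,second_countable_topology}"
 assumes [measurable]: "f \<in> borel_measurable borel" and c: "c ~= 0"
 shows "(LBINT x. f x) = (abs c^DIM('a)) *\<^sub>R (LBINT x. f (t + c *\<^sub>R x))"
proof -
 have "(LBINT x. f x) = (\<integral>x. f x \<partial>density (distr lborel borel (%x. t + c *\<^sub>R x)) (%_. abs c^DIM('a)))"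
  using lborel_affine[OF c, of t] by simp
 also have "... = (\<integral>x. (abs c^DIM('a)) *\<^sub>R f x \<partial>distr lborel borel (%x. t + c *\<^sub>R x))"
  by (subst integral_density) auto
 also have "... = (LBINT x. (abs c^DIM('a)) *\<^sub>R f (t + c *\<^sub>R x))"
  by (subst integral_distr) auto
 finally show ?thesis by simp
qed

lemma AE_lborel_affine:
 fixes t :: "'a::euclidean_space"
 assumes "AE x in lborel. P x" "c ~= 0"
 shows "AE x in lborel. P (t + c *\<^sub>R x)"
proof -
 obtain N where N: "N \<in> null_sets lborel" "{x. \<not> P x} \<subseteq> N"
  using assms(1) by (auto simp: eventually_ae_filter)
 have [measurable]: "N \<in> sets borel" using N by auto
 have "(\<integral>\<^sup>+x. indicator N x \<partial>lborel) = ennreal (abs c^DIM('a)) * (\<integral>\<^sup>+x. indicator N (t + c *\<^sub>R x) \<partial>lborel)"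
  by (rule lborel_nn_integral_affine) (use assms in auto)
 moreover have "(\<integral>\<^sup>+x. indicator N x \<partial>lborel) = 0" using N by (simp add: null_sets_def)
 ultimately have "(\<integral>\<^sup>+x. indicator N (t + c *\<^sub>R x) \<partial>lborel) = 0" using assms by simp
 then have "AE x in lborel. indicator N (t + c *\<^sub>R x) = (0::ennreal)"
  by (subst (asm) nn_integral_0_iff_AE) auto
 then show ?thesis by eventually_elim (use N in \<open>auto split: split_indicator_asm\<close>)
qed

lemma lborel_integral_translate:
 fixes c :: "'a::euclidean_space" and f :: "'a => 'b::{banach,second_countable_topology}"
 assumes "f \<in> borel_measurable borel"
 shows "(LBINT x. f (x + c)) = (LBINT x. f x)"
 using lborel_integral_affine[OF assms, of 1 c] by (simp add: add.commute)

lemma lborel_integrable_translate: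
 fixes c :: "'a::euclidean_space" and f :: "'a => 'b::{banach,second_countable_topology}"
 assumes "integrable lborel f"
 shows "integrable lborel (%x. f (x + c))"
 using lborel_integrable_affine[of f 1 c] assms by (simp add: add.commute)

text \<open>The integral of the difference is twice the measure of \<open>U\<close> minus its
  overlap with the translate. Openness makes the product of the two indicators converge at every
  point of \<open>U\<close>, so the boundary of \<open>U\<close> never has to be examined.\<close>

lemma indicator_translate_L1:
 fixes U :: "'a::euclidean_space set"
 assumes U: "open U" "emeasure lborel U < \<infinity>" and h: "h \<longlonglongrightarrow> 0"
 shows "(%n. (LBINT x. abs (indicator U (x + h n) - indicator U x))) \<longlonglongrightarrow> (0::real)"
proof -
 have [measurable]: "U \<in> sets borel" using U by simp
 have iU: "integrable lborel (indicator U :: 'a => real)" using U by (simp add: integrable_real_indicator)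
 have i2: "integrable lborel (%x. indicator U x * indicator U (x + h n) :: real)" for n
  by (rule Bochner_Integration.integrable_bound[OF iU]) (auto split: split_indicator)
 have "(%n. (LBINT x. indicator U x * indicator U (x + h n))) \<longlonglongrightarrow> ((LBINT x. indicator U x) :: real)"
 proof (rule integral_dominated_convergence[where w="indicator U"])
  show "AE x in lborel. (%n. indicator U x * indicator U (x + h n) :: real) \<longlonglongrightarrow> indicator U x"
  proof (rule AE_I2)
   fix x
   show "(%n. indicator U x * indicator U (x + h n) :: real) \<longlonglongrightarrow> indicator U x"
   proof (cases "x \<in> U")
    case True
    have "(%n. x + h n) \<longlonglongrightarrow> x + 0" by (intro tendsto_intros h)
    then have "eventually (%n. x + h n \<in> U) sequentially"
     using U True by (intro topological_tendstoD) auto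
    then have "eventually (%n. indicator U x * indicator U (x + h n) = (indicator U x :: real)) sequentially"
     by eventually_elim (use True in auto)
    then show ?thesis by (rule tendsto_eventually)
   qed simp
  qed
 qed (use iU in \<open>auto split: split_indicator\<close>)
 moreover have "(LBINT x. abs (indicator U (x + h n) - indicator U x)) =
   2 * ((LBINT x. indicator U x) - ((LBINT x. indicator U x * indicator U (x + h n)) :: real))" for n
 proof -
  have "(LBINT x. abs (indicator U (x + h n) - indicator U x)) =
   (LBINT x. indicator U (x + h n) + indicator U x - 2 * (indicator U x * indicator U (x + h n) :: real))"
   by (intro Bochner_Integration.integral_cong) (auto split: split_indicator)
  also have "... = (LBINT x. indicator U (x + h n)) + (LBINT x. indicator U x) - 2 * (LBINT x. indicator U x * indicator U (x + h n))"
   using iU i2[of n] lborel_integrable_translate[OF iU, of "h n"] by simp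
  finally show ?thesis using lborel_integral_translate[of "indicator U :: 'a => real" "h n"] by simp
 qed
 ultimately show ?thesis
  by (auto intro!: tendsto_eq_intros)
qed

lemma L1_translate:
 fixes f :: "'a::euclidean_space => real"
 assumes f: "integrable lborel f" and h: "h \<longlonglongrightarrow> 0"
 shows "(%n. (LBINT x. abs (f (x + h n) - f x))) \<longlonglongrightarrow> 0"
 using f
proof induction
 case (base A c)
 have [measurable]: "A \<in> sets borel" using base by simp
 show ?case
 proof (rule LIMSEQ_I)
  fix r :: real assume r: "r > 0"
  \<comment> \<open>Four portions of \<open>e\<close> are spent: one for \<open>D = U - A\<close>,
    one for its translate and two for the translation of \<open>U\<close>. The summand 1 covers the
    case c = 0 and makes the final inequality strict.\<close>
  define e where "e = r / (4 * (abs c + 1))"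
  have e: "e > 0" using r by (auto simp: e_def)
  obtain U where U: "open U" "A \<subseteq> U" "emeasure lborel (U - A) < ennreal e"
   using outer_regular_lborel[of A e] base e by auto
  have [measurable]: "U \<in> sets borel" using U by simp
  have fin: "emeasure lborel (U - A) < \<infinity>" using U(3) by (simp add: order_less_trans)
  have "emeasure lborel U = emeasure lborel A + emeasure lborel (U - A)"
   using U by (subst plus_emeasure) (auto intro!: arg_cong[where f="emeasure lborel"])
  then have Uf: "emeasure lborel U < \<infinity>" using base fin by simp
  define D where "D = U - A"
  have iD: "integrable lborel (indicator D :: 'a => real)" using fin by (simp add: D_def integrable_real_indicator)
  have iU: "integrable lborel (indicator U :: 'a => real)" using Uf by (simp add: integrable_real_indicator)
  have mD: "(LBINT x. indicator D x) < e"
   using U(3) e fin by (simp add: D_def measure_def enn2real_less_iff top.not_eq_extremum)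
  obtain N where N: "\<forall>n\<ge>N. norm ((LBINT x. abs (indicator U (x + h n) - indicator U x)) - 0 :: real) < 2 * e"
   using LIMSEQ_D[OF indicator_translate_L1[OF U(1) Uf h], of "2 * e"] e by auto
  have "(LBINT x. abs (indicator A (x + h n) *\<^sub>R c - indicator A x *\<^sub>R c)) < r" if "n >= N" for n
  proof -
   let ?g = "%x. abs c * (indicator D (x + h n) + abs (indicator U (x + h n) - indicator U x) + indicator D x) :: real"
   have ig: "integrable lborel ?g" 
    using iD iU by (intro integrable_mult_right Bochner_Integration.integrable_add lborel_integrable_translate integrable_abs Bochner_Integration.integrable_diff)
   have "(LBINT x. abs (indicator A (x + h n) *\<^sub>R c - indicator A x *\<^sub>R c)) <= integral\<^sup>L lborel ?g"
    by (rule integral_mono'[OF ig]) (use U in \<open>auto simp: D_def split: split_indicator\<close>)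
   also have "... = abs c * ((LBINT x. indicator D (x + h n)) + (LBINT x. abs (indicator U (x + h n) - indicator U x)) + (LBINT x. indicator D x))"
    using iD iU lborel_integrable_translate[OF iD, of "h n"] lborel_integrable_translate[OF iU, of "h n"] by simp
   also have "(LBINT x. indicator D (x + h n)) = ((LBINT x. indicator D x) :: real)"
    using lborel_integral_translate[of "indicator D :: 'a => real" "h n"] by (simp add: D_def)
   also have "abs c * ((LBINT x. indicator D x) + (LBINT x. abs (indicator U (x + h n) - indicator U x)) + (LBINT x. indicator D x))
     <= abs c * (e + 2 * e + e)"
    using mD N that by (intro mult_left_mono add_mono) (auto simp: less_imp_le)
   also have "... < (abs c + 1) * (4 * e)" using e by (simp add: algebra_simps)
   also have "... = r"
   proof -
    have "abs c + 1 ~= 0" by linarith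
    moreover have "k ~= 0 ==> k * (4 * (r / (4 * k))) = r" for k :: real by simp
    ultimately show ?thesis unfolding e_def by blast
   qed
   finally show ?thesis .
  qed
  then show "\<exists>no. \<forall>n\<ge>no. norm ((LBINT x. abs (indicator A (x + h n) *\<^sub>R c - indicator A x *\<^sub>R c)) - 0) < r"
   by auto
 qed
next
 case (add f g)
 have "(%n. (LBINT x. abs (f (x + h n) - f x)) + (LBINT x. abs (g (x + h n) - g x))) \<longlonglongrightarrow> 0 + 0"
  by (intro tendsto_intros add)
 then have l: "(%n. (LBINT x. abs (f (x + h n) - f x)) + (LBINT x. abs (g (x + h n) - g x))) \<longlonglongrightarrow> 0" by simp
 have i: "integrable lborel (%x. abs (f (x + h n) - f x))" "integrable lborel (%x. abs (g (x + h n) - g x))" for n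
  using add by (auto intro!: integrable_abs Bochner_Integration.integrable_diff lborel_integrable_translate)
 have le: "(LBINT x. abs (f (x + h n) + g (x + h n) - (f x + g x))) <= (LBINT x. abs (f (x + h n) - f x)) + (LBINT x. abs (g (x + h n) - g x))" for n
 proof -
  have "(LBINT x. abs (f (x + h n) + g (x + h n) - (f x + g x))) <= (LBINT x. abs (f (x + h n) - f x) + abs (g (x + h n) - g x))"
   by (rule integral_mono') (use i in auto)
  then show ?thesis using i by simp
 qed
 show ?case by (rule tendsto_sandwich[OF _ _ tendsto_const l]) (use le in auto)
next
 case (lim f s)
 have i: "integrable lborel (%x. abs (s k x - f x))" for k using lim by auto
 \<comment> \<open>The simple approximations satisfy |s k| \<le> 2 |f|, which explains the
   dominating function 3 |f|.\<close>
 have c: "(%k. (LBINT x. abs (s k x - f x))) \<longlonglongrightarrow> (\<integral>x. 0 \<partial>(lborel::'a measure))"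
 proof (rule integral_dominated_convergence[where w="%x. 3 * abs (f x)"])
  show "AE x in lborel. (%k. abs (s k x - f x)) \<longlonglongrightarrow> 0"
   using lim.hyps(2) by (intro AE_I2) (auto intro!: tendsto_rabs_zero LIM_zero)
  show "AE x in lborel. norm (abs (s k x - f x)) <= 3 * abs (f x)" for k
  proof (rule AE_I2)
   fix x show "norm (abs (s k x - f x)) <= 3 * abs (f x)" using lim.hyps(3)[of x k] by auto
  qed
 qed (use lim in auto)
 show ?case
 proof (rule LIMSEQ_I)
  fix r :: real assume r: "r > 0"
  obtain k where k: "abs ((LBINT x. abs (s k x - f x))) < r / 4"
   using LIMSEQ_D[OF c, of "r/4"] r by auto
  obtain N where N: "\<forall>n\<ge>N. norm ((LBINT x. abs (s k (x + h n) - s k x)) - 0) < r / 4"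
   using LIMSEQ_D[OF lim.IH[of k], of "r/4"] r by auto
  have "(LBINT x. abs (f (x + h n) - f x)) < r" if "n >= N" for n
  proof -
   have j: "integrable lborel (%x. abs (s k (x + h n) - f (x + h n)))" "integrable lborel (%x. abs (s k (x + h n) - s k x))"
    using lim lborel_integrable_translate[OF i] by (auto intro!: integrable_abs Bochner_Integration.integrable_diff lborel_integrable_translate)
   have "(LBINT x. abs (f (x + h n) - f x)) <= (LBINT x. abs (s k (x + h n) - f (x + h n)) + abs (s k (x + h n) - s k x) + abs (s k x - f x))"
    by (rule integral_mono') (use i j in auto)
   also have "... = (LBINT x. abs (s k (x + h n) - f (x + h n))) + (LBINT x. abs (s k (x + h n) - s k x)) + (LBINT x. abs (s k x - f x))"
    using i j by simp
   also have "(LBINT x. abs (s k (x + h n) - f (x + h n))) = (LBINT x. abs (s k x - f x))"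
    using lborel_integral_translate[of "%x. abs (s k x - f x)" "h n"] i[of k] by (auto dest: borel_measurable_integrable)
   finally show ?thesis using k N[rule_format, OF that] r by (simp add: abs_less_iff)
  qed
  then show "\<exists>no. \<forall>n\<ge>no. norm ((LBINT x. abs (f (x + h n) - f x)) - 0) < r" by auto
 qed
qed

text \<open>The L2 statement follows from the L1 statement for \<open>f (abs f)\<close>.\<close>

lemma sq_diff_le: "((a::real) - b)^2 <= 2 * abs (a * abs a - b * abs b)"
proof -
 have *: "(a - b)^2 <= 2 * abs (a * abs a - b * abs b)" if "a >= b" for a b :: real
 proof -
  consider "b >= 0" | "a <= 0" | "a >= 0" "b <= 0" using that by linarith
  then show ?thesis
  proof cases
   case 1
   have "0 <= b * (a - b)" "0 <= (a - b) * (a + b)" using 1 that by auto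
   then show ?thesis using 1 that by (simp add: power2_eq_square algebra_simps)
  next
   case 2
   have "0 <= (- a) * (a - b)" "0 <= (a - b) * (-a - b)" using 2 that by (auto intro!: mult_nonneg_nonneg mult_nonpos_nonneg)
   then show ?thesis using 2 that by (simp add: power2_eq_square algebra_simps)
  next
   case 3
   have "0 <= (a + b)^2" by simp
   then show ?thesis using 3 by (simp add: power2_eq_square algebra_simps)
  qed
 qed
 show ?thesis using *[of b a] *[of a b] by (cases "a >= b") (auto simp: power2_commute abs_minus_commute)
qed

lemma L2_sq_integrable_diff:
 fixes f g :: "'a => real"
 assumes [measurable]: "f \<in> borel_measurable M" "g \<in> borel_measurable M"
  and "integrable M (%x. (f x)^2)" "integrable M (%x. (g x)^2)"
 shows "integrable M (%x. (f x - g x)^2)" "integrable M (%x. (f x + g x)^2)" "integrable M (%x. f x * g x)"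
proof -
 have i: "integrable M (%x. 2 * (f x)^2 + 2 * (g x)^2)" using assms by auto
 have "(a - b)^2 <= 2 * a\<^sup>2 + 2 * b\<^sup>2" "(a + b)^2 <= 2 * a\<^sup>2 + 2 * b\<^sup>2" "abs (a * b) <= 2 * a\<^sup>2 + 2 * b\<^sup>2" for a b :: real
  using sum_squares_ge_zero[of "a+b" "a-b"] zero_le_power2[of "a+b"] zero_le_power2[of "a-b"]
  by (auto simp: power2_eq_square algebra_simps abs_if)
 then show "integrable M (%x. (f x - g x)^2)" "integrable M (%x. (f x + g x)^2)" "integrable M (%x. f x * g x)"
  by (auto intro!: Bochner_Integration.integrable_bound[OF i] AE_I2)
qed

lemma L2_translate:
 fixes f :: "'a::euclidean_space => real"
 assumes [measurable]: "f \<in> borel_measurable borel" and f: "integrable lborel (%x. (f x)^2)" and h: "h \<longlonglongrightarrow> 0"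
 shows "(%n. (LBINT x. (f (x + h n) - f x)^2)) \<longlonglongrightarrow> 0"
proof -
 define F where "F x = f x * abs (f x)" for x
 have F: "integrable lborel F"
  by (rule Bochner_Integration.integrable_bound[OF f]) (auto simp: F_def[abs_def] abs_mult power2_eq_square)
 have i: "integrable lborel (%x. 2 * abs (F (x + h n) - F x))" for n
  using F by (intro integrable_mult_right integrable_abs Bochner_Integration.integrable_diff lborel_integrable_translate)
 have le: "(LBINT x. (f (x + h n) - f x)^2) <= 2 * (LBINT x. abs (F (x + h n) - F x))" for n
 proof -
  have "(LBINT x. (f (x + h n) - f x)^2) <= (LBINT x. 2 * abs (F (x + h n) - F x))"
   by (rule integral_mono'[OF i]) (auto simp: F_def sq_diff_le)
  then show ?thesis by simp
 qed
 have l: "(%n. 2 * (LBINT x. abs (F (x + h n) - F x))) \<longlonglongrightarrow> 0"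
  using tendsto_mult_left[OF L1_translate[OF F h], of 2] by simp
 show ?thesis by (rule tendsto_sandwich[OF _ _ tendsto_const l]) (use le in auto)
qed

lemma L2_translate_uniform:
 fixes f :: "'a::euclidean_space => real"
 assumes [measurable]: "f \<in> borel_measurable borel" and f: "integrable lborel (%x. (f x)^2)" and e: "e > 0"
 shows "\<exists>d>0. \<forall>h. norm h < d --> (LBINT x. (f (x + h) - f x)^2) < e"
proof (rule ccontr)
 assume "\<not> ?thesis"
 then have "\<exists>h. norm h < 1 / Suc n \<and> \<not> (LBINT x. (f (x + h) - f x)^2) < e" for n
  by (meson of_nat_0_less_iff zero_less_Suc zero_less_divide_1_iff)
 then obtain h where h: "norm (h n) < 1 / Suc n" "\<not> (LBINT x. (f (x + h n) - f x)^2) < e" for n by metis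
 have "h \<longlonglongrightarrow> 0"
  by (rule tendsto_norm_zero_cancel, rule tendsto_sandwich[OF _ _ tendsto_const LIMSEQ_Suc[OF lim_1_over_n]])
    (use h(1) in \<open>auto simp: less_imp_le intro!: always_eventually\<close>)
 from LIMSEQ_D[OF L2_translate[OF assms(1) f this] e] h(2) show False by force
qed

subsection \<open>Convolution with test functions\<close>

lemma test_integrable:
 assumes "test_function_on U rho" shows "integrable lborel rho"
proof -
 obtain r where r: "!!x. norm x >= r ==> rho x = 0" using test_functionD[OF assms] by blast
 have "integrable lborel (%x. indicator (cball 0 r) x *\<^sub>R rho x)"
  by (rule borel_integrable_compact) (use test_functionD(1)[OF assms] smooth_continuous in auto)
 also have "(%x. indicator (cball 0 r) x *\<^sub>R rho x) = rho"
  using r by (auto simp: fun_eq_iff split: split_indicator)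
 finally show ?thesis .
qed

lemma test_grad_lipschitz:
 assumes t: "test_function_on U rho"
 shows "\<exists>L>0. \<forall>x y. norm (grad rho x - grad rho y) <= L * norm (x - y)"
proof -
 have "\<exists>K. \<forall>x y. abs (pd b rho x - pd b rho y) <= K * norm (x - y)" if "b \<in> Basis" for b
 proof -
  have tb: "test_function_on U (pd b rho)" using test_function_pd[OF t that] .
  obtain K where "\<forall>x. norm (grad (pd b rho) x) <= K" using test_function_grad_bounded[OF tb] by blast
  then show ?thesis using smooth_lipschitz[OF test_functionD(1)[OF tb], of UNIV K] by auto
 qed
 then obtain K where K: "!!b x y. b \<in> Basis ==> abs (pd b rho x - pd b rho y) <= K b * norm (x - y)" by metis
 have "norm (grad rho x - grad rho y) <= ((\<Sum>b\<in>Basis. abs (K b)) + 1) * norm (x - y)" for x y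
 proof -
  have "norm (grad rho x - grad rho y) <= (\<Sum>b\<in>Basis. abs ((grad rho x - grad rho y) \<bullet> b))" by (rule norm_le_l1)
  also have "... <= (\<Sum>b\<in>Basis. abs (K b) * norm (x - y))"
  proof (rule sum_mono)
   fix b :: 'a assume b: "b \<in> Basis"
   have "abs (pd b rho x - pd b rho y) <= abs (K b) * norm (x - y)"
    using K[OF b, of x y] by (meson abs_ge_self mult_right_mono norm_ge_zero order_trans)
   then show "abs ((grad rho x - grad rho y) \<bullet> b) <= abs (K b) * norm (x - y)" using b by (simp add: inner_diff_left)
  qed
  also have "... <= ((\<Sum>b\<in>Basis. abs (K b)) + 1) * norm (x - y)"
   unfolding distrib_right sum_distrib_right by simp
  finally show ?thesis .
 qed
 moreover have "(\<Sum>b\<in>Basis. abs (K b)) + 1 > 0" by (smt (verit) sum_nonneg abs_ge_zero)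
 ultimately show ?thesis by blast
qed

text \<open>The gradient of a test function is globally Lipschitz, so the quadratic remainder is
  uniform in the base point; integrated against an integrable \<open>u\<close> it yields the
  derivative of a convolution.\<close>

lemma test_taylor:
 assumes t: "test_function_on U rho"
 shows "\<exists>L>0. \<forall>z h. abs (rho (z + h) - rho z - grad rho z \<bullet> h) <= L * (norm h)^2"
proof -
 obtain L where L: "L > 0" "!!x y. norm (grad rho x - grad rho y) <= L * norm (x - y)"
  using test_grad_lipschitz[OF t] by blast
 have "abs (rho (z + h) - rho z - grad rho z \<bullet> h) <= L * (norm h)^2" for z h
 proof -
  have D: "((%w. rho w - grad rho z \<bullet> w) has_derivative (%k. (grad rho w - grad rho z) \<bullet> k)) (at w within cball z (norm h))" for w
   by (rule has_derivative_eq_rhs[OF has_derivative_diff[OF has_derivative_at_withinI[OF smooth_has_derivative] has_derivative_inner_right[OF has_derivative_ident]]])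
     (use test_functionD(1)[OF t] in \<open>auto simp: inner_diff_left\<close>)
  have "norm ((rho (z + h) - grad rho z \<bullet> (z + h)) - (rho z - grad rho z \<bullet> z)) <= (L * norm h) * norm (z + h - z)"
  proof (rule differentiable_bound[OF convex_cball D])
   fix w assume w: "w \<in> cball z (norm h)"
   show "onorm (%k. (grad rho w - grad rho z) \<bullet> k) <= L * norm h"
   proof (rule onorm_le)
    fix k
    have "norm ((grad rho w - grad rho z) \<bullet> k) <= norm (grad rho w - grad rho z) * norm k"
     using Cauchy_Schwarz_ineq2 by auto
    also have "... <= (L * norm (w - z)) * norm k" by (intro mult_right_mono L) auto
    also have "... <= (L * norm h) * norm k"
     using w L(1) by (intro mult_right_mono mult_left_mono) (auto simp: dist_norm norm_minus_commute)
    finally show "norm ((grad rho w - grad rho z) \<bullet> k) <= L * norm h * norm k" .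
   qed
  qed (auto simp: dist_norm)
  then show ?thesis by (simp add: inner_add_right power2_eq_square algebra_simps)
 qed
 then show ?thesis using L(1) by blast
qed

definition conv :: "('a::euclidean_space => real) => ('a => real) => 'a => real" where
 "conv u rho x = (LBINT y. u y * rho (x - y))"

lemma conv_integrable:
 assumes u: "integrable lborel u" and t: "test_function_on U rho"
 shows "integrable lborel (%y. u y * rho (x - y))"
proof -
 obtain K where K: "!!x. abs (rho x) <= K" using test_function_bounded[OF t] by blast
 have [measurable]: "rho \<in> borel_measurable borel" "u \<in> borel_measurable lborel"
  using test_functionD(1)[OF t] smooth_borel u by auto
 show ?thesis
  by (rule Bochner_Integration.integrable_bound[of _ "%y. K * u y"])
    (use u K in \<open>auto simp: abs_mult mult.commute[of K] intro!: mult_left_mono AE_I2 order_trans[OF K abs_ge_self]\<close>)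
qed

text \<open>Integrating the uniform Taylor remainder of \<open>rho\<close> against |u| bounds the
  error by a multiple of |h|^2, so the derivative passes under the integral with an explicit
  rate.\<close>

lemma conv_has_derivative:
 assumes u: "integrable lborel u" and t: "test_function_on U rho"
 shows "(conv u rho has_derivative (%h. \<Sum>b\<in>Basis. conv u (pd b rho) x * (h \<bullet> b))) (at x)"
proof -
 obtain L where L: "L > 0" "!!z h. abs (rho (z + h) - rho z - grad rho z \<bullet> h) <= L * (norm h)^2"
  using test_taylor[OF t] by blast
 define H where "H y = (LBINT z. abs (u z)) * L * norm (y - x)" for y
 have H: "norm (conv u rho y - conv u rho x - (\<Sum>b\<in>Basis. conv u (pd b rho) x * ((y - x) \<bullet> b))) / norm (y - x) <= H y"
  if "y ~= x" for y
 proof -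
  let ?h = "y - x"
  have ib: "integrable lborel (%z. (u z * pd b rho (x - z)) * (?h \<bullet> b))" if "b \<in> Basis" for b
   using conv_integrable[OF u test_function_pd[OF t that]] by simp
  have iss: "integrable lborel (%z. \<Sum>b\<in>Basis. (u z * pd b rho (x - z)) * (?h \<bullet> b))"
   using ib by (intro Bochner_Integration.integrable_sum) auto
  have s: "(\<Sum>b\<in>Basis. conv u (pd b rho) x * (?h \<bullet> b)) = (LBINT z. (\<Sum>b\<in>Basis. (u z * pd b rho (x - z)) * (?h \<bullet> b)))"
   unfolding conv_def using ib by (subst Bochner_Integration.integral_sum) auto
  have g: "(\<Sum>b\<in>Basis. (u z * pd b rho (x - z)) * (?h \<bullet> b)) = u z * (grad rho (x - z) \<bullet> ?h)" for z
   unfolding grad_def inner_sum_left sum_distrib_left by (intro sum.cong) (auto simp: inner_commute)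
  have ig: "integrable lborel (%z. u z * (grad rho (x - z) \<bullet> ?h))" using iss unfolding g .
  have "conv u rho y - conv u rho x - (\<Sum>b\<in>Basis. conv u (pd b rho) x * (?h \<bullet> b))
   = (LBINT z. u z * rho (y - z) - u z * rho (x - z) - u z * (grad rho (x - z) \<bullet> ?h))"
   unfolding s g unfolding conv_def using conv_integrable[OF u t] ig by simp
  also have "abs (...) <= (LBINT z. abs (u z) * (L * (norm ?h)^2))"
  proof (rule order_trans[OF integral_abs_bound], rule integral_mono')
   show "integrable lborel (%z. abs (u z) * (L * (norm ?h)^2))" using u by simp
   fix z
   have "abs (u z * rho (y - z) - u z * rho (x - z) - u z * (grad rho (x - z) \<bullet> ?h))
    = abs (u z) * abs (rho ((x - z) + ?h) - rho (x - z) - grad rho (x - z) \<bullet> ?h)"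
    unfolding abs_mult[symmetric] by (simp add: algebra_simps)
   also have "... <= abs (u z) * (L * (norm ?h)^2)" by (intro mult_left_mono L) auto
   finally show "abs (u z * rho (y - z) - u z * rho (x - z) - u z * (grad rho (x - z) \<bullet> ?h)) <= abs (u z) * (L * (norm ?h)^2)" .
  qed (use L(1) in auto)
  also have "... = H y * norm ?h" by (simp add: H_def power2_eq_square)
  finally show ?thesis using that by (simp add: divide_le_eq)
 qed
 have lin: "bounded_linear (%h. \<Sum>b\<in>Basis. conv u (pd b rho) x * (h \<bullet> b))"
  by (intro bounded_linear_intros)
 have lim: "(H \<longlongrightarrow> 0) (at x)"
  unfolding H_def[abs_def] by (auto intro!: tendsto_eq_intros)
 show ?thesis
  by (rule has_derivativeI_sandwich[OF zero_less_one lin H lim])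
qed

lemma conv_pd:
 assumes "integrable lborel u" "test_function_on U rho" "b \<in> Basis"
 shows "pd b (conv u rho) = conv u (pd b rho)"
proof (rule ext)
 fix x
 show "pd b (conv u rho) x = conv u (pd b rho) x"
  using pd_eqI[OF conv_has_derivative[OF assms(1,2), of x], of b] assms(3)
  by (simp add: inner_Basis if_distrib sum.delta cong: if_cong)
qed

lemma conv_smooth:
 assumes u: "integrable lborel u" and t: "test_function_on U rho"
 shows "smooth (conv u rho)"
proof -
 have "Ck k (conv u rho)" if "test_function_on U rho" for k rho
  using that
 proof (induction k arbitrary: rho)
  case 0 then show ?case
   using conv_has_derivative[OF u] by (auto intro!: continuous_at_imp_continuous_on has_derivative_continuous)
 next
  case (Suc k)
  have "conv u rho differentiable (at x)" for x
   using conv_has_derivative[OF u Suc.prems] by (auto simp: differentiable_def)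
  then show ?case unfolding Ck_Suc using conv_pd[OF u Suc.prems] Suc.IH[OF test_function_pd[OF Suc.prems]] by auto
 qed
 then show ?thesis using t by (simp add: smooth_def)
qed

lemma conv_commute:
 assumes "u \<in> borel_measurable borel" "rho \<in> borel_measurable borel"
 shows "conv u rho x = (LBINT y. u (x - y) * rho y)"
 unfolding conv_def using lborel_integral_affine[of "%y. u y * rho (x - y)" "-1" x] assms by simp

text \<open>Since \<open>rho\<close> is a probability density, Jensen bounds the squared error at x
  by an average of |u(x - y) - u(x)|^2 over y; Tonelli then leaves an average of squared L2
  distances between \<open>u\<close> and its small translates.\<close>

lemma conv_L2_close:
 fixes u :: "'a::euclidean_space => real"
 assumes [measurable]: "u \<in> borel_measurable borel" and u: "integrable lborel u" "integrable lborel (%x. (u x)^2)"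
  and t: "test_function_on U rho" and pos: "!!x. rho x >= 0" and int: "(LBINT x. rho x) = 1"
  and supp: "!!x. norm x >= d ==> rho x = 0"
  and close: "!!h. norm h < d ==> (LBINT x. (u (x + h) - u x)^2) <= e"
  and e: "e >= 0"
 shows "integrable lborel (%x. (conv u rho x - u x)^2)" "(LBINT x. (conv u rho x - u x)^2) <= e"
proof -
 have sm: "smooth rho" using test_functionD(1)[OF t] .
 have [measurable]: "rho \<in> borel_measurable borel" using sm smooth_borel by auto
 have [measurable]: "conv u rho \<in> borel_measurable borel" using conv_smooth[OF u(1) t] smooth_borel by auto
 obtain K where K: "!!x. abs (rho x) <= K" using test_function_bounded[OF t] by blast
 have irho: "integrable lborel rho" using test_integrable[OF t] .
 have iu1: "integrable lborel (%y. u (x - y))" for x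
  using lborel_integrable_affine[of u "-1" x] u by simp
 have iu2: "integrable lborel (%y. (u (x - y))^2)" for x
  using lborel_integrable_affine[of "%y. (u y)^2" "-1" x] u by simp
 have b1: "integrable lborel (%y. u (x - y) * rho y)" for x
  by (rule Bochner_Integration.integrable_bound[of _ "%y. K * u (x - y)"])
    (use iu1 K in \<open>auto simp: abs_mult mult.commute[of K] intro!: mult_left_mono AE_I2 order_trans[OF K abs_ge_self]\<close>)
 have b2: "integrable lborel (%y. (u (x - y))^2 * rho y)" for x
  by (rule Bochner_Integration.integrable_bound[of _ "%y. K * (u (x - y))^2"])
    (use iu2 K in \<open>auto simp: abs_mult mult.commute[of K] intro!: mult_left_mono AE_I2 order_trans[OF K abs_ge_self]\<close>)
 have e1: "(u (x - y) - c)^2 * rho y = (u (x - y))^2 * rho y - 2 * c * (u (x - y) * rho y) + c\<^sup>2 * rho y" for x y c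
  by (simp add: power2_eq_square algebra_simps)
 have b3: "integrable lborel (%y. (u (x - y) - c)^2 * rho y)" for x c
  unfolding e1 using b1 b2 irho by auto
 have jensen: "(conv u rho x - u x)^2 <= (LBINT y. (u (x - y) - u x)^2 * rho y)" for x
 proof -
  let ?m = "conv u rho x"
  have m: "?m = (LBINT y. u (x - y) * rho y)" by (rule conv_commute) auto
  have v: "(LBINT y. (u (x - y) - c)^2 * rho y) = (LBINT y. (u (x - y))^2 * rho y) - 2 * c * ?m + c\<^sup>2" for c
   unfolding e1 m using b1[of x] b2[of x] irho int by simp
  \<comment> \<open>Jensen in the form variance \<ge> 0: with mean m, the average of (u - c)^2
    equals the variance plus (m - c)^2.\<close>
  have "0 <= (LBINT y. (u (x - y) - ?m)^2 * rho y)"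
   using pos by (intro integral_nonneg_AE) auto
  then show ?thesis unfolding v by (simp add: power2_eq_square algebra_simps)
 qed
 have "(\<integral>\<^sup>+x. ennreal ((conv u rho x - u x)^2) \<partial>lborel) <= (\<integral>\<^sup>+x. ennreal (LBINT y. (u (x - y) - u x)^2 * rho y) \<partial>lborel)"
  by (intro nn_integral_mono ennreal_leI jensen)
 also have "... = (\<integral>\<^sup>+x. \<integral>\<^sup>+y. ennreal ((u (x - y) - u x)^2 * rho y) \<partial>lborel \<partial>lborel)"
  by (intro nn_integral_cong nn_integral_eq_integral[symmetric] b3) (use pos in auto)
 also have "... = (\<integral>\<^sup>+y. \<integral>\<^sup>+x. ennreal ((u (x - y) - u x)^2 * rho y) \<partial>lborel \<partial>lborel)"
  by (rule lborel_pair.Fubini') auto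
 also have "... <= (\<integral>\<^sup>+y. ennreal e * ennreal (rho y) \<partial>lborel)"
 proof (intro nn_integral_mono)
  fix y :: 'a
  show "(\<integral>\<^sup>+x. ennreal ((u (x - y) - u x)^2 * rho y) \<partial>lborel) <= ennreal e * ennreal (rho y)"
  proof (cases "norm y < d")
   case True
   have tr: "integrable lborel (%x. (u (x + - y))^2)"
    using lborel_integrable_translate[OF u(2), of "-y"] .
   have i: "integrable lborel (%x. (u (x + - y) - u x)^2)"
    by (rule L2_sq_integrable_diff) (use tr u in auto)
   have "(\<integral>\<^sup>+x. ennreal ((u (x - y) - u x)^2 * rho y) \<partial>lborel) = (\<integral>\<^sup>+x. ennreal ((u (x + - y) - u x)^2) \<partial>lborel) * ennreal (rho y)"
    by (simp add: ennreal_mult pos nn_integral_multc)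
   also have "(\<integral>\<^sup>+x. ennreal ((u (x + - y) - u x)^2) \<partial>lborel) = ennreal (LBINT x. (u (x + - y) - u x)^2)"
    by (rule nn_integral_eq_integral[OF i]) auto
   finally show ?thesis using close[of "-y"] True by (auto intro!: mult_right_mono ennreal_leI)
  next
   case False then show ?thesis using supp[of y] by simp
  qed
 qed
 also have "... = ennreal e"
  using nn_integral_eq_integral[OF irho] pos int by (simp add: nn_integral_cmult)
 finally have *: "(\<integral>\<^sup>+x. ennreal ((conv u rho x - u x)^2) \<partial>lborel) <= ennreal e" .
 show "integrable lborel (%x. (conv u rho x - u x)^2)"
  unfolding integrable_iff_bounded using * by (auto simp: top.not_eq_extremum intro: le_less_trans[of _ "ennreal e"])
 then show "(LBINT x. (conv u rho x - u x)^2) <= e"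
  using * e by (subst (asm) nn_integral_eq_integral) auto
qed

subsection \<open>Mollifiers and cutoffs\<close>

definition moll :: "real => 'a::euclidean_space => real" where
 "moll d x = bump ((1/d) *\<^sub>R x) / (LBINT y. bump ((1/d) *\<^sub>R (y::'a)))"

lemma test_bump_scaled: "d > 0 ==> test_function_on UNIV (%x. bump ((1/d) *\<^sub>R x))"
 using smooth_affine[OF smooth_bump, of 0 "1/d"]
 by (intro test_functionI[where r=d]) (auto intro!: bump_zero simp: field_simps)

lemma bump_integral_pos: 
 assumes "d > 0" shows "(LBINT y. bump ((1/d) *\<^sub>R (y::'a::euclidean_space))) > 0"
proof -
 let ?f = "%y. bump ((1/d) *\<^sub>R (y::'a))"
 have i: "integrable lborel ?f" using test_integrable[OF test_bump_scaled[OF assms]] .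
 have "(LBINT y. ?f y) ~= 0"
 proof
  assume "(LBINT y. ?f y) = 0"
  then have "AE y in lborel. ?f y = 0"
   using integral_nonneg_eq_0_iff_AE[OF i] bump_nonneg by auto
  then have "AE y in lborel. y \<notin> ball (0::'a) d"
  proof eventually_elim
   fix y :: 'a assume "?f y = 0"
   then have "\<not> norm ((1/d) *\<^sub>R y) < 1" using bump_pos by (metis less_irrefl)
   then show "y \<notin> ball 0 d" using assms by (auto simp: field_simps)
  qed
  then have "emeasure lborel (ball (0::'a) d) = 0"
   by (subst (asm) AE_iff_null_sets[symmetric]) (auto simp: null_sets_def)
  then show False using assms content_ball_pos[of d "0::'a"] by (simp add: measure_def)
 qed
 moreover have "(LBINT y. ?f y) >= 0" by (intro integral_nonneg_AE) (auto simp: bump_nonneg)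
 ultimately show ?thesis by linarith
qed

lemma moll:
 assumes "d > 0"
 shows moll_test: "test_function_on UNIV (moll d :: 'a::euclidean_space => real)" and moll_nonneg: "moll d (x::'a) >= 0"
  and moll_int: "(LBINT x. moll d (x::'a)) = 1"
  and moll_supp: "norm x >= d ==> moll d (x::'a) = 0"
proof -
 note p = bump_integral_pos[OF assms, where 'a='a]
 have supp: "norm x >= d ==> moll d (x::'a) = 0" for x :: 'a
  using assms by (auto simp: moll_def field_simps intro!: bump_zero)
 then show "norm x >= d ==> moll d (x::'a) = 0" .
 have "smooth (%x. bump ((1/d) *\<^sub>R x) * (1 / (LBINT y. bump ((1/d) *\<^sub>R (y::'a)))))"
  using test_functionD(1)[OF test_bump_scaled[OF assms]] by (intro smooth_mult smooth_const)
 then show "test_function_on UNIV (moll d :: 'a => real)"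
  by (intro test_functionI[where r=d]) (use supp in \<open>auto simp: moll_def[abs_def]\<close>)
 show "moll d x >= 0" using bump_nonneg p by (auto simp: moll_def intro!: divide_nonneg_nonneg integral_nonneg_AE)
 show "(LBINT x. moll d (x::'a)) = 1" using p by (simp add: moll_def)
qed

text \<open>The cutoff is a mollified indicator of an intermediate ball.\<close>

lemma cutoff_exists:
 assumes "0 < r" "r < R"
 shows "\<exists>eta :: ('a::euclidean_space) => real. smooth eta \<and> (\<forall>x. 0 <= eta x \<and> eta x <= 1) \<and> (\<forall>x. norm x <= r --> eta x = 1)
   \<and> (\<forall>x. norm x >= R --> eta x = 0)"
proof -
 \<comment> \<open>The indicator of the ball of the middle radius \<open>m\<close> is mollified at
   scale \<open>d\<close>; since r + d = m and m + d = R, the smoothing reaches neither the inner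
   ball nor the exterior of the outer one.\<close>
 define d where "d = (R - r) / 2"
 define m where "m = (R + r) / 2"
 have dm: "d > 0" "m > 0" "r + d = m" "m + d = R" using assms by (auto simp: d_def m_def field_simps)
 let ?u = "indicator (cball 0 m) :: 'a => real"
 have u: "integrable lborel ?u" by (intro integrable_real_indicator emeasure_lborel_cball_finite) auto
 have t: "test_function_on UNIV (moll d :: 'a => real)" using moll_test dm by auto
 have [measurable]: "moll d \<in> borel_measurable (borel :: 'a measure)"
  using smooth_borel test_functionD(1)[OF t] by auto
 have im: "integrable lborel (moll d :: 'a => real)" using test_integrable[OF t] .
 let ?c = "conv ?u (moll d)"
 have c: "?c x = (LBINT y. ?u (x - y) * moll d y)" for x by (rule conv_commute) (auto intro!: borel_measurable_indicator)
 have n: "moll d x >= 0" for x :: 'a using moll_nonneg[OF dm(1)] .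
 have "0 <= ?c x" for x unfolding c using n by (intro integral_nonneg_AE) auto
 moreover have "?c x <= 1" for x
 proof -
  have "?c x <= (LBINT y. moll d (y::'a))"
   unfolding c by (rule integral_mono'[OF im]) (use n in \<open>auto split: split_indicator\<close>)
  then show ?thesis using moll_int[OF dm(1), where 'a='a] by simp
 qed
 moreover have "?c x = 1" if "norm x <= r" for x
 proof -
  have "?u (x - y) * moll d y = moll d y" for y
  proof (cases "norm y < d")
   case True
   then have "norm (x - y) <= m" using that dm norm_triangle_ineq4[of x y] by linarith
   then show ?thesis by simp
  next
   case False then show ?thesis using moll_supp[OF dm(1), of y] by simp
  qed
  then show ?thesis unfolding c using moll_int[OF dm(1), where 'a='a] by (simp only:)
 qed
 moreover have "?c x = 0" if "norm x >= R" for x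
 proof -
  have "?u (x - y) * moll d y = 0" for y
  proof (cases "norm y < d")
   case True
   then have "norm (x - y) > m" using that dm norm_triangle_ineq2[of x y] by linarith
   then show ?thesis by simp
  next
   case False then show ?thesis using moll_supp[OF dm(1), of y] by simp
  qed
  then show ?thesis unfolding c by (simp only: integral_zero)
 qed
 ultimately show ?thesis using conv_smooth[OF u t] by blast
qed

lemma conv_support:
 assumes "!!x. norm x >= R ==> u x = 0" "!!x. norm x >= d ==> rho x = 0" "norm x >= R + d"
 shows "conv u rho x = 0"
proof -
 have "u y * rho (x - y) = 0" for y
 proof (cases "norm y >= R")
  case False
  then have "norm (x - y) >= d" using assms(3) norm_triangle_ineq2[of x y] by linarith
  then show ?thesis using assms by simp
 qed (use assms in simp)
 then show ?thesis unfolding conv_def by (simp only: integral_zero)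
qed

lemma mollify_L2:
 fixes u :: "'a::euclidean_space => real"
 assumes [measurable]: "u \<in> borel_measurable borel" and u: "integrable lborel u" "integrable lborel (%x. (u x)^2)"
 shows "(%n. (LBINT x. (conv u (moll (1 / Suc n)) x - u x)^2)) \<longlonglongrightarrow> 0"
  and "integrable lborel (%x. (conv u (moll (1 / Suc n)) x - u x)^2)"
proof -
 note tr = L2_translate_uniform[OF assms(1) u(2)]
 have close: "integrable lborel (%x. (conv u (moll (1 / Suc n)) x - u x)^2) \<and> (LBINT x. (conv u (moll (1 / Suc n)) x - u x)^2) <= e"
  if "!!h. norm h < 1 / Suc n ==> (LBINT x. (u (x + h) - u x)^2) <= e" "e >= 0" for n e
  using conv_L2_close[OF assms(1) u moll_test moll_nonneg moll_int moll_supp, of "1 / Suc n" "1 / Suc n" e] that by auto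
 show "(%n. (LBINT x. (conv u (moll (1 / Suc n)) x - u x)^2)) \<longlonglongrightarrow> 0"
 proof (rule LIMSEQ_I)
  fix r :: real assume r: "r > 0"
  obtain d where d: "d > 0" "!!h. norm h < d ==> (LBINT x. (u (x + h) - u x)^2) < r / 2"
   using tr[of "r/2"] r by auto
  obtain N where N: "1 / Suc N < d" using d(1) nat_approx_posE by blast
  have le: "(LBINT x. (conv u (moll (1 / Suc n)) x - u x)^2) <= r / 2" if "n >= N" for n
  proof -
   have "1 / Suc n <= 1 / Suc N" using that by (simp add: frac_le)
   then have "norm h < 1 / Suc n ==> (LBINT x. (u (x + h) - u x)^2) <= r / 2" for h
    using d(2)[of h] N by linarith
   then show ?thesis using close[of n "r/2"] r by auto
  qed
  show "\<exists>no. \<forall>n\<ge>no. norm ((LBINT x. (conv u (moll (1 / Suc n)) x - u x)^2) - 0) < r"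
  proof (intro exI[of _ N] allI impI)
   fix n assume "n >= N"
   then have "(LBINT x. (conv u (moll (1 / Suc n)) x - u x)^2) <= r / 2" by (rule le)
   moreover have "(LBINT x. (conv u (moll (1 / Suc n)) x - u x)^2) >= 0" by simp
   ultimately show "norm ((LBINT x. (conv u (moll (1 / Suc n)) x - u x)^2) - 0) < r" using r by simp
  qed
 qed
 \<comment> \<open>A crude bound valid for every shift: it gives integrability of the error for each
   fixed \<open>n\<close>, also when \<open>n\<close> is small.\<close>
 have b: "(LBINT x. (u (x + h) - u x)^2) <= 4 * (LBINT x. (u x)^2)" for h
 proof -
  have t: "integrable lborel (%x. (u (x + h))^2)" using lborel_integrable_translate[OF u(2), of h] .
  have "(u (x + h) - u x)^2 <= 2 * (u (x + h))^2 + 2 * (u x)^2" for x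
   using zero_le_power2[of "u (x + h) + u x"] by (simp add: power2_eq_square algebra_simps)
  then have "(LBINT x. (u (x + h) - u x)^2) <= (LBINT x. 2 * (u (x + h))^2 + 2 * (u x)^2)"
   by (intro integral_mono') (use t u in auto)
  also have "... = 2 * (LBINT x. (u (x + h))^2) + 2 * (LBINT x. (u x)^2)" using t u by simp
  also have "(LBINT x. (u (x + h))^2) = (LBINT x. (u x)^2)"
   using lborel_integral_translate[of "%x. (u x)^2" h] by simp
  finally show ?thesis by simp
 qed
 show "integrable lborel (%x. (conv u (moll (1 / Suc n)) x - u x)^2)"
  using close[of n "4 * (LBINT x. (u x)^2)"] b by (auto intro!: integral_nonneg_AE)
qed

lemma L2_bounded_support_integrable:
 assumes [measurable]: "u \<in> borel_measurable borel" and "integrable lborel (%x. (u x)^2)"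
  and s: "!!x::'a::euclidean_space. norm x >= R ==> u x = (0::real)"
 shows "integrable lborel u"
proof (rule Bochner_Integration.integrable_bound)
 show "integrable lborel (%x. (u x)^2 + indicator (cball 0 R) x)"
  using assms by (intro Bochner_Integration.integrable_add integrable_real_indicator emeasure_lborel_cball_finite) auto
 have "abs t <= t\<^sup>2 + 1" for t :: real
  using zero_le_power2[of "abs t - 1"] by (simp add: power2_eq_square algebra_simps abs_if split: if_splits)
 then show "AE x in lborel. norm (u x) <= norm ((u x)^2 + indicator (cball 0 R) x)"
  using s by (intro AE_I2) (force split: split_indicator simp: not_le intro: less_imp_le)
qed auto

text \<open>For a cutoff \<open>eta\<close>, the mollification of f eta at x is the integral of f
  against the test function y -> eta(y) moll(x - y), hence 0. As mollifications converge in L2, f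
  eta vanishes, and the cutoffs exhaust the ball.\<close>

lemma fundamental_lemma_ball:
 fixes f :: "'a::euclidean_space => real"
 assumes [measurable]: "f \<in> borel_measurable borel" and f: "integrable lborel (%x. indicator (ball 0 R) x * (f x)^2)"
  and z: "!!phi. test_function_on (ball 0 R) phi ==> (LBINT x. f x * phi x) = 0"
 shows "AE x in lborel. x \<in> ball 0 R --> f x = 0"
proof (cases "R > 0")
 case True
 have r: "AE x in lborel. norm x <= r --> f x = 0" if "0 < r" "r < R" for r
 proof -
  have "r < (r + R) / 2" using that by simp
  from cutoff_exists[OF that(1) this, where 'a='a]
  obtain eta :: "'a => real" where eta: "smooth eta" "!!x. 0 <= eta x" "!!x. eta x <= 1" "!!x. norm x <= r ==> eta x = 1"
    "!!x. norm x >= (r + R) / 2 ==> eta x = 0"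
   by blast
  have te: "test_function_on (ball 0 R) eta"
   by (rule test_functionI[OF eta(1), of "(r+R)/2"]) (use eta that in auto)
  have [measurable]: "eta \<in> borel_measurable borel" using eta(1) smooth_borel by auto
  define u where "u x = f x * eta x" for x
  have [measurable]: "u \<in> borel_measurable borel" unfolding u_def[abs_def] by auto
  have us: "norm x >= R ==> u x = 0" for x using eta(5)[of x] that by (simp add: u_def)
  have "(u x)^2 <= indicator (ball 0 R) x * (f x)^2" for x
  proof (cases "norm x < R")
   case True
   have "(eta x)^2 <= 1" using eta(2,3)[of x] by (simp add: power_le_one)
   then show ?thesis using True by (simp add: u_def power_mult_distrib mult_left_le)
  qed (use us in auto)
  then have u2: "integrable lborel (%x. (u x)^2)"
   by (intro Bochner_Integration.integrable_bound[OF f]) auto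
  have u1: "integrable lborel u" using L2_bounded_support_integrable[OF _ u2 us] by auto
  have c0: "conv u (moll (1 / Suc n)) x = 0" for n x
  proof -
   have "smooth (%y. moll (1 / Suc n) (x + (-1) *\<^sub>R y) :: real)"
    by (rule smooth_affine) (use moll_test[of "1 / Suc n"] test_functionD(1) in auto)
   then have "test_function_on (ball 0 R) (%y. eta y * moll (1 / Suc n) (x - y))"
    using test_function_mult[OF te] by auto
   from z[OF this] show ?thesis by (simp add: conv_def u_def mult.assoc)
  qed
  have "(%n. (LBINT x. (u x)^2)) \<longlonglongrightarrow> 0" using mollify_L2(1)[OF _ u1 u2] unfolding c0 by simp
  then have "(LBINT x. (u x)^2) = 0" by (simp add: LIMSEQ_const_iff)
  then have "AE x in lborel. (u x)^2 = 0" using integral_nonneg_eq_0_iff_AE[OF u2] by auto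
  then show ?thesis
  proof eventually_elim
   fix x assume "(u x)^2 = 0"
   then show "norm x <= r --> f x = 0" using eta(4)[of x] by (auto simp: u_def)
  qed
 qed
 \<comment> \<open>Countably many radii increasing to \<open>R\<close>; the shift by 2 keeps the
   first one positive.\<close>
 have "AE x in lborel. \<forall>n. norm x <= R * (1 - 1 / (real n + 2)) --> f x = 0"
  unfolding AE_all_countable
 proof
  fix n :: nat
  have "0 < 1 - 1 / (real n + 2)" "1 - 1 / (real n + 2) < 1" by (simp_all add: field_simps)
  then show "AE x in lborel. norm x <= R * (1 - 1 / (real n + 2)) --> f x = 0"
   using True by (intro r) (auto simp: mult_less_cancel_left2)
 qed
 then show ?thesis
 proof eventually_elim
  fix x assume a: "\<forall>n. norm x <= R * (1 - 1 / (real n + 2)) --> f x = 0"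
  show "x \<in> ball 0 R --> f x = 0"
  proof
   assume x: "x \<in> ball 0 R"
   then have "0 < 1 - norm x / R" using True by simp
   then obtain n where "1 / Suc n < 1 - norm x / R" using nat_approx_posE by blast
   moreover have "1 / (real n + 2) <= 1 / Suc n" by (simp add: frac_le)
   ultimately have "norm x / R <= 1 - 1 / (real n + 2)" by linarith
   then have "norm x <= R * (1 - 1 / (real n + 2))" using True by (simp add: field_simps)
   with a show "f x = 0" by blast
  qed
 qed
next
 case False
 then have "x \<notin> ball (0::'a) R" for x using False order_trans[of R 0 "norm x"] by (simp add: not_less)
 then show ?thesis by auto
qed

lemma ball_borel [measurable, simp]: "ball x r \<in> sets borel" "cball x r \<in> sets borel"
 by auto

subsection \<open>Integrals of directional derivatives\<close>

text \<open>Every difference quotient has integral 0 by translation invariance. The Lipschitz bound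
  and the bounded support dominate the quotients, so an almost everywhere derivative is enough. This
  serves test functions as well as the merely Lipschitz products in Green's formula.\<close>

lemma integral_directional_derivative_zero:
 fixes f :: "'a::euclidean_space => real"
 assumes f: "integrable lborel f" and [measurable]: "f' \<in> borel_measurable borel"
  and supp: "!!x. norm x >= R ==> f x = 0"
  and lip: "!!x t. abs (f (x + t *\<^sub>R b) - f x) <= K * abs t"
  and der: "AE x in lborel. ((%t. f (x + t *\<^sub>R b)) has_real_derivative f' x) (at 0)"
 shows "(LBINT x. f' x) = 0"
proof -
 have [measurable]: "f \<in> borel_measurable borel" using f by auto
 define q where "q n x = (f (x + (1 / Suc n) *\<^sub>R b) - f x) * Suc n" for n x
 have tr: "integrable lborel (%x. f (x + (1 / Suc n) *\<^sub>R b))" for n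
  using lborel_integrable_translate[OF f] .
 have q0: "(LBINT x. q n x) = 0" for n
  unfolding q_def using tr[of n] f lborel_integral_translate[of f "(1 / Suc n) *\<^sub>R b"] by simp
 have "(%n. (LBINT x. q n x)) \<longlonglongrightarrow> (LBINT x. f' x)"
 proof (rule integral_dominated_convergence[where w="%x. abs K * indicator (cball 0 (R + norm b)) x"])
  show "integrable lborel (%x. abs K * indicator (cball 0 (R + norm b)) x)"
   by (intro integrable_mult_right integrable_real_indicator emeasure_lborel_cball_finite) auto
  show "AE x in lborel. (%n. q n x) \<longlonglongrightarrow> f' x"
   using der
  proof eventually_elim
   fix x assume d: "((%t. f (x + t *\<^sub>R b)) has_real_derivative f' x) (at 0)"
   then have "((%h. (f (x + h *\<^sub>R b) - f x) / h) \<longlongrightarrow> f' x) (at 0)"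
    by (simp add: DERIV_def)
   moreover have "filterlim (%n. 1 / real (Suc n)) (at 0) sequentially"
    unfolding filterlim_at using LIMSEQ_Suc[OF lim_1_over_n] by auto
   ultimately have "(%n. (f (x + (1 / Suc n) *\<^sub>R b) - f x) / (1 / Suc n)) \<longlonglongrightarrow> f' x"
    by (rule filterlim_compose)
   then show "(%n. q n x) \<longlonglongrightarrow> f' x" by (simp add: q_def)
  qed
  show "AE x in lborel. norm (q n x) <= abs K * indicator (cball 0 (R + norm b)) x" for n
  proof (rule AE_I2)
   fix x
   show "norm (q n x) <= abs K * indicator (cball 0 (R + norm b)) x"
   proof (cases "norm x <= R + norm b")
    case True
    have "abs (f (x + (1 / Suc n) *\<^sub>R b) - f x) * Suc n <= (abs K * (1 / Suc n)) * Suc n"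
    proof (rule mult_right_mono)
     have "abs (f (x + (1 / Suc n) *\<^sub>R b) - f x) <= K * (1 / Suc n)" using lip[of x "1 / Suc n"] by simp
     also have "... <= abs K * (1 / Suc n)" by (intro mult_right_mono) auto
     finally show "abs (f (x + (1 / Suc n) *\<^sub>R b) - f x) <= abs K * (1 / Suc n)" .
    qed auto
    then show ?thesis using True by (simp add: q_def abs_mult)
   next
    case False
    have "norm ((1 / Suc n) *\<^sub>R b) <= norm b" by (simp add: divide_le_eq mult_le_cancel_left1)
    moreover have "norm (x + (1 / Suc n) *\<^sub>R b) >= norm x - norm ((1 / Suc n) *\<^sub>R b)"
     using norm_diff_ineq by blast
    ultimately have "norm (x + (1 / Suc n) *\<^sub>R b) >= R" "norm x >= R"
     using False norm_ge_zero[of b] by linarith+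
    then show ?thesis using supp by (simp add: q_def)
   qed
  qed
 qed (auto simp: q_def[abs_def])
 then show ?thesis unfolding q0 by (simp add: LIMSEQ_const_iff)
qed

lemma smooth_directional_derivative:
 assumes "smooth f"
 shows "((%t. f (x + t *\<^sub>R b)) has_real_derivative grad f (x + t *\<^sub>R b) \<bullet> b) (at t)"
proof -
 have "((%t. f (x + t *\<^sub>R b)) has_derivative (%h. grad f (x + t *\<^sub>R b) \<bullet> (h *\<^sub>R b))) (at t)"
  by (rule has_derivative_compose[OF _ smooth_has_derivative[OF assms]]) (auto intro!: derivative_eq_intros)
 then show ?thesis by (simp add: has_field_derivative_def mult_commute_abs)
qed

lemma test_lipschitz:
 assumes "test_function_on U f"
 shows "\<exists>K>0. \<forall>x y. abs (f x - f y) <= K * norm (x - y)"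
 using test_function_grad_bounded[OF assms] smooth_lipschitz[OF test_functionD(1)[OF assms] convex_UNIV] by blast

lemma test_integral_pd_zero:
 assumes t: "test_function_on U f" and b: "b \<in> Basis"
 shows "(LBINT x. pd b f x) = 0"
proof -
 obtain R where R: "!!x. norm x >= R ==> f x = 0" using test_functionD[OF t] by blast
 obtain K where K: "!!x y. abs (f x - f y) <= K * norm (x - y)" using test_lipschitz[OF t] by blast
 show ?thesis
 proof (rule integral_directional_derivative_zero[OF test_integrable[OF t] _ R])
  show "pd b f \<in> borel_measurable borel"
   using smooth_borel[OF smooth_pd[OF test_functionD(1)[OF t] b]] .
  show "abs (f (x + s *\<^sub>R b) - f x) <= K * abs s" for x s using K[of "x + s *\<^sub>R b" x] b by simp
  show "AE x in lborel. ((%t. f (x + t *\<^sub>R b)) has_real_derivative pd b f x) (at 0)"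
   using smooth_directional_derivative[OF test_functionD(1)[OF t], of _ b 0] b by auto
 qed
qed

subsection \<open>Borel representatives of Sobolev functions on balls\<close>

text \<open>The gradient is carried along explicitly and both functions are Borel and total, so
  sums, products and dilations can be formed without the choice hidden in
  \<open>weak_gradient\<close>. The weak identity is integrated over the whole space because test
  functions vanish off the ball.\<close>

definition sob_pair :: "real => ('a::euclidean_space => real) => ('a => 'a) => bool" where
 "sob_pair R v g \<longleftrightarrow> v \<in> borel_measurable borel \<and> g \<in> borel_measurable borel \<and>
   integrable lborel (%x. indicator (ball 0 R) x * (v x)^2) \<and>
   integrable lborel (%x. indicator (ball 0 R) x * (norm (g x))^2) \<and>
   (\<forall>phi. test_function_on (ball 0 R) phi --> (\<forall>b\<in>Basis.
    (LBINT x. v x * pd b phi x) = - (LBINT x. (g x \<bullet> b) * phi x)))"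

lemma sob_pairD:
 assumes "sob_pair R v g"
 shows "v \<in> borel_measurable borel" "g \<in> borel_measurable borel"
  "integrable lborel (%x. indicator (ball 0 R) x * (v x)^2)"
  "integrable lborel (%x. indicator (ball 0 R) x * (norm (g x))^2)"
  "!!phi b. test_function_on (ball 0 R) phi ==> b \<in> Basis ==>
    (LBINT x. v x * pd b phi x) = - (LBINT x. (g x \<bullet> b) * phi x)"
 using assms by (auto simp: sob_pair_def)

lemma indicator_ball_integrable: "integrable lborel (indicator (ball (c::'a::euclidean_space) R) :: 'a => real)"
 by (intro integrable_real_indicator emeasure_bounded_finite) auto

lemma L2_ball_comp_integrable:
 assumes [measurable]: "g \<in> borel_measurable borel" and g: "integrable lborel (%x. indicator (ball 0 R) x * (norm (g x))^2)"
  and b: "b \<in> Basis"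
 shows "integrable lborel (%x. indicator (ball 0 R) x * (g x \<bullet> b)^2 :: real)"
proof (rule Bochner_Integration.integrable_bound[OF g])
 have "(g x \<bullet> b)^2 <= (norm (g x))^2" for x
  using Basis_le_norm[OF b, of "g x"] by (simp add: abs_le_square_iff[symmetric])
 then show "AE x in lborel. norm (indicator (ball 0 R) x * (g x \<bullet> b)^2) <= norm (indicator (ball 0 R) x * (norm (g x))^2)"
  by (intro AE_I2) (auto split: split_indicator)
qed auto

lemma L2_mult_bounded_integrable:
 assumes [measurable]: "v \<in> borel_measurable borel" "phi \<in> borel_measurable borel"
  and v: "integrable lborel (%x. indicator (ball 0 R) x * (v x)^2)"
  and K: "!!x. abs (phi x) <= K" and s: "!!x::'a::euclidean_space. x \<notin> ball 0 R ==> phi x = (0::real)"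
 shows "integrable lborel (%x. v x * phi x :: real)"
proof (rule Bochner_Integration.integrable_bound)
 show "integrable lborel (%x. K * (indicator (ball 0 R) x * (v x)^2 + indicator (ball 0 R) x))"
  using v indicator_ball_integrable by (intro integrable_mult_right Bochner_Integration.integrable_add)
 have t: "abs t <= t\<^sup>2 + 1" for t :: real
  using zero_le_power2[of "abs t - 1"] by (simp add: power2_eq_square algebra_simps abs_if split: if_splits)
 have K0: "K >= 0" using K[of undefined] by linarith
 show "AE x in lborel. norm (v x * phi x) <= norm (K * (indicator (ball 0 R) x * (v x)^2 + indicator (ball 0 R) x))"
 proof (rule AE_I2)
  fix x
  show "norm (v x * phi x) <= norm (K * (indicator (ball 0 R) x * (v x)^2 + indicator (ball 0 R) x))"
  proof (cases "x \<in> ball 0 R")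
   case True
   have "abs (v x) * abs (phi x) <= ((v x)^2 + 1) * K" by (intro mult_mono t K) auto
   then show ?thesis using True K0 by (simp add: abs_mult mult.commute)
  qed (use s in auto)
 qed
qed auto

lemma sob_pair_test_integrable:
 assumes s: "sob_pair R v g" and t: "test_function_on (ball 0 R) phi" and b: "b \<in> Basis"
 shows "integrable lborel (%x. v x * phi x)" "integrable lborel (%x. (g x \<bullet> b) * phi x)"
proof -
 note d = sob_pairD[OF s]
 have [measurable]: "v \<in> borel_measurable borel" "g \<in> borel_measurable borel" "phi \<in> borel_measurable borel"
  using d test_functionD(1)[OF t] smooth_borel by auto
 obtain K where "!!x. abs (phi x) <= K" using test_function_bounded[OF t] by blast
 then show "integrable lborel (%x. v x * phi x)" "integrable lborel (%x. (g x \<bullet> b) * phi x)"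
  using L2_mult_bounded_integrable[OF _ _ d(3), of phi K]
   L2_mult_bounded_integrable[OF _ _ L2_ball_comp_integrable[OF d(2,4) b], of phi K] test_functionD(3)[OF t] by auto
qed

lemma sob_pair_mono:
 assumes "sob_pair R v g" "r <= R" shows "sob_pair r v g"
proof -
 note d = sob_pairD[OF assms(1)]
 have [measurable]: "v \<in> borel_measurable borel" "g \<in> borel_measurable borel" using d by auto
 have "ball 0 r \<subseteq> ball (0::'a) R" using assms(2) by auto
 then have i: "indicator (ball 0 r) x <= (indicator (ball 0 R) x :: real)" for x :: 'a by (auto split: split_indicator)
 have "integrable lborel (%x. indicator (ball 0 r) x * (v x)^2)"
  by (rule Bochner_Integration.integrable_bound[OF d(3)]) (auto intro!: mult_right_mono i)
 moreover have "integrable lborel (%x. indicator (ball 0 r) x * (norm (g x))^2)"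
  by (rule Bochner_Integration.integrable_bound[OF d(4)]) (auto intro!: mult_right_mono i)
 ultimately show ?thesis using d test_function_mono[OF _ \<open>ball 0 r \<subseteq> ball 0 R\<close>]
  unfolding sob_pair_def by auto
qed

lemma sob_pair_lincomb:
 assumes "sob_pair R v g" "sob_pair R w k"
 shows "sob_pair R (%x. a * v x + c * w x) (%x. a *\<^sub>R g x + c *\<^sub>R k x)"
proof -
 note d = sob_pairD[OF assms(1)] and e = sob_pairD[OF assms(2)]
 have [measurable]: "v \<in> borel_measurable borel" "g \<in> borel_measurable borel" 
   "w \<in> borel_measurable borel" "k \<in> borel_measurable borel" using d e by auto
 have sq: "(p + q)^2 <= 2 * p\<^sup>2 + 2 * q\<^sup>2" for p q :: real
  using zero_le_power2[of "p - q"] by (simp add: power2_eq_square algebra_simps)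
 have "integrable lborel (%x. indicator (ball 0 R) x * (a * v x + c * w x)^2)"
 proof (rule Bochner_Integration.integrable_bound)
  show "integrable lborel (%x. 2 * a\<^sup>2 * (indicator (ball 0 R) x * (v x)^2) + 2 * c\<^sup>2 * (indicator (ball 0 R) x * (w x)^2))"
   using d e by auto
  show "AE x in lborel. norm (indicator (ball 0 R) x * (a * v x + c * w x)^2) <= norm (2 * a\<^sup>2 * (indicator (ball 0 R) x * (v x)^2) + 2 * c\<^sup>2 * (indicator (ball 0 R) x * (w x)^2))"
   using sq[of "a * v x" "c * w x" for x] by (intro AE_I2) (auto simp: power_mult_distrib mult.assoc split: split_indicator)
 qed auto
 moreover have "integrable lborel (%x. indicator (ball 0 R) x * (norm (a *\<^sub>R g x + c *\<^sub>R k x))^2)"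
 proof (rule Bochner_Integration.integrable_bound)
  show "integrable lborel (%x. 2 * a\<^sup>2 * (indicator (ball 0 R) x * (norm (g x))^2) + 2 * c\<^sup>2 * (indicator (ball 0 R) x * (norm (k x))^2))"
   using d e by auto
  have "(norm (a *\<^sub>R g x + c *\<^sub>R k x))^2 <= 2 * a\<^sup>2 * (norm (g x))^2 + 2 * c\<^sup>2 * (norm (k x))^2" for x
  proof -
   have "(norm (a *\<^sub>R g x + c *\<^sub>R k x))^2 <= (norm (a *\<^sub>R g x) + norm (c *\<^sub>R k x))^2"
    by (intro power_mono norm_triangle_ineq) auto
   also have "... <= 2 * (norm (a *\<^sub>R g x))^2 + 2 * (norm (c *\<^sub>R k x))^2" by (rule sq)
   finally show ?thesis by (simp add: power_mult_distrib)
  qed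
  then show "AE x in lborel. norm (indicator (ball 0 R) x * (norm (a *\<^sub>R g x + c *\<^sub>R k x))^2) <= norm (2 * a\<^sup>2 * (indicator (ball 0 R) x * (norm (g x))^2) + 2 * c\<^sup>2 * (indicator (ball 0 R) x * (norm (k x))^2))"
   by (intro AE_I2) (auto split: split_indicator)
 qed auto
 moreover have "(LBINT x. (a * v x + c * w x) * pd b phi x) = - (LBINT x. ((a *\<^sub>R g x + c *\<^sub>R k x) \<bullet> b) * phi x)"
  if t: "test_function_on (ball 0 R) phi" and b: "b \<in> Basis" for phi b
 proof -
  note p = test_function_pd[OF t b]
  note i = sob_pair_test_integrable[OF assms(1) p b] sob_pair_test_integrable[OF assms(2) p b]
   sob_pair_test_integrable[OF assms(1) t b] sob_pair_test_integrable[OF assms(2) t b]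
  show ?thesis using i d(5)[OF t b] e(5)[OF t b]
   by (simp add: distrib_right inner_add_left mult.assoc)
 qed
 ultimately show ?thesis unfolding sob_pair_def by auto
qed

lemma continuous_ball_integrable:
 assumes "continuous_on UNIV (f :: 'a::euclidean_space => real)"
 shows "integrable lborel (%x. indicator (ball 0 R) x * f x)"
proof -
 have [measurable]: "f \<in> borel_measurable borel" using assms borel_measurable_continuous_onI by blast
 have i: "integrable lborel (%x. indicator (cball 0 R) x *\<^sub>R f x)"
  by (rule borel_integrable_compact) (use assms continuous_on_subset in auto)
 show ?thesis
  by (rule Bochner_Integration.integrable_bound[OF i]) (auto split: split_indicator)
qed

lemma sob_pair_smooth:
 assumes s: "smooth f" shows "sob_pair R f (grad f)"
proof -
 have "(LBINT x. f x * pd b phi x) = - (LBINT x. (grad f x \<bullet> b) * phi x)"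
  if t: "test_function_on (ball 0 R) phi" and b: "b \<in> Basis" for phi b
 proof -
  have t1: "test_function_on (ball 0 R) (%x. phi x * f x)" using test_function_mult[OF t s] .
  have d: "\<forall>x. phi differentiable (at x)" "\<forall>x. f differentiable (at x)"
   using s t test_functionD smooth_differentiable by blast+
  have i: "integrable lborel (%x. phi x * pd b f x)" "integrable lborel (%x. pd b phi x * f x)"
   using test_integrable[OF test_function_mult[OF t smooth_pd[OF s b]]]
    test_integrable[OF test_function_mult[OF test_function_pd[OF t b] s]] by auto
  have "(LBINT x. phi x * pd b f x + pd b phi x * f x) = 0"
   using test_integral_pd_zero[OF t1 b] unfolding pd_mult[OF d] .
  then show ?thesis using i b by (simp add: mult.commute)
 qed
 then show ?thesis unfolding sob_pair_def using s
  by (auto intro: smooth_borel grad_borel intro!: continuous_ball_integrable continuous_on_power continuous_on_norm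
   smooth_continuous[OF s] smooth_grad_continuous[OF s])
qed

lemma smooth_bounded_on_ball:
 assumes "smooth (f :: 'a::euclidean_space => real)"
 shows "\<exists>K>0. \<forall>x\<in>cball 0 R. abs (f x) <= K \<and> norm (grad f x) <= K"
proof -
 have "bounded (f ` cball 0 R)" "bounded (grad f ` cball 0 R)"
  using assms by (intro compact_imp_bounded compact_continuous_image; auto intro: smooth_continuous smooth_grad_continuous)+
 then obtain K L where "K > 0" "\<forall>x\<in>cball 0 R. norm (f x) <= K" "L > 0" "\<forall>x\<in>cball 0 R. norm (grad f x) <= L"
  unfolding bounded_pos by auto
 then show ?thesis by (intro exI[of _ "max K L"]) (auto simp: le_max_iff_disj)
qed

text \<open>The weak identity is applied to the test function phi f; the Leibniz rule for phi f then
  becomes the one for f v.\<close>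

lemma sob_pair_mult_smooth:
 assumes p: "sob_pair R v g" and s: "smooth f"
 shows "sob_pair R (%x. f x * v x) (%x. f x *\<^sub>R g x + v x *\<^sub>R grad f x)"
proof -
 note d = sob_pairD[OF p]
 have [measurable]: "v \<in> borel_measurable borel" "g \<in> borel_measurable borel" "f \<in> borel_measurable borel"
   "grad f \<in> borel_measurable borel" using d s smooth_borel grad_borel by auto
 obtain K where K: "K > 0" "!!x. x \<in> ball 0 R ==> abs (f x) <= K \<and> norm (grad f x) <= K"
  using smooth_bounded_on_ball[OF s, of R] by (meson ball_subset_cball subsetD)
 have sq: "(p + q)^2 <= 2 * p\<^sup>2 + 2 * q\<^sup>2" for p q :: real
  using zero_le_power2[of "p - q"] by (simp add: power2_eq_square algebra_simps)
 have "integrable lborel (%x. indicator (ball 0 R) x * (f x * v x)^2)"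
 proof (rule Bochner_Integration.integrable_bound)
  show "integrable lborel (%x. K\<^sup>2 * (indicator (ball 0 R) x * (v x)^2))" using d by auto
  show "AE x in lborel. norm (indicator (ball 0 R) x * (f x * v x)^2) <= norm (K\<^sup>2 * (indicator (ball 0 R) x * (v x)^2))"
   using K by (intro AE_I2) (auto simp: power_mult_distrib abs_le_square_iff[symmetric] intro!: mult_right_mono split: split_indicator)
 qed auto
 moreover have "integrable lborel (%x. indicator (ball 0 R) x * (norm (f x *\<^sub>R g x + v x *\<^sub>R grad f x))^2)"
 proof (rule Bochner_Integration.integrable_bound)
  show "integrable lborel (%x. 2 * K\<^sup>2 * (indicator (ball 0 R) x * (norm (g x))^2) + 2 * K\<^sup>2 * (indicator (ball 0 R) x * (v x)^2))"
   using d by auto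
  have "(norm (f x *\<^sub>R g x + v x *\<^sub>R grad f x))^2 <= 2 * K\<^sup>2 * (norm (g x))^2 + 2 * K\<^sup>2 * (v x)^2" if "x \<in> ball 0 R" for x
  proof -
   have "(norm (f x *\<^sub>R g x + v x *\<^sub>R grad f x))^2 <= (norm (f x *\<^sub>R g x) + norm (v x *\<^sub>R grad f x))^2"
    by (intro power_mono norm_triangle_ineq) auto
   also have "... <= (K * norm (g x) + K * abs (v x))^2"
    using K(2)[OF that] by (intro power_mono add_mono) (auto intro!: mult_right_mono mult_left_mono simp: mult.commute[of K "abs (v x)"])
   also have "... <= 2 * (K * norm (g x))^2 + 2 * (K * abs (v x))^2" by (rule sq)
   finally show ?thesis by (simp add: power_mult_distrib)
  qed
  then show "AE x in lborel. norm (indicator (ball 0 R) x * (norm (f x *\<^sub>R g x + v x *\<^sub>R grad f x))^2) <= norm (2 * K\<^sup>2 * (indicator (ball 0 R) x * (norm (g x))^2) + 2 * K\<^sup>2 * (indicator (ball 0 R) x * (v x)^2))"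
   by (intro AE_I2) (auto split: split_indicator)
 qed auto
 moreover have "(LBINT x. (f x * v x) * pd b phi x) = - (LBINT x. ((f x *\<^sub>R g x + v x *\<^sub>R grad f x) \<bullet> b) * phi x)"
  if t: "test_function_on (ball 0 R) phi" and b: "b \<in> Basis" for phi b
 proof -
  have t1: "test_function_on (ball 0 R) (%x. phi x * f x)" using test_function_mult[OF t s] .
  have df: "\<forall>x. phi differentiable (at x)" "\<forall>x. f differentiable (at x)"
   using s t test_functionD smooth_differentiable by blast+
  have i: "integrable lborel (%x. v x * (phi x * pd b f x))" "integrable lborel (%x. v x * (pd b phi x * f x))"
   "integrable lborel (%x. (g x \<bullet> b) * (phi x * f x))"
   using sob_pair_test_integrable(1)[OF p test_function_mult[OF t smooth_pd[OF s b]] b]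
    sob_pair_test_integrable(1)[OF p test_function_mult[OF test_function_pd[OF t b] s] b]
    sob_pair_test_integrable(2)[OF p t1 b] by auto
  have "(LBINT x. v x * (phi x * pd b f x + pd b phi x * f x)) = - (LBINT x. (g x \<bullet> b) * (phi x * f x))"
   using d(5)[OF t1 b] unfolding pd_mult[OF df] .
  then have "(LBINT x. v x * (pd b phi x * f x)) = - ((LBINT x. (g x \<bullet> b) * (phi x * f x)) + (LBINT x. v x * (phi x * pd b f x)))"
   using i by (simp add: distrib_left)
  also have "... = - (LBINT x. (g x \<bullet> b) * (phi x * f x) + v x * (phi x * pd b f x))" using i by simp
  finally show ?thesis using b by (simp add: inner_add_left algebra_simps)
 qed
 ultimately show ?thesis unfolding sob_pair_def by auto
qed

text \<open>Each component of the difference of the gradients annihilates all test functions. This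
  is what makes gradients of dilated or re-represented functions comparable.\<close>

lemma sob_pair_unique:
 fixes v w :: "'a::euclidean_space => real"
 assumes p: "sob_pair R v g" and q: "sob_pair R w k" and e: "AE x in lborel. x \<in> ball 0 R --> v x = w x"
 shows "AE x in lborel. x \<in> ball 0 R --> g x = k x"
proof -
 note d = sob_pairD[OF p] and d' = sob_pairD[OF q]
 have [measurable]: "v \<in> borel_measurable borel" "g \<in> borel_measurable borel" 
   "w \<in> borel_measurable borel" "k \<in> borel_measurable borel" using d d' by auto
 have "AE x in lborel. x \<in> ball 0 R --> g x \<bullet> b - k x \<bullet> b = 0" if b: "b \<in> Basis" for b :: 'a
 proof (rule fundamental_lemma_ball)
  show "integrable lborel (%x. indicator (ball 0 R) x * (g x \<bullet> b - k x \<bullet> b)^2)"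
   using L2_ball_comp_integrable[OF _ sob_pairD(4)[OF sob_pair_lincomb[OF p q, of 1 "-1"]] b]
   by (simp add: inner_diff_left)
  fix phi :: "'a => real" assume t: "test_function_on (ball 0 R) phi"
  have [measurable]: "pd b phi \<in> borel_measurable borel"
   using smooth_borel[OF smooth_pd[OF test_functionD(1)[OF t] b]] .
  have "(LBINT x. v x * pd b phi x) = (LBINT x. w x * pd b phi x)"
   by (rule integral_cong_AE) (use e test_functionD(3)[OF test_function_pd[OF t b]] in \<open>auto elim!: eventually_mono\<close>)
  then show "(LBINT x. (g x \<bullet> b - k x \<bullet> b) * phi x) = 0"
   using d(5)[OF t b] d'(5)[OF t b] sob_pair_test_integrable[OF p t b] sob_pair_test_integrable[OF q t b]
   by (simp add: left_diff_distrib)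
 qed auto
 then have "AE x in lborel. \<forall>b\<in>(Basis::'a set). x \<in> ball 0 R --> g x \<bullet> b - k x \<bullet> b = 0"
  by (intro AE_finite_allI) auto
 then show ?thesis by eventually_elim (auto intro: euclidean_eqI)
qed

subsection \<open>The space \<open>W12\<close> in terms of Borel representatives\<close>

text \<open>Links a Lebesgue measurable \<open>w\<close>, as it occurs in \<open>W12\<close>, to a
  Borel pair that agrees with it almost everywhere in the unit ball.\<close>

definition sob_rep :: "('a::euclidean_space => real) => ('a => real) => ('a => 'a) => bool" where
 "sob_rep w v g \<longleftrightarrow> sob_pair 1 v g \<and> w \<in> borel_measurable (lebesgue_on (ball 0 1)) \<and>
   (AE x in lborel. x \<in> ball 0 1 --> w x = v x)"

lemma AE_lebesgue_on_ball:
 "(AE x in lebesgue_on (ball 0 R). P x) \<longleftrightarrow> (AE x in lborel. x \<in> ball (0::'a::euclidean_space) R --> P x)"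
 by (subst AE_restrict_space_iff) (auto simp: AE_completion_iff)

lemma borel_imp_lebesgue_on:
 "(f :: 'a::euclidean_space => 'b::{second_countable_topology,real_normed_vector}) \<in> borel_measurable borel ==> f \<in> borel_measurable (lebesgue_on S)"
 by (intro measurable_restrict_space1 measurable_completion) auto

lemma integral_lebesgue_on_ball:
 fixes f :: "'a::euclidean_space => 'b::{banach,second_countable_topology}"
 assumes [measurable]: "f \<in> borel_measurable borel"
 shows "(\<integral>x. f x \<partial>lebesgue_on (ball 0 R)) = (LBINT x. indicator (ball 0 R) x *\<^sub>R f x)"
  and "integrable (lebesgue_on (ball 0 R)) f \<longleftrightarrow> integrable lborel (%x. indicator (ball 0 R) x *\<^sub>R f x)"
proof -
 have m: "(%x. indicator (ball 0 R) x *\<^sub>R f x) \<in> borel_measurable lborel" by auto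
 show "(\<integral>x. f x \<partial>lebesgue_on (ball 0 R)) = (LBINT x. indicator (ball 0 R) x *\<^sub>R f x)"
  using integral_completion[OF m] by (subst integral_restrict_space) auto
 show "integrable (lebesgue_on (ball 0 R)) f \<longleftrightarrow> integrable lborel (%x. indicator (ball 0 R) x *\<^sub>R f x)"
  using integrable_completion[OF m] by (subst integrable_restrict_space) auto
qed

lemma lebesgue_on_borel_rep:
 fixes f :: "'a::euclidean_space => real"
 assumes "f \<in> borel_measurable (lebesgue_on (ball 0 R))"
 shows "\<exists>f0 \<in> borel_measurable borel. AE x in lborel. x \<in> ball 0 R --> f x = f0 x"
proof -
 have "(%x. indicator (ball 0 R) x *\<^sub>R f x) \<in> borel_measurable lebesgue"
  using assms by (subst (asm) borel_measurable_restrict_space_iff) auto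
 from completion_ex_borel_measurable_real[OF this[simplified]]
 obtain f0 where f0: "f0 \<in> borel_measurable lborel" "AE x in lborel. indicator (ball 0 R) x * f x = f0 x" by auto
 show ?thesis
  by (intro bexI[of _ f0]) (use f0 in \<open>auto elim!: eventually_mono\<close>)
qed

lemma lebesgue_on_borel_rep_vec:
 fixes f :: "'a::euclidean_space => 'a"
 assumes "f \<in> borel_measurable (lebesgue_on (ball 0 R))"
 shows "\<exists>f0 \<in> borel_measurable borel. AE x in lborel. x \<in> ball 0 R --> f x = f0 x"
proof -
 have "\<exists>h \<in> borel_measurable borel. AE x in lborel. x \<in> ball 0 R --> f x \<bullet> b = h x" for b
  by (rule lebesgue_on_borel_rep) (use assms in auto)
 then obtain h where h: "!!b. h b \<in> borel_measurable borel" "!!b. AE x in lborel. x \<in> ball 0 R --> f x \<bullet> b = h b x" by metis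
 define f0 where "f0 x = (\<Sum>b\<in>Basis. h b x *\<^sub>R b)" for x
 have "AE x in lborel. \<forall>b\<in>(Basis::'a set). x \<in> ball 0 R --> f x \<bullet> b = h b x"
  by (intro AE_finite_allI h) auto
 then have "AE x in lborel. x \<in> ball 0 R --> f x = f0 x"
 proof eventually_elim
  fix x assume a: "\<forall>b\<in>(Basis::'a set). x \<in> ball 0 R --> f x \<bullet> b = h b x"
  have "(\<Sum>b\<in>Basis. (f x \<bullet> b) *\<^sub>R b) = f0 x" if "x \<in> ball 0 R"
   unfolding f0_def using a that by (intro sum.cong) auto
  then show "x \<in> ball 0 R --> f x = f0 x" by (simp add: euclidean_representation)
 qed
 moreover have "f0 \<in> borel_measurable borel" unfolding f0_def[abs_def] using h(1) by auto
 ultimately show ?thesis by blast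
qed

lemma pd_outside_ball: "test_function_on (ball 0 R) phi ==> b \<in> Basis ==> indicator (ball 0 R) x * (c * pd b phi x) = c * pd b phi x"
 using test_functionD(3)[OF test_function_pd, of "ball 0 R" phi b x] by (auto simp del: mem_ball split: split_indicator)

lemma test_outside_ball: "test_function_on (ball 0 R) phi ==> indicator (ball 0 R) x * (c * phi x) = c * phi x"
 using test_functionD(3)[of "ball 0 R" phi x] by (auto simp del: mem_ball split: split_indicator)

lemma weak_gradient_iff:
 fixes w :: "'a::euclidean_space => real"
 assumes w: "w \<in> borel_measurable (lebesgue_on (ball 0 1))" and k: "k \<in> borel_measurable (lebesgue_on (ball 0 1))"
  and [measurable]: "v \<in> borel_measurable borel" "g \<in> borel_measurable borel"
  and e: "AE x in lborel. x \<in> ball 0 1 --> w x = v x" "AE x in lborel. x \<in> ball 0 1 --> k x = g x"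
 shows "w \<in> L2 (lebesgue_on (ball 0 1)) \<and> k \<in> L2 (lebesgue_on (ball 0 1)) \<and> has_weak_gradient (ball 0 1) w k \<longleftrightarrow> sob_pair 1 v g"
proof -
 let ?M = "lebesgue_on (ball (0::'a) 1)"
 have v: "v \<in> borel_measurable ?M" and g: "g \<in> borel_measurable ?M" by (auto intro: borel_imp_lebesgue_on)
 have e': "AE x in ?M. w x = v x" "AE x in ?M. k x = g x" using e by (auto simp: AE_lebesgue_on_ball)
 have a: "integrable ?M (%x. (w x)^2) \<longleftrightarrow> integrable lborel (%x. indicator (ball 0 1) x * (v x)^2)"
 proof -
  have "integrable ?M (%x. (w x)^2) \<longleftrightarrow> integrable ?M (%x. (v x)^2)"
   using w v by (intro integrable_cong_AE) (use e'(1) in \<open>auto elim!: eventually_mono\<close>)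
  then show ?thesis using integral_lebesgue_on_ball(2)[of "%x. (v x)^2" 1] by simp
 qed
 have b: "integrable ?M (%x. (norm (k x))^2) \<longleftrightarrow> integrable lborel (%x. indicator (ball 0 1) x * (norm (g x))^2)"
 proof -
  have "integrable ?M (%x. (norm (k x))^2) \<longleftrightarrow> integrable ?M (%x. (norm (g x))^2)"
   using k g by (intro integrable_cong_AE) (use e'(2) in \<open>auto elim!: eventually_mono\<close>)
  then show ?thesis using integral_lebesgue_on_ball(2)[of "%x. (norm (g x))^2" 1] by simp
 qed
 have c: "(\<integral>x. w x * frechet_derivative phi (at x) b \<partial>?M) = (LBINT x. v x * pd b phi x)"
  "(\<integral>x. (k x \<bullet> b) * phi x \<partial>?M) = (LBINT x. (g x \<bullet> b) * phi x)"
  if t: "test_function_on (ball 0 1) phi" and b: "b \<in> Basis" for phi and b :: 'a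
 proof -
  have p: "pd b phi \<in> borel_measurable borel" "phi \<in> borel_measurable borel"
   using smooth_borel smooth_pd test_functionD(1)[OF t] b by auto
  note [measurable] = p
  have m1: "(%x. v x * pd b phi x) \<in> borel_measurable borel" and m2: "(%x. (g x \<bullet> b) * phi x) \<in> borel_measurable borel"
   by measurable
  have p': "pd b phi \<in> borel_measurable ?M" "phi \<in> borel_measurable ?M" using p by (auto intro: borel_imp_lebesgue_on)
  have "(\<integral>x. w x * pd b phi x \<partial>?M) = (\<integral>x. v x * pd b phi x \<partial>?M)"
   using w v p' by (intro integral_cong_AE) (use e'(1) in \<open>auto elim!: eventually_mono\<close>)
  then show "(\<integral>x. w x * frechet_derivative phi (at x) b \<partial>?M) = (LBINT x. v x * pd b phi x)"
   using integral_lebesgue_on_ball(1)[OF m1, of 1] unfolding real_scaleR_def pd_outside_ball[OF t b] unfolding pd_def by simp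
  have "(\<integral>x. (k x \<bullet> b) * phi x \<partial>?M) = (\<integral>x. (g x \<bullet> b) * phi x \<partial>?M)"
   using k g p' by (intro integral_cong_AE) (use e'(2) in \<open>auto elim!: eventually_mono\<close>)
  then show "(\<integral>x. (k x \<bullet> b) * phi x \<partial>?M) = (LBINT x. (g x \<bullet> b) * phi x)"
   using integral_lebesgue_on_ball(1)[OF m2, of 1] unfolding real_scaleR_def test_outside_ball[OF t] by simp
 qed
 show ?thesis using w k a b c by (auto simp: sob_pair_def L2_def has_weak_gradient_def)
qed

lemma W12_imp_sob_rep:
 assumes "w \<in> W12 (ball 0 1)" shows "\<exists>v g. sob_rep w v g"
proof -
 obtain k where k: "k \<in> L2 (lebesgue_on (ball 0 1))" "has_weak_gradient (ball 0 1) w k" and w: "w \<in> L2 (lebesgue_on (ball 0 1))"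
  using assms by (auto simp: W12_def)
 have m: "w \<in> borel_measurable (lebesgue_on (ball 0 1))" "k \<in> borel_measurable (lebesgue_on (ball 0 1))"
  using w k by (auto simp: L2_def)
 obtain v where v: "v \<in> borel_measurable borel" "AE x in lborel. x \<in> ball 0 1 --> w x = v x"
  using lebesgue_on_borel_rep[OF m(1)] by blast
 obtain g where g: "g \<in> borel_measurable borel" "AE x in lborel. x \<in> ball 0 1 --> k x = g x"
  using lebesgue_on_borel_rep_vec[OF m(2)] by blast
 show ?thesis using weak_gradient_iff[OF m v(1) g(1) v(2) g(2)] w k m v by (auto simp: sob_rep_def)
qed

text \<open>The gradient picked by \<open>weak_gradient\<close> has a Borel representative of its
  own, and uniqueness identifies it with \<open>g\<close> almost everywhere; so integrals of the
  chosen gradient may be computed with \<open>g\<close>.\<close>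

lemma sob_rep_W12:
 assumes r: "sob_rep w v g"
 shows "w \<in> W12 (ball 0 1)"
  and "(\<integral>x. (w x)^2 \<partial>lebesgue_on (ball 0 1)) = (LBINT x. indicator (ball 0 1) x * (v x)^2)"
  and "(\<integral>x. (norm (weak_gradient (ball 0 1) w x))^2 \<partial>lebesgue_on (ball 0 1)) = (LBINT x. indicator (ball 0 1) x * (norm (g x))^2)"
proof -
 let ?M = "lebesgue_on (ball (0::'a) 1)"
 have p: "sob_pair 1 v g" and w: "w \<in> borel_measurable ?M" and e: "AE x in lborel. x \<in> ball 0 1 --> w x = v x"
  using r by (auto simp: sob_rep_def)
 note d = sob_pairD[OF p]
 note [measurable] = d(1,2)
 have wg: "w \<in> L2 ?M \<and> g \<in> L2 ?M \<and> has_weak_gradient (ball 0 1) w g"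
  using weak_gradient_iff[OF w borel_imp_lebesgue_on[OF d(2)] d(1,2) e] p by auto
 then show W: "w \<in> W12 (ball 0 1)" by (auto simp: W12_def)
 have v': "v \<in> borel_measurable ?M" and g': "g \<in> borel_measurable ?M" by (auto intro: borel_imp_lebesgue_on)
 have "(\<integral>x. (w x)^2 \<partial>?M) = (\<integral>x. (v x)^2 \<partial>?M)"
  using w v' by (intro integral_cong_AE) (use e in \<open>auto simp: AE_lebesgue_on_ball elim!: eventually_mono\<close>)
 then show "(\<integral>x. (w x)^2 \<partial>?M) = (LBINT x. indicator (ball 0 1) x * (v x)^2)"
  using integral_lebesgue_on_ball(1)[of "%x. (v x)^2" 1] by simp
 let ?k = "weak_gradient (ball 0 1) w"
 have "?k \<in> L2 ?M \<and> has_weak_gradient (ball 0 1) w ?k"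
  unfolding weak_gradient_def by (rule someI[where x=g]) (use wg in auto)
 then have k: "?k \<in> L2 ?M" "has_weak_gradient (ball 0 1) w ?k" and km: "?k \<in> borel_measurable ?M" by (auto simp: L2_def)
 obtain g0 where g0: "g0 \<in> borel_measurable borel" "AE x in lborel. x \<in> ball 0 1 --> ?k x = g0 x"
  using lebesgue_on_borel_rep_vec[OF km] by blast
 have p0: "sob_pair 1 v g0"
  using weak_gradient_iff[OF w km d(1) g0(1) e g0(2)] k wg by auto
 have "AE x in lborel. x \<in> ball 0 1 --> g x = g0 x" using sob_pair_unique[OF p p0] by auto
 with g0(2) have "AE x in lborel. x \<in> ball 0 1 --> ?k x = g x" by eventually_elim auto
 then have "(\<integral>x. (norm (?k x))^2 \<partial>?M) = (\<integral>x. (norm (g x))^2 \<partial>?M)"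
  using km g' by (intro integral_cong_AE) (auto simp: AE_lebesgue_on_ball elim!: eventually_mono)
 then show "(\<integral>x. (norm (?k x))^2 \<partial>?M) = (LBINT x. indicator (ball 0 1) x * (norm (g x))^2)"
  using integral_lebesgue_on_ball(1)[of "%x. (norm (g x))^2" 1] by simp
qed

lemma sob_rep_self: "sob_pair 1 v g ==> sob_rep v v g"
 by (auto simp: sob_rep_def intro: borel_imp_lebesgue_on dest: sob_pairD)

lemma sob_rep_lincomb:
 assumes "sob_rep w v g" "sob_rep w' v' g'"
 shows "sob_rep (%x. a * w x + c * w' x) (%x. a * v x + c * v' x) (%x. a *\<^sub>R g x + c *\<^sub>R g' x)"
 using assms sob_pair_lincomb[of 1 v g v' g' a c] by (auto simp: sob_rep_def)

definition Bint :: "('a::euclidean_space => real) => real" where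
 "Bint f = (LBINT x. indicator (ball 0 1) x * f x)"

definition pair_norm2 :: "('a::euclidean_space => real) => ('a => 'a) => real" where
 "pair_norm2 v g = Bint (%x. (v x)^2) + Bint (%x. (norm (g x))^2)"

lemma sob_rep_norm: "sob_rep w v g ==> W12_norm (ball 0 1) w = sqrt (pair_norm2 v g)"
 by (simp add: W12_norm_def sob_rep_W12 pair_norm2_def Bint_def)

lemma sob_rep_smooth_diff:
 assumes "sob_rep w v g" "smooth phi"
 shows "sob_rep (%x. phi x - w x) (%x. phi x - v x) (%x. grad phi x - g x)"
 using sob_rep_lincomb[OF sob_rep_self[OF sob_pair_smooth[OF assms(2)]] assms(1), of 1 "-1"] by simp

text \<open>Writing the convergence with the squared norm of the pair eliminates the square root and
  the chosen gradient from the definition of a trace.\<close>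

lemma has_trace_iff:
 assumes "sob_rep w v g"
 shows "has_trace (ball 0 1) M w \<gamma> \<longleftrightarrow> \<gamma> \<in> L2 M \<and>
   (\<exists>phi::nat => 'a::euclidean_space => real. (\<forall>k. smooth (phi k)) \<and>
    (%k. pair_norm2 (%x. phi k x - v x) (%x. grad (phi k) x - g x)) \<longlonglongrightarrow> 0 \<and>
    (%k. \<integral>x. (phi k x - \<gamma> x)^2 \<partial>M) \<longlonglongrightarrow> 0)"
proof -
 have "(%k. W12_norm (ball 0 1) (%x. phi k x - w x)) \<longlonglongrightarrow> 0 \<longleftrightarrow>
   (%k. pair_norm2 (%x. phi k x - v x) (%x. grad (phi k) x - g x)) \<longlonglongrightarrow> 0"
  if s: "\<forall>k. smooth (phi k)" for phi :: "nat => 'a => real"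
 proof -
  let ?N = "%k. pair_norm2 (%x. phi k x - v x) (%x. grad (phi k) x - g x)"
  have e: "W12_norm (ball 0 1) (%x. phi k x - w x) = sqrt (?N k)" for k
   using sob_rep_norm[OF sob_rep_smooth_diff[OF assms]] s by blast
  have n: "?N k >= 0" for k by (auto simp: pair_norm2_def Bint_def intro!: add_nonneg_nonneg integral_nonneg_AE)
  have "(%k. sqrt (?N k)) \<longlonglongrightarrow> 0 \<longleftrightarrow> ?N \<longlonglongrightarrow> 0"
  proof
   assume "(%k. sqrt (?N k)) \<longlonglongrightarrow> 0"
   from tendsto_power[OF this, of 2] show "?N \<longlonglongrightarrow> 0" using n by simp
  next
   assume "?N \<longlonglongrightarrow> 0" from tendsto_real_sqrt[OF this] show "(%k. sqrt (?N k)) \<longlonglongrightarrow> 0" by simp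
  qed
  then show ?thesis by (simp add: e)
 qed
 then have "(\<forall>k. smooth (phi k)) \<and> (%k. W12_norm (ball 0 1) (%x. phi k x - w x)) \<longlonglongrightarrow> 0 \<and> P \<longleftrightarrow>
   (\<forall>k. smooth (phi k)) \<and> (%k. pair_norm2 (%x. phi k x - v x) (%x. grad (phi k) x - g x)) \<longlonglongrightarrow> 0 \<and> P" for phi P
  by blast
 then show ?thesis unfolding has_trace_def by presburger
qed

subsection \<open>Homogeneous functions and radial weights\<close>

text \<open>The exceptional null set may depend on \<open>t\<close>, which is all that the
  hypothesis on \<open>w\<close> provides and all that integrals of dilated functions can
  detect.\<close>

definition hom :: "real => ('a::euclidean_space => 'b::real_normed_vector) => bool" where
 "hom a f \<longleftrightarrow> (\<forall>t>0. AE x in lborel. f (t *\<^sub>R x) = (t powr a) *\<^sub>R f x)"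

lemma homD: "hom a f ==> t > 0 ==> AE x in lborel. f (t *\<^sub>R x) = (t powr a) *\<^sub>R f x"
 by (simp add: hom_def)

lemma hom_add: "hom a f ==> hom a g ==> hom a (%x. f x + g x)"
 unfolding hom_def
proof (intro allI impI)
 fix t :: real
 assume "\<forall>t>0. AE x in lborel. f (t *\<^sub>R x) = t powr a *\<^sub>R f x" "\<forall>t>0. AE x in lborel. g (t *\<^sub>R x) = t powr a *\<^sub>R g x" "t > 0"
 then have "AE x in lborel. f (t *\<^sub>R x) = t powr a *\<^sub>R f x" "AE x in lborel. g (t *\<^sub>R x) = t powr a *\<^sub>R g x" by auto
 then show "AE x in lborel. f (t *\<^sub>R x) + g (t *\<^sub>R x) = t powr a *\<^sub>R (f x + g x)"
  by eventually_elim (simp add: scaleR_add_right)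
qed

lemma hom_scale: "hom a f ==> hom a (%x. c *\<^sub>R f x)"
 unfolding hom_def by (auto elim!: eventually_mono)

lemma hom_mult:
 fixes f g :: "'a::euclidean_space => real"
 assumes "hom a f" "hom b g" shows "hom (a + b) (%x. f x * g x)"
 unfolding hom_def
proof (intro allI impI)
 fix t :: real assume t: "t > 0"
 show "AE x in lborel. f (t *\<^sub>R x) * g (t *\<^sub>R x) = t powr (a + b) *\<^sub>R (f x * g x)"
  using homD[OF assms(1) t] homD[OF assms(2) t] by eventually_elim (simp add: powr_add)
qed

lemma hom_inner:
 fixes f g :: "'a::euclidean_space => 'a"
 assumes "hom a f" "hom b g" shows "hom (a + b) (%x. f x \<bullet> g x)"
 unfolding hom_def
proof (intro allI impI)
 fix t :: real assume t: "t > 0"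
 show "AE x in lborel. f (t *\<^sub>R x) \<bullet> g (t *\<^sub>R x) = t powr (a + b) *\<^sub>R (f x \<bullet> g x)"
  using homD[OF assms(1) t] homD[OF assms(2) t] by eventually_elim (simp add: powr_add)
qed

lemma hom_max0:
 fixes f :: "'a::euclidean_space => real"
 assumes "hom a f" shows "hom a (%x. max 0 (f x))"
 unfolding hom_def
proof (intro allI impI)
 fix t :: real assume t: "t > 0"
 show "AE x in lborel. max 0 (f (t *\<^sub>R x)) = t powr a *\<^sub>R max 0 (f x)"
  using homD[OF assms t] by eventually_elim (simp add: max_mult_distrib_left)
qed

lemma hom_strict: "(!!t x. t > 0 ==> f (t *\<^sub>R x) = (t powr a) *\<^sub>R f x) ==> hom a f"
 by (simp add: hom_def)

lemma sphere_null: "sphere (0::'a::euclidean_space) r \<in> null_sets lborel"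
proof -
 have "sphere (0::'a) r \<in> null_sets (completion lborel)"
  using negligible_convex_frontier[of "cball (0::'a) r"] negligible_sphere[of "0::'a" r] by (simp add: negligible_iff_null_sets)
 then show ?thesis by (subst (asm) null_sets_completion_iff) auto
qed

lemma AE_not_sphere: "AE x in lborel. x \<notin> sphere (0::'a::euclidean_space) r"
 using AE_not_in[OF sphere_null] .

lemma hom_cball_nn_integral:
 fixes f :: "'a::euclidean_space => real"
 assumes [measurable]: "f \<in> borel_measurable borel" and h: "hom a f" and pos: "!!x. f x >= 0" and s: "s > 0"
 shows "(\<integral>\<^sup>+x. ennreal (f x) * indicator (cball 0 s) x \<partial>lborel) =
  ennreal (s powr (a + DIM('a))) * (\<integral>\<^sup>+x. ennreal (indicator (ball 0 1) x * f x) \<partial>lborel)"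
proof -
 have "(\<integral>\<^sup>+x. ennreal (f x) * indicator (cball 0 s) x \<partial>lborel) =
   ennreal (abs s^DIM('a)) * (\<integral>\<^sup>+x. ennreal (f (0 + s *\<^sub>R x)) * indicator (cball 0 s) (0 + s *\<^sub>R x) \<partial>lborel)"
  by (rule lborel_nn_integral_affine) (use s in auto)
 also have "(\<integral>\<^sup>+x. ennreal (f (0 + s *\<^sub>R x)) * indicator (cball 0 s) (0 + s *\<^sub>R x) \<partial>lborel)
  = (\<integral>\<^sup>+x. ennreal (s powr a) * ennreal (indicator (ball 0 1) x * f x) \<partial>lborel)"
 proof (rule nn_integral_cong_AE)
  show "AE x in lborel. ennreal (f (0 + s *\<^sub>R x)) * indicator (cball 0 s) (0 + s *\<^sub>R x) = ennreal (s powr a) * ennreal (indicator (ball 0 1) x * f x)"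
   using homD[OF h s] AE_not_sphere[of 1]
  proof eventually_elim
   fix x assume a: "f (s *\<^sub>R x) = s powr a *\<^sub>R f x" "x \<notin> sphere 0 1"
   have "s *\<^sub>R x \<in> cball 0 s \<longleftrightarrow> x \<in> ball 0 1" using s a(2) by (auto simp: mult_le_cancel_left1)
   then show "ennreal (f (0 + s *\<^sub>R x)) * indicator (cball 0 s) (0 + s *\<^sub>R x) = ennreal (s powr a) * ennreal (indicator (ball 0 1) x * f x)"
    using a pos by (auto simp: ennreal_mult split: split_indicator)
  qed
 qed
 also have "... = ennreal (s powr a) * (\<integral>\<^sup>+x. ennreal (indicator (ball 0 1) x * f x) \<partial>lborel)"
  by (rule nn_integral_cmult) auto
 finally show ?thesis using s by (simp add: powr_add powr_realpow ennreal_mult mult_ac)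
qed

text \<open>Layer-cake formula for a radial weight \<open>w(r) = \<integral>\<^sub>r\<^sup>\<infinity> k\<close>.\<close>

lemma layer_cake_nn:
 fixes f :: "'a::euclidean_space => real"
 assumes [measurable]: "f \<in> borel_measurable borel" "k \<in> borel_measurable borel" and h: "hom a f" and pos: "!!x. f x >= 0"
  and kpos: "!!s. k s >= 0" and w: "!!x::'a. (\<integral>\<^sup>+s. ennreal (k s) * indicator {norm x ..} s \<partial>lborel) = ennreal (w x)"
  and wpos: "!!x. w x >= 0"
 shows "(\<integral>\<^sup>+x. ennreal (f x * w x) \<partial>lborel) =
   (\<integral>\<^sup>+s. ennreal (k s * s powr (a + DIM('a))) * indicator {0..} s \<partial>lborel) * (\<integral>\<^sup>+x. ennreal (indicator (ball 0 1) x * f x) \<partial>lborel)"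
proof -
 let ?I = "\<integral>\<^sup>+x. ennreal (indicator (ball 0 1) x * f x) \<partial>lborel"
 have "(\<integral>\<^sup>+x. ennreal (f x * w x) \<partial>lborel) = (\<integral>\<^sup>+x. ennreal (f x) * (\<integral>\<^sup>+s. ennreal (k s) * indicator {norm x ..} s \<partial>lborel) \<partial>lborel)"
  by (simp add: w ennreal_mult pos wpos)
 also have "... = (\<integral>\<^sup>+x. \<integral>\<^sup>+s. ennreal (f x) * (ennreal (k s) * indicator {p. norm (fst p) <= snd p} (x, s)) \<partial>lborel \<partial>lborel)"
  by (intro nn_integral_cong, subst nn_integral_cmult[symmetric]) (auto intro!: nn_integral_cong split: split_indicator)
 \<comment> \<open>Tonelli in (x, s) trades the radial weight for integrals over the balls
   \<open>cball 0 s\<close>, and homogeneity evaluates each of these as a power of \<open>s\<close>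
   times the unit ball integral.\<close>
 also have "... = (\<integral>\<^sup>+s. \<integral>\<^sup>+x. ennreal (f x) * (ennreal (k s) * indicator {p. norm (fst p) <= snd p} (x, s)) \<partial>lborel \<partial>lborel)"
  by (rule lborel_pair.Fubini') measurable
 also have "... = (\<integral>\<^sup>+s. (ennreal (k s * s powr (a + DIM('a))) * indicator {0..} s) * ?I \<partial>lborel)"
 proof (rule nn_integral_cong_AE)
  have "AE s in lborel. s ~= (0::real)" using AE_lborel_singleton by auto
  then show "AE s in lborel. (\<integral>\<^sup>+x. ennreal (f x) * (ennreal (k s) * indicator {p. norm (fst p) <= snd p} (x, s)) \<partial>lborel)
    = (ennreal (k s * s powr (a + DIM('a))) * indicator {0..} s) * ?I"
  proof eventually_elim
   fix s :: real assume s0: "s ~= 0"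
   show "(\<integral>\<^sup>+x. ennreal (f x) * (ennreal (k s) * indicator {p. norm (fst p) <= snd p} (x, s)) \<partial>lborel)
    = (ennreal (k s * s powr (a + DIM('a))) * indicator {0..} s) * ?I"
   proof (cases "s > 0")
    case True
    have "(\<integral>\<^sup>+x. ennreal (f x) * (ennreal (k s) * indicator {p. norm (fst p) <= snd p} (x, s)) \<partial>lborel)
     = (\<integral>\<^sup>+x. ennreal (k s) * (ennreal (f x) * indicator (cball 0 s) x) \<partial>lborel)"
     by (intro nn_integral_cong) (auto simp: mult_ac split: split_indicator)
    also have "... = ennreal (k s) * (\<integral>\<^sup>+x. ennreal (f x) * indicator (cball 0 s) x \<partial>lborel)"
     by (rule nn_integral_cmult) auto
    also have "... = ennreal (k s) * (ennreal (s powr (a + DIM('a))) * ?I)"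
     by (subst hom_cball_nn_integral[OF _ h pos True]) auto
    finally show ?thesis using True kpos by (simp add: ennreal_mult mult_ac)
   next
    case False
    then have "indicator {p. norm (fst p) <= snd p} (x::'a, s) = (0::ennreal)" for x
     using s0 order_trans[OF norm_ge_zero[of x], of s] by (auto split: split_indicator) 
    then show ?thesis using False s0 by (simp split: split_indicator)
   qed
  qed
 qed
 also have "... = (\<integral>\<^sup>+s. ennreal (k s * s powr (a + DIM('a))) * indicator {0..} s \<partial>lborel) * ?I"
  by (rule nn_integral_multc) measurable
 finally show ?thesis .
qed

lemma Bint_nonneg: "(!!x. f x >= 0) ==> Bint f >= 0"
 unfolding Bint_def by (intro integral_nonneg_AE) auto

lemma Bint_nn:
 assumes "f \<in> borel_measurable borel" "integrable lborel (%x. indicator (ball 0 1) x * f x)" "!!x::'a::euclidean_space. f x >= 0"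
 shows "(\<integral>\<^sup>+x. ennreal (indicator (ball 0 1) x * f x) \<partial>lborel) = ennreal (Bint f)"
 unfolding Bint_def by (rule nn_integral_eq_integral[OF assms(2)]) (use assms(3) in auto)

lemma layer_cake_quadratic_nn:
 fixes f :: "'a::euclidean_space => real"
 assumes [measurable]: "f \<in> borel_measurable borel" and i: "integrable lborel (%x. indicator (ball 0 1) x * f x)"
  and h: "hom a f" and pos: "!!x. f x >= 0" and a: "a >= 0"
 shows "Bint (%x. (1 - (norm x)^2) * f x) = 2 / (a + DIM('a) + 2) * Bint f"
proof -
 \<comment> \<open>The kernel comes from 1 - r^2 being the integral of 2 s over [r, 1].\<close>
 define k where "k s = (if 0 <= s \<and> s <= 1 then 2 * s else (0::real))" for s
 define w where "w x = indicator (ball 0 1) x * (1 - (norm (x::'a))^2)" for x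
 have w0: "w x >= 0" for x unfolding w_def by (auto split: split_indicator simp: abs_square_le_1 power_le_one)
 have kw: "(\<integral>\<^sup>+s. ennreal (k s) * indicator {norm x ..} s \<partial>lborel) = ennreal (w x)" for x :: 'a
 proof (cases "norm x < 1")
  case True
  have "(\<integral>\<^sup>+s. ennreal (k s) * indicator {norm x ..} s \<partial>lborel) = (\<integral>\<^sup>+s. ennreal (2 * s) * indicator {norm x .. 1} s \<partial>lborel)"
   by (intro nn_integral_cong) (auto simp: k_def split: split_indicator intro: order_trans[OF norm_ge_zero])
  also have "... = ennreal (1\<^sup>2 - (norm x)^2)"
   using True by (intro nn_integral_FTC_Icc) (auto intro!: derivative_eq_intros order_trans[OF norm_ge_zero])
  finally show ?thesis using True by (simp add: w_def)
 next
  case False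
  have "AE s in lborel. s ~= (1::real)" using AE_lborel_singleton by auto
  then have "(\<integral>\<^sup>+s. ennreal (k s) * indicator {norm x ..} s \<partial>lborel) = (\<integral>\<^sup>+s. 0 \<partial>(lborel :: real measure))"
   by (intro nn_integral_cong_AE, elim eventually_mono) (use False in \<open>auto simp: k_def split: split_indicator\<close>)
  then show ?thesis using False by (simp add: w_def)
 qed
 have c: "(\<integral>\<^sup>+s. ennreal (k s * s powr (a + DIM('a))) * indicator {0..} s \<partial>lborel) = ennreal (2 / (a + DIM('a) + 2))"
 proof -
  let ?p = "a + DIM('a)"
  have "(\<integral>\<^sup>+s. ennreal (k s * s powr ?p) * indicator {0..} s \<partial>lborel) = (\<integral>\<^sup>+s. ennreal (2 * s powr (?p + 1)) * indicator {0..1} s \<partial>lborel)"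
   by (intro nn_integral_cong) (auto simp: k_def powr_add split: split_indicator)
  also have "... = ennreal (2 / (?p + 2) * abs 1 powr (?p + 2) - 2 / (?p + 2) * abs 0 powr (?p + 2))"
  \<comment> \<open>The antiderivative is written with |s| because a two-sided derivative is wanted
    also at s = 0.\<close>
  proof (rule nn_integral_FTC_Icc[where F="%s. 2 / (?p + 2) * abs s powr (?p + 2)"])
   fix s :: real assume s01: "s \<in> {0..1}"
   then have "0 <= s" by simp
   have p: "?p > 0" using a by (simp add: add_nonneg_pos)
   show "((%s. 2 / (?p + 2) * abs s powr (?p + 2)) has_real_derivative 2 * s powr (?p + 1)) (at s)"
   proof (cases "s = 0")
    case False
    have "((%s. 2 / (?p + 2) * s powr (?p + 2)) has_real_derivative 2 / (?p + 2) * ((?p + 2) * s powr (?p + 2 - 1))) (at s)"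
     using False \<open>0 <= s\<close> by (intro DERIV_cmult has_real_derivative_powr) auto
    moreover have "?p + 2 - 1 = ?p + 1" "2 / (?p + 2) * ((?p + 2) * c) = 2 * c" for c using p by simp_all
    ultimately have d: "((%s. 2 / (?p + 2) * s powr (?p + 2)) has_real_derivative 2 * s powr (?p + 1)) (at s)"
     by (simp only:)
    show ?thesis
     by (rule has_field_derivative_transform_within_open[OF d open_greaterThan[of 0]]) (use False \<open>0 <= s\<close> in auto)
   next
    case True
    have l: "((%h. abs h powr (?p + 1)) \<longlongrightarrow> 0) (at 0)"
     using p tendsto_powr'[of "%h::real. abs h" 0 "at 0" "%_. ?p + 1" "?p + 1"] by (auto intro!: tendsto_eq_intros)
    have "((%h. (abs h powr (?p + 2)) / h) \<longlongrightarrow> 0) (at 0)"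
    proof (rule Lim_null_comparison[OF _ l], intro always_eventually allI)
     fix h :: real
     show "norm (abs h powr (?p + 2) / h) <= abs h powr (?p + 1)"
     proof (cases "h = 0")
      case False
      have "abs h powr ((?p + 1) + 1) = abs h powr (?p + 1) * abs h" using False by (subst powr_add) simp
      then have e: "abs h powr (?p + 2) = abs h powr (?p + 1) * abs h" by (simp add: add.assoc)
      have "norm (abs h powr (?p + 2) / h) = abs h powr (?p + 2) / abs h" by simp
      also have "... = abs h powr (?p + 1)" unfolding e using False by (simp only: nonzero_mult_div_cancel_right abs_eq_0 not_False_eq_True)
      finally show ?thesis by simp
     qed simp
    qed
    from tendsto_mult_left[OF this, of "2 / (?p + 2)"] show ?thesis using True p unfolding DERIV_def by simp
   qed
  qed (use a in auto)
  finally show ?thesis using a by simp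
 qed
 have m: "k \<in> borel_measurable borel" unfolding k_def[abs_def] by measurable
 have L: "(\<integral>\<^sup>+x. ennreal (f x * w x) \<partial>lborel) = ennreal (2 / (a + DIM('a) + 2)) * ennreal (Bint f)"
  using layer_cake_nn[OF assms(1) m h pos _ kw w0] Bint_nn[OF assms(1) i pos] c by (auto simp: k_def)
 have iw: "integrable lborel (%x. indicator (ball 0 1) x * ((1 - (norm x)^2) * f x))"
 proof (rule Bochner_Integration.integrable_bound[OF i])
  show "AE x in lborel. norm (indicator (ball 0 1) x * ((1 - (norm x)^2) * f x)) <= norm (indicator (ball 0 1) x * f x)"
  proof (rule AE_I2)
   fix x :: 'a
   have "abs (1 - (norm x)^2) <= 1" if "norm x < 1" using that by (simp add: abs_le_iff power_le_one)
   then show "norm (indicator (ball 0 1) x * ((1 - (norm x)^2) * f x)) <= norm (indicator (ball 0 1) x * f x)"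
    by (auto simp: abs_mult mult_le_cancel_right2 split: split_indicator)
  qed
 qed auto
 have "ennreal (Bint (%x. (1 - (norm x)^2) * f x)) = (\<integral>\<^sup>+x. ennreal (indicator (ball 0 1) x * ((1 - (norm x)^2) * f x)) \<partial>lborel)"
  unfolding Bint_def
  by (rule nn_integral_eq_integral[OF iw, symmetric]) (use pos in \<open>auto split: split_indicator simp: power_le_one\<close>)
 also have "... = (\<integral>\<^sup>+x. ennreal (f x * w x) \<partial>lborel)" by (simp add: w_def mult_ac)
 also have "... = ennreal (2 / (a + DIM('a) + 2) * Bint f)"
  unfolding L using a Bint_nonneg[of f, OF pos] by (intro ennreal_mult[symmetric]) auto
 finally show ?thesis
  by (subst (asm) ennreal_inj) (use a pos in \<open>auto simp: Bint_def power_le_one split: split_indicator intro!: integral_nonneg_AE mult_nonneg_nonneg\<close>)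
qed

section \<open>Integration over the unit ball\<close>

abbreviation Bi :: "('a::euclidean_space => real) => bool" where
 "Bi f \<equiv> integrable lborel (%x. indicator (ball 0 1) x * f x)"

lemma Bint_add: "Bi f ==> Bi g ==> Bint (%x. f x + g x) = Bint f + Bint g"
 unfolding Bint_def by (simp add: distrib_left)
lemma Bint_diff: "Bi f ==> Bi g ==> Bint (%x. f x - g x) = Bint f - Bint g"
 unfolding Bint_def by (simp add: right_diff_distrib)
lemma Bint_cmult: "Bint (%x. c * f x) = c * Bint f"
 unfolding Bint_def by (simp add: mult.left_commute[of _ c])
lemma Bi_add: "Bi f ==> Bi g ==> Bi (%x. f x + g x)"
 by (simp add: distrib_left)
lemma Bi_diff: "Bi f ==> Bi g ==> Bi (%x. f x - g x)"
 by (simp add: right_diff_distrib)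
lemma Bi_cmult: "Bi f ==> Bi (%x. c * f x)"
 by (simp add: mult.left_commute[of _ c])
lemma Bint_mono: "Bi f ==> Bi g ==> (!!x. norm x < 1 ==> f x <= g x) ==> Bint f <= Bint g"
 unfolding Bint_def by (intro integral_mono) (auto split: split_indicator)
lemma Bint_cong: "(!!x. norm x < 1 ==> f x = g x) ==> Bint f = Bint g"
 unfolding Bint_def by (intro Bochner_Integration.integral_cong) (auto split: split_indicator)
lemma Bint_cong_AE: "f \<in> borel_measurable borel ==> g \<in> borel_measurable borel ==>
  AE x in lborel. norm x < 1 --> f x = g x ==> Bint f = Bint g"
 unfolding Bint_def by (intro integral_cong_AE) (auto elim!: eventually_mono split: split_indicator)

lemma Bi_bound:
 assumes "Bi g" and [measurable]: "f \<in> borel_measurable borel" and "!!x. norm x < 1 ==> abs (f x) <= g x"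
 shows "Bi f"
 by (rule Bochner_Integration.integrable_bound[OF assms(1)])
   (use assms(3) in \<open>auto split: split_indicator intro: order_trans[OF _ abs_ge_self]\<close>)

lemma Bi_mult_bounded:
 assumes "Bi g" and [measurable]: "g \<in> borel_measurable borel" "f \<in> borel_measurable borel" and "!!x. norm x < 1 ==> abs (f x) <= K"
 shows "Bi (%x. f x * g x)"
proof (rule Bi_bound[of "%x. K * abs (g x)"])
 have "integrable lborel (%x. abs (indicator (ball 0 1) x * g x))" using assms(1) by (rule integrable_abs)
 then show "Bi (%x. K * abs (g x))" by (intro Bi_cmult) (simp add: abs_mult)
qed (use assms in \<open>auto simp: abs_mult intro: mult_right_mono\<close>)

text \<open>Positive and negative parts of a homogeneous function are homogeneous of the same
  degree, so the nonnegative case applies to both with the same factor.\<close>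

lemma layer_cake_quadratic:
 fixes f :: "'a::euclidean_space => real"
 assumes m[measurable]: "f \<in> borel_measurable borel" and i: "Bi f" and h: "hom a f" and a: "a >= 0"
 shows "Bint (%x. (1 - (norm x)^2) * f x) = 2 / (a + DIM('a) + 2) * Bint f"
proof -
 define p where "p x = max 0 (f x)" for x
 define q where "q x = max 0 (- f x)" for x
 have [measurable]: "p \<in> borel_measurable borel" "q \<in> borel_measurable borel" by (auto simp: p_def[abs_def] q_def[abs_def])
 have ia: "Bi (%x. abs (f x))" using integrable_abs[OF i] by (simp add: abs_mult)
 have ip: "Bi p" "Bi q" by (rule Bi_bound[OF ia]; auto simp: p_def q_def)+
 have hp: "hom a p" "hom a q"
  using hom_max0[OF h] hom_max0[OF hom_scale[OF h, of "-1"]] by (auto simp: p_def[abs_def] q_def[abs_def])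
 have f: "f = (%x. p x - q x)" by (auto simp: p_def q_def)
 have w: "norm x < 1 ==> abs (1 - (norm x)^2) <= 1" for x :: 'a by (simp add: abs_le_iff power_le_one)
 have iw: "Bi (%x. (1 - (norm x)^2) * p x)" "Bi (%x. (1 - (norm x)^2) * q x)"
  using ip w by (auto intro!: Bi_mult_bounded[where K=1])
 have "Bint (%x. (1 - (norm x)^2) * f x) = Bint (%x. (1 - (norm x)^2) * p x - (1 - (norm x)^2) * q x)"
  by (simp add: f right_diff_distrib)
 also have "... = 2 / (a + DIM('a) + 2) * Bint p - 2 / (a + DIM('a) + 2) * Bint q"
  using layer_cake_quadratic_nn[OF _ ip(1) hp(1) _ a] layer_cake_quadratic_nn[OF _ ip(2) hp(2) _ a]
  by (subst Bint_diff[OF iw]) (auto simp: p_def q_def)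
 also have "... = 2 / (a + DIM('a) + 2) * Bint f"
  unfolding f Bint_diff[OF ip] by (simp add: right_diff_distrib)
 finally show ?thesis .
qed

section \<open>Half-line Gaussian moments and the Gaussian radial weight\<close>

text \<open>The integral of s^p exp(-s^2) over s \<ge> 0, that is Gamma((p + 1)/2)/2, in the closed
  forms for even and odd p.\<close>

definition gm :: "nat => real" where
 "gm p = (if even p then (sqrt pi / 2) * (fact p / (2 ^ p * fact (p div 2))) else fact (p div 2) / 2)"

lemma gm_has_integral: "has_bochner_integral lborel (%s::real. indicator {0..} s *\<^sub>R (exp (- s\<^sup>2) * s ^ p)) (gm p)"
proof (cases "even p")
 case True
 then obtain k where "p = 2 * k" by blast
 then show ?thesis using gaussian_moment_even_pos[of k] by (simp add: gm_def)
next
 case False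
 then obtain k where "p = 2 * k + 1" using oddE by blast
 then show ?thesis using gaussian_moment_odd_pos[of k] by (simp add: gm_def)
qed

lemma gm_pos: "gm p > 0" by (simp add: gm_def)

text \<open>The functional equation of the Gamma function. Together with positivity it is the only
  information on the moments that enters the spectral gap constant.\<close>

lemma gm_rec: "gm (p + 2) = (real p + 1) / 2 * gm p"
proof (cases "even p")
 case True
 then obtain k where k: "p = 2 * k" by blast
 have f: "fact (2 * k + 2) = (2 * (real k + 1)) * ((2 * real k + 1) * fact (2 * k))"
  by (simp add: algebra_simps)
 have e: "(2 * (K + 1) * ((2 * K + 1) * A)) / (B * 4 * ((K + 1) * C)) = (2 * K + 1) / 2 * (A / (B * C))"
  if "B > 0" "C > 0" "K >= 0" for A B C K :: real
  using that by (simp add: divide_simps)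
 have "fact (2 * k + 2) / (2 ^ (2 * k + 2) * fact (k + 1)) = (2 * real k + 1) / 2 * (fact (2 * k) / (2 ^ (2 * k) * fact k))"
  unfolding f using e[of "2 ^ (2 * k)" "fact k" "real k" "fact (2 * k)"] by (simp add: power_add algebra_simps)
 then show ?thesis unfolding k by (simp add: gm_def)
next
 case False
 then obtain k where "p = 2 * k + 1" using oddE by blast
 then show ?thesis by (simp add: gm_def field_simps)
qed

text \<open>The Gaussian as a layer-cake weight: exp(-r^2) is the integral of 2 s exp(-s^2) over [r,
  \<infinity>).\<close>

lemma gauss_weight_nn:
 "(\<integral>\<^sup>+s. ennreal (if s >= 0 then 2 * s * exp (- s\<^sup>2) else 0) * indicator {norm (x::'a::euclidean_space) ..} s \<partial>lborel) = ennreal (exp (- (norm x)\<^sup>2))"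
proof -
 have "(\<integral>\<^sup>+s. ennreal (if s >= 0 then 2 * s * exp (- s\<^sup>2) else 0) * indicator {norm x ..} s \<partial>lborel)
  = (\<integral>\<^sup>+s. ennreal (2 * s * exp (- s\<^sup>2)) * indicator {norm x ..} s \<partial>lborel)"
  by (intro nn_integral_cong) (auto split: split_indicator dest: order_trans[OF norm_ge_zero])
 also have "... = ennreal (0 - (- exp (- (norm x)\<^sup>2)))"
 proof (rule nn_integral_FTC_atLeast)
  show "((%s::real. - exp (- s\<^sup>2)) \<longlongrightarrow> 0) at_top" by real_asymp
 qed (auto intro!: derivative_eq_intros dest: order_trans[OF norm_ge_zero])
 finally show ?thesis by simp
qed

lemma layer_cake_gauss_nn:
 fixes f :: "'a::euclidean_space => real"
 assumes [measurable]: "f \<in> borel_measurable borel" and h: "hom a f" and pos: "!!x. f x >= 0" and i: "Bi f"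
 shows "(\<integral>\<^sup>+x. ennreal (f x * exp (- (norm x)\<^sup>2)) \<partial>lborel) =
   (\<integral>\<^sup>+s. ennreal ((if s >= 0 then 2 * s * exp (- s\<^sup>2) else 0) * s powr (a + DIM('a))) * indicator {0..} s \<partial>lborel) * ennreal (Bint f)"
 by (subst layer_cake_nn[OF _ _ h pos _ gauss_weight_nn]) (use Bint_nn[OF _ i pos] in auto)

text \<open>An integer degree makes the radial factor one of the moments \<open>gm\<close>. The
  functions of interest are v^2 and |g|^2, of degrees 3 and 1.\<close>

lemma layer_cake_gauss:
 fixes f :: "'a::euclidean_space => real"
 assumes [measurable]: "f \<in> borel_measurable borel" and h: "hom (real n) f" and pos: "!!x. f x >= 0" and i: "Bi f"
 shows "integrable lborel (%x. f x * exp (- (norm x)\<^sup>2))"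
  and "(LBINT x. f x * exp (- (norm x)\<^sup>2)) = 2 * gm (n + DIM('a) + 1) * Bint f"
proof -
 have "(\<integral>\<^sup>+s. ennreal ((if s >= 0 then 2 * s * exp (- s\<^sup>2) else 0) * s powr (real n + DIM('a))) * indicator {0..} s \<partial>lborel)
  = (\<integral>\<^sup>+s. ennreal (2 * (indicator {0..} s *\<^sub>R (exp (- s\<^sup>2) * s ^ (n + DIM('a) + 1)))) \<partial>lborel)"
 proof (intro nn_integral_cong)
  fix s :: real
  show "ennreal ((if s >= 0 then 2 * s * exp (- s\<^sup>2) else 0) * s powr (real n + DIM('a))) * indicator {0..} s
   = ennreal (2 * (indicator {0..} s *\<^sub>R (exp (- s\<^sup>2) * s ^ (n + DIM('a) + 1))))"
   using powr_realpow[of s "n + DIM('a)"] by (cases "s > 0") (auto simp: mult_ac split: split_indicator)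
 qed
 also have "... = ennreal (2 * gm (n + DIM('a) + 1))"
  using has_bochner_integral_mult_right[OF gm_has_integral[of "n + DIM('a) + 1"], of 2]
  by (subst nn_integral_eq_integral) (auto simp: has_bochner_integral_iff split: split_indicator)
 finally have *: "(\<integral>\<^sup>+x. ennreal (f x * exp (- (norm x)\<^sup>2)) \<partial>lborel) = ennreal (2 * gm (n + DIM('a) + 1) * Bint f)"
  using layer_cake_gauss_nn[OF assms(1) h pos i] gm_pos[of "n + DIM('a) + 1"] Bint_nonneg[of f, OF pos]
  by (simp only: ennreal_mult less_imp_le mult_nonneg_nonneg zero_le_numeral)
 then show "integrable lborel (%x. f x * exp (- (norm x)\<^sup>2))"
  by (intro integrableI_nonneg) (auto simp: pos)
 show "(LBINT x. f x * exp (- (norm x)\<^sup>2)) = 2 * gm (n + DIM('a) + 1) * Bint f"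
  by (subst integral_eq_nn_integral) (use pos * Bint_nonneg[of f, OF pos] gm_pos[of "n + DIM('a) + 1"] in \<open>auto simp: mult_nonneg_nonneg less_imp_le\<close>)
qed

text \<open>Positive and negative part have equal ball integrals and pick up the same radial factor,
  so they cancel without that factor being evaluated. This permits the degrees 3/2 and 5/2 of v and
  x_b v.\<close>

lemma layer_cake_gauss_zero:
 fixes f :: "'a::euclidean_space => real"
 assumes m[measurable]: "f \<in> borel_measurable borel" and h: "hom a f" and i: "Bi f" and z: "Bint f = 0"
  and ig: "integrable lborel (%x. f x * exp (- (norm x)\<^sup>2))"
 shows "(LBINT x. f x * exp (- (norm x)\<^sup>2)) = 0"
proof -
 define p where "p x = max 0 (f x)" for x
 define q where "q x = max 0 (- f x)" for x
 have [measurable]: "p \<in> borel_measurable borel" "q \<in> borel_measurable borel" by (auto simp: p_def[abs_def] q_def[abs_def])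
 have ia: "Bi (%x. abs (f x))" using integrable_abs[OF i] by (simp add: abs_mult)
 have ip: "Bi p" "Bi q" by (rule Bi_bound[OF ia]; auto simp: p_def q_def)+
 have hp: "hom a p" "hom a q"
  using hom_max0[OF h] hom_max0[OF hom_scale[OF h, of "-1"]] by (auto simp: p_def[abs_def] q_def[abs_def])
 have f: "f = (%x. p x - q x)" by (auto simp: p_def q_def)
 have pq: "p x >= 0" "q x >= 0" for x by (auto simp: p_def q_def)
 have e: "Bint p = Bint q" using z Bint_diff[OF ip] unfolding f by simp
 have "(\<integral>\<^sup>+x. ennreal (f x * exp (- (norm x)\<^sup>2)) \<partial>lborel) = (\<integral>\<^sup>+x. ennreal (p x * exp (- (norm x)\<^sup>2)) \<partial>lborel)"
  by (intro nn_integral_cong) (auto simp: p_def max_def mult_nonpos_nonneg ennreal_neg)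
 moreover have "(\<integral>\<^sup>+x. ennreal (- (f x * exp (- (norm x)\<^sup>2))) \<partial>lborel) = (\<integral>\<^sup>+x. ennreal (q x * exp (- (norm x)\<^sup>2)) \<partial>lborel)"
  by (intro nn_integral_cong) (auto simp: q_def max_def mult_nonneg_nonneg ennreal_neg)
 ultimately show ?thesis unfolding real_lebesgue_integral_def[OF ig]
  using layer_cake_gauss_nn[OF _ hp(1) _ ip(1)] layer_cake_gauss_nn[OF _ hp(2) _ ip(2)] e pq by simp
qed

subsection \<open>Global homogeneous extension and the Euler identity\<close>

lemma sob_pair_cong:
 assumes p: "sob_pair R v g" and [measurable]: "v' \<in> borel_measurable borel" "g' \<in> borel_measurable borel"
  and e: "AE x in lborel. x \<in> ball 0 R --> v x = v' x" "AE x in lborel. x \<in> ball 0 R --> g x = g' x"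
 shows "sob_pair R v' g'"
proof -
 note d = sob_pairD[OF p]
 note [measurable] = d(1,2)
 have "integrable lborel (%x. indicator (ball 0 R) x * (v' x)^2)"
  by (rule integrable_cong_AE_imp[OF d(3)]) (use e(1) in \<open>auto elim!: eventually_mono split: split_indicator\<close>)
 moreover have "integrable lborel (%x. indicator (ball 0 R) x * (norm (g' x))^2)"
  by (rule integrable_cong_AE_imp[OF d(4)]) (use e(2) in \<open>auto elim!: eventually_mono split: split_indicator\<close>)
 moreover have "(LBINT x. v' x * pd b phi x) = - (LBINT x. (g' x \<bullet> b) * phi x)"
  if t: "test_function_on (ball 0 R) phi" and b: "b \<in> Basis" for phi b
 proof -
  have [measurable]: "pd b phi \<in> borel_measurable borel" "phi \<in> borel_measurable borel"
   using smooth_borel smooth_pd test_functionD(1)[OF t] b by auto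
  have "(LBINT x. v' x * pd b phi x) = (LBINT x. v x * pd b phi x)"
   by (rule integral_cong_AE) (use e(1) test_functionD(3)[OF test_function_pd[OF t b]] in \<open>auto elim!: eventually_mono simp del: mem_ball\<close>)
  moreover have "(LBINT x. (g' x \<bullet> b) * phi x) = (LBINT x. (g x \<bullet> b) * phi x)"
   by (rule integral_cong_AE) (use e(2) test_functionD(3)[OF t] in \<open>auto elim!: eventually_mono simp del: mem_ball\<close>)
  ultimately show ?thesis using d(5)[OF t b] by simp
 qed
 ultimately show ?thesis unfolding sob_pair_def by auto
qed

lemma test_function_dilate:
 assumes t: "test_function_on (ball 0 (s * R)) phi" and s: "s > 0"
 shows "test_function_on (ball 0 R) (%y. phi (0 + s *\<^sub>R y))"
proof -
 let ?K = "(%x. (1/s) *\<^sub>R x) ` closure {x. phi x ~= 0}"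
 have K: "compact (closure {x. phi x ~= 0})" "closure {x. phi x ~= 0} \<subseteq> ball 0 (s * R)"
  using t by (auto simp: test_function_on_def)
 have cK: "compact ?K" by (intro compact_continuous_image K continuous_intros)
 have sub: "closure {y. phi (0 + s *\<^sub>R y) ~= 0} \<subseteq> ?K"
 proof (rule closure_minimal)
  show "{y. phi (0 + s *\<^sub>R y) ~= 0} \<subseteq> ?K"
  proof
   fix y assume "y \<in> {y. phi (0 + s *\<^sub>R y) ~= 0}"
   then have "s *\<^sub>R y \<in> closure {x. phi x ~= 0}" using closure_subset[of "{x. phi x ~= 0}"] by auto
   then show "y \<in> ?K" using s by (intro image_eqI[of _ _ "s *\<^sub>R y"]) auto
  qed
  show "closed ?K" using cK compact_imp_closed by auto
 qed
 have "?K \<subseteq> ball 0 R" using K(2) s by (auto simp: field_simps)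
 moreover have "compact (closure {y. phi (0 + s *\<^sub>R y) ~= 0})"
  using compact_Int_closed[OF cK, of "closure {y. phi (0 + s *\<^sub>R y) ~= 0}"] sub by (simp add: inf_absorb2)
 ultimately show ?thesis using sub smooth_affine[OF test_functionD(1)[OF t], of 0 s] by (auto simp: test_function_on_def)
qed

text \<open>The exponent 3/2 makes 3/2-homogeneous functions the fixed points of this scaling; the
  chain rule lowers it to 1/2 for the gradient.\<close>

lemma sob_pair_dilate:
 fixes v :: "'a::euclidean_space => real"
 assumes p: "sob_pair R v g" and s: "s > 0"
 shows "sob_pair (s * R) (%x. s powr (3/2) * v ((1/s) *\<^sub>R x)) (%x. s powr (1/2) *\<^sub>R g ((1/s) *\<^sub>R x))"
proof -
 note d = sob_pairD[OF p]
 note [measurable] = d(1,2)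
 have b: "0 + s *\<^sub>R x \<in> ball 0 (s * R) \<longleftrightarrow> x \<in> ball 0 R" for x :: 'a using s by auto
 have ind: "indicator (ball 0 (s * R)) (0 + s *\<^sub>R x) = (indicator (ball 0 R) x :: real)" for x :: 'a
  using b[of x] by (auto split: split_indicator)
 have "integrable lborel (%x. indicator (ball 0 (s * R)) x * (s powr (3/2) * v ((1/s) *\<^sub>R x))^2)"
 proof (subst lborel_integrable_affine[of _ s 0, symmetric])
  have "(%x. indicator (ball 0 (s * R)) (0 + s *\<^sub>R x) * (s powr (3/2) * v ((1/s) *\<^sub>R (0 + s *\<^sub>R x)))^2)
   = (%x. (s powr (3/2))^2 * (indicator (ball 0 R) x * (v x)^2))"
   unfolding ind using s by (simp add: power_mult_distrib mult_ac)
  then show "integrable lborel (%x. indicator (ball 0 (s * R)) (0 + s *\<^sub>R x) * (s powr (3/2) * v ((1/s) *\<^sub>R (0 + s *\<^sub>R x)))^2)"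
   using d(3) by simp
 qed (use s in auto)
 moreover have "integrable lborel (%x. indicator (ball 0 (s * R)) x * (norm (s powr (1/2) *\<^sub>R g ((1/s) *\<^sub>R x)))^2)"
 proof (subst lborel_integrable_affine[of _ s 0, symmetric])
  have "(%x. indicator (ball 0 (s * R)) (0 + s *\<^sub>R x) * (norm (s powr (1/2) *\<^sub>R g ((1/s) *\<^sub>R (0 + s *\<^sub>R x))))^2)
   = (%x. (s powr (1/2))^2 * (indicator (ball 0 R) x * (norm (g x))^2))"
   unfolding ind using s by (simp add: power_mult_distrib mult_ac)
  then show "integrable lborel (%x. indicator (ball 0 (s * R)) (0 + s *\<^sub>R x) * (norm (s powr (1/2) *\<^sub>R g ((1/s) *\<^sub>R (0 + s *\<^sub>R x))))^2)"
   using d(4) by simp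
 qed (use s in auto)
 moreover have "(LBINT x. (s powr (3/2) * v ((1/s) *\<^sub>R x)) * pd b phi x) = - (LBINT x. ((s powr (1/2) *\<^sub>R g ((1/s) *\<^sub>R x)) \<bullet> b) * phi x)"
  if t: "test_function_on (ball 0 (s * R)) phi" and b: "b \<in> Basis" for phi b
 proof -
  have sm: "smooth phi" using test_functionD(1)[OF t] .
  have [measurable]: "pd b phi \<in> borel_measurable borel" "phi \<in> borel_measurable borel"
   using smooth_borel smooth_pd sm b by auto
  have e: "s powr (3/2) = s powr (1/2) * s" using s powr_add[of s "1/2" 1] by simp
  have "(LBINT x. (s powr (3/2) * v ((1/s) *\<^sub>R x)) * pd b phi x)
   = abs s^DIM('a) *\<^sub>R (LBINT x. (s powr (3/2) * v ((1/s) *\<^sub>R (0 + s *\<^sub>R x))) * pd b phi (0 + s *\<^sub>R x))"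
   by (rule lborel_integral_affine) (use s in auto)
  also have "(LBINT x. (s powr (3/2) * v ((1/s) *\<^sub>R (0 + s *\<^sub>R x))) * pd b phi (0 + s *\<^sub>R x))
   = s powr (1/2) * (LBINT x. v x * pd b (%y. phi (0 + s *\<^sub>R y)) x)"
   unfolding pd_affine[OF sm] e using s by (simp add: mult_ac flip: integral_mult_right_zero)
  also have "(LBINT x. v x * pd b (%y. phi (0 + s *\<^sub>R y)) x) = - (LBINT x. (g x \<bullet> b) * phi (0 + s *\<^sub>R x))"
   by (rule d(5)[OF test_function_dilate[OF t s] b])
  also have "abs s^DIM('a) *\<^sub>R (s powr (1/2) * - (LBINT x. (g x \<bullet> b) * phi (0 + s *\<^sub>R x)))
    = - (abs s^DIM('a) *\<^sub>R (LBINT x. ((s powr (1/2) *\<^sub>R g ((1/s) *\<^sub>R (0 + s *\<^sub>R x))) \<bullet> b) * phi (0 + s *\<^sub>R x)))"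
   using s by (simp add: mult_ac flip: integral_mult_right_zero)
  also have "abs s^DIM('a) *\<^sub>R (LBINT x. ((s powr (1/2) *\<^sub>R g ((1/s) *\<^sub>R (0 + s *\<^sub>R x))) \<bullet> b) * phi (0 + s *\<^sub>R x))
   = (LBINT x. ((s powr (1/2) *\<^sub>R g ((1/s) *\<^sub>R x)) \<bullet> b) * phi x)"
   by (rule lborel_integral_affine[symmetric]) (use s in auto)
  finally show ?thesis .
 qed
 ultimately show ?thesis unfolding sob_pair_def using s by auto
qed

text \<open>A homogeneous function on the unit ball is replaced by its extension to the whole space,
  so that mollification near the unit sphere and integration against the Gaussian make
  sense.\<close>

definition hsob :: "('a::euclidean_space => real) => ('a => 'a) => bool" where
 "hsob v g \<longleftrightarrow> (\<forall>R. sob_pair R v g) \<and> hom (3/2) v"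

lemma hsob_lincomb:
 assumes "hsob v g" "hsob w k" shows "hsob (%x. a * v x + c * w x) (%x. a *\<^sub>R g x + c *\<^sub>R k x)"
 using assms sob_pair_lincomb[of R v g w k a c for R] hom_add[OF hom_scale[of "3/2" v a] hom_scale[of "3/2" w c]]
 unfolding hsob_def by auto

lemma AE_all_balls:
 assumes "!!n::nat. AE x in lborel. x \<in> ball (0::'a::euclidean_space) (real n) --> P x"
 shows "AE x in lborel. P x"
proof -
 have "AE x in lborel. \<forall>n. x \<in> ball (0::'a) (real n) --> P x" unfolding AE_all_countable using assms by blast
 then show ?thesis
 proof eventually_elim
  fix x :: 'a assume "\<forall>n. x \<in> ball 0 (real n) --> P x"
  moreover obtain n where "norm x < real n" using reals_Archimedean2 by blast
  ultimately show "P x" by auto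
 qed
qed

text \<open>Dilating the pair returns the same function almost everywhere, so by uniqueness on every
  ball it returns the same gradient.\<close>

lemma hsob_hom_grad:
 assumes h: "hsob v g" shows "hom (1/2) g"
 unfolding hom_def
proof (intro allI impI)
 fix t :: real assume t: "t > 0"
 let ?v = "%x. (1/t) powr (3/2) * v ((1/(1/t)) *\<^sub>R x)" and ?g = "%x. (1/t) powr (1/2) *\<^sub>R g ((1/(1/t)) *\<^sub>R x)"
 have p: "sob_pair R v g" for R using h by (simp add: hsob_def)
 have q: "sob_pair R ?v ?g" for R using sob_pair_dilate[OF p[of "t * R"], of "1/t"] t by simp
 have pw: "(1/t) powr r * t powr r = 1" for r using t by (simp flip: powr_mult)
 have "AE x in lborel. ?v x = v x"
  using homD[OF _ t, of "3/2" v] h unfolding hsob_def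
  by (auto elim!: eventually_mono) (use pw[of "3/2"] in \<open>simp flip: mult.assoc\<close>)
 then have "AE x in lborel. x \<in> ball 0 (real n) --> ?g x = g x" for n
  by (intro sob_pair_unique[OF q p]) (auto elim: eventually_mono)
 then have "AE x in lborel. ?g x = g x" by (rule AE_all_balls)
 then show "AE x in lborel. g (t *\<^sub>R x) = t powr (1/2) *\<^sub>R g x"
 proof eventually_elim
  fix x assume "?g x = g x"
  then have "t powr (1/2) *\<^sub>R g x = (t powr (1/2) * (1/t) powr (1/2)) *\<^sub>R g (t *\<^sub>R x)"
   using t by (simp add: scaleR_scaleR[symmetric] del: scaleR_scaleR)
  then show "g (t *\<^sub>R x) = t powr (1/2) *\<^sub>R g x" using pw[of "1/2"] by (simp add: mult.commute)
 qed
qed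

text \<open>The dilations of a representative to the balls of radius k agree almost everywhere where
  they overlap, by homogeneity; their gradients then agree by uniqueness. Gluing along integer radii
  needs only countably many exceptional null sets.\<close>

lemma homogeneous_extension:
 fixes w :: "'a::euclidean_space => real"
 assumes r: "sob_rep w v0 g0"
  and hw: "\<forall>t>0. AE x in lebesgue. x \<in> ball 0 1 --> t *\<^sub>R x \<in> ball 0 1 --> w (t *\<^sub>R x) = t powr (3/2) * w x"
 shows "\<exists>v g. hsob v g \<and> sob_rep w v g"
proof -
 have p: "sob_pair 1 v0 g0" and wm: "w \<in> borel_measurable (lebesgue_on (ball 0 1))"
  and e: "AE x in lborel. x \<in> ball 0 1 --> w x = v0 x"
  using r by (auto simp: sob_rep_def)
 note [measurable] = sob_pairD(1,2)[OF p]
 have hv0: "AE x in lborel. x \<in> ball 0 1 --> t *\<^sub>R x \<in> ball 0 1 --> v0 (t *\<^sub>R x) = t powr (3/2) * v0 x" if t: "t > 0" for t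
 proof -
  have "AE x in lborel. (0 + t *\<^sub>R x) \<in> ball 0 1 --> w (0 + t *\<^sub>R x) = v0 (0 + t *\<^sub>R x)"
   by (rule AE_lborel_affine[OF e]) (use t in auto)
  moreover have "AE x in lborel. x \<in> ball 0 1 --> t *\<^sub>R x \<in> ball 0 1 --> w (t *\<^sub>R x) = t powr (3/2) * w x"
   using hw t by (auto simp: AE_completion_iff)
  ultimately show ?thesis using e by eventually_elim (simp del: mem_ball)
 qed
 define V where "V k x = real k powr (3/2) * v0 ((1 / real k) *\<^sub>R x)" for k :: nat and x
 define G where "G k x = real k powr (1/2) *\<^sub>R g0 ((1 / real k) *\<^sub>R x)" for k :: nat and x
 have VG: "sob_pair (real k) (V k) (G k)" if "k > 0" for k
  using sob_pair_dilate[OF p, of "real k"] that by (simp add: V_def[abs_def] G_def[abs_def])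
 have V_eq: "AE x in lborel. x \<in> ball 0 (real j) --> V j x = V k x" if "0 < j" "j <= k" for j k
 proof -
  have "AE x in lborel. (0 + (1 / real j) *\<^sub>R x) \<in> ball 0 1 --> (real j / real k) *\<^sub>R (0 + (1 / real j) *\<^sub>R x) \<in> ball 0 1
    --> v0 ((real j / real k) *\<^sub>R (0 + (1 / real j) *\<^sub>R x)) = (real j / real k) powr (3/2) * v0 (0 + (1 / real j) *\<^sub>R x)"
   by (rule AE_lborel_affine[OF hv0]) (use that in auto)
  then show ?thesis
  proof eventually_elim
   fix x :: 'a assume a: "(0 + (1 / real j) *\<^sub>R x) \<in> ball 0 1 --> (real j / real k) *\<^sub>R (0 + (1 / real j) *\<^sub>R x) \<in> ball 0 1
    --> v0 ((real j / real k) *\<^sub>R (0 + (1 / real j) *\<^sub>R x)) = (real j / real k) powr (3/2) * v0 (0 + (1 / real j) *\<^sub>R x)"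
   show "x \<in> ball 0 (real j) --> V j x = V k x"
   proof
    assume x: "x \<in> ball 0 (real j)"
    have "norm x < real k" using x that by auto
    then have "v0 ((1 / real k) *\<^sub>R x) = (real j / real k) powr (3/2) * v0 ((1 / real j) *\<^sub>R x)"
     using a x that by (auto simp: field_simps)
    then show "V j x = V k x"
     using that by (simp add: V_def powr_divide)
   qed
  qed
 qed
 have G_eq: "AE x in lborel. x \<in> ball 0 (real j) --> G j x = G k x" if "0 < j" "j <= k" for j k
  by (rule sob_pair_unique[OF VG[OF that(1)] sob_pair_mono[OF VG] V_eq]) (use that in auto)
 \<comment> \<open>The least natural number exceeding the norm of x: x lies in the open ball of that
   radius, and \<open>N\<close> is measurable with countable range.\<close>
 define N where "N x = nat \<lfloor>norm x\<rfloor> + 1" for x :: 'a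
 have N: "norm x < real (N x)" "N x > 0" for x unfolding N_def by linarith+
 define v where "v x = V (N x) x" for x
 define g where "g x = G (N x) x" for x
 have Nle: "x \<in> ball 0 (real k) ==> N x <= k" for x k
 proof -
  assume "x \<in> ball 0 (real k)"
  then have "\<lfloor>norm x\<rfloor> < int k" by (simp add: floor_less_iff)
  moreover have "0 <= \<lfloor>norm x\<rfloor>" by simp
  ultimately show "N x <= k" unfolding N_def by linarith
 qed
 have [measurable]: "V k \<in> borel_measurable borel" "G k \<in> borel_measurable borel" for k
  unfolding V_def[abs_def] G_def[abs_def] by auto
 have Nm[measurable]: "N \<in> borel \<rightarrow>\<^sub>M count_space UNIV"
  unfolding N_def[abs_def] by measurable
 have vm[measurable]: "v \<in> borel_measurable borel" "g \<in> borel_measurable borel"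
  unfolding v_def[abs_def] g_def[abs_def]
  by (rule measurable_compose_countable[OF _ Nm]; simp)+
 have VE: "AE x in lborel. \<forall>j k. 0 < j --> j <= k --> x \<in> ball 0 (real j) --> V j x = V k x \<and> G j x = G k x"
  unfolding AE_all_countable
 proof (intro allI)
  fix j k :: nat
  show "AE x in lborel. 0 < j --> j <= k --> x \<in> ball 0 (real j) --> V j x = V k x \<and> G j x = G k x"
  proof (cases "0 < j \<and> j <= k")
   case True then show ?thesis using V_eq[of j k] G_eq[of j k] by (auto elim: eventually_elim2)
  qed auto
 qed
 have vk: "AE x in lborel. \<forall>k. x \<in> ball 0 (real k) --> V k x = v x \<and> G k x = g x"
  using VE
 proof eventually_elim
  fix x :: 'a assume a: "\<forall>j k. 0 < j --> j <= k --> x \<in> ball 0 (real j) --> V j x = V k x \<and> G j x = G k x"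
  show "\<forall>k. x \<in> ball 0 (real k) --> V k x = v x \<and> G k x = g x"
  proof (intro allI impI)
   fix k assume "x \<in> ball 0 (real k)"
   then have "V (N x) x = V k x \<and> G (N x) x = G k x" using a[rule_format, of "N x" k] N[of x] Nle[of x k] by auto
   then show "V k x = v x \<and> G k x = g x" by (simp add: v_def g_def)
  qed
 qed
 have pk: "sob_pair (real k) v g" if "k > 0" for k
  by (rule sob_pair_cong[OF VG[OF that] vm]) (use vk in \<open>auto elim: eventually_mono\<close>)
 have pR: "sob_pair R v g" for R
 proof -
  obtain k where "R < real k" using reals_Archimedean2 by blast
  then show ?thesis using sob_pair_mono[OF pk[of "k + 1"], of R] by auto
 qed
 have hv: "hom (3/2) v"
  unfolding hom_def
 proof (intro allI impI)
  fix t :: real assume t: "t > 0"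
  show "AE x in lborel. v (t *\<^sub>R x) = t powr (3/2) *\<^sub>R v x"
  proof (rule AE_all_balls)
   fix n :: nat
   \<comment> \<open>One radius \<open>k\<close> that contains both x and t x for all x in the ball
     at hand, so that a single dilation \<open>V k\<close> represents \<open>v\<close> at both
     points.\<close>
   obtain k :: nat where k: "real k > max (real n) (t * real n)" using reals_Archimedean2 by blast
   have k0: "k > 0" using k by (metis le_less_trans of_nat_0_le_iff max_less_iff_conj of_nat_0_less_iff)
   have vt: "AE x in lborel. \<forall>k. (0 + t *\<^sub>R x) \<in> ball 0 (real k) --> V k (0 + t *\<^sub>R x) = v (0 + t *\<^sub>R x) \<and> G k (0 + t *\<^sub>R x) = g (0 + t *\<^sub>R x)"
    by (rule AE_lborel_affine[OF vk]) (use t in auto)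
   have hk: "AE x in lborel. (0 + (1 / real k) *\<^sub>R x) \<in> ball 0 1 --> t *\<^sub>R (0 + (1 / real k) *\<^sub>R x) \<in> ball 0 1
    --> v0 (t *\<^sub>R (0 + (1 / real k) *\<^sub>R x)) = t powr (3/2) * v0 (0 + (1 / real k) *\<^sub>R x)"
    by (rule AE_lborel_affine[OF hv0[OF t]]) (use k0 in auto)
   show "AE x in lborel. x \<in> ball 0 (real n) --> v (t *\<^sub>R x) = t powr (3/2) *\<^sub>R v x"
    using vk vt hk
   proof eventually_elim
    fix x :: 'a
    assume a: "\<forall>k. x \<in> ball 0 (real k) --> V k x = v x \<and> G k x = g x"
     "\<forall>k. (0 + t *\<^sub>R x) \<in> ball 0 (real k) --> V k (0 + t *\<^sub>R x) = v (0 + t *\<^sub>R x) \<and> G k (0 + t *\<^sub>R x) = g (0 + t *\<^sub>R x)"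
     "(0 + (1 / real k) *\<^sub>R x) \<in> ball 0 1 --> t *\<^sub>R (0 + (1 / real k) *\<^sub>R x) \<in> ball 0 1
    --> v0 (t *\<^sub>R (0 + (1 / real k) *\<^sub>R x)) = t powr (3/2) * v0 (0 + (1 / real k) *\<^sub>R x)"
    show "x \<in> ball 0 (real n) --> v (t *\<^sub>R x) = t powr (3/2) *\<^sub>R v x"
    proof
     assume x: "x \<in> ball 0 (real n)"
     have "t * norm x <= t * real n" using x t by (intro mult_left_mono) auto
     then have x1: "norm x < real k" "t * norm x < real k" using x k by auto
     have "v0 (t *\<^sub>R (1 / real k) *\<^sub>R x) = t powr (3/2) * v0 ((1 / real k) *\<^sub>R x)"
      using a(3) x1 k0 t by (auto simp: field_simps)
     then have "V k (t *\<^sub>R x) = t powr (3/2) * V k x"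
      by (simp add: V_def scaleR_left_commute mult_ac)
     moreover have "V k x = v x" "V k (t *\<^sub>R x) = v (t *\<^sub>R x)" using a(1,2) x1 t by auto
     ultimately show "v (t *\<^sub>R x) = t powr (3/2) *\<^sub>R v x" by simp
    qed
   qed
  qed
 qed
 have "AE x in lborel. x \<in> ball 0 1 --> w x = v x"
  using e vk
 proof eventually_elim
  fix x :: 'a assume "x \<in> ball 0 1 --> w x = v0 x" "\<forall>k. x \<in> ball 0 (real k) --> V k x = v x \<and> G k x = g x"
  then show "x \<in> ball 0 1 --> w x = v x" by (auto dest!: spec[of _ 1] simp: V_def)
 qed
 then have "sob_rep w v g" using pR wm by (auto simp: sob_rep_def)
 moreover have "hsob v g" using pR hv by (simp add: hsob_def)
 ultimately show ?thesis by blast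
qed

text \<open>The dominating function has to serve all parameters at once; unbounded families are
  therefore reparametrized by the sine before this is applied.\<close>

lemma has_real_derivative_integral:
 fixes F :: "real => 'a => real"
 assumes d: "!!th x. x \<in> space M ==> ((%th. F th x) has_real_derivative F' th x) (at th)"
  and b: "!!th x. x \<in> space M ==> abs (F' th x) <= w x" and w: "integrable M w"
  and i: "!!th. integrable M (F th)" and m: "F' th \<in> borel_measurable M"
 shows "((%th. \<integral>x. F th x \<partial>M) has_real_derivative (\<integral>x. F' th x \<partial>M)) (at th)"
 unfolding DERIV_def tendsto_at_iff_sequentially
proof (intro allI impI)
 fix X :: "nat => real" assume X: "\<forall>i. X i \<in> UNIV - {0}" "X \<longlonglongrightarrow> 0"
 have [measurable]: "F t \<in> borel_measurable M" for t using i by auto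
 have "(%n. \<integral>x. (F (th + X n) x - F th x) / X n \<partial>M) \<longlonglongrightarrow> (\<integral>x. F' th x \<partial>M)"
 proof (rule integral_dominated_convergence[where w=w])
  show "AE x in M. (%n. (F (th + X n) x - F th x) / X n) \<longlonglongrightarrow> F' th x"
  proof (rule AE_I2)
   fix x assume "x \<in> space M"
   from d[OF this, of th] have "((%h. (F (th + h) x - F th x) / h) \<longlongrightarrow> F' th x) (at 0)" by (simp add: DERIV_def)
   then have "((%h. (F (th + h) x - F th x) / h) \<circ> X) \<longlonglongrightarrow> F' th x"
    using X unfolding tendsto_at_iff_sequentially by blast
   then show "(%n. (F (th + X n) x - F th x) / X n) \<longlonglongrightarrow> F' th x" by (simp add: o_def)
  qed
  show "AE x in M. norm ((F (th + X n) x - F th x) / X n) <= w x" for n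
  proof (rule AE_I2)
   fix x assume x: "x \<in> space M"
   have "norm (F (th + X n) x - F th x) <= w x * norm (th + X n - th)"
    by (rule field_differentiable_bound[OF convex_UNIV]) (use d[OF x] b[OF x] in \<open>auto intro: has_field_derivative_at_within\<close>)
   then show "norm ((F (th + X n) x - F th x) / X n) <= w x" using X(1) by (simp add: divide_le_eq)
  qed
 qed (use w m in auto)
 moreover have "(\<integral>x. (F (th + X n) x - F th x) / X n \<partial>M) = ((\<integral>x. F (th + X n) x \<partial>M) - (\<integral>x. F th x \<partial>M)) / X n" for n
  using i by simp
 ultimately have "(%n. ((\<integral>x. F (th + X n) x \<partial>M) - (\<integral>x. F th x \<partial>M)) / X n) \<longlonglongrightarrow> (\<integral>x. F' th x \<partial>M)"
  by (simp only:)
 then show "((%h. ((\<integral>x. F (th + h) x \<partial>M) - (\<integral>x. F th x \<partial>M)) / h) \<circ> X) \<longlonglongrightarrow> (\<integral>x. F' th x \<partial>M)"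
  by (simp add: o_def)
qed

text \<open>By homogeneity the integral of v(y) phi(s y) is s^(-q) times that of v phi, with q = n +
  3/2. Differentiating at s = 1 and integrating the resulting v (grad phi . y) by parts in the weak
  sense gives Euler's identity tested against phi.\<close>

lemma hsob_euler:
 fixes v :: "'a::euclidean_space => real"
 assumes h: "hsob v g"
 shows "AE x in lborel. g x \<bullet> x = 3/2 * v x"
proof (rule AE_all_balls)
 fix n :: nat
 define R where "R = real n"
 have p: "sob_pair R v g" using h by (simp add: hsob_def)
 note d = sob_pairD[OF p]
 note [measurable] = d(1,2)
 have key: "(LBINT x. (g x \<bullet> x - 3/2 * v x) * phi x) = 0" if t: "test_function_on (ball 0 R) phi" for phi
 proof -
  have sm: "smooth phi" using test_functionD(1)[OF t] .
  have [measurable]: "phi \<in> borel_measurable borel" "grad phi \<in> borel_measurable borel"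
   using smooth_borel grad_borel sm by auto
  obtain K where K: "K > 0" "!!x. norm (grad phi x) <= K" using test_function_grad_bounded[OF t] by blast
  define q where "q = DIM('a) + 3/2"
  \<comment> \<open>Keeps the dilation factor between 1/2 and 3/2 for all parameters, so every phi(s
    y) is supported in the ball of radius 2 R.\<close>
  define s where "s th = 1 + sin th / 2" for th :: real
  have s1: "s th >= 1/2" for th using sin_ge_minus_one[of th] unfolding s_def by linarith
  have iphi: "integrable lborel (%x. v x * phi x)"
  proof -
   obtain b :: 'a where b: "b \<in> Basis" using nonempty_Basis by blast
   show ?thesis using sob_pair_test_integrable(1)[OF p t b] .
  qed
  have dil: "(LBINT y. v y * phi (s k *\<^sub>R y)) = s k powr (- q) * (LBINT y. v y * phi y)"
   and idil: "integrable lborel (%y. v y * phi (s k *\<^sub>R y))" for k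
  proof -
   let ?t = "s k"
   have t0: "?t > 0" using s1[of k] by linarith
   have A: "AE y in lborel. v (?t *\<^sub>R y) = ?t powr (3/2) *\<^sub>R v y" using h t0 homD unfolding hsob_def by blast
   have "(LBINT y. v y * phi y) = abs (?t)^DIM('a) *\<^sub>R (LBINT y. v (0 + ?t *\<^sub>R y) * phi (0 + ?t *\<^sub>R y))"
    by (rule lborel_integral_affine) (use t0 in auto)
   also have "(LBINT y. v (0 + ?t *\<^sub>R y) * phi (0 + ?t *\<^sub>R y)) = (LBINT y. ?t powr (3/2) * (v y * phi (?t *\<^sub>R y)))"
    by (rule integral_cong_AE) (use A in \<open>auto elim!: eventually_mono\<close>)
   also have "abs (?t)^DIM('a) *\<^sub>R (LBINT y. ?t powr (3/2) * (v y * phi (?t *\<^sub>R y))) = ?t powr q * (LBINT y. v y * phi (?t *\<^sub>R y))"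
    unfolding integral_mult_right_zero using t0 by (simp add: q_def powr_add powr_realpow mult_ac)
   finally show "(LBINT y. v y * phi (?t *\<^sub>R y)) = ?t powr (- q) * (LBINT y. v y * phi y)"
    using t0 by (simp add: powr_minus field_simps)
   have "integrable lborel (%y. v (0 + ?t *\<^sub>R y) * phi (0 + ?t *\<^sub>R y))"
    using lborel_integrable_affine[of "%y. v y * phi y" ?t 0] iphi t0 by simp
   then have "integrable lborel (%y. ?t powr (3/2) * (v y * phi (?t *\<^sub>R y)))"
    by (rule integrable_cong_AE_imp) (use A in \<open>auto elim!: eventually_mono\<close>)
   then show "integrable lborel (%y. v y * phi (?t *\<^sub>R y))"
    using t0 by simp
  qed
  define E where "E th y = v y * (cos th / 2 * (grad phi (s th *\<^sub>R y) \<bullet> y))" for th y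
  have "((%th. (LBINT y. v y * phi (s th *\<^sub>R y))) has_real_derivative (LBINT y. E 0 y)) (at 0)"
  proof (rule has_real_derivative_integral[where w="%y. abs (v y * (K * (2 * R) * indicator (ball 0 (2 * R)) y))"])
   fix th and y :: 'a
   have "((%th. s th *\<^sub>R y) has_derivative (%h. (h * (cos th / 2)) *\<^sub>R y)) (at th)"
    unfolding s_def by (auto intro!: derivative_eq_intros simp: has_field_derivative_def)
   from has_derivative_compose[OF this smooth_has_derivative[OF sm]]
   have "((%th. phi (s th *\<^sub>R y)) has_real_derivative cos th / 2 * (grad phi (s th *\<^sub>R y) \<bullet> y)) (at th)"
    unfolding has_field_derivative_def by (rule has_derivative_eq_rhs) (simp add: fun_eq_iff)
   from DERIV_cmult[OF this, of "v y"]
   show "((%th. v y * phi (s th *\<^sub>R y)) has_real_derivative E th y) (at th)" by (simp add: E_def)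
   show "abs (E th y) <= abs (v y * (K * (2 * R) * indicator (ball 0 (2 * R)) y))"
   proof (cases "norm y < 2 * R")
    case True
    have c: "abs (cos th / 2) <= 1" using abs_cos_le_one[of th] unfolding abs_divide abs_numeral by linarith
    have "abs (cos th / 2) * abs (grad phi (s th *\<^sub>R y) \<bullet> y) <= 1 * (K * (2 * R))"
     using True K(1) c by (intro mult_mono order_trans[OF Cauchy_Schwarz_ineq2] mult_mono K(2)) auto
    then have "abs (v y) * (abs (cos th / 2) * abs (grad phi (s th *\<^sub>R y) \<bullet> y)) <= abs (v y) * (K * (2 * R))" by (intro mult_left_mono) auto
    then show ?thesis using True K(1) unfolding E_def by (simp add: abs_mult R_def)
   next
    case False
    have "R <= s th * norm y" using mult_mono[of "1/2" "s th" "2 * R" "norm y"] s1[of th] False by (simp add: R_def)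
    then have "s th *\<^sub>R y \<notin> ball 0 R" using s1[of th] by (auto simp: abs_mult)
    then have "grad phi (s th *\<^sub>R y) = 0" using test_functionD(3)[OF test_function_pd[OF t]] by (simp add: grad_def)
    then show ?thesis by (simp add: E_def)
   qed
  next
   have "integrable lborel (%y. v y * (K * (2 * R) * indicator (ball 0 (2 * R)) y))"
    by (rule L2_mult_bounded_integrable[OF _ _ sob_pairD(3)[of "2 * R" v g], where K="abs (K * (2 * R))"])
      (use h in \<open>auto simp: hsob_def split: split_indicator\<close>)
   then show "integrable lborel (%y. abs (v y * (K * (2 * R) * indicator (ball 0 (2 * R)) y)))" by (rule integrable_abs)
  qed (use idil in \<open>auto simp: E_def\<close>)
  moreover have "((%th. (LBINT y. v y * phi (s th *\<^sub>R y))) has_real_derivative - q / 2 * (LBINT y. v y * phi y)) (at 0)"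
   unfolding dil unfolding s_def by (auto intro!: derivative_eq_intros)
  ultimately have "(LBINT y. E 0 y) = - q / 2 * (LBINT y. v y * phi y)" by (rule DERIV_unique)
  moreover have "E 0 = (%y. 1/2 * (v y * (grad phi y \<bullet> y)))" by (simp add: E_def s_def fun_eq_iff)
  ultimately have E: "(LBINT y. v y * (grad phi y \<bullet> y)) = - q * (LBINT y. v y * phi y)" by simp
  \<comment> \<open>Testing with phi(x) x_b produces, besides the radial derivative of phi, one copy
    of phi for each b; these n copies account for the n in \<open>q\<close>, leaving 3/2.\<close>
  have tb: "test_function_on (ball 0 R) (%x. phi x * (x \<bullet> b))" for b :: 'a
   using test_function_mult[OF t smooth_inner] .
  have pb: "pd b (%x. phi x * (x \<bullet> b)) x = phi x + pd b phi x * (x \<bullet> b)" if b: "b \<in> Basis" for b x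
  proof -
   have "pd b (%x. x \<bullet> b) x = b \<bullet> b" by (rule pd_eqI) (auto intro!: derivative_eq_intros)
   then show ?thesis using b pd_mult[of phi "%x. x \<bullet> b" b] smooth_differentiable[OF sm] smooth_differentiable[OF smooth_inner]
    by auto
  qed
  have ib: "integrable lborel (%x. v x * (pd b phi x * (x \<bullet> b)))" if "b \<in> Basis" for b
   using sob_pair_test_integrable(1)[OF p test_function_mult[OF test_function_pd[OF t that] smooth_inner] that] .
  have B: "(LBINT x. v x * (pd b phi x * (x \<bullet> b))) = - (LBINT x. (g x \<bullet> b) * (phi x * (x \<bullet> b))) - (LBINT x. v x * phi x)"
   if b: "b \<in> Basis" for b
  proof -
   have "(LBINT x. v x * (phi x + pd b phi x * (x \<bullet> b))) = - (LBINT x. (g x \<bullet> b) * (phi x * (x \<bullet> b)))"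
    using d(5)[OF tb[of b] b] unfolding pb[OF b] .
   then show ?thesis using iphi ib[OF b] by (simp add: distrib_left)
  qed
  have igb: "integrable lborel (%x. (g x \<bullet> b) * (phi x * (x \<bullet> b)))" if "b \<in> Basis" for b
   using sob_pair_test_integrable(2)[OF p tb that] .
  have "(LBINT y. v y * (grad phi y \<bullet> y)) = (LBINT y. (\<Sum>b\<in>Basis. v y * (pd b phi y * (y \<bullet> b))))"
   unfolding grad_def inner_sum_left sum_distrib_left by (simp add: inner_commute)
  also have "... = (\<Sum>b\<in>Basis. (LBINT y. v y * (pd b phi y * (y \<bullet> b))))"
   by (rule Bochner_Integration.integral_sum) (use ib in auto)
  also have "... = (\<Sum>b\<in>Basis. - (LBINT x. (g x \<bullet> b) * (phi x * (x \<bullet> b))) - (LBINT x. v x * phi x))"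
   using B by (intro sum.cong) auto
  also have "... = - (\<Sum>b\<in>Basis. (LBINT x. (g x \<bullet> b) * (phi x * (x \<bullet> b)))) - DIM('a) * (LBINT x. v x * phi x)"
   by (simp add: sum_subtractf sum_negf)
  also have "(\<Sum>b\<in>Basis. (LBINT x. (g x \<bullet> b) * (phi x * (x \<bullet> b)))) = (LBINT x. (\<Sum>b\<in>Basis. (g x \<bullet> b) * (phi x * (x \<bullet> b))))"
   by (rule Bochner_Integration.integral_sum[symmetric]) (use igb in auto)
  also have "(%x. \<Sum>b\<in>Basis. (g x \<bullet> b) * (phi x * (x \<bullet> b))) = (%x. (g x \<bullet> x) * phi x)"
   by (rule ext, subst (3) euclidean_inner) (simp add: sum_distrib_left sum_distrib_right mult_ac)
  finally have F: "(LBINT x. (g x \<bullet> x) * phi x) = 3/2 * (LBINT x. v x * phi x)"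
   using E by (simp add: q_def algebra_simps)
  have ig: "integrable lborel (%x. (g x \<bullet> x) * phi x)"
  proof -
   have "integrable lborel (%x. \<Sum>b\<in>Basis. (g x \<bullet> b) * (phi x * (x \<bullet> b)))"
    using igb by (intro Bochner_Integration.integrable_sum) auto
   also have "(%x. \<Sum>b\<in>Basis. (g x \<bullet> b) * (phi x * (x \<bullet> b))) = (%x. (g x \<bullet> x) * phi x)"
    by (rule ext, subst (3) euclidean_inner) (simp add: sum_distrib_left sum_distrib_right mult_ac)
   finally show ?thesis .
  qed
  have "(LBINT x. (g x \<bullet> x) * phi x - 3/2 * (v x * phi x)) = 0" using ig iphi F by simp
  then show ?thesis by (simp add: left_diff_distrib mult.assoc)
 qed
 have "AE x in lborel. x \<in> ball 0 R --> g x \<bullet> x - 3/2 * v x = 0"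
 proof (rule fundamental_lemma_ball[OF _ _ key])
  have "integrable lborel (%x. (2 * R\<^sup>2) * (indicator (ball 0 R) x * (norm (g x))^2) + 9/2 * (indicator (ball 0 R) x * (v x)^2))"
   using d by auto
  then show "integrable lborel (%x. indicator (ball 0 R) x * (g x \<bullet> x - 3/2 * v x)^2)"
  proof (rule Bochner_Integration.integrable_bound)
   have "(g x \<bullet> x - 3/2 * v x)^2 <= 2 * R\<^sup>2 * (norm (g x))^2 + 9/2 * (v x)^2" if "x \<in> ball 0 R" for x
   proof -
    have "(g x \<bullet> x - 3/2 * v x)^2 <= 2 * (g x \<bullet> x)^2 + 2 * (3/2 * v x)^2"
     using zero_le_power2[of "g x \<bullet> x + 3/2 * v x"] by (simp add: power2_eq_square algebra_simps)
    also have "(g x \<bullet> x)^2 <= (norm (g x) * R)^2"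
    proof (rule abs_le_square_iff[THEN iffD1])
     have "abs (g x \<bullet> x) <= norm (g x) * norm x" by (rule Cauchy_Schwarz_ineq2)
     also have "... <= norm (g x) * R" using that by (intro mult_left_mono) auto
     finally show "abs (g x \<bullet> x) <= abs (norm (g x) * R)" by simp
    qed
    finally show ?thesis by (simp add: power_mult_distrib power2_eq_square mult_ac)
   qed
   then show "AE x in lborel. norm (indicator (ball 0 R) x * (g x \<bullet> x - 3/2 * v x)^2) <= norm ((2 * R\<^sup>2) * (indicator (ball 0 R) x * (norm (g x))^2) + 9/2 * (indicator (ball 0 R) x * (v x)^2))"
    by (intro AE_I2) (auto simp del: mem_ball split: split_indicator)
  qed auto
 qed auto
 then show "AE x in lborel. x \<in> ball 0 (real n) --> g x \<bullet> x = 3/2 * v x"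
  unfolding R_def by (auto elim: eventually_mono)
qed

subsection \<open>Limits in \<open>L\<^sup>2\<close>\<close>

lemma L2_real_iff: "(f :: 'a => real) \<in> L2 M \<longleftrightarrow> f \<in> borel_measurable M \<and> integrable M (%x. (f x)^2)"
 by (simp add: L2_def)

lemma L2_diff: "(f :: 'a => real) \<in> L2 M ==> g \<in> L2 M ==> (%x. f x - g x) \<in> L2 M"
 unfolding L2_real_iff using L2_sq_integrable_diff[of f M g] by auto

lemma L2_add: "(f :: 'a => real) \<in> L2 M ==> g \<in> L2 M ==> (%x. f x + g x) \<in> L2 M"
 unfolding L2_real_iff using L2_sq_integrable_diff[of f M g] by auto

lemma L2_mult_integrable: "(f :: 'a => real) \<in> L2 M ==> g \<in> L2 M ==> integrable M (%x. f x * g x)"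
 unfolding L2_real_iff using L2_sq_integrable_diff[of f M g] by auto

lemma L2_Cauchy_Schwarz:
 fixes f g :: "'a => real"
 assumes f: "f \<in> L2 M" and g: "g \<in> L2 M"
 shows "abs (\<integral>x. f x * g x \<partial>M) <= sqrt (\<integral>x. (f x)^2 \<partial>M) * sqrt (\<integral>x. (g x)^2 \<partial>M)"
proof -
 let ?A = "\<integral>x. (f x)^2 \<partial>M" and ?B = "\<integral>x. (g x)^2 \<partial>M" and ?c = "\<integral>x. f x * g x \<partial>M"
 have i: "integrable M (%x. (f x)^2)" "integrable M (%x. (g x)^2)" "integrable M (%x. f x * g x)"
  using f g L2_mult_integrable by (auto simp: L2_real_iff)
 have q: "0 <= ?A - 2 * t * ?c + t\<^sup>2 * ?B" for t
 proof -
  have "0 <= (\<integral>x. (f x - t * g x)^2 \<partial>M)" by simp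
  also have "(%x. (f x - t * g x)^2) = (%x. (f x)^2 - 2 * t * (f x * g x) + t\<^sup>2 * (g x)^2)"
   by (simp add: power2_eq_square algebra_simps)
  also have "(\<integral>x. (f x)^2 - 2 * t * (f x * g x) + t\<^sup>2 * (g x)^2 \<partial>M) = ?A - 2 * t * ?c + t\<^sup>2 * ?B" using i by simp
  finally show ?thesis .
 qed
 have "?c\<^sup>2 <= ?A * ?B"
 proof (cases "?B = 0")
  case True
  have "?c = 0"
  proof (rule ccontr)
   assume "?c ~= 0"
   \<comment> \<open>If B = 0 the quadratic is affine in t; at this t it equals A - (A + 1) =
     -1.\<close>
   then show False using q[of "(?A + 1) / (2 * ?c)"] True by simp
  qed
  then show ?thesis using True by simp
 next
  case False
  moreover have "?B >= 0" by simp
  ultimately have B: "?B > 0" by linarith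
  have "0 <= ?A - 2 * (?c / ?B) * ?c + (?c / ?B)^2 * ?B" by (rule q)
  also have "... = ?A - ?c\<^sup>2 / ?B" using B by (simp add: power2_eq_square field_simps)
  finally show ?thesis using B by (simp add: field_simps)
 qed
 then have "sqrt (?c\<^sup>2) <= sqrt (?A * ?B)" by (rule real_sqrt_le_mono)
 then show ?thesis by (simp add: real_sqrt_mult)
qed

text \<open>The difference of products is (fk - f)(hk - h) + f (hk - h) + (fk - f) h, and
  Cauchy-Schwarz bounds each term.\<close>

lemma L2_prod_tendsto:
 fixes f h :: "'a => real"
 assumes f: "!!k. fk k \<in> L2 M" "f \<in> L2 M" and h: "!!k. hk k \<in> L2 M" "h \<in> L2 M"
  and lf: "(%k. \<integral>x. (fk k x - f x)^2 \<partial>M) \<longlonglongrightarrow> 0" and lh: "(%k. \<integral>x. (hk k x - h x)^2 \<partial>M) \<longlonglongrightarrow> 0"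
 shows "(%k. \<integral>x. fk k x * hk k x \<partial>M) \<longlonglongrightarrow> (\<integral>x. f x * h x \<partial>M)"
proof -
 let ?a = "%k. \<integral>x. (fk k x - f x)^2 \<partial>M" and ?b = "%k. \<integral>x. (hk k x - h x)^2 \<partial>M"
 let ?F = "\<integral>x. (f x)^2 \<partial>M" and ?H = "\<integral>x. (h x)^2 \<partial>M"
 have df: "(%x. fk k x - f x) \<in> L2 M" and dh: "(%x. hk k x - h x) \<in> L2 M" for k
  using f h by (auto intro: L2_diff)
 have "abs ((\<integral>x. fk k x * hk k x \<partial>M) - (\<integral>x. f x * h x \<partial>M)) <= sqrt (?a k) * sqrt (?b k) + sqrt ?F * sqrt (?b k) + sqrt (?a k) * sqrt ?H" for k
 proof -
  note i = L2_mult_integrable[OF f(1) h(1), of k k] L2_mult_integrable[OF f(2) h(2)]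
   L2_mult_integrable[OF df dh, of k k] L2_mult_integrable[OF f(2) dh, of k] L2_mult_integrable[OF df h(2), of k]
  have "(\<integral>x. fk k x * hk k x \<partial>M) - (\<integral>x. f x * h x \<partial>M) = (\<integral>x. fk k x * hk k x - f x * h x \<partial>M)" using i by simp
  also have "... = (\<integral>x. (fk k x - f x) * (hk k x - h x) + f x * (hk k x - h x) + (fk k x - f x) * h x \<partial>M)"
   by (intro Bochner_Integration.integral_cong) (auto simp: algebra_simps)
  also have "... = (\<integral>x. (fk k x - f x) * (hk k x - h x) \<partial>M) + (\<integral>x. f x * (hk k x - h x) \<partial>M) + (\<integral>x. (fk k x - f x) * h x \<partial>M)"
   using i by simp
  finally show ?thesis
   using L2_Cauchy_Schwarz[OF df dh, of k k] L2_Cauchy_Schwarz[OF f(2) dh, of k] L2_Cauchy_Schwarz[OF df h(2), of k] by linarith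
 qed
 note le = this
 have "(%k. sqrt (?a k) * sqrt (?b k) + sqrt ?F * sqrt (?b k) + sqrt (?a k) * sqrt ?H) \<longlonglongrightarrow> sqrt 0 * sqrt 0 + sqrt ?F * sqrt 0 + sqrt 0 * sqrt ?H"
  by (intro tendsto_intros lf lh)
 then have z: "(%k. sqrt (?a k) * sqrt (?b k) + sqrt ?F * sqrt (?b k) + sqrt (?a k) * sqrt ?H) \<longlonglongrightarrow> 0" by simp
 have "(%k. (\<integral>x. fk k x * hk k x \<partial>M) - (\<integral>x. f x * h x \<partial>M)) \<longlonglongrightarrow> 0"
  by (rule Lim_null_comparison[OF _ z]) (use le in auto)
 then show ?thesis by (simp add: LIM_zero_iff)
qed

lemma L2_sum_le:
 fixes f g :: "'a => real"
 assumes "f \<in> L2 M" "g \<in> L2 M"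
 shows "(\<integral>x. (f x + g x)^2 \<partial>M) <= 2 * (\<integral>x. (f x)^2 \<partial>M) + 2 * (\<integral>x. (g x)^2 \<partial>M)"
proof -
 have i: "integrable M (%x. (f x)^2)" "integrable M (%x. (g x)^2)" using assms by (auto simp: L2_real_iff)
 have "(\<integral>x. (f x + g x)^2 \<partial>M) <= (\<integral>x. 2 * (f x)^2 + 2 * (g x)^2 \<partial>M)"
 proof (rule integral_mono')
  show "(f x + g x)^2 <= 2 * (f x)^2 + 2 * (g x)^2" for x
   using zero_le_power2[of "f x - g x"] by (simp add: power2_eq_square algebra_simps)
 qed (use i in auto)
 then show ?thesis using i by simp
qed

text \<open>Completeness of L2 in the form needed for traces: on a finite measure the consecutive
  differences are summable in L1, which gives an almost everywhere limit, and Fatou carries the L2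
  bounds over to it.\<close>

lemma L2_fast_Cauchy_limit:
 fixes f :: "nat => 'a => real"
 assumes M: "finite_measure M" and f: "!!k. f k \<in> L2 M"
  and fast: "!!k. (\<integral>x. (f (Suc k) x - f k x)^2 \<partial>M) <= K * (1/4)^k"
 shows "\<exists>\<gamma>\<in>L2 M. (%k. \<integral>x. (f k x - \<gamma> x)^2 \<partial>M) \<longlonglongrightarrow> 0"
proof -
 interpret finite_measure M by fact
 have [measurable]: "f k \<in> borel_measurable M" for k using f by (auto simp: L2_real_iff)
 have "0 <= (\<integral>x. (f (Suc 0) x - f 0 x)^2 \<partial>M)" by simp
 also have "... <= K" using fast[of 0] by simp
 finally have K0: "K >= 0" .
 have id: "integrable M (%x. (f k x - f l x)^2)" for k l using L2_diff[OF f f, of k l] by (simp add: L2_real_iff)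
 \<comment> \<open>The constant 4 reproduces itself in the induction, because 2 * 4/4 + 2 =
   4.\<close>
 have far: "(\<integral>x. (f (k + m) x - f k x)^2 \<partial>M) <= 4 * K * (1/4)^k" for k m
 proof (induction m arbitrary: k)
  case (Suc m)
  have "(\<integral>x. (f (k + Suc m) x - f k x)^2 \<partial>M) = (\<integral>x. ((f (Suc k + m) x - f (Suc k) x) + (f (Suc k) x - f k x))^2 \<partial>M)" by simp
  also have "... <= 2 * (\<integral>x. (f (Suc k + m) x - f (Suc k) x)^2 \<partial>M) + 2 * (\<integral>x. (f (Suc k) x - f k x)^2 \<partial>M)"
   by (intro L2_sum_le L2_diff f)
  also have "... <= 2 * (4 * K * (1/4)^(Suc k)) + 2 * (K * (1/4)^k)"
   using Suc[of "Suc k"] fast[of k] by (intro add_mono mult_left_mono) auto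
  finally show ?case by simp
 qed (use K0 in simp)
 define d where "d k x = abs (f (Suc k) x - f k x)" for k x
 have [measurable]: "d k \<in> borel_measurable M" for k unfolding d_def by measurable
 \<comment> \<open>Weighted arithmetic-geometric mean: d is at most half of 2^(-k) + 2^k d^2. The
   weight 2^k turns the decay 4^(-k) of the squares into 2^(-k) for both terms.\<close>
 have dn: "(\<integral>\<^sup>+x. ennreal (d k x) \<partial>M) <= ennreal ((measure M (space M) + K) / 2 * (1/2)^k)" for k
 proof -
  have ib: "integrable M (%x. 1/2 * ((1/2)^k + 2^k * (f (Suc k) x - f k x)^2))" using id by auto
  have "(\<integral>\<^sup>+x. ennreal (d k x) \<partial>M) <= (\<integral>\<^sup>+x. ennreal (1/2 * ((1/2)^k + 2^k * (f (Suc k) x - f k x)^2)) \<partial>M)"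
  proof (intro nn_integral_mono ennreal_leI)
   fix x
   have "0 <= (1/2)^k * (2^k * d k x - 1)^2" by simp
   also have "... = ((1/2)^k * 2^k) * 2^k * (d k x)^2 - 2 * ((1/2)^k * 2^k) * d k x + (1/2)^k"
    by (simp add: power2_eq_square algebra_simps)
   also have "(1/2)^k * 2^k = (1::real)" by (simp flip: power_mult_distrib)
   finally show "d k x <= 1/2 * ((1/2)^k + 2^k * (f (Suc k) x - f k x)^2)" by (simp add: d_def)
  qed
  also have "... = ennreal (\<integral>x. 1/2 * ((1/2)^k + 2^k * (f (Suc k) x - f k x)^2) \<partial>M)"
   by (rule nn_integral_eq_integral[OF ib]) auto
  also have "(\<integral>x. 1/2 * ((1/2)^k + 2^k * (f (Suc k) x - f k x)^2) \<partial>M) = 1/2 * ((1/2)^k * measure M (space M) + 2^k * (\<integral>x. (f (Suc k) x - f k x)^2 \<partial>M))"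
   using id by simp
  also have "... <= 1/2 * ((1/2)^k * measure M (space M) + 2^k * (K * (1/4)^k))"
   by (intro mult_left_mono add_left_mono fast) auto
  also have "2^k * (K * (1/4)^k) = K * (1/2)^k"
   by (simp add: power_divide field_simps power_mult_distrib[symmetric])
  also have "1/2 * ((1/2)^k * measure M (space M) + K * (1/2)^k) = (measure M (space M) + K) / 2 * (1/2)^k" by (simp add: algebra_simps)
  finally show ?thesis by (simp add: ennreal_leI)
 qed
 have "(\<integral>\<^sup>+x. (\<Sum>k. ennreal (d k x)) \<partial>M) = (\<Sum>k. \<integral>\<^sup>+x. ennreal (d k x) \<partial>M)"
  by (rule nn_integral_suminf) auto
 also have "... <= (\<Sum>k. ennreal ((measure M (space M) + K) / 2 * (1/2)^k))"
  by (intro suminf_le dn) auto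
 also have "... = ennreal (\<Sum>k. (measure M (space M) + K) / 2 * (1/2)^k)"
  using K0 by (intro suminf_ennreal2) (auto intro!: summable_mult summable_geometric)
 also have "... < \<infinity>" by simp
 finally have "AE x in M. (\<Sum>k. ennreal (d k x)) ~= \<infinity>"
  by (intro nn_integral_PInf_AE) auto
 then have conv: "AE x in M. convergent (%k. f k x)"
 proof eventually_elim
  fix x assume "(\<Sum>k. ennreal (d k x)) ~= \<infinity>"
  then have "summable (%k. d k x)" by (intro summable_suminf_not_top) (auto simp: d_def)
  then have "summable (%k. f (Suc k) x - f k x)" unfolding d_def by (rule summable_rabs_cancel)
  then have "convergent (%n. f 0 x + (\<Sum>k<n. f (Suc k) x - f k x))"
   by (auto simp: summable_iff_convergent intro!: convergent_add convergent_const)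
  then show "convergent (%k. f k x)" using sum_lessThan_telescope[of "%k. f k x"] by simp
 qed
 define \<gamma> where "\<gamma> x = lim (%k. f k x)" for x
 have [measurable]: "\<gamma> \<in> borel_measurable M" unfolding \<gamma>_def by measurable
 have fat: "(\<integral>\<^sup>+x. ennreal ((f k x - \<gamma> x)^2) \<partial>M) <= ennreal (4 * K * (1/4)^k)" for k
 proof -
  have "(\<integral>\<^sup>+x. ennreal ((f k x - \<gamma> x)^2) \<partial>M) = (\<integral>\<^sup>+x. liminf (%l. ennreal ((f k x - f l x)^2)) \<partial>M)"
  proof (rule nn_integral_cong_AE)
   show "AE x in M. ennreal ((f k x - \<gamma> x)^2) = liminf (%l. ennreal ((f k x - f l x)^2))"
    using conv
   proof eventually_elim
    fix x assume "convergent (%k. f k x)"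
    then have "(%l. f l x) \<longlonglongrightarrow> \<gamma> x" by (simp add: \<gamma>_def convergent_LIMSEQ_iff)
    then have "(%l. ennreal ((f k x - f l x)^2)) \<longlonglongrightarrow> ennreal ((f k x - \<gamma> x)^2)"
     by (intro tendsto_ennrealI tendsto_intros)
    then show "ennreal ((f k x - \<gamma> x)^2) = liminf (%l. ennreal ((f k x - f l x)^2))"
     by (intro lim_imp_Liminf[symmetric]) auto
   qed
  qed
  also have "... <= liminf (%l. \<integral>\<^sup>+x. ennreal ((f k x - f l x)^2) \<partial>M)"
   by (rule nn_integral_liminf) auto
  also have "... <= liminf (%l. ennreal (4 * K * (1/4)^k))"
  proof (rule Liminf_mono)
   show "eventually (%l. (\<integral>\<^sup>+x. ennreal ((f k x - f l x)^2) \<partial>M) <= ennreal (4 * K * (1/4)^k)) sequentially"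
    using eventually_ge_at_top[of k]
   proof eventually_elim
    fix l assume "k <= l"
    then obtain m where l: "l = k + m" using le_Suc_ex by blast
    have "(\<integral>\<^sup>+x. ennreal ((f k x - f l x)^2) \<partial>M) = ennreal (\<integral>x. (f k x - f l x)^2 \<partial>M)"
     by (rule nn_integral_eq_integral[OF id]) auto
    also have "(\<integral>x. (f k x - f l x)^2 \<partial>M) = (\<integral>x. (f l x - f k x)^2 \<partial>M)" by (simp add: power2_commute)
    finally show "(\<integral>\<^sup>+x. ennreal ((f k x - f l x)^2) \<partial>M) <= ennreal (4 * K * (1/4)^k)"
     using far[of k m] by (simp add: l ennreal_leI)
   qed
  qed
  also have "... = ennreal (4 * K * (1/4)^k)" by (simp add: Liminf_const)
  finally show ?thesis .
 qed
 have i\<gamma>: "integrable M (%x. (f k x - \<gamma> x)^2)" for k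
  unfolding integrable_iff_bounded using fat[of k] by (auto simp: top.not_eq_extremum intro: le_less_trans)
 have le: "(\<integral>x. (f k x - \<gamma> x)^2 \<partial>M) <= 4 * K * (1/4)^k" for k
  using fat[of k] K0 by (subst (asm) nn_integral_eq_integral[OF i\<gamma>]) auto
 have "(%x. f 0 x - \<gamma> x) \<in> L2 M" using i\<gamma>[of 0] by (simp add: L2_real_iff)
 from L2_diff[OF f[of 0] this] have "\<gamma> \<in> L2 M" by simp
 moreover have "(%k. \<integral>x. (f k x - \<gamma> x)^2 \<partial>M) \<longlonglongrightarrow> 0"
 proof (rule tendsto_sandwich[OF _ _ tendsto_const])
  show "(%k. 4 * K * (1/4)^k) \<longlonglongrightarrow> 0"
   using tendsto_mult_left[OF LIMSEQ_realpow_zero[of "1/4::real"], of "4 * K"] by simp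
 qed (use le in auto)
 ultimately show ?thesis by blast
qed

subsection \<open>Traces with respect to a measure satisfying a trace inequality\<close>

text \<open>Isolates the trace inequality, so that existence, uniqueness and stability of traces are
  shown once for both the sphere and the thin ball.\<close>

definition trace_measure :: "'a::euclidean_space measure => real => bool" where
 "trace_measure M C \<longleftrightarrow> finite_measure M \<and> C >= 0 \<and>
   (\<forall>phi. smooth phi --> phi \<in> L2 M \<and> (\<integral>x. (phi x)^2 \<partial>M) <= C * pair_norm2 phi (grad phi))"

lemma Bi_sq: "sob_pair 1 v g ==> Bi (%x. (v x)^2)" "sob_pair 1 v g ==> Bi (%x. (norm (g x))^2)"
 by (auto dest: sob_pairD)

lemma pair_norm2_nonneg: "pair_norm2 v g >= 0"
 by (auto simp: pair_norm2_def intro!: add_nonneg_nonneg Bint_nonneg)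

lemma pair_norm2_triangle:
 assumes p: "sob_pair 1 v g" and q: "sob_pair 1 w k"
 shows "pair_norm2 (%x. v x + w x) (%x. g x + k x) <= 2 * pair_norm2 v g + 2 * pair_norm2 w k"
proof -
 have s: "sob_pair 1 (%x. v x + w x) (%x. g x + k x)" using sob_pair_lincomb[OF p q, of 1 1] by simp
 have sq: "(p + q)^2 <= 2 * p\<^sup>2 + 2 * q\<^sup>2" for p q :: real
  using zero_le_power2[of "p - q"] by (simp add: power2_eq_square algebra_simps)
 have "Bint (%x. (v x + w x)^2) <= Bint (%x. 2 * (v x)^2 + 2 * (w x)^2)"
  by (rule Bint_mono[OF Bi_sq(1)[OF s]]) (use Bi_sq[OF p] Bi_sq[OF q] in \<open>auto intro!: sq Bi_add Bi_cmult\<close>)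
 also have "... = 2 * Bint (%x. (v x)^2) + 2 * Bint (%x. (w x)^2)"
  using Bi_sq[OF p] Bi_sq[OF q] by (simp only: Bint_add Bi_cmult Bint_cmult)
 finally have 1: "Bint (%x. (v x + w x)^2) <= 2 * Bint (%x. (v x)^2) + 2 * Bint (%x. (w x)^2)" .
 have n: "(norm (g x + k x))^2 <= 2 * (norm (g x))^2 + 2 * (norm (k x))^2" for x
 proof -
  have "(norm (g x + k x))^2 <= (norm (g x) + norm (k x))^2" by (intro power_mono norm_triangle_ineq) auto
  then show ?thesis using sq[of "norm (g x)" "norm (k x)"] by linarith
 qed
 have "Bint (%x. (norm (g x + k x))^2) <= Bint (%x. 2 * (norm (g x))^2 + 2 * (norm (k x))^2)"
  by (rule Bint_mono[OF Bi_sq(2)[OF s]]) (use Bi_sq[OF p] Bi_sq[OF q] in \<open>auto intro!: n Bi_add Bi_cmult\<close>)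
 also have "... = 2 * Bint (%x. (norm (g x))^2) + 2 * Bint (%x. (norm (k x))^2)"
  using Bi_sq[OF p] Bi_sq[OF q] by (simp only: Bint_add Bi_cmult Bint_cmult)
 finally show ?thesis using 1 by (simp add: pair_norm2_def)
qed

lemma pair_norm2_uminus: "pair_norm2 (%x. - v x) (%x. - g x) = pair_norm2 v g"
 by (simp add: pair_norm2_def)

lemma pair_norm2_smooth_diff:
 assumes p: "sob_pair 1 v g" and s: "smooth phi" "smooth psi"
 shows "pair_norm2 (%x. phi x - psi x) (grad (%x. phi x - psi x)) <=
  2 * pair_norm2 (%x. phi x - v x) (%x. grad phi x - g x) + 2 * pair_norm2 (%x. psi x - v x) (%x. grad psi x - g x)"
proof -
 have a: "sob_pair 1 (%x. phi x - v x) (%x. grad phi x - g x)"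
  using sob_pair_lincomb[OF sob_pair_smooth[OF s(1)] p, of 1 "-1"] by simp
 have b: "sob_pair 1 (%x. - (psi x - v x)) (%x. - (grad psi x - g x))"
  using sob_pair_lincomb[OF sob_pair_smooth[OF s(2)] p, of "-1" "1"] by simp
 have "pair_norm2 (%x. (phi x - v x) + (- (psi x - v x))) (%x. (grad phi x - g x) + (- (grad psi x - g x)))
   <= 2 * pair_norm2 (%x. phi x - v x) (%x. grad phi x - g x) + 2 * pair_norm2 (%x. - (psi x - v x)) (%x. - (grad psi x - g x))"
  by (rule pair_norm2_triangle[OF a b])
 moreover have "grad (%x. phi x - psi x) = (%x. grad phi x - grad psi x)"
  using grad_diff[OF s] by auto
 ultimately show ?thesis unfolding pair_norm2_uminus by simp
qed

lemma trace_measure_diff_le: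
 assumes M: "trace_measure M C" and p: "sob_pair 1 v g" and s: "smooth phi" "smooth psi"
 shows "(\<integral>x. (phi x - psi x)^2 \<partial>M) <= 2 * C * (pair_norm2 (%x. phi x - v x) (%x. grad phi x - g x) + pair_norm2 (%x. psi x - v x) (%x. grad psi x - g x))"
proof -
 have C: "C >= 0" using M by (simp add: trace_measure_def)
 have "(\<integral>x. (phi x - psi x)^2 \<partial>M) <= C * pair_norm2 (%x. phi x - psi x) (grad (%x. phi x - psi x))"
  using M smooth_diff[OF s] by (simp add: trace_measure_def)
 also have "... <= C * (2 * pair_norm2 (%x. phi x - v x) (%x. grad phi x - g x) + 2 * pair_norm2 (%x. psi x - v x) (%x. grad psi x - g x))"
  using C by (intro mult_left_mono pair_norm2_smooth_diff[OF p s])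
 finally show ?thesis by (simp add: algebra_simps)
qed

text \<open>The trace inequality for psi k - phi k, where phi is the sequence defining the trace,
  shows that every approximating sequence has the same boundary limit.\<close>

lemma trace_convergence:
 assumes M: "trace_measure M C" and r: "sob_rep w v g" and t: "has_trace (ball 0 1) M w \<gamma>"
  and s: "!!k. smooth (psi k)" and l: "(%k. pair_norm2 (%x. psi k x - v x) (%x. grad (psi k) x - g x)) \<longlonglongrightarrow> 0"
 shows "\<gamma> \<in> L2 M" "(%k. \<integral>x. (psi k x - \<gamma> x)^2 \<partial>M) \<longlonglongrightarrow> 0"
proof -
 have p: "sob_pair 1 v g" using r by (simp add: sob_rep_def)
 obtain phi where phi: "!!k. smooth (phi k)" "(%k. pair_norm2 (%x. phi k x - v x) (%x. grad (phi k) x - g x)) \<longlonglongrightarrow> 0"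
  "(%k. \<integral>x. (phi k x - \<gamma> x)^2 \<partial>M) \<longlonglongrightarrow> 0" and \<gamma>: "\<gamma> \<in> L2 M"
  using t unfolding has_trace_iff[OF r] by blast
 show "\<gamma> \<in> L2 M" by fact
 have L2s: "smooth f ==> f \<in> L2 M" for f using M by (simp add: trace_measure_def)
 let ?b = "%k. 2 * (2 * C * (pair_norm2 (%x. psi k x - v x) (%x. grad (psi k) x - g x) + pair_norm2 (%x. phi k x - v x) (%x. grad (phi k) x - g x))) + 2 * (\<integral>x. (phi k x - \<gamma> x)^2 \<partial>M)"
 have "(\<integral>x. (psi k x - \<gamma> x)^2 \<partial>M) <= ?b k" for k
 proof -
  have "(\<integral>x. (psi k x - \<gamma> x)^2 \<partial>M) = (\<integral>x. ((psi k x - phi k x) + (phi k x - \<gamma> x))^2 \<partial>M)" by simp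
  also have "... <= 2 * (\<integral>x. (psi k x - phi k x)^2 \<partial>M) + 2 * (\<integral>x. (phi k x - \<gamma> x)^2 \<partial>M)"
   by (intro L2_sum_le L2_diff L2s s phi \<gamma>)
  finally show ?thesis using trace_measure_diff_le[OF M p s phi(1), of k k] by linarith
 qed
 note le = this
 have "?b \<longlonglongrightarrow> 2 * (2 * C * (0 + 0)) + 2 * 0"
  by (intro tendsto_intros l phi)
 then have b0: "?b \<longlonglongrightarrow> 0" by simp
 show "(%k. \<integral>x. (psi k x - \<gamma> x)^2 \<partial>M) \<longlonglongrightarrow> 0"
  by (rule tendsto_sandwich[OF _ _ tendsto_const b0]) (use le in auto)
qed

lemma trace_unique:
 assumes M: "trace_measure M C" and r: "sob_rep w v g"
  and t: "has_trace (ball 0 1) M w \<gamma>" "has_trace (ball 0 1) M w \<delta>"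
 shows "AE x in M. \<gamma> x = \<delta> x"
proof -
 obtain phi where phi: "!!k. smooth (phi k)" "(%k. pair_norm2 (%x. phi k x - v x) (%x. grad (phi k) x - g x)) \<longlonglongrightarrow> 0"
  "(%k. \<integral>x. (phi k x - \<gamma> x)^2 \<partial>M) \<longlonglongrightarrow> 0" and \<gamma>: "\<gamma> \<in> L2 M"
  using t(1) unfolding has_trace_iff[OF r] by blast
 note \<delta> = trace_convergence[OF M r t(2) phi(1,2)]
 have L2s: "smooth f ==> f \<in> L2 M" for f using M by (simp add: trace_measure_def)
 let ?b = "%k. 2 * (\<integral>x. (phi k x - \<delta> x)^2 \<partial>M) + 2 * (\<integral>x. (phi k x - \<gamma> x)^2 \<partial>M)"
 have le: "(\<integral>x. (\<gamma> x - \<delta> x)^2 \<partial>M) <= ?b k" for k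
 proof -
  have "(\<integral>x. (\<gamma> x - \<delta> x)^2 \<partial>M) = (\<integral>x. ((phi k x - \<delta> x) + (\<gamma> x - phi k x))^2 \<partial>M)" by simp
  also have "... <= 2 * (\<integral>x. (phi k x - \<delta> x)^2 \<partial>M) + 2 * (\<integral>x. (\<gamma> x - phi k x)^2 \<partial>M)"
   by (intro L2_sum_le L2_diff L2s phi \<gamma> \<delta>)
  finally show ?thesis by (simp add: power2_commute)
 qed
 have "?b \<longlonglongrightarrow> 2 * 0 + 2 * 0" by (intro tendsto_intros phi \<delta>)
 then have "(\<integral>x. (\<gamma> x - \<delta> x)^2 \<partial>M) <= 0" using le by (intro LIMSEQ_le_const[of ?b]) auto
 then have "(\<integral>x. (\<gamma> x - \<delta> x)^2 \<partial>M) = 0" by (intro antisym) auto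
 moreover have "integrable M (%x. (\<gamma> x - \<delta> x)^2)" using L2_diff[OF \<gamma> \<delta>(1)] by (simp add: L2_real_iff)
 ultimately have "AE x in M. (\<gamma> x - \<delta> x)^2 = 0" using integral_nonneg_eq_0_iff_AE[of M "%x. (\<gamma> x - \<delta> x)^2"] by auto
 then show ?thesis by eventually_elim simp
qed

text \<open>A subsequence converging at rate 4^(-k) has restrictions that are geometrically Cauchy
  in L2 of \<open>M\<close>. Existence of one trace is what makes the choice in
  \<open>sobolev_trace\<close> meaningful.\<close>

lemma trace_exists:
 assumes M: "trace_measure M C" and r: "sob_rep w v g"
  and s: "!!k. smooth (psi k)" and l: "(%k. pair_norm2 (%x. psi k x - v x) (%x. grad (psi k) x - g x)) \<longlonglongrightarrow> 0"
 shows "has_trace (ball 0 1) M w (sobolev_trace (ball 0 1) M w)"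
proof -
 have p: "sob_pair 1 v g" using r by (simp add: sob_rep_def)
 have "\<exists>j. pair_norm2 (%x. psi j x - v x) (%x. grad (psi j) x - g x) <= (1/4)^k" for k
  using order_tendstoD(2)[OF l, of "(1/4)^k"] by (auto simp: eventually_sequentially intro: less_imp_le)
 then obtain j where j: "!!k. pair_norm2 (%x. psi (j k) x - v x) (%x. grad (psi (j k)) x - g x) <= (1/4)^k" by metis
 define phi where "phi k = psi (j k)" for k
 have phi: "smooth (phi k)" "pair_norm2 (%x. phi k x - v x) (%x. grad (phi k) x - g x) <= (1/4)^k" for k
  using s j by (auto simp: phi_def)
 have C: "C >= 0" and fm: "finite_measure M" and L2s: "smooth f ==> f \<in> L2 M" for f using M by (auto simp: trace_measure_def)
 have "(\<integral>x. (phi (Suc k) x - phi k x)^2 \<partial>M) <= 4 * C * (1/4)^k" for k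
 proof -
  have "(\<integral>x. (phi (Suc k) x - phi k x)^2 \<partial>M) <= 2 * C * ((1/4)^(Suc k) + (1/4)^k)"
   by (rule order_trans[OF trace_measure_diff_le[OF M p phi(1) phi(1)]]) (intro mult_left_mono add_mono phi; use C in simp)
  also have "... <= 2 * C * ((1/4)^k + (1/4)^k)" using C by (intro mult_left_mono add_right_mono) auto
  finally show ?thesis by simp
 qed
 from L2_fast_Cauchy_limit[OF fm L2s[OF phi(1)] this]
 obtain \<gamma> where \<gamma>: "\<gamma> \<in> L2 M" "(%k. \<integral>x. (phi k x - \<gamma> x)^2 \<partial>M) \<longlonglongrightarrow> 0" by blast
 have "(%k. pair_norm2 (%x. phi k x - v x) (%x. grad (phi k) x - g x)) \<longlonglongrightarrow> 0"
  by (rule tendsto_sandwich[OF _ _ tendsto_const LIMSEQ_realpow_zero[of "1/4"]]) (use phi(2) pair_norm2_nonneg in \<open>auto intro!: always_eventually\<close>)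
 then have "has_trace (ball 0 1) M w \<gamma>" unfolding has_trace_iff[OF r] using \<gamma> phi(1) by blast
 then show ?thesis using someI[of "has_trace (ball 0 1) M w" \<gamma>] by (simp add: sobolev_trace_def)
qed

subsection \<open>Smooth approximation\<close>

lemma grad_zero_outside:
 assumes "smooth eta" "!!x. norm x >= R ==> eta x = 0" "norm x > R"
 shows "grad eta x = 0"
proof -
 have "closure {x. eta x ~= 0} \<subseteq> cball 0 R"
  by (rule closure_minimal[OF _ closed_cball]) (use assms(2) in \<open>force simp: not_le intro: less_imp_le\<close>)
 then have "pd b eta x = 0" for b by (intro test_pd_support assms(1)) (use assms(3) in auto)
 then show ?thesis by (simp add: grad_def)
qed

text \<open>The reflected kernel y -> rho(x - y) is itself a test function; the sign from the
  reflection cancels the sign in the weak derivative.\<close>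

lemma conv_pd_weak:
 fixes x :: "'a::euclidean_space"
 assumes p: "!!R. sob_pair R u G" and t: "test_function_on UNIV rho" and b: "b \<in> Basis"
 shows "conv u (pd b rho) x = conv (%y. G y \<bullet> b) rho x"
proof -
 have sm: "smooth rho" using test_functionD(1)[OF t] .
 obtain r where r: "r > 0" "!!x. norm x >= r ==> rho x = 0" using test_functionD(2)[OF t] by blast
 let ?f = "%y. rho (x + (-1) *\<^sub>R y)"
 have t1: "test_function_on (ball 0 (norm x + r + 1)) ?f"
 proof (rule test_functionI[where r="norm x + r"])
  show "smooth ?f" by (rule smooth_affine[OF sm])
  fix y :: 'a assume "norm y >= norm x + r"
  then have "norm (x + (-1) *\<^sub>R y) >= r" using norm_triangle_ineq2[of y x] by (simp add: norm_minus_commute)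
  then show "?f y = 0" by (rule r(2))
 qed auto
 have "(LBINT y. u y * pd b ?f y) = - (LBINT y. (G y \<bullet> b) * ?f y)"
  by (rule sob_pairD(5)[OF p t1 b])
 then show ?thesis unfolding pd_affine[OF sm] conv_def by simp
qed

lemma norm2_Basis: "(norm x)^2 = (\<Sum>b\<in>Basis. (x \<bullet> b)^2)" for x :: "'a::euclidean_space"
 unfolding power2_norm_eq_inner by (subst euclidean_inner) (simp add: power2_eq_square)

text \<open>Mollification commutes with weak differentiation, so the L2 convergence of mollified
  functions applies to \<open>u\<close> and to every component of \<open>G\<close>.\<close>

lemma smooth_approx_compact:
 fixes u :: "'a::euclidean_space => real"
 assumes p: "!!R. sob_pair R u G" and s: "!!x. norm x >= r ==> u x = 0" "!!x. norm x >= r ==> G x = 0"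
 defines "phi \<equiv> %k. conv u (moll (1 / Suc k))"
 shows "smooth (phi k)" "norm x >= r + 1 ==> phi k x = 0"
  "integrable lborel (%x. (phi k x - u x)^2)" "(%k. (LBINT x. (phi k x - u x)^2)) \<longlonglongrightarrow> 0"
  "b \<in> Basis ==> integrable lborel (%x. (pd b (phi k) x - G x \<bullet> b)^2)"
  "b \<in> Basis ==> (%k. (LBINT x. (pd b (phi k) x - G x \<bullet> b)^2)) \<longlonglongrightarrow> 0"
proof -
 note d = sob_pairD[OF p[of r]]
 note [measurable] = d(1,2)
 have tm: "test_function_on UNIV (moll (1 / Suc k) :: 'a => real)" for k using moll_test[of "1 / Suc k"] by simp
 have u2: "integrable lborel (%x. (u x)^2)"
 proof -
  have "(%x. indicator (ball 0 r) x * (u x)^2) = (%x. (u x)^2)" using s by (auto split: split_indicator)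
  then show ?thesis using d(3) by simp
 qed
 have u1: "integrable lborel u" by (rule L2_bounded_support_integrable[OF _ u2 s(1)]) auto
 have G2: "integrable lborel (%x. (G x \<bullet> b)^2)" if "b \<in> Basis" for b
 proof -
  have "(%x. indicator (ball 0 r) x * (G x \<bullet> b)^2) = (%x. (G x \<bullet> b)^2)" using s by (auto split: split_indicator)
  then show ?thesis using L2_ball_comp_integrable[OF d(2,4) that] by simp
 qed
 have G1: "integrable lborel (%x. G x \<bullet> b)" if "b \<in> Basis" for b
  by (rule L2_bounded_support_integrable[OF _ G2[OF that], of r]) (use s in auto)
 show "smooth (phi k)" unfolding phi_def by (rule conv_smooth[OF u1 tm])
 show "norm x >= r + 1 ==> phi k x = 0"
 proof -
  assume x: "norm x >= r + 1"
  have "1 / real (Suc k) <= 1" by simp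
  then have "norm x >= r + 1 / Suc k" using x by linarith
  then show "phi k x = 0"
   unfolding phi_def by (intro conv_support[where R=r and d="1 / Suc k"] s(1) moll_supp) auto
 qed
 show "integrable lborel (%x. (phi k x - u x)^2)" "(%k. (LBINT x. (phi k x - u x)^2)) \<longlonglongrightarrow> 0"
  unfolding phi_def using mollify_L2[OF _ u1 u2] by auto
 have pdk: "pd b (phi k) = conv (%y. G y \<bullet> b) (moll (1 / Suc k))" if "b \<in> Basis" for b k
  unfolding phi_def conv_pd[OF u1 tm that] using conv_pd_weak[OF p tm that] by auto
 show "b \<in> Basis ==> integrable lborel (%x. (pd b (phi k) x - G x \<bullet> b)^2)"
  "b \<in> Basis ==> (%k. (LBINT x. (pd b (phi k) x - G x \<bullet> b)^2)) \<longlonglongrightarrow> 0"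
  using mollify_L2[OF _ G1 G2] by (auto simp: pdk)
qed

lemma Bint_le_integral:
 assumes "integrable lborel f" "!!x. f x >= 0"
 shows "Bint f <= (LBINT x. f x)"
 unfolding Bint_def by (rule integral_mono'[OF assms(1)]) (use assms(2) in \<open>auto split: split_indicator\<close>)

text \<open>The pair lives on all balls, so it can be cut off away from the unit ball and mollified
  there without any boundary effect. The uniform convergence for continuous functions serves to
  identify the thin trace of the comparison function.\<close>

lemma smooth_approx:
 fixes v :: "'a::euclidean_space => real"
 assumes p: "!!R. sob_pair R v g"
 shows "\<exists>phi. (\<forall>k. smooth (phi k)) \<and> (%k. pair_norm2 (%x. phi k x - v x) (%x. grad (phi k) x - g x)) \<longlonglongrightarrow> 0
  \<and> (continuous_on UNIV v --> (\<forall>e>0. \<forall>\<^sub>F k in sequentially. \<forall>x. norm x < 1 --> abs (phi k x - v x) <= e))"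
proof -
 \<comment> \<open>The cutoff is 1 up to radius 2 because mollifying at scale at most 1 from inside
   the unit ball looks no further.\<close>
 obtain eta :: "'a => real" where eta: "smooth eta" "!!x. norm x <= 2 ==> eta x = 1" "!!x. norm x >= 3 ==> eta x = 0"
  using cutoff_exists[of 2 3, where 'a='a] by auto
 define u where "u x = eta x * v x" for x
 define G where "G x = eta x *\<^sub>R g x + v x *\<^sub>R grad eta x" for x
 have pu: "sob_pair R u G" for R using sob_pair_mult_smooth[OF p eta(1)] by (simp add: u_def[abs_def] G_def[abs_def])
 have su: "norm x >= 4 ==> u x = 0" "norm x >= 4 ==> G x = 0" for x
  using eta(3) grad_zero_outside[OF eta(1,3), where x=x] by (auto simp: u_def G_def)
 have e1: "norm x < 1 ==> u x = v x" for x using eta(2) by (simp add: u_def)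
 have "smooth (%x. 1 - eta x)" by (intro smooth_diff smooth_const eta)
 have gr: "grad eta x = 0" if "norm x < 1" for x
 proof -
  have "((%x. 1::real) has_derivative (%h. 0)) (at x)" by simp
  then have "(eta has_derivative (%h. 0)) (at x)"
   by (rule has_derivative_transform_within_open[OF _ open_ball[of 0 2]]) (use that eta(2) in auto)
  then show ?thesis by (intro gradI) simp
 qed
 have e2: "norm x < 1 ==> G x = g x" for x using eta(2) gr by (simp add: G_def)
 define phi where "phi k = conv u (moll (1 / Suc k))" for k
 note A = smooth_approx_compact[OF pu su, folded phi_def]
 have "(%k. pair_norm2 (%x. phi k x - v x) (%x. grad (phi k) x - g x)) \<longlonglongrightarrow> 0"
 proof (rule tendsto_sandwich[OF _ _ tendsto_const])
  show "(%k. (LBINT x. (phi k x - u x)^2) + (\<Sum>b\<in>Basis. (LBINT x. (pd b (phi k) x - G x \<bullet> b)^2))) \<longlonglongrightarrow> 0"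
   by (intro tendsto_add_zero tendsto_null_sum A)
  show "eventually (%k. 0 <= pair_norm2 (%x. phi k x - v x) (%x. grad (phi k) x - g x)) sequentially"
   by (intro always_eventually allI pair_norm2_nonneg)
  show "eventually (%k. pair_norm2 (%x. phi k x - v x) (%x. grad (phi k) x - g x) <=
   (LBINT x. (phi k x - u x)^2) + (\<Sum>b\<in>Basis. (LBINT x. (pd b (phi k) x - G x \<bullet> b)^2))) sequentially"
  proof (intro always_eventually allI)
   fix k
   have 1: "Bint (%x. (phi k x - v x)^2) <= (LBINT x. (phi k x - u x)^2)"
   proof -
    have "Bint (%x. (phi k x - v x)^2) = Bint (%x. (phi k x - u x)^2)" by (rule Bint_cong) (simp add: e1)
    also have "... <= (LBINT x. (phi k x - u x)^2)" by (rule Bint_le_integral[OF A(3)]) auto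
    finally show ?thesis .
   qed
   have iS: "integrable lborel (%x. \<Sum>b\<in>Basis. (pd b (phi k) x - G x \<bullet> b)^2)"
    by (intro Bochner_Integration.integrable_sum A(5))
   have 2: "Bint (%x. (norm (grad (phi k) x - g x))^2) <= (\<Sum>b\<in>Basis. (LBINT x. (pd b (phi k) x - G x \<bullet> b)^2))"
   proof -
    have "Bint (%x. (norm (grad (phi k) x - g x))^2) = Bint (%x. \<Sum>b\<in>Basis. (pd b (phi k) x - G x \<bullet> b)^2)"
     by (rule Bint_cong) (simp add: e2 norm2_Basis inner_diff_left)
    also have "... <= (LBINT x. (\<Sum>b\<in>Basis. (pd b (phi k) x - G x \<bullet> b)^2))"
     by (rule Bint_le_integral[OF iS]) (auto intro: sum_nonneg)
    also have "... = (\<Sum>b\<in>Basis. (LBINT x. (pd b (phi k) x - G x \<bullet> b)^2))"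
     by (rule Bochner_Integration.integral_sum) (rule A(5))
    finally show ?thesis .
   qed
   show "pair_norm2 (%x. phi k x - v x) (%x. grad (phi k) x - g x) <=
    (LBINT x. (phi k x - u x)^2) + (\<Sum>b\<in>Basis. (LBINT x. (pd b (phi k) x - G x \<bullet> b)^2))"
    using 1 2 by (simp add: pair_norm2_def)
  qed
 qed
 moreover have "\<forall>e>0. \<forall>\<^sub>F k in sequentially. \<forall>x. norm x < 1 --> abs (phi k x - v x) <= e" if c: "continuous_on UNIV v"
 proof (intro allI impI)
  fix e :: real assume e: "e > 0"
  have um: "u \<in> borel_measurable borel" using sob_pairD(1)[OF pu] .
  have "uniformly_continuous_on (cball 0 2) v"
   by (intro compact_uniformly_continuous continuous_on_subset[OF c]) auto
  then obtain d where d: "d > 0" "!!x y. x \<in> cball 0 2 ==> y \<in> cball 0 2 ==> dist y x < d ==> dist (v y) (v x) < e"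
   using e unfolding uniformly_continuous_on_def by metis
  obtain N where N: "1 / Suc N < d" using d(1) nat_approx_posE by blast
  show "\<forall>\<^sub>F k in sequentially. \<forall>x. norm x < 1 --> abs (phi k x - v x) <= e"
   using eventually_ge_at_top[of N]
  proof (eventually_elim, intro allI impI)
   fix k and x :: 'a assume k: "N <= k" and x: "norm x < 1"
   let ?m = "moll (1 / Suc k) :: 'a => real"
   have kd: "1 / Suc k < d" "1 / Suc k <= (1::real)" 
    using N k by (auto intro!: le_less_trans[OF _ N] simp: frac_le)
   have tm: "test_function_on UNIV ?m" using moll_test[of "1 / Suc k"] by simp
   note im = test_integrable[OF tm]
   have mm: "?m \<in> borel_measurable borel" using borel_measurable_integrable[OF im] by simp
   note [measurable] = mm
   have c1: "phi k x = (LBINT y. u (x - y) * ?m y)" unfolding phi_def by (rule conv_commute[OF um mm])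
   have c2: "v x = (LBINT y. v x * ?m y)" using moll_int[of "1 / Suc k", where 'a='a] by simp
   have pw: "abs (u (x - y) * ?m y - v x * ?m y) <= e * ?m y" for y
   proof (cases "norm y < 1 / Suc k")
    case True
    have n: "norm (x - y) <= 2" using norm_triangle_ineq4[of x y] x True kd by linarith
    then have "u (x - y) = v (x - y)" using eta(2) by (simp add: u_def)
    moreover have "dist (v (x - y)) (v x) < e"
     by (rule d(2)) (use x n True kd in \<open>auto simp: dist_norm norm_minus_commute\<close>)
    ultimately have "abs (u (x - y) - v x) * ?m y <= e * ?m y"
     using moll_nonneg[of "1 / Suc k" y] by (intro mult_right_mono) (auto simp: dist_real_def)
    then show ?thesis using moll_nonneg[of "1 / Suc k" y] by (simp add: abs_mult flip: left_diff_distrib)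
   next
    case False then show ?thesis using moll_supp[of "1 / Suc k" y] by simp
   qed
   have iu: "integrable lborel (%y. u (x - y) * ?m y)"
   proof (rule Bochner_Integration.integrable_bound[of _ "%y. (e + abs (v x)) * ?m y"])
    show "AE y in lborel. norm (u (x - y) * ?m y) <= norm ((e + abs (v x)) * ?m y)"
    proof (rule AE_I2)
     fix y
     have m0: "?m y >= 0" using moll_nonneg[of "1 / Suc k" y] by simp
     have "abs (u (x - y) * ?m y) <= abs (u (x - y) * ?m y - v x * ?m y) + abs (v x * ?m y)" by linarith
     also have "... <= e * ?m y + abs (v x) * ?m y" using pw[of y] m0 by (simp add: abs_mult)
     finally show "norm (u (x - y) * ?m y) <= norm ((e + abs (v x)) * ?m y)" using m0 e by (simp add: algebra_simps)
    qed
   qed (use im um in auto)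
   have "phi k x - v x = (LBINT y. u (x - y) * ?m y - v x * ?m y)" using c1 c2 iu im by simp
   also have "abs (...) <= (LBINT y. e * ?m y)"
    by (rule order_trans[OF integral_abs_bound], rule integral_mono') (use pw im e moll_nonneg[of "1 / Suc k"] in \<open>auto intro!: mult_nonneg_nonneg\<close>)
   also have "... = e" using moll_int[of "1 / Suc k", where 'a='a] by simp
   finally show "abs (phi k x - v x) <= e" .
  qed
 qed
 ultimately show ?thesis using A(1) by blast
qed

subsection \<open>Surface measure on the sphere\<close>

lemma sgn_borel [measurable]: "(sgn :: 'a::euclidean_space => 'a) \<in> borel_measurable borel"
 unfolding sgn_div_norm[abs_def] by measurable

lemma sphere_measure_nn_integral:
 fixes f :: "'a::euclidean_space => real"
 assumes [measurable]: "f \<in> borel_measurable borel"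
 shows "(\<integral>\<^sup>+x. ennreal (f x) \<partial>(unit_sphere_measure :: 'a measure)) = of_nat DIM('a) * (\<integral>\<^sup>+x. ennreal (indicator (ball 0 1) x * f (sgn x)) \<partial>lborel)"
proof -
 have "(\<integral>\<^sup>+x. ennreal (f x) \<partial>(unit_sphere_measure :: 'a measure)) = of_nat DIM('a) * (\<integral>\<^sup>+x. ennreal (f x) \<partial>distr (restrict_space lborel (ball 0 1)) borel sgn)"
  unfolding unit_sphere_measure_def by (rule nn_integral_scale_measure) auto
 also have "(\<integral>\<^sup>+x. ennreal (f x) \<partial>distr (restrict_space lborel (ball 0 1)) borel sgn) = (\<integral>\<^sup>+x. ennreal (f (sgn x)) \<partial>restrict_space lborel (ball 0 1))"
  by (rule nn_integral_distr) (auto intro!: measurable_restrict_space1)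
 also have "... = (\<integral>\<^sup>+x. ennreal (indicator (ball 0 1) x * f (sgn x)) \<partial>lborel)"
  by (subst nn_integral_restrict_space) (auto intro!: nn_integral_cong split: split_indicator)
 finally show ?thesis .
qed

lemma sets_sphere_measure [measurable_cong, simp]: "sets unit_sphere_measure = sets borel"
 by (simp add: unit_sphere_measure_def)

lemma sphere_measure_integral:
 fixes f :: "'a::euclidean_space => real"
 assumes m[measurable]: "f \<in> borel_measurable borel"
 shows "integrable (unit_sphere_measure :: 'a measure) f \<longleftrightarrow> Bi (%x. f (sgn x))"
  and "Bi (%x. f (sgn x)) ==> (\<integral>x. f x \<partial>(unit_sphere_measure :: 'a measure)) = DIM('a) * Bint (%x. f (sgn x))"
proof -
 have m': "f \<in> borel_measurable unit_sphere_measure" by simp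
 have n: "(\<integral>\<^sup>+x. ennreal (norm (f x)) \<partial>(unit_sphere_measure :: 'a measure)) = of_nat DIM('a) * (\<integral>\<^sup>+x. ennreal (norm (indicator (ball 0 1) x * f (sgn x))) \<partial>lborel)"
  using sphere_measure_nn_integral[of "%x. norm (f x)"] by (simp add: abs_mult)
 show i: "integrable (unit_sphere_measure :: 'a measure) f \<longleftrightarrow> Bi (%x. f (sgn x))"
  unfolding integrable_iff_bounded n
  by (auto simp: ennreal_mult_less_top of_nat_less_top ennreal_mult_eq_top_iff less_top)
 assume B: "Bi (%x. f (sgn x))"
 then have iS: "integrable (unit_sphere_measure :: 'a measure) f" using i by simp
 have "(\<integral>\<^sup>+x. ennreal (- f x) \<partial>(unit_sphere_measure :: 'a measure)) = of_nat DIM('a) * (\<integral>\<^sup>+x. ennreal (- (indicator (ball 0 1) x * f (sgn x))) \<partial>lborel)"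
  using sphere_measure_nn_integral[of "%x. - f x"] by simp
 then show "(\<integral>x. f x \<partial>(unit_sphere_measure :: 'a measure)) = DIM('a) * Bint (%x. f (sgn x))"
  unfolding real_lebesgue_integral_def[OF iS] Bint_def real_lebesgue_integral_def[OF B] sphere_measure_nn_integral[OF m]
  by (simp add: enn2real_mult right_diff_distrib)
qed

lemma finite_sphere_measure: "finite_measure (unit_sphere_measure :: 'a::euclidean_space measure)"
proof
 have "(\<integral>\<^sup>+x. ennreal 1 \<partial>(unit_sphere_measure :: 'a measure)) = of_nat DIM('a) * (\<integral>\<^sup>+x. ennreal (indicator (ball 0 1) (x::'a) * 1) \<partial>lborel)"
  by (rule sphere_measure_nn_integral) auto
 also have "(\<integral>\<^sup>+x. ennreal (indicator (ball 0 1) (x::'a) * 1) \<partial>lborel) = emeasure lborel (ball (0::'a) 1)"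
  by (subst nn_integral_indicator[symmetric]) (auto intro!: nn_integral_cong simp del: nn_integral_indicator split: split_indicator)
 also have "of_nat DIM('a) * emeasure lborel (ball (0::'a) 1) < \<infinity>"
  using emeasure_bounded_finite[of "ball (0::'a) 1"] by (auto simp: ennreal_mult_less_top of_nat_less_top)
 finally show "emeasure (unit_sphere_measure :: 'a measure) (space unit_sphere_measure) ~= \<infinity>" by simp
qed

text \<open>The divergence theorem for the field \<open>x F(x)\<close> on the unit ball.\<close>

lemma sphere_integral_smooth:
 fixes F :: "'a::euclidean_space => real"
 assumes s: "smooth F"
 shows "integrable unit_sphere_measure F"
  and "(\<integral>x. F x \<partial>unit_sphere_measure) = DIM('a) * Bint F + Bint (%x. x \<bullet> grad F x)"
proof -
 have [measurable]: "F \<in> borel_measurable borel" "grad F \<in> borel_measurable borel" using s smooth_borel grad_borel by auto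
 obtain K where K: "K > 0" "!!x. x \<in> cball 0 1 ==> abs (F x) <= K" "!!x. x \<in> cball 0 1 ==> norm (grad F x) <= K"
  using smooth_bounded_on_ball[OF s, of 1] by blast
 have lip: "abs (F x - F y) <= K * norm (x - y)" if "x \<in> cball 0 1" "y \<in> cball 0 1" for x y
  using smooth_lipschitz[OF s convex_cball K(3) that] by simp
 have B1: "Bi (%x. 1)" using indicator_ball_integrable[of 0 1] by simp
 have iF: "Bi F" by (rule Bi_bound[of "%x. K * 1"]) (use B1 K(2) in \<open>auto intro!: Bi_cmult\<close>)
 have ng: "norm (sgn x) <= 1" for x :: 'a by (simp add: norm_sgn)
 have iG: "Bi (%x. F (sgn x))" by (rule Bi_bound[of "%x. K * 1"]) (use B1 K(2) ng in \<open>auto intro!: Bi_cmult\<close>)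
 then show "integrable unit_sphere_measure F" by (simp add: sphere_measure_integral)
 \<comment> \<open>The integral of F o sgn over the ball is 1/n times the sphere integral. It is
   invariant under dilation up to the Jacobian, and subtracting it makes the difference vanish on
   the sphere at a linear rate.\<close>
 define H where "H x = F x - F (sgn x)" for x
 have [measurable]: "H \<in> borel_measurable borel" unfolding H_def[abs_def] by measurable
 have iH: "Bi H" unfolding H_def[abs_def] by (rule Bi_diff[OF iF iG])
 have Hb: "abs (H x) <= K * (1 - norm x)" if "norm x < 1" "x ~= 0" for x
 proof -
  have "norm x *\<^sub>R sgn x = x" using that(2) by (simp add: sgn_div_norm)
  then have "x - sgn x = (norm x - 1) *\<^sub>R sgn x" by (simp add: scaleR_left_diff_distrib)
  then have "norm (x - sgn x) = 1 - norm x" using that by (simp add: norm_sgn)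
  then show ?thesis unfolding H_def using lip[of x "sgn x"] that ng[of x] by simp
 qed
 \<comment> \<open>Dilation factors tending to 1 with 1 - t k = 1/(k + 2); the factor k + 2 below is
   therefore the reciprocal of the increment in a radial difference quotient, and the shift by 2
   keeps \<open>t k\<close> positive.\<close>
 define t where "t k = 1 - 1 / (real k + 2)" for k :: nat
 have t: "0 < t k" "t k < 1" for k unfolding t_def by (auto simp: field_simps)
 have tl: "t \<longlonglongrightarrow> 1" unfolding t_def by real_asymp
 define R where "R k = (LBINT x. indicator (ball 0 1 - ball 0 (t k)) x * H x)" for k
 have iR: "integrable lborel (%x. indicator (ball 0 1 - ball 0 (t k)) x * H x)" for k
  by (rule Bochner_Integration.integrable_bound[OF iH]) (auto split: split_indicator)
 have iRt: "integrable lborel (%x. indicator (ball 0 (t k)) x * H x)" for k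
  by (rule Bochner_Integration.integrable_bound[OF iH]) (use t[of k] in \<open>auto split: split_indicator\<close>)
 have dil: "(t k)^DIM('a) * Bint (%x. F (t k *\<^sub>R x) - F (sgn x)) = Bint H - R k" for k
 proof -
  have "Bint H - R k = (LBINT x. indicator (ball 0 1) x * H x - indicator (ball 0 1 - ball 0 (t k)) x * H x)"
   unfolding Bint_def R_def using iH iR by simp
  also have "... = (LBINT x. indicator (ball 0 (t k)) x * H x)"
   by (intro Bochner_Integration.integral_cong) (use t[of k] in \<open>auto split: split_indicator\<close>)
  also have "... = abs (t k)^DIM('a) *\<^sub>R (LBINT x. indicator (ball 0 (t k)) (0 + t k *\<^sub>R x) * H (0 + t k *\<^sub>R x))"
   by (rule lborel_integral_affine) (use t[of k] in auto)
  also have "(LBINT x. indicator (ball 0 (t k)) (0 + t k *\<^sub>R x) * H (0 + t k *\<^sub>R x)) = Bint (%x. F (t k *\<^sub>R x) - F (sgn x))"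
  proof -
   have "sgn (t k *\<^sub>R x) = sgn x" for x :: 'a using t[of k] by (simp add: sgn_scaleR)
   moreover have "t k *\<^sub>R x \<in> ball 0 (t k) \<longleftrightarrow> x \<in> ball 0 1" for x :: 'a using t[of k] by auto
   ultimately show ?thesis unfolding Bint_def H_def
    by (intro Bochner_Integration.integral_cong) (auto simp del: mem_ball split: split_indicator)
  qed
  finally show ?thesis using t[of k] by simp
 qed
 have iFt: "Bi (%x. F (t k *\<^sub>R x))" for k
 proof (rule Bi_bound[of "%x. K * 1"])
  fix x :: 'a assume "norm x < 1"
  then have "norm (t k *\<^sub>R x) <= 1" using t[of k] by (simp add: mult_le_one)
  then show "abs (F (t k *\<^sub>R x)) <= K * 1" using K(2) by simp
 qed (use B1 in \<open>auto intro!: Bi_cmult\<close>)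
 have E: "Bint (%x. (F x - F (t k *\<^sub>R x)) * (real k + 2)) = (1 - 1 / (t k)^DIM('a)) * (real k + 2) * Bint H + R k * (real k + 2) / (t k)^DIM('a)" for k
 proof -
  have "Bint (%x. F (t k *\<^sub>R x) - F (sgn x)) = (Bint H - R k) / (t k)^DIM('a)"
   using dil[of k] t[of k] by (simp add: field_simps)
  moreover have "Bint (%x. F x - F (t k *\<^sub>R x)) = Bint H - Bint (%x. F (t k *\<^sub>R x) - F (sgn x))"
   unfolding H_def using iF iG iFt[of k] by (simp add: Bint_diff)
  moreover have "Bint (%x. (F x - F (t k *\<^sub>R x)) * (real k + 2)) = (real k + 2) * Bint (%x. F x - F (t k *\<^sub>R x))"
   by (subst Bint_cmult[symmetric]) (simp add: mult.commute)
  moreover have "q * (b - (b - r) / T) = (1 - 1 / T) * q * b + r * q / T" if "T > 0" for q b r T :: real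
   using that by (simp add: field_simps)
  ultimately show ?thesis using t[of k] by (simp only: zero_less_power)
 qed
 have L1: "(%k. Bint (%x. (F x - F (t k *\<^sub>R x)) * (real k + 2))) \<longlonglongrightarrow> Bint (%x. x \<bullet> grad F x)"
  unfolding Bint_def
 proof (rule integral_dominated_convergence[where w="%x. K * indicator (ball 0 1) x"])
  show "integrable lborel (%x. K * indicator (ball (0::'a) 1) x)" using indicator_ball_integrable by auto
  show "AE x in lborel. (%k. indicator (ball 0 1) x * ((F x - F (t k *\<^sub>R x)) * (real k + 2))) \<longlonglongrightarrow> indicator (ball 0 1) x * (x \<bullet> grad F x)"
  proof (intro AE_I2 tendsto_mult_left)
   fix x
   have "((%h. (F (x + h *\<^sub>R x) - F x) / h) \<longlongrightarrow> grad F x \<bullet> x) (at 0)"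
    using smooth_directional_derivative[OF s, of x x 0] by (simp add: DERIV_def)
   moreover have "filterlim (%n. - 1 / (real n + 2)) (at 0) sequentially"
    unfolding filterlim_at by (auto intro: always_eventually) real_asymp
   ultimately have "(%n. (F (x + (- 1 / (real n + 2)) *\<^sub>R x) - F x) / (- 1 / (real n + 2))) \<longlonglongrightarrow> grad F x \<bullet> x"
    by (rule filterlim_compose)
   moreover have "(F (x + (- 1 / (real n + 2)) *\<^sub>R x) - F x) / (- 1 / (real n + 2)) = (F x - F (t n *\<^sub>R x)) * (real n + 2)" for n
   proof -
    have e: "x + (- 1 / (real n + 2)) *\<^sub>R x = t n *\<^sub>R x" by (simp add: t_def scaleR_left_diff_distrib)
    have "(a - b) / (- 1 / q) = (b - a) * q" if "q > 0" for a b q :: real using that by (simp add: field_simps)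
    then show ?thesis unfolding e by simp
   qed
   ultimately show "(%k. (F x - F (t k *\<^sub>R x)) * (real k + 2)) \<longlonglongrightarrow> x \<bullet> grad F x" by (simp add: inner_commute)
  qed
  show "AE x in lborel. norm (indicator (ball 0 1) x * ((F x - F (t k *\<^sub>R x)) * (real k + 2))) <= K * indicator (ball 0 1) x" for k
  proof (rule AE_I2)
   fix x :: 'a
   show "norm (indicator (ball 0 1) x * ((F x - F (t k *\<^sub>R x)) * (real k + 2))) <= K * indicator (ball 0 1) x"
   proof (cases "norm x < 1")
    case True
    have "norm (t k *\<^sub>R x) <= 1" using t[of k] True by (simp add: mult_le_one)
    then have "abs (F x - F (t k *\<^sub>R x)) <= K * norm (x - t k *\<^sub>R x)" using lip[of x "t k *\<^sub>R x"] True by simp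
    also have "x - t k *\<^sub>R x = (1 / (real k + 2)) *\<^sub>R x" by (simp add: t_def scaleR_left_diff_distrib)
    finally have "abs (F x - F (t k *\<^sub>R x)) * (real k + 2) <= K * norm x" by (simp add: field_simps)
    also have "... <= K" using True K(1) by simp
    finally show ?thesis using True by (simp add: abs_mult)
   qed auto
  qed
 qed (auto intro!: borel_measurable_times borel_measurable_inner)
 \<comment> \<open>On the shell |H| is at most K/(k + 2), which cancels the factor k + 2; what
   remains is the volume of the shell, and it tends to 0.\<close>
 have Rb: "abs (R k) * (real k + 2) <= K * (1 - (t k)^DIM('a)) * measure lborel (ball (0::'a) 1)" for k
 proof -
  have i1: "integrable lborel (%x. K / (real k + 2) * (indicator (ball 0 1) (x::'a) - indicator (ball 0 (t k)) x))"
   by (intro integrable_mult_right Bochner_Integration.integrable_diff indicator_ball_integrable)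
  have "abs (R k) <= (LBINT x. K / (real k + 2) * (indicator (ball 0 1) (x::'a) - indicator (ball 0 (t k)) x))"
   unfolding R_def
  proof (rule order_trans[OF integral_abs_bound], rule integral_mono'[OF i1])
   fix x :: 'a
   show "abs (indicator (ball 0 1 - ball 0 (t k)) x * H x) <= K / (real k + 2) * (indicator (ball 0 1) x - indicator (ball 0 (t k)) x)"
   proof (cases "x \<in> ball 0 1 - ball 0 (t k)")
    case True
    then have x: "norm x < 1" "t k <= norm x" by auto
    then have "x ~= 0" using t[of k] by auto
    then have "abs (H x) <= K * (1 - norm x)" using Hb x by blast
    also have "... <= K * (1 / (real k + 2))" using x(2) K(1) by (intro mult_left_mono) (auto simp: t_def)
    finally show ?thesis using True by simp
   qed (use t[of k] in \<open>auto split: split_indicator\<close>)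
   show "0 <= K / (real k + 2) * (indicator (ball 0 1) x - indicator (ball 0 (t k)) x)"
    using K(1) t[of k] by (auto split: split_indicator)
  qed
  also have "... = K / (real k + 2) * (measure lborel (ball (0::'a) 1) - measure lborel (ball (0::'a) (t k)))"
   using indicator_ball_integrable[of "0::'a"] by simp
  also have "measure lborel (ball (0::'a) (t k)) = (t k)^DIM('a) * measure lborel (ball (0::'a) 1)"
   using t[of k] by (simp add: content_ball)
  finally show ?thesis by (simp add: field_simps)
 qed
 have L2: "(%k. R k * (real k + 2) / (t k)^DIM('a)) \<longlonglongrightarrow> 0"
 proof -
  have "(%k. K * (1 - (t k)^DIM('a)) * measure lborel (ball (0::'a) 1)) \<longlonglongrightarrow> K * (1 - 1^DIM('a)) * measure lborel (ball (0::'a) 1)"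
   by (intro tendsto_intros tl)
  then have z: "(%k. K * (1 - (t k)^DIM('a)) * measure lborel (ball (0::'a) 1)) \<longlonglongrightarrow> 0" by simp
  have "(%k. R k * (real k + 2)) \<longlonglongrightarrow> 0"
   by (rule Lim_null_comparison[OF _ z]) (use Rb in \<open>auto simp: abs_mult\<close>)
  from tendsto_divide[OF this tendsto_power[OF tl, of "DIM('a)"]] show ?thesis by simp
 qed
 \<comment> \<open>The derivative of (1 - h)^(-n) at h = 0, read along h = 1/(k + 2), with the
   opposite sign.\<close>
 have L3: "(%k. (1 - 1 / (t k)^DIM('a)) * (real k + 2)) \<longlonglongrightarrow> - real DIM('a)"
 proof -
  have d: "((%h. 1 / (1 - h)^DIM('a)) has_real_derivative real DIM('a)) (at 0)"
   by (auto intro!: derivative_eq_intros)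
  then have "((%h. (1 / (1 - h)^DIM('a) - 1) / h) \<longlongrightarrow> real DIM('a)) (at 0)" by (simp add: DERIV_def)
  moreover have "filterlim (%n. 1 / (real n + 2)) (at 0) sequentially"
   unfolding filterlim_at by (auto intro: always_eventually) real_asymp
  ultimately have "(%n. (1 / (1 - 1 / (real n + 2))^DIM('a) - 1) / (1 / (real n + 2))) \<longlonglongrightarrow> real DIM('a)"
   by (rule filterlim_compose)
  from tendsto_minus[OF this] show ?thesis by (simp add: t_def algebra_simps)
 qed
 have "(%k. (1 - 1 / (t k)^DIM('a)) * (real k + 2) * Bint H + R k * (real k + 2) / (t k)^DIM('a)) \<longlonglongrightarrow> - real DIM('a) * Bint H + 0"
  by (intro tendsto_add tendsto_mult_right L3 L2)
 with L1 have "Bint (%x. x \<bullet> grad F x) = - real DIM('a) * Bint H" unfolding E by (simp add: LIMSEQ_unique)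
 moreover have "Bint H = Bint F - Bint (%x. F (sgn x))" unfolding H_def[abs_def] by (rule Bint_diff[OF iF iG])
 ultimately show "(\<integral>x. F x \<partial>unit_sphere_measure) = DIM('a) * Bint F + Bint (%x. x \<bullet> grad F x)"
  using sphere_measure_integral(2)[OF _ iG] by (simp add: algebra_simps)
qed

text \<open>The divergence formula is applied to phi^2; its radial derivative 2 phi (x . grad phi)
  is at most phi^2 + |grad phi|^2 inside the ball.\<close>

lemma sphere_trace_measure: "trace_measure (unit_sphere_measure :: 'a::euclidean_space measure) (DIM('a) + 1)"
 unfolding trace_measure_def
proof (intro conjI allI impI)
 fix phi :: "'a => real" assume s: "smooth phi"
 have [measurable]: "phi \<in> borel_measurable borel" "grad phi \<in> borel_measurable borel" using s smooth_borel grad_borel by auto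
 have s2: "smooth (%x. (phi x)^2)" using smooth_mult[OF s s] by (simp add: power2_eq_square)
 show "phi \<in> L2 unit_sphere_measure" using sphere_integral_smooth(1)[OF s2] by (simp add: L2_real_iff)
 have g: "grad (%x. (phi x)^2) x = (2 * phi x) *\<^sub>R grad phi x" for x
  using grad_mult[OF s s, of x] by (simp add: power2_eq_square scaleR_left_distrib[symmetric])
 note p = sob_pair_smooth[OF s, of 1]
 note b = Bi_sq[OF p]
 have "Bint (%x. x \<bullet> grad (%x. (phi x)^2) x) <= Bint (%x. (phi x)^2 + (norm (grad phi x))^2)"
 proof (rule Bint_mono)
  have le: "abs (x \<bullet> grad (%x. (phi x)^2) x) <= (phi x)^2 + (norm (grad phi x))^2" if "norm x < 1" for x
  proof -
   have "abs (x \<bullet> grad phi x) <= norm x * norm (grad phi x)" by (rule Cauchy_Schwarz_ineq2)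
   also have "... <= 1 * norm (grad phi x)" using that by (intro mult_right_mono) auto
   finally have "2 * abs (phi x) * abs (x \<bullet> grad phi x) <= 2 * abs (phi x) * norm (grad phi x)" by (intro mult_left_mono) auto
   also have "... <= (phi x)^2 + (norm (grad phi x))^2"
    using zero_le_power2[of "abs (phi x) - norm (grad phi x)"] by (simp add: power2_eq_square algebra_simps)
   finally show ?thesis unfolding g by (simp add: abs_mult)
  qed
  then show "norm x < 1 ==> x \<bullet> grad (%x. (phi x)^2) x <= (phi x)^2 + (norm (grad phi x))^2" for x
   by (meson abs_ge_self order_trans)
  show bb: "Bi (%x. (phi x)^2 + (norm (grad phi x))^2)" by (intro Bi_add b)
  show "Bi (%x. x \<bullet> grad (%x. (phi x)^2) x)" by (rule Bi_bound[OF bb _ le]) (auto simp: g)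
 qed
 also have "... = pair_norm2 phi (grad phi)" by (simp add: Bint_add b pair_norm2_def)
 finally have "(\<integral>x. (phi x)^2 \<partial>unit_sphere_measure) <= DIM('a) * Bint (%x. (phi x)^2) + pair_norm2 phi (grad phi)"
  using sphere_integral_smooth(2)[OF s2] by simp
 also have "DIM('a) * Bint (%x. (phi x)^2) <= DIM('a) * pair_norm2 phi (grad phi)"
  by (intro mult_left_mono) (auto simp: pair_norm2_def intro!: Bint_nonneg)
 finally show "(\<integral>x. (phi x)^2 \<partial>unit_sphere_measure) <= (DIM('a) + 1) * pair_norm2 phi (grad phi)" by (simp add: algebra_simps)
qed (use finite_sphere_measure in auto)

lemma Bint_tendsto_prod:
 assumes "!!k. sob_pair 1 (phi k) (\<Phi> k)" "sob_pair 1 v g"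
  and [measurable]: "!!k. (h :: nat => 'a::euclidean_space => real) k \<in> borel_measurable borel" "f \<in> borel_measurable borel"
  and i: "!!k. Bi (%x. (h k x)^2)" "Bi (%x. (f x)^2)"
  and l: "(%k. Bint (%x. (phi k x - v x)^2)) \<longlonglongrightarrow> 0" "(%k. Bint (%x. (h k x - f x)^2)) \<longlonglongrightarrow> 0"
 shows "(%k. Bint (%x. phi k x * h k x)) \<longlonglongrightarrow> Bint (%x. v x * f x)"
proof -
 let ?i = "indicator (ball 0 1) :: 'a => real"
 have sq: "(?i x * c)^2 = ?i x * c\<^sup>2" "(?i x * c - ?i x * d)^2 = ?i x * (c - d)^2" "(?i x * c) * (?i x * d) = ?i x * (c * d)" for x c d
  by (auto split: split_indicator)
 have "(%k. (LBINT x. (?i x * phi k x) * (?i x * h k x))) \<longlonglongrightarrow> (LBINT x. (?i x * v x) * (?i x * f x))"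
 proof (rule L2_prod_tendsto)
  show "(%x. ?i x * phi k x) \<in> L2 lborel" "(%x. ?i x * v x) \<in> L2 lborel" for k
   using assms(1)[of k] assms(2) unfolding L2_real_iff sq by (auto dest: sob_pairD)
  show "(%x. ?i x * h k x) \<in> L2 lborel" "(%x. ?i x * f x) \<in> L2 lborel" for k
   using i unfolding L2_real_iff sq by auto
 qed (use l in \<open>simp_all add: sq Bint_def\<close>)
 then show ?thesis by (simp add: sq Bint_def)
qed

text \<open>The divergence formula for squares passes to the limit along a smooth approximation. The
  factor splits as n from the divergence of x and 3 = 2 * 3/2 from Euler's identity for v (x .
  g).\<close>

lemma hsob_sphere_trace:
 fixes v :: "'a::euclidean_space => real"
 assumes h: "hsob v g" and r: "sob_rep w v g"
  and t: "has_trace (ball 0 1) unit_sphere_measure w \<gamma>"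
 shows "(\<integral>x. (\<gamma> x)^2 \<partial>unit_sphere_measure) = (DIM('a) + 3) * Bint (%x. (v x)^2)"
proof -
 have p: "sob_pair R v g" for R using h by (simp add: hsob_def)
 note [measurable] = sob_pairD(1,2)[OF p]
 obtain phi where phi: "!!k. smooth (phi k)" "(%k. pair_norm2 (%x. phi k x - v x) (%x. grad (phi k) x - g x)) \<longlonglongrightarrow> 0"
  using smooth_approx[OF p] by blast
 have [measurable]: "phi k \<in> borel_measurable borel" "grad (phi k) \<in> borel_measurable borel" for k
  using phi(1) smooth_borel grad_borel by auto
 have ps: "sob_pair 1 (phi k) (grad (phi k))" for k using sob_pair_smooth[OF phi(1)] .
 have pd: "sob_pair 1 (%x. phi k x - v x) (%x. grad (phi k) x - g x)" for k
  using sob_pair_lincomb[OF ps[of k] p[of 1], of 1 "-1"] by simp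
 let ?S = "unit_sphere_measure :: 'a measure"
 note tc = trace_convergence[OF sphere_trace_measure r t phi]
 have s2: "smooth (%x. (phi k x)^2)" for k using smooth_mult[OF phi(1) phi(1), of k k] by (simp add: power2_eq_square)
 have L2s: "phi k \<in> L2 ?S" for k using sphere_trace_measure phi(1) unfolding trace_measure_def by blast
 have lim1: "(%k. \<integral>x. (phi k x)^2 \<partial>?S) \<longlonglongrightarrow> (\<integral>x. (\<gamma> x)^2 \<partial>?S)"
  using L2_prod_tendsto[OF L2s tc(1) L2s tc(1) tc(2) tc(2)] by (simp add: power2_eq_square)
 have lv: "(%k. Bint (%x. (phi k x - v x)^2)) \<longlonglongrightarrow> 0"
  by (rule tendsto_sandwich[OF _ _ tendsto_const phi(2)])
    (auto intro!: always_eventually Bint_nonneg simp: pair_norm2_def)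
 have xk: "(x \<bullet> y)^2 <= (norm y)^2" if "norm x < 1" for x y :: 'a
  using order_trans[OF Cauchy_Schwarz_ineq2 mult_right_mono[of "norm x" 1 "norm y"]] that by (simp add: abs_le_square_iff[symmetric])
 have lg: "(%k. Bint (%x. (x \<bullet> grad (phi k) x - x \<bullet> g x)^2)) \<longlonglongrightarrow> 0"
 proof (rule tendsto_sandwich[OF _ _ tendsto_const phi(2)])
  have "Bint (%x. (x \<bullet> grad (phi k) x - x \<bullet> g x)^2) <= pair_norm2 (%x. phi k x - v x) (%x. grad (phi k) x - g x)" for k
  proof -
   have le: "(x \<bullet> grad (phi k) x - x \<bullet> g x)^2 <= (norm (grad (phi k) x - g x))^2" if "norm x < 1" for x
    using xk[OF that] by (simp flip: inner_diff_right)
   have "Bint (%x. (x \<bullet> grad (phi k) x - x \<bullet> g x)^2) <= Bint (%x. (norm (grad (phi k) x - g x))^2)"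
    by (rule Bint_mono[OF Bi_bound[OF Bi_sq(2)[OF pd]] Bi_sq(2)[OF pd] le]) (use le in auto)
   also have "... <= pair_norm2 (%x. phi k x - v x) (%x. grad (phi k) x - g x)"
    by (simp add: pair_norm2_def Bint_nonneg)
   finally show ?thesis .
  qed
  then show "eventually (%k. Bint (%x. (x \<bullet> grad (phi k) x - x \<bullet> g x)^2) <= pair_norm2 (%x. phi k x - v x) (%x. grad (phi k) x - g x)) sequentially"
   by simp
 qed (auto intro!: always_eventually Bint_nonneg)
 have xg: "Bi (%x. (x \<bullet> k x)^2)" if "sob_pair 1 u k" for u and k :: "'a => 'a"
 proof -
  have [measurable]: "k \<in> borel_measurable borel" using sob_pairD(2)[OF that] .
  show ?thesis by (rule Bi_bound[OF Bi_sq(2)[OF that]]) (auto simp: xk)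
 qed
 have lim2: "(%k. Bint (%x. phi k x * (x \<bullet> grad (phi k) x))) \<longlonglongrightarrow> Bint (%x. v x * (x \<bullet> g x))"
  by (rule Bint_tendsto_prod[OF ps p _ _ xg[OF ps] xg[OF p] lv lg]) auto
 have lim3: "(%k. Bint (%x. phi k x * phi k x)) \<longlonglongrightarrow> Bint (%x. v x * v x)"
  by (rule Bint_tendsto_prod[OF ps p _ _ Bi_sq(1)[OF ps] Bi_sq(1)[OF p] lv lv]) auto
 have g: "grad (%x. (phi k x)^2) x = (2 * phi k x) *\<^sub>R grad (phi k) x" for k x
  using grad_mult[OF phi(1) phi(1), of k k x] by (simp add: power2_eq_square scaleR_left_distrib[symmetric])
 have eq: "(\<integral>x. (phi k x)^2 \<partial>?S) = DIM('a) * Bint (%x. phi k x * phi k x) + 2 * Bint (%x. phi k x * (x \<bullet> grad (phi k) x))" for k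
  unfolding sphere_integral_smooth(2)[OF s2] g by (simp add: power2_eq_square mult.assoc Bint_cmult)
 have "(%k. \<integral>x. (phi k x)^2 \<partial>?S) \<longlonglongrightarrow> DIM('a) * Bint (%x. v x * v x) + 2 * Bint (%x. v x * (x \<bullet> g x))"
  unfolding eq by (intro tendsto_intros lim2 lim3)
 with lim1 have "(\<integral>x. (\<gamma> x)^2 \<partial>?S) = DIM('a) * Bint (%x. v x * v x) + 2 * Bint (%x. v x * (x \<bullet> g x))"
  by (rule LIMSEQ_unique)
 also have "Bint (%x. v x * (x \<bullet> g x)) = Bint (%x. 3/2 * (v x * v x))"
  by (rule Bint_cong_AE) (use hsob_euler[OF h] in \<open>auto elim!: eventually_mono simp: inner_commute\<close>)
 finally show ?thesis by (simp only: Bint_cmult) (simp add: power2_eq_square algebra_simps)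
qed

subsection \<open>The trace inequality on the thin ball\<close>

lemma thin_measure_nn_integral:
 fixes f :: "(real^'m) \<times> real => real"
 assumes [measurable]: "f \<in> borel_measurable borel"
 shows "(\<integral>\<^sup>+x. ennreal (f x) \<partial>thin_ball_measure) = (\<integral>\<^sup>+x. ennreal (f (x, 0)) * indicator (ball 0 1) x \<partial>lborel)"
proof -
 have [measurable]: "(%x'::real^'m. (x', 0::real)) \<in> borel_measurable borel"
  by (intro borel_measurable_continuous_onI continuous_intros)
 have "(\<integral>\<^sup>+x. ennreal (f x) \<partial>thin_ball_measure) = (\<integral>\<^sup>+x. ennreal (f (x, 0)) \<partial>restrict_space lborel (ball 0 1))"
  unfolding thin_ball_measure_def by (rule nn_integral_distr) (auto intro!: measurable_restrict_space1)
 then show ?thesis by (subst (asm) nn_integral_restrict_space) auto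
qed

lemma sets_thin_measure [measurable_cong, simp]: "sets thin_ball_measure = sets borel"
 by (simp add: thin_ball_measure_def)

lemma finite_thin_measure: "finite_measure (thin_ball_measure :: ((real^'m) \<times> real) measure)"
proof
 have "(\<integral>\<^sup>+x. ennreal 1 \<partial>(thin_ball_measure :: ((real^'m) \<times> real) measure)) = (\<integral>\<^sup>+x. ennreal 1 * indicator (ball 0 1) (x :: real^'m) \<partial>lborel)"
  by (rule thin_measure_nn_integral) auto
 also have "... < \<infinity>"
  using emeasure_bounded_finite[of "ball (0::real^'m) 1"] by simp
 finally show "emeasure thin_ball_measure (space (thin_ball_measure :: ((real^'m) \<times> real) measure)) ~= \<infinity>" by simp
qed

text \<open>The value at a point of the thin ball is controlled along the segment towards the north pole.\<close>

lemma thin_segment_bound: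
 fixes phi :: "(real^'m) \<times> real => real"
 assumes s: "smooth phi" and x: "norm x < 1"
 shows "ennreal ((phi (x, 0))^2) <= (\<integral>\<^sup>+t. ennreal (3 * (phi ((1 - t) *\<^sub>R x, t))^2 + 2 * (norm (grad phi ((1 - t) *\<^sub>R x, t)))^2) * indicator {0..1/2} t \<partial>lborel)"
proof -
 define p where "p t = ((1 - t) *\<^sub>R x, t)" for t :: real
 define c where "c t = phi (p t)" for t
 define c' where "c' t = grad phi (p t) \<bullet> (- x, 1)" for t
 define \<Psi> where "\<Psi> t = 3 * (c t)^2 + 2 * (norm (grad phi (p t)))^2" for t
 have pc: "continuous_on S p" for S unfolding p_def by (intro continuous_intros)
 have c: "continuous_on S \<Psi>" for S
  unfolding \<Psi>_def c_def
  by (intro continuous_intros continuous_on_compose2[OF smooth_continuous[OF s, of UNIV] pc]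
    continuous_on_compose2[OF smooth_grad_continuous[OF s, of UNIV] pc]) auto
 have dc: "(c has_real_derivative c' t) (at t)" for t
 proof -
  have "(p has_derivative (%h. h *\<^sub>R (- x, 1))) (at t)"
   unfolding p_def by (auto intro!: derivative_eq_intros simp: scaleR_Pair algebra_simps)
  then have "((%t. phi (p t)) has_derivative (%h. grad phi (p t) \<bullet> (h *\<^sub>R (- x, 1)))) (at t)"
   by (rule has_derivative_compose[OF _ smooth_has_derivative[OF s]])
  moreover have "(%h. grad phi (p t) \<bullet> (h *\<^sub>R (- x, 1))) = (*) (c' t)"
   unfolding inner_scaleR_right c'_def by (rule ext) (rule mult.commute)
  ultimately show ?thesis unfolding has_field_derivative_def c_def[abs_def] by (simp only:)
 qed
 \<comment> \<open>An antiderivative on [-1, 1], which contains [0, 1/2] in its interior, is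
   differentiable from both sides at the two endpoints that matter.\<close>
 obtain F where F: "!!t. t \<in> {-1..1} ==> (F has_vector_derivative \<Psi> t) (at t within {-1..1})"
  by (rule antiderivative_continuous[OF c[of "{-1..1}"]], rule that, assumption)
 have dF: "(F has_real_derivative \<Psi> t) (at t)" if "t \<in> {0..1/2}" for t
 proof -
  have "at t within {-1..1} = at t" using that by (intro at_within_interior) auto
  then show ?thesis using F[of t] that by (simp add: has_real_derivative_iff_has_vector_derivative)
 qed
 \<comment> \<open>The factor 1 - 2 t is 1 at the thin ball and 0 at t = 1/2. Its derivative costs 2
   c^2, the mixed term costs at most c^2 + c'^2, and c'^2 is at most 2 |grad phi|^2 as the velocity
   (-x, 1) has squared norm at most 2; hence the coefficients 3 and 2 in \<Psi>.\<close>
 define D where "D t = F t + (c t)^2 * (1 - 2 * t)" for t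
 have "D 0 <= D (1/2)"
 proof (rule DERIV_nonneg_imp_nondecreasing[where f=D and a=0 and b="1/2"])
  fix t :: real assume t: "0 <= t" "t <= 1/2"
  have d: "(D has_real_derivative \<Psi> t + (2 * c t * c' t * (1 - 2 * t) - 2 * (c t)^2)) (at t)"
   unfolding D_def using t dF[of t] by (auto intro!: derivative_eq_intros dc)
  have "abs (c' t) <= norm (grad phi (p t)) * norm (- x, 1::real)" unfolding c'_def by (rule Cauchy_Schwarz_ineq2)
  then have "(c' t)^2 <= (norm (grad phi (p t)) * norm (- x, 1::real))^2"
   by (simp add: abs_le_square_iff[symmetric])
  also have "... = (norm (grad phi (p t)))^2 * ((norm x)^2 + 1)"
   by (simp add: power_mult_distrib norm_Pair)
  also have "... <= (norm (grad phi (p t)))^2 * 2"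
   using x by (intro mult_left_mono) (auto simp: power_le_one)
  finally have c2: "(c' t)^2 <= 2 * (norm (grad phi (p t)))^2" by simp
  have "abs (2 * c t * c' t * (1 - 2 * t)) <= 2 * abs (c t) * abs (c' t) * 1"
   using t unfolding abs_mult by (intro mult_mono) auto
  also have "... <= (c t)^2 + (c' t)^2"
   using zero_le_power2[of "abs (c t) - abs (c' t)"] by (simp add: power2_eq_square algebra_simps)
  finally have "0 <= \<Psi> t + (2 * c t * c' t * (1 - 2 * t) - 2 * (c t)^2)"
   using c2 by (simp add: \<Psi>_def)
  with d show "\<exists>y. (D has_real_derivative y) (at t) \<and> 0 <= y" by blast
 qed simp
 then have "(phi (x, 0))^2 <= F (1/2) - F 0" by (simp add: D_def c_def p_def)
 then have "ennreal ((phi (x, 0))^2) <= ennreal (F (1/2) - F 0)" by (rule ennreal_leI)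
 also have "... = (\<integral>\<^sup>+t. ennreal (\<Psi> t) * indicator {0..1/2} t \<partial>lborel)"
  by (rule nn_integral_FTC_Icc[symmetric]) (use dF c in \<open>auto simp: \<Psi>_def intro!: borel_measurable_continuous_onI\<close>)
 finally show ?thesis by (simp add: \<Psi>_def c_def p_def)
qed

text \<open>The segment bound is integrated over the thin ball. At height t \<le> 1/2 the map x ->
  (1 - t) x has Jacobian at least 2^(-m) with m = \<open>CARD('m)\<close>, and its image at that
  height lies in the unit ball; this gives the factor 2^m.\<close>

lemma thin_trace_measure: "trace_measure (thin_ball_measure :: ((real^'m) \<times> real) measure) (3 * 2 ^ CARD('m))"
 unfolding trace_measure_def
proof (intro conjI allI impI)
 fix phi :: "(real^'m) \<times> real => real" assume s: "smooth phi"
 have [measurable]: "phi \<in> borel_measurable borel" "grad phi \<in> borel_measurable borel" using s smooth_borel grad_borel by auto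
 let ?P = "%y. 3 * (phi y)^2 + 2 * (norm (grad phi y))^2"
 let ?d = "CARD('m)"
 have [measurable]: "?P \<in> borel_measurable borel" by auto
 note p = sob_pair_smooth[OF s, of 1]
 have iP: "Bi ?P" by (intro Bi_add Bi_cmult Bi_sq[OF p])
 have "ennreal ((1/2)^?d) * (\<integral>\<^sup>+x. ennreal ((phi x)^2) \<partial>thin_ball_measure)
  = ennreal ((1/2)^?d) * (\<integral>\<^sup>+x. ennreal ((phi (x, 0))^2) * indicator (ball 0 1) x \<partial>lborel)"
  by (subst thin_measure_nn_integral) auto
 also have "... <= ennreal ((1/2)^?d) * (\<integral>\<^sup>+x. \<integral>\<^sup>+t. ennreal (?P ((1 - t) *\<^sub>R x, t)) * indicator {0..1/2} t * indicator (ball 0 1) x \<partial>lborel \<partial>lborel)"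
 proof (intro mult_left_mono nn_integral_mono)
  fix x :: "real^'m"
  show "ennreal ((phi (x, 0))^2) * indicator (ball 0 1) x <= (\<integral>\<^sup>+t. ennreal (?P ((1 - t) *\<^sub>R x, t)) * indicator {0..1/2} t * indicator (ball 0 1) x \<partial>lborel)"
   using thin_segment_bound[OF s, of x] by (auto split: split_indicator)
 qed auto
 also have "(\<integral>\<^sup>+x. \<integral>\<^sup>+t. ennreal (?P ((1 - t) *\<^sub>R x, t)) * indicator {0..1/2} t * indicator (ball 0 1) x \<partial>lborel \<partial>lborel)
  = (\<integral>\<^sup>+t. \<integral>\<^sup>+x. ennreal (?P ((1 - t) *\<^sub>R x, t)) * indicator {0..1/2} t * indicator (ball 0 1) x \<partial>lborel \<partial>lborel)"
  by (rule lborel_pair.Fubini') measurable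
 also have "ennreal ((1/2)^?d) * ... = (\<integral>\<^sup>+t. ennreal ((1/2)^?d) * (\<integral>\<^sup>+x. ennreal (?P ((1 - t) *\<^sub>R x, t)) * indicator {0..1/2} t * indicator (ball 0 1) x \<partial>lborel) \<partial>lborel)"
  by (rule nn_integral_cmult[symmetric]) measurable
 also have "... <= (\<integral>\<^sup>+t. \<integral>\<^sup>+y. ennreal (indicator (ball 0 1) (y, t) * ?P (y, t)) \<partial>lborel \<partial>lborel)"
 proof (rule nn_integral_mono)
  fix t :: real
  show "ennreal ((1/2)^?d) * (\<integral>\<^sup>+x. ennreal (?P ((1 - t) *\<^sub>R x, t)) * indicator {0..1/2} t * indicator (ball 0 1) x \<partial>lborel)
   <= (\<integral>\<^sup>+y. ennreal (indicator (ball 0 1) (y, t) * ?P (y, t)) \<partial>lborel)"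
  proof (cases "t \<in> {0..1/2}")
   case True
   then have t: "0 <= t" "t <= 1/2" by auto
   have "ennreal ((1/2)^?d) * (\<integral>\<^sup>+x. ennreal (?P ((1 - t) *\<^sub>R x, t)) * indicator {0..1/2} t * indicator (ball 0 1) x \<partial>lborel)
     <= ennreal (abs (1 - t)^DIM(real^'m)) * (\<integral>\<^sup>+x. ennreal (?P (0 + (1 - t) *\<^sub>R x, t)) * indicator (ball 0 (1 - t)) (0 + (1 - t) *\<^sub>R x) \<partial>lborel)"
   proof (rule mult_mono[OF ennreal_leI nn_integral_mono])
    show "(1/2)^?d <= abs (1 - t)^DIM(real^'m)" using t by (simp add: power_mono)
    fix x :: "real^'m"
    show "ennreal (?P ((1 - t) *\<^sub>R x, t)) * indicator {0..1/2} t * indicator (ball 0 1) x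
     <= ennreal (?P (0 + (1 - t) *\<^sub>R x, t)) * indicator (ball 0 (1 - t)) (0 + (1 - t) *\<^sub>R x)"
     using t True by (auto split: split_indicator)
   qed auto
   also have "... = (\<integral>\<^sup>+y. ennreal (?P (y, t)) * indicator (ball 0 (1 - t)) y \<partial>lborel)"
    by (rule lborel_nn_integral_affine[symmetric]) (use t in auto)
   also have "... <= (\<integral>\<^sup>+y. ennreal (indicator (ball 0 1) (y, t) * ?P (y, t)) \<partial>lborel)"
   proof (intro nn_integral_mono)
    fix y :: "real^'m"
    have "norm (y, t) < 1" if "norm y < 1 - t"
    proof -
     have "(norm y)^2 < (1 - t)^2" using that by (intro power_strict_mono) auto
     moreover have "t * t <= t * 1" using t by (intro mult_left_mono) auto
     ultimately have "(norm y)^2 + t\<^sup>2 < 1" by (simp add: power2_eq_square algebra_simps)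
     then show ?thesis by (simp add: norm_Pair real_sqrt_lt_1_iff)
    qed
    then show "ennreal (?P (y, t)) * indicator (ball 0 (1 - t)) y <= ennreal (indicator (ball 0 1) (y, t) * ?P (y, t))"
     by (auto split: split_indicator)
   qed
   finally show ?thesis .
  qed simp
 qed
 also have "... = (\<integral>\<^sup>+z. ennreal (indicator (ball 0 1) z * ?P z) \<partial>(lborel \<Otimes>\<^sub>M lborel))"
  by (rule lborel_pair.nn_integral_snd) (simp add: lborel_prod)
 also have "... = ennreal (Bint ?P)" unfolding lborel_prod by (rule Bint_nn[OF _ iP]) auto
 also have "Bint ?P = 3 * Bint (%x. (phi x)^2) + 2 * Bint (%x. (norm (grad phi x))^2)"
  using Bi_sq[OF p] by (simp only: Bint_add Bi_cmult Bint_cmult)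
 also have "... <= 3 * pair_norm2 phi (grad phi)" by (simp add: pair_norm2_def Bint_nonneg)
 finally have main: "ennreal ((1/2)^?d) * (\<integral>\<^sup>+x. ennreal ((phi x)^2) \<partial>thin_ball_measure) <= ennreal (3 * pair_norm2 phi (grad phi))"
  by (simp add: ennreal_leI)
 have "(\<integral>\<^sup>+x. ennreal ((phi x)^2) \<partial>thin_ball_measure) = ennreal (2^?d) * (ennreal ((1/2)^?d) * (\<integral>\<^sup>+x. ennreal ((phi x)^2) \<partial>thin_ball_measure))"
  by (simp add: mult.assoc[symmetric] flip: ennreal_mult power_mult_distrib)
 also have "... <= ennreal (2^?d) * ennreal (3 * pair_norm2 phi (grad phi))" by (intro mult_left_mono main) auto
 also have "... = ennreal (2^?d * (3 * pair_norm2 phi (grad phi)))"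
  by (rule ennreal_mult[symmetric]) (auto simp: pair_norm2_nonneg)
 also have "2^?d * (3 * pair_norm2 phi (grad phi)) = 3 * 2^?d * pair_norm2 phi (grad phi)" by simp
 finally have fin: "(\<integral>\<^sup>+x. ennreal ((phi x)^2) \<partial>thin_ball_measure) <= ennreal (3 * 2^?d * pair_norm2 phi (grad phi))" .
 have i: "integrable thin_ball_measure (%x. (phi x)^2)"
  unfolding integrable_iff_bounded using fin by (auto simp: top.not_eq_extremum intro: le_less_trans)
 then show "phi \<in> L2 thin_ball_measure" by (simp add: L2_real_iff)
 show "(\<integral>x. (phi x)^2 \<partial>thin_ball_measure) <= 3 * 2^?d * pair_norm2 phi (grad phi)"
  using fin pair_norm2_nonneg[of phi "grad phi"] by (subst (asm) nn_integral_eq_integral[OF i]) auto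
qed (use finite_thin_measure in auto)

subsection \<open>The second spectral gap of the Gaussian measure\<close>

definition gexp :: "'a::euclidean_space => real" where "gexp x = exp (- (norm x)\<^sup>2)"

lemma gexp_borel [measurable]: "gexp \<in> borel_measurable borel" unfolding gexp_def[abs_def] by measurable
lemma gexp_pos: "gexp x > 0" by (simp add: gexp_def)
lemma gexp_le1: "gexp x <= 1" by (simp add: gexp_def)

lemma Bi_bounded:
 assumes "f \<in> borel_measurable borel" "!!x. norm x < 1 ==> abs (f x) <= K" shows "Bi f"
proof (rule Bi_bound[of "%x. K * 1"])
 show "Bi (%x. K * 1)" using indicator_ball_integrable[of 0 1] by (intro Bi_cmult) simp
qed (use assms in auto)

lemma gexp_integrable: "integrable lborel (gexp :: 'a::euclidean_space => real)"
 using layer_cake_gauss(1)[of "%x. 1" 0] unfolding gexp_def[abs_def]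
 by (simp add: hom_strict) (use Bi_bounded[of "%x. 1" 1] in simp)

lemma gexp_norm_integrable: "integrable lborel (%x::'a::euclidean_space. norm x * gexp x)"
proof -
 have h: "hom (real 1) (%x::'a. norm x)" by (rule hom_strict) simp
 have b: "Bi (%x::'a. norm x)" by (rule Bi_bounded[where K=1]) auto
 show ?thesis unfolding gexp_def[abs_def] by (rule layer_cake_gauss(1)[OF _ h _ b]) auto
qed

definition gZ :: "'a::euclidean_space itself => real" where "gZ _ = (LBINT x. gexp (x::'a))"

lemma gZ_pos: "gZ TYPE('a::euclidean_space) > 0"
proof -
 have "gZ TYPE('a) ~= 0"
 proof
  assume "gZ TYPE('a) = 0"
  then have "(LBINT x. gexp (x::'a)) = 0" unfolding gZ_def .
  then have "AE x in lborel. gexp (x::'a) = 0"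
   by (subst (asm) integral_nonneg_eq_0_iff_AE[OF gexp_integrable]) (auto intro!: AE_I2 less_imp_le[OF gexp_pos])
  then have "AE x in (lborel :: 'a measure). False" using gexp_pos by (auto elim!: eventually_mono simp: less_le)
  then have "emeasure lborel (UNIV :: 'a set) = 0" by (subst (asm) AE_iff_measurable[where N=UNIV]) auto
  then show False by (simp add: emeasure_lborel_UNIV)
 qed
 moreover have "gZ TYPE('a) >= 0" unfolding gZ_def by (intro integral_nonneg_AE) (auto simp: gexp_pos less_imp_le)
 ultimately show ?thesis by linarith
qed

text \<open>The centred Gaussian with covariance one half of the identity; the eigenvalues of its
  Dirichlet form are 0, 2, 4, and so on. The constant \<open>gZ\<close> is never evaluated, since it
  cancels in the gap.\<close>

definition gauss :: "'a::euclidean_space measure" where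
 "gauss = density lborel (%x. ennreal (gexp x / gZ TYPE('a)))"

lemma gauss_sets [measurable_cong, simp]: "sets gauss = sets borel" by (simp add: gauss_def)
lemma gauss_space [simp]: "space gauss = UNIV" by (simp add: gauss_def)

lemma gauss_integral:
 fixes f :: "'a::euclidean_space => real"
 assumes "f \<in> borel_measurable borel"
 shows "(\<integral>x. f x \<partial>gauss) = (LBINT x. f x * gexp x) / gZ TYPE('a)"
  and "integrable gauss f \<longleftrightarrow> integrable lborel (%x. f x * gexp x)"
proof -
 have p: "0 <= gexp x / gZ TYPE('a)" for x :: 'a using gexp_pos[of x] gZ_pos[where 'a='a] by (simp add: less_imp_le)
 have "(\<integral>x. f x \<partial>gauss) = (LBINT x. (gexp x / gZ TYPE('a)) *\<^sub>R f x)"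
  unfolding gauss_def by (rule integral_density) (use assms p in auto)
 also have "... = (LBINT x. (f x * gexp x) / gZ TYPE('a))" by (simp add: mult_ac)
 finally show "(\<integral>x. f x \<partial>gauss) = (LBINT x. f x * gexp x) / gZ TYPE('a)" by simp
 have "integrable gauss f \<longleftrightarrow> integrable lborel (%x. (gexp x / gZ TYPE('a)) *\<^sub>R f x)"
  unfolding gauss_def by (rule integrable_density) (use assms p in auto)
 also have "... \<longleftrightarrow> integrable lborel (%x. (f x * gexp x) / gZ TYPE('a))" by (simp add: mult_ac)
 also have "... \<longleftrightarrow> integrable lborel (%x. f x * gexp x)" 
 proof
  assume "integrable lborel (%x. (f x * gexp x) / gZ TYPE('a))"
  from integrable_mult_right[OF this, of "gZ TYPE('a)"] show "integrable lborel (%x. f x * gexp x)"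
   using gZ_pos[where 'a='a] by simp
 qed simp
 finally show "integrable gauss f \<longleftrightarrow> integrable lborel (%x. f x * gexp x)" .
qed

lemma gauss_prob: "prob_space (gauss :: 'a::euclidean_space measure)"
proof
 have "emeasure (gauss :: 'a measure) (space gauss) = (\<integral>\<^sup>+x. ennreal (gexp (x::'a) / gZ TYPE('a)) \<partial>lborel)"
  unfolding gauss_def by (subst emeasure_density) auto
 also have "... = ennreal (LBINT x. gexp (x::'a) / gZ TYPE('a))"
  by (rule nn_integral_eq_integral) (use gexp_integrable in \<open>auto intro!: divide_nonneg_pos gZ_pos less_imp_le[OF gexp_pos] AE_I2\<close>)
 also have "(LBINT x. gexp (x::'a) / gZ TYPE('a)) = 1" using gZ_pos[where 'a='a] by (simp add: gZ_def)
 finally show "emeasure (gauss :: 'a measure) (space gauss) = 1" by simp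
qed

lemma gauss_bounded_integrable:
 fixes f :: "'a::euclidean_space => real"
 assumes "f \<in> borel_measurable borel" "!!x. abs (f x) <= K"
 shows "integrable (gauss :: 'a::euclidean_space measure) f"
proof -
 interpret prob_space "gauss :: 'a measure" by (rule gauss_prob)
 show ?thesis by (rule integrable_const_bound[where B=K]) (use assms in auto)
qed

lemma gauss_affine_integrable: "integrable (gauss :: 'a::euclidean_space measure) (%x. K + L * norm x)"
 using gauss_bounded_integrable[of "%x. K" "abs K"] gexp_norm_integrable[where 'a='a]
 by (intro Bochner_Integration.integrable_add integrable_mult_right) (auto simp: gauss_integral)

lemma gauss_linear_integrable:
 fixes f :: "'a::euclidean_space => real"
 assumes "f \<in> borel_measurable borel" "!!x. abs (f x) <= K + L * norm x"
 shows "integrable (gauss :: 'a::euclidean_space measure) f"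
proof (rule Bochner_Integration.integrable_bound)
 show "integrable (gauss :: 'a measure) (%x. K + L * norm x)" by (rule gauss_affine_integrable)
 show "AE x in gauss. norm (f x) <= norm (K + L * norm x)" using assms(2) by (auto intro: order_trans[OF _ abs_ge_self])
qed (use assms in auto)

text \<open>From |x + t b| \<ge> |x| - 1 follows |x + t b|^2 \<ge> |x|^2/2 - 1. Halving the exponent
  buys a dominating function common to all shifts of length at most 1.\<close>

lemma gexp_shift_le:
 assumes "b \<in> Basis" "abs t <= 1"
 shows "gexp (x + t *\<^sub>R b) <= exp 1 * exp (- ((norm x)^2 / 2))"
proof -
 have "norm (x + t *\<^sub>R b) >= norm x - norm (t *\<^sub>R b)" by (rule norm_diff_ineq)
 moreover have "norm (t *\<^sub>R b) <= 1" using assms by simp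
 ultimately have n: "norm (x + t *\<^sub>R b) >= norm x - 1" by linarith
 have "(norm (x + t *\<^sub>R b))^2 >= (norm x)^2 / 2 - 1"
 proof (cases "norm x >= 1")
  case True
  then have "(norm x - 1)^2 <= (norm (x + t *\<^sub>R b))^2" using n by (intro power_mono) auto
  moreover have "0 <= (norm x - 2)^2" by simp
  ultimately show ?thesis by (simp add: power2_eq_square algebra_simps)
 next
  case False
  then have "(norm x)^2 <= 1" by (simp add: power_le_one)
  moreover have "0 <= (norm (x + t *\<^sub>R b))^2" by simp
  ultimately show ?thesis by linarith
 qed
 then show ?thesis unfolding gexp_def exp_add[symmetric] by simp
qed

lemma integrable_half_gauss:
 "integrable lborel (%x::'a::euclidean_space. (K + L * norm x) * exp (- ((norm x)^2 / 2)))"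
proof -
 have "integrable lborel (%x::'a. K * gexp x + L * sqrt 2 * (norm x * gexp x))"
  using gexp_integrable gexp_norm_integrable by auto
 then have "integrable lborel (%x::'a. K * gexp (0 + (1 / sqrt 2) *\<^sub>R x) + L * sqrt 2 * (norm (0 + (1 / sqrt 2) *\<^sub>R x) * gexp (0 + (1 / sqrt 2) *\<^sub>R x)))"
  by (subst lborel_integrable_affine) auto
 moreover have "K * gexp (0 + (1 / sqrt 2) *\<^sub>R x) + L * sqrt 2 * (norm (0 + (1 / sqrt 2) *\<^sub>R x) * gexp (0 + (1 / sqrt 2) *\<^sub>R x))
  = (K + L * norm x) * exp (- ((norm x)^2 / 2))" for x :: 'a
  by (simp add: gexp_def power_divide algebra_simps)
 ultimately show ?thesis by simp
qed

text \<open>Lebesgue measure is translation invariant, so the integral of h \<open>gexp\<close>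
  along the shifts x + t b is constant; its derivative at 0 is the integral of (h' - 2 (x . b) h)
  \<open>gexp\<close>.\<close>

lemma gauss_ibp:
 fixes h :: "'a::euclidean_space => real"
 assumes b: "b \<in> Basis" and [measurable]: "h \<in> borel_measurable borel" "h' \<in> borel_measurable borel"
  and d: "!!x t. ((%t. h (x + t *\<^sub>R b)) has_real_derivative h' (x + t *\<^sub>R b)) (at t)"
  and K: "!!x. abs (h x) <= K" "!!x. abs (h' x) <= K"
 shows "(\<integral>x. (x \<bullet> b) * h x \<partial>gauss) = (\<integral>x. h' x \<partial>gauss) / 2"
proof -
 have K0: "K >= 0" using K(1)[of 0] by linarith
 have xb: "abs (x \<bullet> b) <= norm x" for x using Basis_le_norm[OF b] .
 have ih: "integrable gauss h" "integrable gauss h'" using K by (auto intro!: gauss_bounded_integrable)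
 have ixh: "integrable gauss (%x. (x \<bullet> b) * h x)"
 proof (rule gauss_linear_integrable[where K=0 and L=K])
  show "abs ((x \<bullet> b) * h x) <= 0 + K * norm x" for x
   using mult_mono[OF xb[of x] K(1)[of x]] by (simp add: abs_mult mult.commute)
 qed auto
 define f where "f x = h x * gexp x" for x
 define f' where "f' x = h' x * gexp x - 2 * ((x \<bullet> b) * h x * gexp x)" for x
 have [measurable]: "f' \<in> borel_measurable borel" unfolding f'_def[abs_def] by measurable
 have if': "integrable lborel f'" and if0: "integrable lborel f"
  using ih ixh unfolding f'_def[abs_def] f_def[abs_def] by (auto simp: gauss_integral)
 have df: "((%t. f (x + t *\<^sub>R b)) has_real_derivative f' (x + t *\<^sub>R b)) (at t)" for x t
 proof -
  have n: "(norm (x + t *\<^sub>R b))^2 = (norm x)^2 + 2 * t * (x \<bullet> b) + t\<^sup>2" for t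
   using b dot_norm[of x "t *\<^sub>R b"] by (simp add: power_mult_distrib)
  have "((%t. gexp (x + t *\<^sub>R b)) has_real_derivative - (2 * ((x + t *\<^sub>R b) \<bullet> b)) * gexp (x + t *\<^sub>R b)) (at t)"
   unfolding gexp_def n using b by (auto intro!: derivative_eq_intros simp: inner_add_left)
  from DERIV_mult[OF d this] show ?thesis unfolding f_def f'_def by (simp add: algebra_simps)
 qed
 let ?w = "%x. (exp 1 * 3 * K + exp 1 * 2 * K * norm x) * exp (- ((norm x)^2 / 2))"
 have iw: "integrable lborel ?w" by (rule integrable_half_gauss)
 have bd: "abs (f' (x + t *\<^sub>R b)) <= ?w x" if t: "abs t <= 1" for x t
 proof -
  let ?y = "x + t *\<^sub>R b"
  have ny: "norm ?y <= norm x + 1" using norm_triangle_ineq[of x "t *\<^sub>R b"] t b by simp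
  have "f' ?y = (h' ?y - 2 * (?y \<bullet> b) * h ?y) * gexp ?y" by (simp add: f'_def algebra_simps)
  then have "abs (f' ?y) = abs (h' ?y - 2 * (?y \<bullet> b) * h ?y) * gexp ?y" using gexp_pos[of ?y] by (simp add: abs_mult)
  also have "... <= (K + 2 * (norm x + 1) * K) * (exp 1 * exp (- ((norm x)^2 / 2)))"
  proof (rule mult_mono)
   have "abs (?y \<bullet> b) * abs (h ?y) <= (norm x + 1) * K" using xb[of ?y] ny K(1)[of ?y] by (intro mult_mono) auto
   moreover have "abs (h' ?y - 2 * (?y \<bullet> b) * h ?y) <= abs (h' ?y) + 2 * (abs (?y \<bullet> b) * abs (h ?y))"
    using abs_triangle_ineq4[of "h' ?y" "2 * (?y \<bullet> b) * h ?y"] by (simp add: abs_mult)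
   ultimately show "abs (h' ?y - 2 * (?y \<bullet> b) * h ?y) <= K + 2 * (norm x + 1) * K" using K(2)[of ?y] by (simp add: algebra_simps)
   show "gexp ?y <= exp 1 * exp (- ((norm x)^2 / 2))" by (rule gexp_shift_le[OF b t])
  qed (use K0 gexp_pos[of ?y] in \<open>auto simp: less_imp_le\<close>)
  finally show ?thesis by (simp add: algebra_simps)
 qed
 have [measurable]: "f \<in> borel_measurable borel" using if0 by auto
 \<comment> \<open>The shift sin th stays within length 1, where the domination holds, and has
   derivative 1 at th = 0.\<close>
 have "((%th. (LBINT x. f (x + sin th *\<^sub>R b))) has_real_derivative (LBINT x. cos 0 * f' (x + sin 0 *\<^sub>R b))) (at 0)"
 proof (rule has_real_derivative_integral[where w="?w"])
  fix th x
  show "((%th. f (x + sin th *\<^sub>R b)) has_real_derivative cos th * f' (x + sin th *\<^sub>R b)) (at th)"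
   using DERIV_chain2[OF df DERIV_sin[of th], of x] by (simp add: mult.commute)
  show "abs (cos th * f' (x + sin th *\<^sub>R b)) <= ?w x"
   using mult_mono[OF abs_cos_le_one[of th] bd[of "sin th" x]] by (simp add: abs_mult)
 qed (use iw lborel_integrable_translate[OF if0] in auto)
 moreover have "(LBINT x. f (x + sin th *\<^sub>R b)) = (LBINT x. f x)" for th by (rule lborel_integral_translate) simp
 ultimately have "(LBINT x. f' x) = 0" using DERIV_unique[OF _ DERIV_const] by simp
 then have "(LBINT x. h' x * gexp x) = 2 * (LBINT x. (x \<bullet> b) * h x * gexp x)"
  using ih ixh unfolding f'_def[abs_def] by (simp add: gauss_integral)
 then show ?thesis by (simp add: gauss_integral)
qed

section \<open>The Ornstein-Uhlenbeck semigroup in Mehler's form\<close>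

text \<open>With c = cos th and s = sin th this is the Ornstein-Uhlenbeck semigroup at the time t
  with exp(-t) = cos th, up to the normalization of time: the identity at th = 0, the mean at th =
  pi/2. The angle makes both coefficients smooth on the closed interval.\<close>

definition mehler :: "real => real => ('a::euclidean_space => real) => 'a => real" where
 "mehler c s f x = (\<integral>y. f (c *\<^sub>R x + s *\<^sub>R y) \<partial>gauss)"

lemma mehler_borel [measurable]:
 fixes f :: "'a::euclidean_space => real"
 assumes [measurable]: "f \<in> borel_measurable borel" shows "mehler c s f \<in> borel_measurable borel"
proof -
 interpret prob_space "gauss :: 'a measure" by (rule gauss_prob)
 show ?thesis unfolding mehler_def[abs_def] by measurable
qed

lemma mehler_integrable:
 fixes f :: "'a::euclidean_space => real"
 assumes "f \<in> borel_measurable borel" "!!x. abs (f x) <= K"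
 shows "integrable gauss (%y. f (c *\<^sub>R x + s *\<^sub>R y))"
 using assms by (intro gauss_bounded_integrable[where K=K]) auto

lemma mehler_bound:
 fixes f :: "'a::euclidean_space => real"
 assumes "f \<in> borel_measurable borel" "!!x. abs (f x) <= K"
 shows "abs (mehler c s f x) <= K"
proof -
 interpret prob_space "gauss :: 'a measure" by (rule gauss_prob)
 have "abs (mehler c s f x) <= (\<integral>y. K \<partial>(gauss :: 'a measure))"
  unfolding mehler_def by (rule order_trans[OF integral_abs_bound], rule integral_mono)
   (use assms mehler_integrable[OF assms] in \<open>auto simp: integrable_abs\<close>)
 then show ?thesis using prob_space by simp
qed

lemma test_data:
 assumes "test_function_on UNIV f"
 shows "smooth f" "f \<in> borel_measurable borel" "\<exists>K. \<forall>x. abs (f x) <= K"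
 using test_functionD(1)[OF assms] smooth_borel test_function_bounded[OF assms] by blast+

text \<open>The commutation rule of the semigroup with derivatives: each derivative brings out one
  factor \<open>c\<close>.\<close>

lemma mehler_deriv_x:
 fixes f :: "'a::euclidean_space => real"
 assumes t: "test_function_on UNIV f" and b: "b \<in> Basis"
 shows "((%t. mehler c s f (x + t *\<^sub>R b)) has_real_derivative c * mehler c s (pd b f) (x + t *\<^sub>R b)) (at t)"
proof -
 note f = test_data[OF t] and f' = test_data[OF test_function_pd[OF t b]]
 note [measurable] = f(2) f'(2)
 obtain K where K: "!!x. abs (pd b f x) <= K" using f'(3) by blast
 obtain K' where K': "!!x. abs (f x) <= K'" using f(3) by blast
 have e: "c *\<^sub>R (x + t *\<^sub>R b) + s *\<^sub>R y = (c *\<^sub>R x + s *\<^sub>R y) + t *\<^sub>R (c *\<^sub>R b)" for t y by (simp add: algebra_simps)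
 have "((%t. \<integral>y. f (c *\<^sub>R (x + t *\<^sub>R b) + s *\<^sub>R y) \<partial>gauss) has_real_derivative (\<integral>y. c * pd b f (c *\<^sub>R (x + t *\<^sub>R b) + s *\<^sub>R y) \<partial>gauss)) (at t)"
 proof (rule has_real_derivative_integral[where w="%y. abs c * K"])
  show "((%t. f (c *\<^sub>R (x + t *\<^sub>R b) + s *\<^sub>R y)) has_real_derivative c * pd b f (c *\<^sub>R (x + t *\<^sub>R b) + s *\<^sub>R y)) (at t)" for t y
   unfolding e using smooth_directional_derivative[OF f(1), of "c *\<^sub>R x + s *\<^sub>R y" "c *\<^sub>R b" t] b by simp
  show "abs (c * pd b f (c *\<^sub>R (x + t *\<^sub>R b) + s *\<^sub>R y)) <= abs c * K" for t y using K by (simp add: abs_mult mult_left_mono)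
  show "integrable gauss (%y::'a. abs c * K)" by (rule gauss_bounded_integrable[where K="abs ((abs c) * K)"]) auto
  show "integrable gauss (%y. f (c *\<^sub>R (x + t *\<^sub>R b) + s *\<^sub>R y))" for t by (rule mehler_integrable[OF f(2) K'])
 qed measurable
 then show ?thesis unfolding mehler_def by simp
qed

text \<open>The chain rule yields terms with x . b and with y . b. The latter are integrated by
  parts in the Gaussian variable y, which leaves the generator: a drift term and a
  Laplacian.\<close>

lemma mehler_deriv_theta:
 fixes f :: "'a::euclidean_space => real"
 assumes t: "test_function_on UNIV f"
 shows "((%th. mehler (cos th) (sin th) f x) has_real_derivative
  (\<Sum>b\<in>Basis. - sin th * (x \<bullet> b) * mehler (cos th) (sin th) (pd b f) x + cos th * sin th / 2 * mehler (cos th) (sin th) (pd b (pd b f)) x)) (at th)"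
proof -
 note f = test_data[OF t]
 have tb: "test_function_on UNIV (pd b f)" "test_function_on UNIV (pd b (pd b f))" if "b \<in> Basis" for b
  using test_function_pd[OF test_function_pd[OF t that] that] test_function_pd[OF t that] by auto
 obtain K' where K': "!!x. abs (f x) <= K'" using f(3) by blast
 have "\<forall>b\<in>Basis. \<exists>K. \<forall>x. abs (pd b f x) <= K" using test_data(3)[OF tb(1)] by auto
 then obtain K where K: "!!b x. b \<in> Basis ==> abs (pd b f x) <= K b" by metis
 have K0: "b \<in> Basis ==> K b >= 0" for b using K[of b 0] by linarith
 let ?F' = "%th y. \<Sum>b\<in>Basis. pd b f (cos th *\<^sub>R x + sin th *\<^sub>R y) * (- sin th * (x \<bullet> b) + cos th * (y \<bullet> b))"
 have m[measurable]: "b \<in> Basis ==> pd b f \<in> borel_measurable borel" for b using test_data(2)[OF tb(1)] .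
 have D: "((%th. mehler (cos th) (sin th) f x) has_real_derivative (\<integral>y. ?F' th y \<partial>gauss)) (at th)"
  unfolding mehler_def
 proof (rule has_real_derivative_integral[where w="%y. (\<Sum>b\<in>Basis. K b) * norm x + (\<Sum>b\<in>Basis. K b) * norm y"])
  fix th and y :: 'a
  have "((%th. f (cos th *\<^sub>R x + sin th *\<^sub>R y)) has_derivative (%h. grad f (cos th *\<^sub>R x + sin th *\<^sub>R y) \<bullet> (h *\<^sub>R (- sin th *\<^sub>R x + cos th *\<^sub>R y)))) (at th)"
   by (rule has_derivative_compose[OF _ smooth_has_derivative[OF f(1)]])
     (auto intro!: derivative_eq_intros simp: algebra_simps)
  then have "((%th. f (cos th *\<^sub>R x + sin th *\<^sub>R y)) has_real_derivative grad f (cos th *\<^sub>R x + sin th *\<^sub>R y) \<bullet> (- sin th *\<^sub>R x + cos th *\<^sub>R y)) (at th)"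
   unfolding inner_scaleR_right has_field_derivative_def by (simp add: mult_commute_abs)
  moreover have "grad f z \<bullet> (- sin th *\<^sub>R x + cos th *\<^sub>R y) = (\<Sum>b\<in>Basis. pd b f z * (- sin th * (x \<bullet> b) + cos th * (y \<bullet> b)))" for z
   unfolding grad_def inner_sum_left by (intro sum.cong) (auto simp: inner_diff_right inner_add_right inner_commute algebra_simps)
  ultimately show "((%th. f (cos th *\<^sub>R x + sin th *\<^sub>R y)) has_real_derivative ?F' th y) (at th)" by simp
  have "abs (?F' th y) <= (\<Sum>b\<in>Basis. K b * (norm x + norm y))"
  proof (rule order_trans[OF sum_abs], rule sum_mono)
   fix b :: 'a assume b: "b \<in> Basis"
   have "abs (- sin th * (x \<bullet> b) + cos th * (y \<bullet> b)) <= abs (sin th) * abs (x \<bullet> b) + abs (cos th) * abs (y \<bullet> b)"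
    using abs_triangle_ineq[of "- sin th * (x \<bullet> b)" "cos th * (y \<bullet> b)"] by (simp add: abs_mult)
   also have "... <= 1 * norm x + 1 * norm y"
    using Basis_le_norm[OF b, of x] Basis_le_norm[OF b, of y] by (intro add_mono mult_mono) auto
   finally show "abs (pd b f (cos th *\<^sub>R x + sin th *\<^sub>R y) * (- sin th * (x \<bullet> b) + cos th * (y \<bullet> b))) <= K b * (norm x + norm y)"
    using K[OF b] K0[OF b] unfolding abs_mult by (intro mult_mono) auto
  qed
  then show "abs (?F' th y) <= (\<Sum>b\<in>Basis. K b) * norm x + (\<Sum>b\<in>Basis. K b) * norm y"
   by (simp add: sum_distrib_right distrib_left sum.distrib)
 next
  show "integrable gauss (%y::'a. (\<Sum>b\<in>Basis. K b) * norm x + (\<Sum>b\<in>Basis. K b) * norm y)"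
   by (rule gauss_affine_integrable)
  show "integrable gauss (%y. f (cos th *\<^sub>R x + sin th *\<^sub>R y))" for th by (rule mehler_integrable[OF f(2) K'])
 qed measurable
 let ?z = "%y. cos th *\<^sub>R x + sin th *\<^sub>R y"
 have i1: "integrable gauss (%y. pd b f (?z y))" if "b \<in> Basis" for b by (rule mehler_integrable[OF m[OF that] K[OF that]])
 have i2: "integrable gauss (%y. (y \<bullet> b) * pd b f (?z y))" if b: "b \<in> Basis" for b
 proof (rule gauss_linear_integrable[where K=0 and L="K b"])
  show "abs ((y \<bullet> b) * pd b f (?z y)) <= 0 + K b * norm y" for y
   using mult_mono[OF Basis_le_norm[OF b, of y] K[OF b, of "?z y"]] by (simp add: abs_mult mult.commute)
 qed (use m[OF b] in measurable)
 have ibp: "(\<integral>y. (y \<bullet> b) * pd b f (?z y) \<partial>gauss) = sin th / 2 * mehler (cos th) (sin th) (pd b (pd b f)) x" if b: "b \<in> Basis" for b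
 proof -
  note [measurable] = test_data(2)[OF tb(1)[OF b]] test_data(2)[OF tb(2)[OF b]]
  obtain L where L: "!!x. abs (pd b (pd b f) x) <= L" using test_data(3)[OF tb(2)[OF b]] by blast
  have L0: "L >= 0" using L[of 0] by linarith
  have "(\<integral>y. (y \<bullet> b) * pd b f (?z y) \<partial>gauss) = (\<integral>y. sin th * pd b (pd b f) (?z y) \<partial>gauss) / 2"
  proof (rule gauss_ibp[OF b, where K="K b + L"])
   fix y s
   have e: "?z (y + s *\<^sub>R b) = ?z y + s *\<^sub>R (sin th *\<^sub>R b)" for s by (simp add: algebra_simps)
   show "((%s. pd b f (?z (y + s *\<^sub>R b))) has_real_derivative sin th * pd b (pd b f) (?z (y + s *\<^sub>R b))) (at s)"
    unfolding e using smooth_directional_derivative[OF test_data(1)[OF tb(1)[OF b]], of "?z y" "sin th *\<^sub>R b" s] b by simp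
   show "abs (pd b f (?z y)) <= K b + L" using K[OF b, of "?z y"] L0 by linarith
   have "abs (sin th) * abs (pd b (pd b f) (?z y)) <= 1 * L" using L by (intro mult_mono) auto
   then show "abs (sin th * pd b (pd b f) (?z y)) <= K b + L" using K0[OF b] by (simp add: abs_mult)
  qed measurable
  then show ?thesis by (simp add: mehler_def)
 qed
 have "(\<integral>y. ?F' th y \<partial>gauss) = (\<integral>y. (\<Sum>b\<in>Basis. - sin th * (x \<bullet> b) * pd b f (?z y) + cos th * ((y \<bullet> b) * pd b f (?z y))) \<partial>gauss)"
  by (intro Bochner_Integration.integral_cong sum.cong) (auto simp: algebra_simps)
 also have "... = (\<Sum>b\<in>Basis. (\<integral>y. - sin th * (x \<bullet> b) * pd b f (?z y) + cos th * ((y \<bullet> b) * pd b f (?z y)) \<partial>gauss))"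
  by (rule Bochner_Integration.integral_sum) (intro Bochner_Integration.integrable_add integrable_mult_right i1 i2)
 also have "... = (\<Sum>b\<in>Basis. - sin th * (x \<bullet> b) * mehler (cos th) (sin th) (pd b f) x + cos th * sin th / 2 * mehler (cos th) (sin th) (pd b (pd b f)) x)"
 proof (rule sum.cong[OF refl])
  fix b :: 'a assume b: "b \<in> Basis"
  have "(\<integral>y. - sin th * (x \<bullet> b) * pd b f (?z y) + cos th * ((y \<bullet> b) * pd b f (?z y)) \<partial>gauss)
   = - sin th * (x \<bullet> b) * (\<integral>y. pd b f (?z y) \<partial>gauss) + cos th * (\<integral>y. (y \<bullet> b) * pd b f (?z y) \<partial>gauss)"
   using i1[OF b] i2[OF b] by (subst Bochner_Integration.integral_add) auto
  then show "(\<integral>y. - sin th * (x \<bullet> b) * pd b f (?z y) + cos th * ((y \<bullet> b) * pd b f (?z y)) \<partial>gauss) =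
   - sin th * (x \<bullet> b) * mehler (cos th) (sin th) (pd b f) x + cos th * sin th / 2 * mehler (cos th) (sin th) (pd b (pd b f)) x"
   unfolding ibp[OF b] by (simp add: mehler_def)
 qed
 finally show ?thesis using D by simp
qed

text \<open>In terms of the Hermite components f_k of \<open>f\<close> this is the sum of s^k
  |f_k|^2 with s = cos^2 th, a power series in s with nonnegative coefficients.\<close>

definition gN :: "('a::euclidean_space => real) => real => real" where
 "gN f th = (\<integral>x. (mehler (cos th) (sin th) f x)^2 \<partial>gauss)"

lemma gN_nonneg: "gN f th >= 0" by (simp add: gN_def)

text \<open>Integrating the drift term by parts in x produces the squared gradient and a multiple of
  the second-order term that cancels the Laplacian part exactly.\<close>

lemma gN_deriv:
 fixes f :: "'a::euclidean_space => real"
 assumes t: "test_function_on UNIV f"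
 shows "(gN f has_real_derivative - (sin th * cos th) * (\<Sum>b\<in>Basis. gN (pd b f) th)) (at th)"
proof -
 note f = test_data[OF t]
 note tb = test_function_pd[OF t]
 note tbb = test_function_pd[OF tb]
 obtain K' where K': "!!x. abs (f x) <= K'" using f(3) by blast
 have "\<forall>b\<in>Basis. \<exists>K. \<forall>x. abs (pd b f x) <= K" using test_data(3)[OF tb] by auto
 then obtain K where K: "!!b x. b \<in> Basis ==> abs (pd b f x) <= K b" by metis
 have "\<forall>b\<in>Basis. \<exists>K. \<forall>x. abs (pd b (pd b f) x) <= K" using test_data(3)[OF tbb] by auto
 then obtain L where L: "!!b x. b \<in> Basis ==> abs (pd b (pd b f) x) <= L b" by metis
 have K0: "b \<in> Basis ==> K b >= 0" and L0: "b \<in> Basis ==> L b >= 0" for b using K[of b 0] L[of b 0] by linarith+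
 have K'0: "K' >= 0" using K'[of 0] by linarith
 let ?T = "%th. mehler (cos th) (sin th)"
 have m[measurable]: "f \<in> borel_measurable borel" by (rule f)
 have mb[measurable]: "b \<in> Basis ==> pd b f \<in> borel_measurable borel" "b \<in> Basis ==> pd b (pd b f) \<in> borel_measurable borel" for b
  using test_data(2)[OF tb] test_data(2)[OF tbb] by auto
 have Tb: "abs (?T th f x) <= K'" for th x by (rule mehler_bound[OF m K'])
 have Tb1: "b \<in> Basis ==> abs (?T th (pd b f) x) <= K b" for th b x by (rule mehler_bound[OF mb(1) K])
 have Tb2: "b \<in> Basis ==> abs (?T th (pd b (pd b f)) x) <= L b" for th b x by (rule mehler_bound[OF mb(2) L])
 let ?d = "%th x. (\<Sum>b\<in>Basis. - sin th * (x \<bullet> b) * ?T th (pd b f) x + cos th * sin th / 2 * ?T th (pd b (pd b f)) x)"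
 have dm: "?d th \<in> borel_measurable borel" for th
  by (intro borel_measurable_sum borel_measurable_add borel_measurable_times) auto
 have db: "abs (?d th x) <= (\<Sum>b\<in>Basis. L b) + (\<Sum>b\<in>Basis. K b) * norm x" for th x
 proof -
  have "abs (?d th x) <= (\<Sum>b\<in>Basis. L b + K b * norm x)"
  proof (rule order_trans[OF sum_abs], rule sum_mono)
   fix b :: 'a assume b: "b \<in> Basis"
   have "abs (sin th) * abs (x \<bullet> b) * abs (?T th (pd b f) x) <= 1 * norm x * K b"
    using Basis_le_norm[OF b, of x] Tb1[OF b] by (intro mult_mono) auto
   moreover have "abs (cos th) * abs (sin th) * abs (?T th (pd b (pd b f)) x) <= 1 * 1 * L b"
    using Tb2[OF b] by (intro mult_mono) auto
   ultimately show "abs (- sin th * (x \<bullet> b) * ?T th (pd b f) x + cos th * sin th / 2 * ?T th (pd b (pd b f)) x) <= L b + K b * norm x"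
    using abs_triangle_ineq[of "- sin th * (x \<bullet> b) * ?T th (pd b f) x" "cos th * sin th / 2 * ?T th (pd b (pd b f)) x"] L0[OF b]
    by (simp add: abs_mult mult.commute)
  qed
  then show ?thesis by (simp add: sum.distrib sum_distrib_right)
 qed
 have D: "(gN f has_real_derivative (\<integral>x. 2 * (?T th f x * ?d th x) \<partial>gauss)) (at th)"
  unfolding gN_def[abs_def]
 proof (rule has_real_derivative_integral[where w="%x. 2 * K' * (\<Sum>b\<in>Basis. L b) + 2 * K' * (\<Sum>b\<in>Basis. K b) * norm x"])
  fix th x
  show "((%th. (?T th f x)^2) has_real_derivative 2 * (?T th f x * ?d th x)) (at th)"
   using DERIV_power[OF mehler_deriv_theta[OF t, of x th], of 2] by (simp add: mult_ac)
  have "abs (?T th f x) * abs (?d th x) <= K' * ((\<Sum>b\<in>Basis. L b) + (\<Sum>b\<in>Basis. K b) * norm x)"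
   by (intro mult_mono Tb db) (use K'0 in auto)
  then show "abs (2 * (?T th f x * ?d th x)) <= 2 * K' * (\<Sum>b\<in>Basis. L b) + 2 * K' * (\<Sum>b\<in>Basis. K b) * norm x"
   by (simp add: abs_mult algebra_simps)
 next
  show "integrable gauss (%x::'a. 2 * K' * (\<Sum>b\<in>Basis. L b) + 2 * K' * (\<Sum>b\<in>Basis. K b) * norm x)"
   by (rule gauss_affine_integrable)
  show "integrable gauss (%x. (?T th f x)^2)" for th
   by (rule gauss_bounded_integrable[where K="K'\<^sup>2"]) (use Tb K'0 in \<open>auto simp: abs_le_square_iff[symmetric]\<close>)
  show "(%x. 2 * (?T th f x * ?d th x)) \<in> borel_measurable gauss" using dm[of th] by auto
 qed
 have i1: "integrable gauss (%x. (x \<bullet> b) * (?T th f x * ?T th (pd b f) x))" if b: "b \<in> Basis" for b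
 proof (rule gauss_linear_integrable[where K=0 and L="K' * K b"])
  fix x
  have "abs (x \<bullet> b) * (abs (?T th f x) * abs (?T th (pd b f) x)) <= norm x * (K' * K b)"
   using Basis_le_norm[OF b, of x] Tb Tb1[OF b] K'0 by (intro mult_mono) auto
  then show "abs ((x \<bullet> b) * (?T th f x * ?T th (pd b f) x)) <= 0 + K' * K b * norm x" by (simp add: abs_mult mult_ac)
 qed (use mb(1)[OF b] in measurable)
 have i2: "integrable gauss (%x. ?T th f x * ?T th (pd b (pd b f)) x)" if b: "b \<in> Basis" for b
  by (rule gauss_bounded_integrable[where K="K' * L b"]) (use mb(2)[OF b] Tb Tb2[OF b] K'0 in \<open>auto simp: abs_mult intro!: mult_mono\<close>)
 have i3: "integrable gauss (%x. (?T th (pd b f) x)^2)" if b: "b \<in> Basis" for b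
  by (rule gauss_bounded_integrable[where K="(K b)^2"]) (use mb(1)[OF b] Tb1[OF b] K0[OF b] in \<open>auto simp: abs_le_square_iff[symmetric]\<close>)
 have ibp: "(\<integral>x. (x \<bullet> b) * (?T th f x * ?T th (pd b f) x) \<partial>gauss) = cos th / 2 * (gN (pd b f) th + (\<integral>x. ?T th f x * ?T th (pd b (pd b f)) x \<partial>gauss))"
  if b: "b \<in> Basis" for b
 proof -
  note [measurable] = mb[OF b]
  have "(\<integral>x. (x \<bullet> b) * (?T th f x * ?T th (pd b f) x) \<partial>gauss) = (\<integral>x. cos th * ((?T th (pd b f) x)^2 + ?T th f x * ?T th (pd b (pd b f)) x) \<partial>gauss) / 2"
  proof (rule gauss_ibp[OF b, where K="K' * K b + ((K b)^2 + K' * L b)"])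
   fix x s
   show "((%t. ?T th f (x + t *\<^sub>R b) * ?T th (pd b f) (x + t *\<^sub>R b)) has_real_derivative
    cos th * ((?T th (pd b f) (x + s *\<^sub>R b))^2 + ?T th f (x + s *\<^sub>R b) * ?T th (pd b (pd b f)) (x + s *\<^sub>R b))) (at s)"
    using DERIV_mult[OF mehler_deriv_x[OF t b, of "cos th" "sin th" x s] mehler_deriv_x[OF tb[OF b] b, of "cos th" "sin th" x s]]
    by (simp add: power2_eq_square algebra_simps)
   have a: "abs (?T th f x * ?T th (pd b f) x) <= K' * K b"
    unfolding abs_mult using Tb Tb1[OF b] K'0 by (intro mult_mono) auto
   have c: "(?T th (pd b f) x)^2 <= (K b)^2" using Tb1[OF b, of th x] K0[OF b] by (simp add: abs_le_square_iff[symmetric])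
   have d: "abs (?T th f x * ?T th (pd b (pd b f)) x) <= K' * L b"
    unfolding abs_mult using Tb Tb2[OF b] K'0 by (intro mult_mono) auto
   have n: "0 <= K' * K b" "0 <= K' * L b" using K'0 K0[OF b] L0[OF b] by auto
   show "abs (?T th f x * ?T th (pd b f) x) <= K' * K b + ((K b)^2 + K' * L b)" using a n by (smt (verit) zero_le_power2)
   have "abs (cos th) * abs ((?T th (pd b f) x)\<^sup>2 + ?T th f x * ?T th (pd b (pd b f)) x) <= 1 * ((K b)^2 + K' * L b)"
    using c d order_trans[OF abs_triangle_ineq[of "(?T th (pd b f) x)^2" "?T th f x * ?T th (pd b (pd b f)) x"]]
    by (intro mult_mono) auto
   then show "abs (cos th * ((?T th (pd b f) x)^2 + ?T th f x * ?T th (pd b (pd b f)) x)) <= K' * K b + ((K b)^2 + K' * L b)"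
    using n by (simp add: abs_mult)
  qed measurable
  then show ?thesis using i2[OF b] i3[OF b] by (simp add: gN_def)
 qed
 have "(\<integral>x. 2 * (?T th f x * ?d th x) \<partial>gauss) = (\<integral>x. (\<Sum>b\<in>Basis. - 2 * sin th * ((x \<bullet> b) * (?T th f x * ?T th (pd b f) x)) + cos th * sin th * (?T th f x * ?T th (pd b (pd b f)) x)) \<partial>gauss)"
  unfolding sum_distrib_left by (intro Bochner_Integration.integral_cong sum.cong) (auto simp: algebra_simps)
 also have "... = (\<Sum>b\<in>Basis. (\<integral>x. - 2 * sin th * ((x \<bullet> b) * (?T th f x * ?T th (pd b f) x)) + cos th * sin th * (?T th f x * ?T th (pd b (pd b f)) x) \<partial>gauss))"
  by (rule Bochner_Integration.integral_sum) (intro Bochner_Integration.integrable_add integrable_mult_right i1 i2)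
 also have "... = (\<Sum>b\<in>Basis. - (sin th * cos th) * gN (pd b f) th)"
 proof (rule sum.cong[OF refl])
  fix b :: 'a assume b: "b \<in> Basis"
  have "(\<integral>x. - 2 * sin th * ((x \<bullet> b) * (?T th f x * ?T th (pd b f) x)) + cos th * sin th * (?T th f x * ?T th (pd b (pd b f)) x) \<partial>gauss)
   = - 2 * sin th * (\<integral>x. (x \<bullet> b) * (?T th f x * ?T th (pd b f) x) \<partial>gauss) + cos th * sin th * (\<integral>x. ?T th f x * ?T th (pd b (pd b f)) x \<partial>gauss)"
   using i1[OF b] i2[OF b] by (subst Bochner_Integration.integral_add) auto
  then show "(\<integral>x. - 2 * sin th * ((x \<bullet> b) * (?T th f x * ?T th (pd b f) x)) + cos th * sin th * (?T th f x * ?T th (pd b (pd b f)) x) \<partial>gauss) = - (sin th * cos th) * gN (pd b f) th"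
   unfolding ibp[OF b] by (simp add: algebra_simps)
 qed
 also have "... = - (sin th * cos th) * (\<Sum>b\<in>Basis. gN (pd b f) th)" by (simp add: sum_distrib_left)
 finally show ?thesis using D by simp
qed

lemma mehler_1_0: "f \<in> borel_measurable borel ==> mehler 1 0 f = (f :: 'a::euclidean_space => real)"
 using prob_space.prob_space[OF gauss_prob] by (auto simp: mehler_def fun_eq_iff)

lemma mehler_0_1: "mehler 0 1 f x = (\<integral>y. f y \<partial>gauss)"
 by (simp add: mehler_def)

lemma gN_0: "f \<in> borel_measurable borel ==> gN f 0 = (\<integral>x. (f (x::'a::euclidean_space))^2 \<partial>gauss)"
 by (simp add: gN_def mehler_1_0)

lemma gN_pi_half: "gN f (pi/2) = (\<integral>x. f (x::'a::euclidean_space) \<partial>gauss)^2"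
 using prob_space.prob_space[OF gauss_prob] by (auto simp: gN_def mehler_0_1)

text \<open>With \<open>s = cos\<^sup>2 th\<close>, the first three \<open>s\<close>-derivatives of \<open>gN f\<close> are nonnegative; the gap is the
 resulting inequality \<open>A'(1) - 2 A(1) >= - A'(0) - 2 A(0)\<close>.\<close>

lemma gauss_gap_test:
 fixes f :: "'a::euclidean_space => real"
 assumes t: "test_function_on UNIV f"
 shows "4 * (\<integral>x. (f x)^2 \<partial>gauss) <= (\<Sum>b\<in>Basis. \<integral>x. (pd b f x)^2 \<partial>gauss)
   + 4 * (\<integral>x. f x \<partial>gauss)^2 + (\<Sum>b\<in>Basis. (\<integral>x. pd b f x \<partial>gauss)^2)"
proof -
 note t1 = test_function_pd[OF t]
 note t2 = test_function_pd[OF t1]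
 define A where "A = gN f"
 \<comment> \<open>Since ds = -2 sin th cos th d th, these are the successive derivatives of A with
   respect to s = cos^2 th, each derivative contributing a factor 1/2.\<close>
 define A1 where "A1 th = (\<Sum>b\<in>Basis. gN (pd b f) th) / 2" for th
 define A2 where "A2 th = (\<Sum>b\<in>Basis. \<Sum>c\<in>Basis. gN (pd c (pd b f)) th) / 4" for th
 define A3 where "A3 th = (\<Sum>b\<in>Basis. \<Sum>c\<in>Basis. \<Sum>d\<in>Basis. gN (pd d (pd c (pd b f))) th) / 8" for th
 have A3n: "A3 th >= 0" and A1n: "A1 th >= 0" for th unfolding A3_def A1_def by (auto intro!: sum_nonneg gN_nonneg)
 have dA: "(A has_real_derivative - 2 * sin th * cos th * A1 th) (at th)" for th
  using gN_deriv[OF t, of th] by (simp add: A_def A1_def algebra_simps)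
 have dA1: "(A1 has_real_derivative - 2 * sin th * cos th * A2 th) (at th)" for th
 proof -
  have "((%th. (\<Sum>b\<in>Basis. gN (pd b f) th) / 2) has_real_derivative (\<Sum>b\<in>Basis. - (sin th * cos th) * (\<Sum>c\<in>Basis. gN (pd c (pd b f)) th)) / 2) (at th)"
   by (intro DERIV_cdivide DERIV_sum gN_deriv t1)
  also have "(\<Sum>b\<in>Basis. - (sin th * cos th) * (\<Sum>c\<in>Basis. gN (pd c (pd b f)) th)) / 2 = - 2 * sin th * cos th * A2 th"
   unfolding A2_def sum_distrib_left[symmetric] by simp
  finally show ?thesis unfolding A1_def[abs_def] .
 qed
 have dA2: "(A2 has_real_derivative - 2 * sin th * cos th * A3 th) (at th)" for th
 proof -
  have "((%th. (\<Sum>b\<in>Basis. \<Sum>c\<in>Basis. gN (pd c (pd b f)) th) / 4) has_real_derivative (\<Sum>b\<in>Basis. \<Sum>c\<in>Basis. - (sin th * cos th) * (\<Sum>d\<in>Basis. gN (pd d (pd c (pd b f))) th)) / 4) (at th)"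
   by (intro DERIV_cdivide DERIV_sum gN_deriv t2)
  also have "(\<Sum>b\<in>Basis. \<Sum>c\<in>Basis. - (sin th * cos th) * (\<Sum>d\<in>Basis. gN (pd d (pd c (pd b f))) th)) / 4 = - 2 * sin th * cos th * A3 th"
   unfolding A3_def sum_distrib_left[symmetric] by simp
  finally show ?thesis unfolding A2_def[abs_def] .
 qed
 \<comment> \<open>In the variable s these are D1 = s A'' - A' and D0 = s A' - 2 A, so that D0' = D1
   and D1' = s A''' \<ge> 0. At s = 1 the Hermite component f_k enters D0 with the weight k -
   2.\<close>
 define D1 where "D1 th = (cos th)^2 * A2 th - A1 th" for th
 define D0 where "D0 th = (cos th)^2 * A1 th - 2 * A th" for th
 have dD1: "(D1 has_real_derivative - 2 * sin th * cos th * ((cos th)^2 * A3 th)) (at th)" for th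
  unfolding D1_def[abs_def]
  by (auto intro!: derivative_eq_intros dA1 dA2 simp: algebra_simps power2_eq_square)
 have dD0: "(D0 has_real_derivative - 2 * sin th * cos th * D1 th) (at th)" for th
  unfolding D0_def[abs_def] D1_def
  by (auto intro!: derivative_eq_intros dA dA1 simp: algebra_simps power2_eq_square)
 have sc: "0 <= sin th * cos th" if "0 <= th" "th <= pi/2" for th
  using that by (intro mult_nonneg_nonneg sin_ge_zero cos_ge_zero) (use pi_gt3 in linarith)+
 define m where "m = A1 (pi/2)"
 have D1: "D1 th >= - m" if th: "0 <= th" "th <= pi/2" for th
 proof -
  have "D1 (pi/2) <= D1 th"
  proof (rule DERIV_nonpos_imp_nonincreasing[where f=D1, OF th(2)])
   fix x assume x: "th <= x" "x <= pi/2"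
   have "0 <= 2 * (sin x * cos x) * ((cos x)^2 * A3 x)"
    using x th by (intro mult_nonneg_nonneg[OF mult_nonneg_nonneg] mult_nonneg_nonneg[OF zero_le_power2] sc A3n) auto
   then show "\<exists>y. (D1 has_real_derivative y) (at x) \<and> y <= 0" using dD1[of x] by (auto simp: mult.assoc)
  qed
  then show ?thesis by (simp add: D1_def m_def)
 qed
 \<comment> \<open>Up to a constant the function is D0 + m s, which is nondecreasing in s because D1
   \<ge> D1(s = 0) = -m; as a function of th it decreases.\<close>
 have "D0 (pi/2) - m * (sin (pi/2))^2 <= D0 0 - m * (sin 0)^2"
 proof (rule DERIV_nonpos_imp_nonincreasing[where f="%th. D0 th - m * (sin th)^2"])
  fix x :: real assume x: "0 <= x" "x <= pi/2"
  have "((%th. D0 th - m * (sin th)^2) has_real_derivative - (2 * (sin x * cos x) * (D1 x + m))) (at x)"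
   by (auto intro!: derivative_eq_intros dD0 simp: algebra_simps)
  moreover have "0 <= 2 * (sin x * cos x) * (D1 x + m)"
   using sc[OF x] D1[OF x] by (intro mult_nonneg_nonneg[OF mult_nonneg_nonneg]) auto
  ultimately show "\<exists>y. ((%th. D0 th - m * (sin th)^2) has_real_derivative y) (at x) \<and> y <= 0" by (metis neg_le_0_iff_le)
 qed simp
 then have "2 * A 0 <= A1 0 + 2 * A (pi/2) + A1 (pi/2)" by (simp add: D0_def m_def)
 moreover have "A 0 = (\<integral>x. (f x)^2 \<partial>gauss)" "A (pi/2) = (\<integral>x. f x \<partial>gauss)^2"
  using test_data(2)[OF t] by (auto simp: A_def gN_0 gN_pi_half)
 moreover have "A1 0 = (\<Sum>b\<in>Basis. \<integral>x. (pd b f x)^2 \<partial>gauss) / 2"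
  unfolding A1_def using test_data(2)[OF t1] by (auto simp: gN_0 intro!: sum.cong)
 moreover have "A1 (pi/2) = (\<Sum>b\<in>Basis. (\<integral>x. pd b f x \<partial>gauss)^2) / 2"
  unfolding A1_def by (simp add: gN_pi_half)
 ultimately show ?thesis by (simp add: algebra_simps)
qed

text \<open>Integration by parts turns the means of the first derivatives into first moments: these
  are stable under L2 limits and vanish in the application.\<close>

lemma gauss_gap_test':
 fixes f :: "'a::euclidean_space => real"
 assumes t: "test_function_on UNIV f"
 shows "4 * (\<integral>x. (f x)^2 \<partial>gauss) <= (\<Sum>b\<in>Basis. \<integral>x. (pd b f x)^2 \<partial>gauss)
   + (4 * (\<integral>x. f x \<partial>gauss)^2 + 4 * (\<Sum>b\<in>Basis. (\<integral>x. (x \<bullet> b) * f x \<partial>gauss)^2))"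
proof -
 note tb = test_function_pd[OF t]
 have "(\<integral>x. pd b f x \<partial>gauss)^2 = 4 * (\<integral>x. (x \<bullet> b) * f x \<partial>gauss)^2" if b: "b \<in> Basis" for b
 proof -
  obtain K where K: "!!x. abs (f x) <= K" using test_data(3)[OF t] by blast
  obtain L where L: "!!x. abs (pd b f x) <= L" using test_data(3)[OF tb[OF b]] by blast
  have "(\<integral>x. (x \<bullet> b) * f x \<partial>gauss) = (\<integral>x. pd b f x \<partial>gauss) / 2"
  proof (rule gauss_ibp[OF b test_data(2)[OF t] test_data(2)[OF tb[OF b]], where K="max K L"])
   show "((%t. f (x + t *\<^sub>R b)) has_real_derivative pd b f (x + t *\<^sub>R b)) (at t)" for x t
    using smooth_directional_derivative[OF test_data(1)[OF t], of x b t] b by simp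
  qed (use K L in \<open>auto simp: le_max_iff_disj\<close>)
  then have e: "(\<integral>x. pd b f x \<partial>gauss) = 2 * (\<integral>x. (x \<bullet> b) * f x \<partial>gauss)" by simp
  show ?thesis unfolding e by (simp add: power_mult_distrib)
 qed
 then show ?thesis using gauss_gap_test[OF t] by (simp add: sum_distrib_left)
qed

lemma gexp_norm2_integrable: "integrable lborel (%x::'a::euclidean_space. (norm x)^2 * gexp x)"
proof -
 have h: "hom (real 2) (%x::'a. (norm x)^2)" by (rule hom_strict) (simp add: power_mult_distrib)
 have b: "Bi (%x::'a. (norm x)^2)" by (rule Bi_bounded[where K=1]) (auto simp: power_le_one)
 show ?thesis unfolding gexp_def[abs_def] by (rule layer_cake_gauss(1)[OF _ h _ b]) auto
qed

lemma gauss_L2: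
 fixes f :: "'a::euclidean_space => real"
 assumes [measurable]: "f \<in> borel_measurable borel" and i: "integrable lborel (%x. (f x)^2)"
 shows "f \<in> L2 gauss" "(\<integral>x. (f x)^2 \<partial>gauss) <= (LBINT x. (f x)^2) / gZ TYPE('a)"
proof -
 have le: "(f x)^2 * gexp x <= (f x)^2" for x using gexp_le1[of x] by (simp add: mult_left_le)
 have "integrable lborel (%x. (f x)^2 * gexp x)"
  by (rule Bochner_Integration.integrable_bound[OF i])
    (use le in \<open>auto simp: abs_mult abs_of_pos[OF gexp_pos]\<close>)
 then show "f \<in> L2 gauss" by (simp add: L2_real_iff gauss_integral)
 show "(\<integral>x. (f x)^2 \<partial>gauss) <= (LBINT x. (f x)^2) / gZ TYPE('a)"
  using le gZ_pos[where 'a='a] by (subst gauss_integral) (auto intro!: divide_right_mono integral_mono'[OF i])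
qed

text \<open>Mollifications converge in Lebesgue L2, hence in Gaussian L2 because the density is
  bounded, and every term of the gap inequality is a product of L2 quantities.\<close>

lemma gauss_gap_compact:
 fixes u :: "'a::euclidean_space => real"
 assumes p: "!!R. sob_pair R u G" and s: "!!x. norm x >= r ==> u x = 0" "!!x. norm x >= r ==> G x = 0"
 shows "4 * (\<integral>x. (u x)^2 \<partial>gauss) <= (\<integral>x. (norm (G x))^2 \<partial>gauss)
   + (4 * (\<integral>x. u x \<partial>gauss)^2 + 4 * (\<Sum>b\<in>Basis. (\<integral>x. (x \<bullet> b) * u x \<partial>gauss)^2))"
proof -
 note d = sob_pairD[OF p[of r]]
 note [measurable] = d(1,2)
 define phi where "phi k = conv u (moll (1 / Suc k))" for k
 note A = smooth_approx_compact[OF p s, folded phi_def]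
 have t: "test_function_on UNIV (phi k)" for k by (rule test_functionI[OF A(1) A(2)]) auto
 have m[measurable]: "phi k \<in> borel_measurable borel" "b \<in> Basis ==> pd b (phi k) \<in> borel_measurable borel" for k b
  using test_data(2)[OF t] test_data(2)[OF test_function_pd[OF t]] by auto
 have L2t: "f \<in> L2 gauss" if "test_function_on UNIV f" for f :: "'a => real"
  using test_integrable[OF test_function_mult[OF that test_data(1)[OF that]]] test_data(2)[OF that]
  by (intro gauss_L2(1)) (auto simp: power2_eq_square)
 have Lu: "u \<in> L2 gauss"
 proof (rule gauss_L2(1))
  have "(%x. indicator (ball 0 r) x * (u x)^2) = (%x. (u x)^2)" using s by (auto split: split_indicator)
  then show "integrable lborel (%x. (u x)^2)" using d(3) by simp
 qed simp
 have LG: "(%x. G x \<bullet> b) \<in> L2 gauss" if "b \<in> Basis" for b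
 proof (rule gauss_L2(1))
  have "(%x. indicator (ball 0 r) x * (G x \<bullet> b)^2) = (%x. (G x \<bullet> b)^2)" using s by (auto split: split_indicator)
  then show "integrable lborel (%x. (G x \<bullet> b)^2)" using L2_ball_comp_integrable[OF d(2,4) that] by simp
 qed simp
 have wl: "(%k. \<integral>x. (h k x - f x)^2 \<partial>gauss) \<longlonglongrightarrow> 0"
  if "!!k. (%x. h k x - f x) \<in> borel_measurable borel" "!!k. integrable lborel (%x. (h k x - f x)^2)"
   and l: "(%k. (LBINT x. (h k x - f x)^2)) \<longlonglongrightarrow> 0" for h :: "nat => 'a => real" and f
  by (rule tendsto_sandwich[OF _ _ tendsto_const tendsto_divide_zero[OF l, of "gZ TYPE('a)"]])
    (use gauss_L2(2)[OF that(1,2)] in auto)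
 have lu: "(%k. \<integral>x. (phi k x - u x)^2 \<partial>gauss) \<longlonglongrightarrow> 0" by (rule wl) (auto intro: A)
 have lG: "(%k. \<integral>x. (pd b (phi k) x - G x \<bullet> b)^2 \<partial>gauss) \<longlonglongrightarrow> 0" if b: "b \<in> Basis" for b
  by (rule wl) (use m(2)[OF b] b in \<open>auto intro: A\<close>)
 have L1: "(%x. 1 :: real) \<in> L2 (gauss :: 'a measure)" using gauss_bounded_integrable[of "%x::'a. 1" 1] by (auto simp: L2_real_iff)
 have Lx: "(%x. x \<bullet> b) \<in> L2 gauss" if b: "b \<in> Basis" for b :: 'a
 proof -
  have "integrable lborel (%x. (x \<bullet> b)^2 * gexp x)"
  proof (rule Bochner_Integration.integrable_bound[OF gexp_norm2_integrable])
   have "(x \<bullet> b)^2 <= (norm x)^2" for x using Basis_le_norm[OF b, of x] by (simp add: abs_le_square_iff[symmetric])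
   then show "AE x in lborel. norm ((x \<bullet> b)^2 * gexp x) <= norm ((norm x)^2 * gexp x)"
    by (intro AE_I2) (auto simp: abs_mult gexp_pos less_imp_le intro!: mult_right_mono)
  qed auto
  then show ?thesis by (simp add: L2_real_iff gauss_integral)
 qed
 note Lphi = L2t[OF t] and Lpsi = L2t[OF test_function_pd[OF t]]
 have 1: "(%k. \<integral>x. (phi k x)^2 \<partial>gauss) \<longlonglongrightarrow> (\<integral>x. (u x)^2 \<partial>gauss)"
  unfolding power2_eq_square by (rule L2_prod_tendsto[OF Lphi Lu Lphi Lu lu lu])
 have 2: "(%k. \<integral>x. (pd b (phi k) x)^2 \<partial>gauss) \<longlonglongrightarrow> (\<integral>x. (G x \<bullet> b)^2 \<partial>gauss)" if b: "b \<in> Basis" for b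
  unfolding power2_eq_square by (rule L2_prod_tendsto[OF Lpsi[OF b] LG[OF b] Lpsi[OF b] LG[OF b] lG[OF b] lG[OF b]])
 have 3: "(%k. \<integral>x. phi k x \<partial>gauss) \<longlonglongrightarrow> (\<integral>x. u x \<partial>gauss)"
  using L2_prod_tendsto[OF L1 L1 Lphi Lu _ lu] by simp
 have 4: "(%k. \<integral>x. (x \<bullet> b) * phi k x \<partial>gauss) \<longlonglongrightarrow> (\<integral>x. (x \<bullet> b) * u x \<partial>gauss)" if b: "b \<in> Basis" for b
  using L2_prod_tendsto[OF Lx[OF b] Lx[OF b] Lphi Lu _ lu] by simp
 have "4 * (\<integral>x. (u x)^2 \<partial>gauss) <= (\<Sum>b\<in>Basis. \<integral>x. (G x \<bullet> b)^2 \<partial>gauss)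
   + (4 * (\<integral>x. u x \<partial>gauss)^2 + 4 * (\<Sum>b\<in>Basis. (\<integral>x. (x \<bullet> b) * u x \<partial>gauss)^2))"
  by (rule LIMSEQ_le[OF tendsto_mult_left[OF 1] tendsto_add[OF tendsto_sum[OF 2] tendsto_add[OF
    tendsto_mult_left[OF tendsto_power[OF 3]] tendsto_mult_left[OF tendsto_sum[OF tendsto_power[OF 4]]]]]])
   (use gauss_gap_test'[OF t] in blast)+
 also have "(\<Sum>b\<in>Basis. \<integral>x. (G x \<bullet> b)^2 \<partial>gauss) = (\<integral>x. (\<Sum>b\<in>Basis. (G x \<bullet> b)^2) \<partial>gauss)"
  by (rule Bochner_Integration.integral_sum[symmetric]) (use LG in \<open>simp add: L2_real_iff\<close>)
 also have "... = (\<integral>x. (norm (G x))^2 \<partial>gauss)" by (simp add: norm2_Basis)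
 finally show ?thesis .
qed

text \<open>Vanishing affine moments on the ball are vanishing affine moments for the Gaussian, so
  the second gap 4 applies after cutting off. Back on the ball, v^2 and |g|^2 carry radial moments
  with ratio (n + 3)/2, which turns 4 into 2 (n + 3).\<close>

lemma hsob_gap:
 fixes v :: "'a::euclidean_space => real"
 assumes h: "hsob v g" and z: "Bint v = 0" "!!b. b \<in> Basis ==> Bint (%x. (x \<bullet> b) * v x) = 0"
 shows "2 * (DIM('a) + 3) * Bint (%x. (v x)^2) <= Bint (%x. (norm (g x))^2)"
proof -
 have p: "sob_pair R v g" for R using h by (simp add: hsob_def)
 note d = sob_pairD[OF p]
 note [measurable] = d(1,2)
 have hv: "hom (3/2) v" using h by (simp add: hsob_def)
 have hg: "hom (1/2) g" by (rule hsob_hom_grad[OF h])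
 have hv2: "hom (real 3) (%x. (v x)^2)" using hom_mult[OF hv hv] by (simp add: power2_eq_square)
 have hg2: "hom (real 1) (%x. (norm (g x))^2)" using hom_inner[OF hg hg] by (simp add: power2_norm_eq_inner)
 note iv2 = layer_cake_gauss[OF _ hv2 _ Bi_sq(1)[OF p]]
 note ig2 = layer_cake_gauss[OF _ hg2 _ Bi_sq(2)[OF p]]
 have Iv: "integrable gauss (%x. (v x)^2)" and Ig: "integrable gauss (%x. (norm (g x))^2)"
  using iv2(1) ig2(1) by (auto simp: gauss_integral gexp_def)
 have I2: "integrable gauss (%x::'a. (norm x)^2)" using gexp_norm2_integrable by (simp add: gauss_integral)
 \<comment> \<open>The growth condition on \<open>q\<close> covers the constant 1 and the
   coordinates x . b at once.\<close>
 have Iw: "integrable gauss (%x. q x * v x)" and Bw: "Bi (%x. q x * v x)" if [measurable]: "q \<in> borel_measurable borel" and q: "!!x. abs (q x) <= 1 + norm x" for q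
 proof -
  have le: "abs (q x * v x) <= (2 + 2 * (norm x)^2) + (v x)^2" for x
  proof -
   have "abs (q x) * abs (v x) <= (1 + norm x) * abs (v x)" by (intro mult_right_mono q) auto
   also have "... <= (1 + norm x)^2 + (abs (v x))\<^sup>2"
    using zero_le_power2[of "1 + norm x - abs (v x)"] mult_nonneg_nonneg[of "1 + norm x" "abs (v x)"] norm_ge_zero[of x] abs_ge_zero[of "v x"]
    unfolding power2_diff by linarith
   also have "(1 + norm x)^2 <= 2 + 2 * (norm x)^2" using zero_le_power2[of "1 - norm x"] unfolding power2_diff power2_sum by simp
   finally show ?thesis by (simp add: abs_mult)
  qed
  show "integrable gauss (%x. q x * v x)"
   by (rule Bochner_Integration.integrable_bound[where f="%x. (2 + 2 * (norm x)^2) + (v x)^2"])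
     (use le gauss_bounded_integrable[of "%x::'a. 2" 2] I2 Iv in \<open>auto intro: order_trans[OF _ abs_ge_self]\<close>)
  show "Bi (%x. q x * v x)"
   by (rule Bi_bound[OF Bi_add[OF Bi_bounded[where K=4] Bi_sq(1)[OF p]], where f="%x. q x * v x"])
     (use le in \<open>auto simp: power_le_one\<close>)
 qed
 have zw: "(\<integral>x. q x * v x \<partial>gauss) = 0"
  if "q \<in> borel_measurable borel" "!!x. abs (q x) <= 1 + norm x" "hom a q" "Bint (%x. q x * v x) = 0" for q a
  using layer_cake_gauss_zero[OF _ hom_mult[OF that(3) hv] Bw[OF that(1,2)] that(4)] Iw[OF that(1,2)] that(1)
  by (simp add: gauss_integral gexp_def)
 have q1: "abs (x \<bullet> b) <= 1 + norm x" if "b \<in> Basis" for b x :: 'a using Basis_le_norm[OF that, of x] by linarith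
 have z1: "(\<integral>x. 1 * v x \<partial>gauss) = 0" by (rule zw[of _ 0]) (auto simp: z intro: hom_strict)
 have z2: "(\<integral>x. (x \<bullet> b) * v x \<partial>gauss) = 0" if b: "b \<in> Basis" for b
  by (rule zw[of _ 1]) (use q1 z b in \<open>auto intro: hom_strict\<close>)
 obtain eta :: "'a => real" where eta: "smooth eta" "!!x. 0 <= eta x" "!!x. eta x <= 1" "!!x. norm x <= 1 ==> eta x = 1" "!!x. norm x >= 2 ==> eta x = 0"
  using cutoff_exists[of 1 2, where 'a='a] by auto
 have teta: "test_function_on UNIV eta" by (rule test_functionI[OF eta(1,5)]) auto
 obtain K where K: "K > 0" "!!x. norm (grad eta x) <= K" using test_function_grad_bounded[OF teta] by blast
 \<comment> \<open>Cutoffs at scale n + 1: they equal 1 eventually at each point, and their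
   gradients are at most K/(n + 1), so the commutator v grad(e n) disappears in the limit.\<close>
 define e where "e n x = eta (0 + (1 / Suc n) *\<^sub>R x)" for n x
 have se: "smooth (e n)" for n unfolding e_def[abs_def] by (rule smooth_affine[OF eta(1)])
 have ge: "grad (e n) x = (1 / Suc n) *\<^sub>R grad eta (0 + (1 / Suc n) *\<^sub>R x)" for n x
  by (rule euclidean_eqI) (simp add: e_def[abs_def] pd_affine[OF eta(1), of _ 0, simplified])
 have ge_b: "norm (grad (e n) x) <= K / Suc n" for n x using K by (simp add: ge divide_right_mono)
 have [measurable]: "e n \<in> borel_measurable borel" "grad (e n) \<in> borel_measurable borel" for n
  using smooth_borel[OF se] grad_borel[OF se] by auto
 define u where "u n x = e n x * v x" for n x
 define G where "G n x = e n x *\<^sub>R g x + v x *\<^sub>R grad (e n) x" for n x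
 have pu: "sob_pair R (u n) (G n)" for R n using sob_pair_mult_smooth[OF p se] by (simp add: u_def[abs_def] G_def[abs_def])
 have [measurable]: "u n \<in> borel_measurable borel" "G n \<in> borel_measurable borel" for n using sob_pairD(1,2)[OF pu] by auto
 have e1: "\<forall>\<^sub>F n in sequentially. e n x = 1" for x
 proof -
  obtain N where "norm x < real N" using reals_Archimedean2 by blast
  then have "e n x = 1" if "n >= N" for n unfolding e_def using that by (intro eta(4)) (simp add: divide_le_eq)
  then show ?thesis unfolding eventually_sequentially by blast
 qed
 have e0: "e n x = 0" if "norm x >= 2 * Suc n" for n x
  unfolding e_def using that by (intro eta(5)) (simp add: le_divide_eq)
 have e01: "0 <= e n x" "e n x <= 1" for n x unfolding e_def using eta by auto
 have su: "norm x >= 2 * Suc n + 1 ==> u n x = 0" "norm x >= 2 * Suc n + 1 ==> G n x = 0" for n x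
  using e0[of n x] grad_zero_outside[OF se, of "2 * Suc n" n x] e0 by (auto simp: u_def G_def)
 have ineq: "4 * (\<integral>x. (u n x)^2 \<partial>gauss) <= (\<integral>x. (norm (G n x))^2 \<partial>gauss)
   + (4 * (\<integral>x. u n x \<partial>gauss)^2 + 4 * (\<Sum>b\<in>Basis. (\<integral>x. (x \<bullet> b) * u n x \<partial>gauss)^2))" for n
  by (rule gauss_gap_compact[OF pu su]) auto
 have ul: "\<forall>\<^sub>F n in sequentially. u n x = v x" for x using e1[of x] by eventually_elim (simp add: u_def)
 have ub: "abs (u n x) <= abs (v x)" for n x unfolding u_def using e01[of n x] by (simp add: abs_mult mult_left_le_one_le)
 have Gl: "(%n. G n x) \<longlonglongrightarrow> g x" for x
 proof -
  have "(%n. K * (1 / Suc n)) \<longlonglongrightarrow> K * 0" by (intro tendsto_mult_left LIMSEQ_Suc[OF lim_1_over_n])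
  then have k0: "(%n. K / Suc n) \<longlonglongrightarrow> 0" by simp
  have "(%n. grad (e n) x) \<longlonglongrightarrow> 0"
   by (rule Lim_null_comparison[OF _ k0]) (use ge_b in auto)
  moreover have "(%n. e n x) \<longlonglongrightarrow> 1" using e1[of x] by (rule tendsto_eventually)
  ultimately have "(%n. G n x) \<longlonglongrightarrow> 1 *\<^sub>R g x + v x *\<^sub>R 0" unfolding G_def by (intro tendsto_intros)
  then show ?thesis by simp
 qed
 have Gb: "(norm (G n x))^2 <= 2 * (norm (g x))^2 + 2 * K\<^sup>2 * (v x)^2" for n x
 proof -
  have kn: "norm (grad (e n) x) <= K" by (rule order_trans[OF ge_b]) (use K(1) in \<open>simp add: divide_le_eq\<close>)
  have "norm (G n x) <= norm (e n x *\<^sub>R g x) + norm (v x *\<^sub>R grad (e n) x)" unfolding G_def by (rule norm_triangle_ineq)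
  also have "... <= norm (g x) + K * abs (v x)"
   using e01[of n x] mult_left_mono[OF kn abs_ge_zero[of "v x"]] by (intro add_mono) (auto simp: mult_left_le mult.commute)
  finally have "(norm (G n x))^2 <= (norm (g x) + K * abs (v x))^2" by (intro power_mono) auto
  also have "... <= 2 * (norm (g x))^2 + 2 * (K * abs (v x))^2"
   using zero_le_power2[of "norm (g x) - K * abs (v x)"] by (simp add: power2_eq_square algebra_simps)
  finally show ?thesis by (simp add: power_mult_distrib)
 qed
 have L1: "(%n. \<integral>x. (u n x)^2 \<partial>gauss) \<longlonglongrightarrow> (\<integral>x. (v x)^2 \<partial>gauss)"
 proof (rule integral_dominated_convergence[OF _ _ Iv])
  show "AE x in gauss. (%n. (u n x)^2) \<longlonglongrightarrow> (v x)\<^sup>2"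
   by (intro AE_I2 tendsto_intros tendsto_eventually ul)
  show "AE x in gauss. norm ((u n x)^2) <= (v x)^2" for n using ub by (simp add: abs_le_square_iff)
 qed auto
 have L2: "(%n. \<integral>x. (norm (G n x))^2 \<partial>gauss) \<longlonglongrightarrow> (\<integral>x. (norm (g x))^2 \<partial>gauss)"
 proof (rule integral_dominated_convergence[where w="%x. 2 * (norm (g x))^2 + 2 * K\<^sup>2 * (v x)^2"])
  show "AE x in gauss. (%n. (norm (G n x))^2) \<longlonglongrightarrow> (norm (g x))\<^sup>2"
   by (intro AE_I2 tendsto_intros Gl)
 qed (use Iv Ig Gb in auto)
 have L3: "(%n. \<integral>x. q x * u n x \<partial>gauss) \<longlonglongrightarrow> (\<integral>x. q x * v x \<partial>gauss)"
  if [measurable]: "q \<in> borel_measurable borel" and q: "!!x. abs (q x) <= 1 + norm x" for q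
 proof (rule integral_dominated_convergence[where w="%x. norm (q x * v x)"])
  show "AE x in gauss. (%n. q x * u n x) \<longlonglongrightarrow> q x * v x"
   by (intro AE_I2 tendsto_intros tendsto_eventually ul)
  show "AE x in gauss. norm (q x * u n x) <= norm (q x * v x)" for n
   using ub by (intro AE_I2) (auto simp: abs_mult intro!: mult_left_mono)
 qed (use Iw[OF that] in auto)
 have "4 * (\<integral>x. (v x)^2 \<partial>gauss) <= (\<integral>x. (norm (g x))^2 \<partial>gauss) + (4 * 0\<^sup>2 + 4 * (\<Sum>b\<in>(Basis :: 'a set). 0\<^sup>2))"
 proof (rule LIMSEQ_le)
  show "(%n. 4 * (\<integral>x. (u n x)^2 \<partial>gauss)) \<longlonglongrightarrow> 4 * (\<integral>x. (v x)^2 \<partial>gauss)" by (intro tendsto_intros L1)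
  have "(%n. \<integral>x. u n x \<partial>gauss) \<longlonglongrightarrow> 0" using L3[of "%x. 1"] z1 by simp
  moreover have "(%n. \<integral>x. (x \<bullet> b) * u n x \<partial>gauss) \<longlonglongrightarrow> 0" if "b \<in> Basis" for b
   using L3[of "%x. x \<bullet> b"] z2[OF that] q1[OF that] by simp
  ultimately show "(%n. (\<integral>x. (norm (G n x))^2 \<partial>gauss)
   + (4 * (\<integral>x. u n x \<partial>gauss)^2 + 4 * (\<Sum>b\<in>Basis. (\<integral>x. (x \<bullet> b) * u n x \<partial>gauss)^2))) \<longlonglongrightarrow>
   (\<integral>x. (norm (g x))^2 \<partial>gauss) + (4 * 0\<^sup>2 + 4 * (\<Sum>b\<in>(Basis :: 'a set). 0\<^sup>2))"
   by (intro tendsto_intros L2) auto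
 qed (use ineq in blast)
 then have "4 * (LBINT x. (v x)^2 * gexp x) <= (LBINT x. (norm (g x))^2 * gexp x)"
  using gZ_pos[where 'a='a] by (simp add: gauss_integral divide_le_cancel)
 also have "(LBINT x. (norm (g x))^2 * gexp x) = 2 * gm (1 + DIM('a) + 1) * Bint (%x. (norm (g x))^2)"
  unfolding gexp_def[abs_def] by (rule ig2(2)) auto
 also have "(LBINT x. (v x)^2 * gexp x) = 2 * gm (3 + DIM('a) + 1) * Bint (%x. (v x)^2)"
  unfolding gexp_def[abs_def] by (rule iv2(2)) auto
 also have "gm (3 + DIM('a) + 1) = (DIM('a) + 3) / 2 * gm (1 + DIM('a) + 1)"
  using gm_rec[of "1 + DIM('a) + 1"] by (simp add: eval_nat_numeral)
 finally have "gm (1 + DIM('a) + 1) * (2 * (DIM('a) + 3) * Bint (%x. (v x)^2)) <= gm (1 + DIM('a) + 1) * Bint (%x. (norm (g x))^2)"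
  by (simp add: algebra_simps)
 then show ?thesis using gm_pos[of "1 + DIM('a) + 1"] by (simp only: mult_le_cancel_left_pos)
qed

subsection \<open>Green's formula for locally Lipschitz fields\<close>

text \<open>The condition is local because products of the explicit functions grow at infinity:
  locally Lipschitz functions form an algebra, globally Lipschitz ones do not.\<close>

definition llip :: "('a::euclidean_space => real) => bool" where
 "llip f \<longleftrightarrow> (\<forall>R. \<exists>K. K-lipschitz_on (cball 0 R) f)"

lemma llipI:
 assumes "!!R. \<exists>K. \<forall>x y. norm x <= R --> norm y <= R --> abs (f x - f y) <= K * norm (x - y)"
 shows "llip f"
 unfolding llip_def
proof
 fix R
 obtain K where K: "!!x y. norm x <= R ==> norm y <= R ==> abs (f x - f y) <= K * norm (x - y)" using assms by blast
 have "abs (f x - f y) <= abs K * norm (x - y)" if "norm x <= R" "norm y <= R" for x y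
  by (rule order_trans[OF K[OF that]]) (simp add: mult_right_mono)
 then have "(abs K)-lipschitz_on (cball 0 R) f" by (intro lipschitz_onI) (auto simp: dist_norm)
 then show "\<exists>K. K-lipschitz_on (cball 0 R) f" by blast
qed

lemma llip_lipschitz: "K-lipschitz_on UNIV f ==> llip f"
 unfolding llip_def using lipschitz_on_subset by blast

lemma llip_bounded:
 assumes "llip f" shows "\<exists>K\<ge>0. \<forall>x. norm x <= R --> abs (f x) <= K"
proof -
 obtain L where L: "L-lipschitz_on (cball 0 R) f" using assms by (auto simp: llip_def)
 have L0: "L >= 0" by (rule lipschitz_on_nonneg[OF L])
 have "abs (f x) <= abs (f 0) + L * abs R" if x: "norm x <= R" for x
 proof -
 from x have "0 <= R" using norm_ge_zero order_trans by blast
 then have "abs (f x - f 0) <= L * norm x" using lipschitz_onD[OF L, of x 0] x by (simp add: dist_norm)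
 also have "... <= L * abs R" using x L0 by (intro mult_left_mono) auto
 finally show ?thesis by linarith
 qed
 then show ?thesis using L0 by (intro exI[of _ "abs (f 0) + L * abs R"]) auto
qed

lemma llip_continuous: assumes "llip f" shows "continuous_on UNIV f"
proof (rule continuous_at_imp_continuous_on, intro ballI)
 fix x :: 'a
 obtain L where "L-lipschitz_on (cball 0 (norm x + 1)) f" using assms by (auto simp: llip_def)
 from lipschitz_on_continuous_on[OF this] have "continuous_on (ball 0 (norm x + 1)) f"
  by (rule continuous_on_subset) auto
 then show "isCont f x" by (simp add: continuous_on_eq_continuous_at)
qed

lemma llip_borel: "llip f ==> f \<in> borel_measurable borel"
 using llip_continuous borel_measurable_continuous_onI by blast

lemma llip_Bi: assumes "llip f" shows "Bi f"
proof -
 obtain K where "!!x. norm x <= 1 ==> abs (f x) <= K" using llip_bounded[OF assms, of 1] by blast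
 then show ?thesis by (intro Bi_bounded[OF llip_borel[OF assms], of K]) auto
qed

lemma llip_const: "llip (%x. c)"
 by (rule llip_lipschitz[OF lipschitz_on_constant])

lemma llip_add: assumes "llip f" "llip g" shows "llip (%x. f x + g x)"
 using assms unfolding llip_def by (blast intro: lipschitz_on_add)

lemma llip_diff: assumes "llip f" "llip g" shows "llip (%x. f x - g x)"
 using assms unfolding llip_def by (blast intro: lipschitz_on_diff)

lemma llip_mult: assumes "llip f" "llip g" shows "llip (%x. f x * g x)"
proof (rule llipI)
 fix R
 obtain K L M N where K: "K-lipschitz_on (cball 0 R) f" and L: "L-lipschitz_on (cball 0 R) g"
  and M: "M >= 0" "!!x. norm x <= R ==> abs (f x) <= M" and N: "N >= 0" "!!x. norm x <= R ==> abs (g x) <= N"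
  using assms llip_bounded[OF assms(1), of R] llip_bounded[OF assms(2), of R] unfolding llip_def by meson
 show "\<exists>C. \<forall>x y. norm x <= R --> norm y <= R --> abs (f x * g x - f y * g y) <= C * norm (x - y)"
 proof (intro exI allI impI)
  fix x y :: 'a assume x: "norm x <= R" and y: "norm y <= R"
  have "abs (f x * g x - f y * g y) <= abs (f x - f y) * abs (g x) + abs (f y) * abs (g x - g y)"
   using abs_triangle_ineq[of "(f x - f y) * g x" "f y * (g x - g y)"] by (simp add: abs_mult[symmetric] algebra_simps)
  also have "... <= (K * norm (x - y)) * N + M * (L * norm (x - y))"
   using lipschitz_onD[OF K, of x y] lipschitz_onD[OF L, of x y] x y M N
   by (intro add_mono mult_mono) (auto simp: dist_norm intro: order_trans[OF abs_ge_zero])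
  also have "... = (K * N + M * L) * norm (x - y)" by (simp add: algebra_simps)
  finally show "abs (f x * g x - f y * g y) <= (K * N + M * L) * norm (x - y)" .
 qed
qed

lemma llip_inner: "llip (%x. x \<bullet> b)"
 by (rule llipI, rule exI[of _ "norm b"])
   (auto simp: inner_diff_left[symmetric] Cauchy_Schwarz_ineq2 mult.commute[of "norm b"])

lemma llip_compose:
 assumes "llip f" "!!s t. abs (phi s - phi t) <= abs (s - t)" shows "llip (%x. phi (f x))"
proof (rule llipI)
 fix R
 obtain K where "K-lipschitz_on (cball 0 R) f" using assms(1) by (auto simp: llip_def)
 from lipschitz_onD[OF this] have "norm x <= R ==> norm y <= R ==> abs (f x - f y) <= K * norm (x - y)" for x y
  by (auto simp: dist_norm)
 then show "\<exists>K. \<forall>x y. norm x <= R --> norm y <= R --> abs (phi (f x) - phi (f y)) <= K * norm (x - y)"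
  using order_trans[OF assms(2)] by blast
qed

text \<open>A relation at a single point, since derivatives of the explicit functions are computed
  only off a hyperplane, which is a null set; the derivative field is always supplied
  explicitly.\<close>

definition dder :: "('a::euclidean_space => real) => 'a => real => 'a => bool" where
 "dder f b D x \<longleftrightarrow> ((%t. f (x + t *\<^sub>R b)) has_real_derivative D) (at 0)"

lemma dder_mult: "dder f b D x ==> dder g b E x ==> dder (%x. f x * g x) b (f x * E + D * g x) x"
 unfolding dder_def by (drule (1) DERIV_mult) (simp add: ac_simps)

lemma llip_dder_bound:
 assumes "llip f"
 shows "\<exists>K. \<forall>x D. norm x < R --> dder f b D x --> abs D <= K"
proof -
 obtain K where K: "K-lipschitz_on (cball 0 R) f" using assms by (auto simp: llip_def)
 show ?thesis
 proof (intro exI allI impI)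
  fix x D assume x: "norm x < R" and d: "dder f b D x"
  have "((%h. (f (x + h *\<^sub>R b) - f x) / h) \<longlongrightarrow> D) (at 0)" using d by (simp add: dder_def DERIV_def)
  moreover have "\<forall>\<^sub>F h in at 0. norm ((f (x + h *\<^sub>R b) - f x) / h) <= K * norm b"
  proof -
   have "((%h. norm (x + h *\<^sub>R b)) \<longlongrightarrow> norm (x + 0 *\<^sub>R b)) (at (0::real))" by (intro tendsto_intros)
   then have "\<forall>\<^sub>F h in at (0::real). norm (x + h *\<^sub>R b) < R" using x by (intro order_tendstoD(2)) auto
   moreover have "\<forall>\<^sub>F h in at (0::real). h ~= 0" by (simp add: eventually_at_filter)
   ultimately show ?thesis
   proof eventually_elim
    case (elim h)
    have "abs (f (x + h *\<^sub>R b) - f x) <= K * norm b * abs h"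
     using lipschitz_onD[OF K, of "x + h *\<^sub>R b" x] elim(1) x unfolding mem_cball_0 by (simp add: dist_norm mult_ac)
    then show ?case using elim by (simp add: divide_le_eq)
   qed
  qed
  ultimately have "norm D <= K * norm b" by (rule Lim_norm_ubound[rotated]) simp
  then show "abs D <= K * norm b" by simp
 qed
qed

text \<open>The product v eta is globally Lipschitz with bounded support and has the Leibniz
  derivative almost everywhere, so its directional derivative integrates to 0.\<close>

lemma integral_by_parts_llip:
 fixes v :: "'a::euclidean_space => real"
 assumes v: "llip v" and [measurable]: "D \<in> borel_measurable borel" and dv: "AE x in lborel. dder v b (D x) x"
  and e: "L-lipschitz_on UNIV eta" and s: "!!x. norm x >= R ==> eta x = 0" and R: "R >= 0"
  and [measurable]: "E \<in> borel_measurable borel" and de: "AE x in lborel. dder eta b (E x) x"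
 shows "(LBINT x. v x * E x + D x * eta x) = 0"
proof -
 note [measurable] = llip_borel[OF v] llip_borel[OF llip_lipschitz[OF e]]
 obtain K where K: "K-lipschitz_on (cball 0 R) v" using v by (auto simp: llip_def)
 obtain M where M: "M >= 0" "!!x. norm x <= R ==> abs (v x) <= M" using llip_bounded[OF v, of R] by blast
 obtain N where N: "N >= 0" "!!x. norm x <= R ==> abs (eta x) <= N" using llip_bounded[OF llip_lipschitz[OF e], of R] by blast
 have Nb: "abs (eta x) <= N" for x using N s[of x] by (cases "norm x <= R") auto
 \<comment> \<open>Projecting onto the ball is 1-Lipschitz and does not change the product, since
   \<open>eta\<close> vanishes where the projection moves points. It makes the local bounds on
   \<open>v\<close> global.\<close>
 define c where "c = closest_point (cball (0::'a) R)"
 have c: "norm (c x) <= R" "dist (c x) (c y) <= dist x y" for x y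
  using closest_point_in_set[of "cball 0 R" x] closest_point_lipschitz[of "cball 0 R" x y] R unfolding c_def by auto
 have c1: "norm x <= R ==> c x = x" for x unfolding c_def by (intro closest_point_self) auto
 let ?f = "%x. v x * eta x"
 have fc: "?f x = v (c x) * eta x" for x using c1[of x] s[of x] by (cases "norm x <= R") auto
 have lip: "abs (?f x - ?f y) <= (K * N + M * L) * norm (x - y)" for x y
 proof -
  have "abs (?f x - ?f y) <= abs (v (c x) - v (c y)) * abs (eta x) + abs (v (c y)) * abs (eta x - eta y)"
   using abs_triangle_ineq[of "(v (c x) - v (c y)) * eta x" "v (c y) * (eta x - eta y)"]
   unfolding fc abs_mult[symmetric] by (simp add: algebra_simps)
  also have "... <= (K * norm (x - y)) * N + M * (L * norm (x - y))"
  proof (intro add_mono mult_mono Nb M)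
   have "abs (v (c x) - v (c y)) <= K * dist (c x) (c y)"
    using lipschitz_onD[OF K, of "c x" "c y"] c by (simp add: dist_norm)
   also have "... <= K * dist x y" by (intro mult_left_mono c lipschitz_on_nonneg[OF K])
   finally show "abs (v (c x) - v (c y)) <= K * norm (x - y)" by (simp add: dist_norm)
  qed (use c M(1) N(1) lipschitz_onD[OF e, of x y] lipschitz_on_nonneg[OF K] in \<open>auto simp: dist_norm\<close>)
  finally show ?thesis by (simp add: algebra_simps)
 qed
 have int: "integrable lborel ?f"
 proof (rule Bochner_Integration.integrable_bound)
  show "integrable lborel (%x::'a. (M * N) * indicator (ball 0 (R+1)) x)" by (intro integrable_mult_right indicator_ball_integrable)
  show "AE x in lborel. norm (?f x) <= norm ((M * N) * indicator (ball 0 (R+1)) x :: real)"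
  proof (rule AE_I2)
   fix x
   have "norm (?f x) <= M * N" using M(2)[of x] M(1) N(1) Nb[of x] s[of x] by (cases "norm x <= R") (auto simp: abs_mult mult_mono)
   then show "norm (?f x) <= norm ((M * N) * indicator (ball 0 (R+1)) x :: real)"
    using s[of x] M(1) N(1) by (auto split: split_indicator)
  qed
 qed auto
 show ?thesis
 proof (rule integral_directional_derivative_zero[OF int, where b=b and R=R and K="(K * N + M * L) * norm b"])
  show "AE x in lborel. ((%t. ?f (x + t *\<^sub>R b)) has_real_derivative v x * E x + D x * eta x) (at 0)"
   using dv de by eventually_elim (drule (1) dder_mult, simp add: dder_def)
  show "abs (?f (x + t *\<^sub>R b) - ?f x) <= (K * N + M * L) * norm b * abs t" for x t
   using lip[of "x + t *\<^sub>R b" x] by (simp add: mult_ac)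
 qed (use s in auto)
qed

text \<open>Local Lipschitz continuity bounds the almost everywhere derivative on balls, and
  integration by parts against test functions identifies it as the weak gradient. The explicit
  functions enter the Sobolev setting this way.\<close>

lemma sob_pair_llip:
 fixes v :: "'a::euclidean_space => real"
 assumes v: "llip v" and g[measurable]: "g \<in> borel_measurable borel"
  and d: "!!b. b \<in> Basis ==> AE x in lborel. dder v b (g x \<bullet> b) x"
 shows "sob_pair R v g"
 unfolding sob_pair_def
proof (intro conjI allI impI ballI)
 show "g \<in> borel_measurable borel" by (rule g)
 show [measurable]: "v \<in> borel_measurable borel" by (rule llip_borel[OF v])
 obtain M where M: "M >= 0" "!!x. norm x <= R ==> abs (v x) <= M" using llip_bounded[OF v, of R] by blast
 have ib: "integrable lborel (%x. indicator (ball 0 R) x * f x)"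
  if [measurable]: "f \<in> borel_measurable borel" and "AE x in lborel. norm x < R --> abs (f x) <= C" for f :: "'a => real" and C
 proof (rule Bochner_Integration.integrable_bound)
  show "integrable lborel (%x::'a. C * indicator (ball 0 R) x)" by (intro integrable_mult_right indicator_ball_integrable)
  show "AE x in lborel. norm (indicator (ball 0 R) x * f x) <= norm (C * indicator (ball 0 R) x)"
   using that(2) by eventually_elim (auto split: split_indicator)
 qed auto
 have v2: "AE x in lborel. norm x < R --> abs ((v x)\<^sup>2) <= M\<^sup>2"
  using M by (intro AE_I2) (auto simp: abs_le_square_iff[symmetric])
 show "integrable lborel (%x. indicator (ball 0 R) x * (v x)^2)" by (rule ib[OF _ v2]) auto
 obtain K where K: "!!b x. b \<in> Basis ==> norm x < R ==> dder v b (g x \<bullet> b) x ==> abs (g x \<bullet> b) <= K b"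
  using llip_dder_bound[OF v, of R] by metis
 have gb: "AE x in lborel. norm x < R --> abs (g x \<bullet> b) <= K b" if "b \<in> Basis" for b
  using d[OF that] by eventually_elim (use K that in auto)
 have "AE x in lborel. norm x < R --> abs ((g x \<bullet> b)\<^sup>2) <= (K b)^2" if "b \<in> Basis" for b
  using gb[OF that] by eventually_elim (auto simp: abs_le_square_iff[symmetric])
 then have "integrable lborel (%x. indicator (ball 0 R) x * (g x \<bullet> b)^2)" if "b \<in> Basis" for b
  using that by (intro ib) auto
 then have "integrable lborel (%x. \<Sum>b\<in>Basis. indicator (ball 0 R) x * (g x \<bullet> b)^2)"
  by (intro Bochner_Integration.integrable_sum)
 then show "integrable lborel (%x. indicator (ball 0 R) x * (norm (g x))^2)"
  by (simp add: norm2_Basis sum_distrib_left)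
 fix phi :: "'a => real" and b :: 'a assume t: "test_function_on (ball 0 R) phi" and b: "b \<in> Basis"
 note s = test_functionD(1)[OF t]
 have [measurable]: "phi \<in> borel_measurable borel" "pd b phi \<in> borel_measurable borel"
  using smooth_borel[OF s] smooth_borel[OF smooth_pd[OF s b]] by auto
 have z: "phi x = 0" if "norm x >= abs R" for x using test_functionD(3)[OF t, of x] that by auto
 have zp: "pd b phi x = 0" if "norm x >= abs R" for x using test_functionD(3)[OF test_function_pd[OF t b], of x] that by auto
 obtain L where L: "L > 0" "!!x y. abs (phi x - phi y) <= L * norm (x - y)" using test_lipschitz[OF t] by blast
 have Llip: "L-lipschitz_on UNIV phi" using L by (intro lipschitz_onI) (auto simp: dist_norm)
 obtain P where P: "!!x. abs (phi x) <= P" using test_function_bounded[OF t] by blast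
 obtain Q where Q: "!!x. abs (pd b phi x) <= Q" using test_function_bounded[OF test_function_pd[OF t b]] by blast
 have "(LBINT x. v x * pd b phi x + (g x \<bullet> b) * phi x) = 0"
 proof (rule integral_by_parts_llip[OF v _ d[OF b] Llip z])
  show "AE x in lborel. dder phi b (pd b phi x) x"
   using smooth_directional_derivative[OF s, of _ b 0] b by (auto simp: dder_def)
 qed auto
 moreover have "integrable lborel (%x. v x * pd b phi x)"
 proof -
  have "AE x in lborel. norm x < R --> abs (v x * pd b phi x) <= M * Q"
   using M Q by (intro AE_I2) (auto simp: abs_mult intro!: mult_mono)
  from ib[OF _ this] have "integrable lborel (%x. indicator (ball 0 R) x * (v x * pd b phi x))" by simp
  also have "(%x. indicator (ball 0 R) x * (v x * pd b phi x)) = (%x. v x * pd b phi x)"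
   using test_functionD(3)[OF test_function_pd[OF t b]] by (auto split: split_indicator)
  finally show ?thesis .
 qed
 moreover have "integrable lborel (%x. (g x \<bullet> b) * phi x)"
 proof -
  have "AE x in lborel. norm x < R --> abs ((g x \<bullet> b) * phi x) <= K b * P"
   using gb[OF b] by eventually_elim (use P in \<open>auto simp: abs_mult intro!: mult_mono intro: order_trans[OF abs_ge_zero]\<close>)
  from ib[OF _ this] have "integrable lborel (%x. indicator (ball 0 R) x * ((g x \<bullet> b) * phi x))" by simp
  also have "(%x. indicator (ball 0 R) x * ((g x \<bullet> b) * phi x)) = (%x. (g x \<bullet> b) * phi x)"
   using test_functionD(3)[OF t] by (auto split: split_indicator)
  finally show ?thesis .
 qed
 ultimately show "(LBINT x. v x * pd b phi x) = - (LBINT x. (g x \<bullet> b) * phi x)" by simp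
qed

text \<open>The weight 1 - |x|^2, continued by 0, is Lipschitz on the whole space, so integrating by
  parts leaves no boundary term on the sphere; its derivative -2 (x . b) gives the right-hand
  side.\<close>

lemma Bint_quadratic_weight_ibp:
 fixes v :: "'a::euclidean_space => real"
 assumes v: "llip v" and D[measurable]: "D \<in> borel_measurable borel" and d: "AE x in lborel. dder v b (D x) x"
 shows "Bi D" "Bint (%x. (1 - (norm x)^2) * D x) = 2 * Bint (%x. (x \<bullet> b) * v x)"
proof -
 note [measurable] = llip_borel[OF v]
 obtain K where K: "!!x. norm x < 1 ==> dder v b (D x) x ==> abs (D x) <= K" using llip_dder_bound[OF v, of 1 b] by blast
 have kb: "AE x in lborel. norm x < 1 --> abs (D x) <= K" using d by eventually_elim (use K in auto)
 show bD: "Bi D"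
 proof (rule Bochner_Integration.integrable_bound)
  show "integrable lborel (%x::'a. K * indicator (ball 0 1) x)" by (intro integrable_mult_right indicator_ball_integrable)
  show "AE x in lborel. norm (indicator (ball 0 1) x * D x) <= norm (K * indicator (ball 0 1) x)"
   using kb by eventually_elim (auto split: split_indicator)
 qed auto
 \<comment> \<open>Truncating the norm at 1 continues the weight by 0 with Lipschitz constant 2; the
   derivative fails to be controlled only on the unit sphere, a null set.\<close>
 define eta where "eta x = 1 - (min 1 (norm x))^2" for x :: 'a
 define E where "E x = indicator (ball 0 1) x * (- 2 * (x \<bullet> b))" for x
 have L: "2-lipschitz_on UNIV eta"
 proof (rule lipschitz_onI)
  fix x y :: 'a
  let ?m = "min 1 (norm x)" and ?k = "min 1 (norm y)"
  have "abs (eta x - eta y) = abs (?m - ?k) * abs (?m + ?k)"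
   unfolding eta_def abs_mult[symmetric] by (simp add: power2_eq_square algebra_simps abs_minus_commute)
  also have "... <= norm (x - y) * 2"
  proof (rule mult_mono)
   show "abs (?m - ?k) <= norm (x - y)" using norm_triangle_ineq3[of x y] by (auto simp: min_def)
   show "abs (?m + ?k) <= 2" using norm_ge_zero[of x] norm_ge_zero[of y] by (auto simp: min_def)
  qed auto
  finally show "dist (eta x) (eta y) <= 2 * dist x y" by (simp add: dist_norm mult.commute)
 qed simp
 have de: "AE x in lborel. dder eta b (E x) x"
 proof -
  have "AE x in lborel. x \<notin> sphere (0::'a) 1" by (rule AE_not_in[OF sphere_null])
  then show ?thesis
  proof eventually_elim
   case (elim x)
   then have ne: "norm x ~= 1" by simp
   have c: "((%t. norm (x + t *\<^sub>R b)) \<longlongrightarrow> norm (x + 0 *\<^sub>R b)) (nhds (0::real))"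
    by (intro tendsto_intros filterlim_ident)
   show ?case
   proof (cases "norm x < 1")
    case True
    have "\<forall>\<^sub>F t in nhds (0::real). norm (x + t *\<^sub>R b) < 1" using c True by (intro order_tendstoD(2)) auto
    then have ev: "\<forall>\<^sub>F t in nhds (0::real). eta (x + t *\<^sub>R b) = 1 - (x + t *\<^sub>R b) \<bullet> (x + t *\<^sub>R b)"
     by eventually_elim (simp add: eta_def power2_norm_eq_inner)
    have "((%t. 1 - (x + t *\<^sub>R b) \<bullet> (x + t *\<^sub>R b)) has_real_derivative - 2 * (x \<bullet> b)) (at 0)"
     by (auto intro!: derivative_eq_intros simp: inner_commute has_field_derivative_def)
    then show ?thesis unfolding dder_def using True DERIV_cong_ev[OF refl ev refl] by (simp add: E_def)
   next
    case False
    then have "\<forall>\<^sub>F t in nhds (0::real). norm (x + t *\<^sub>R b) > 1" using c ne by (intro order_tendstoD(1)) auto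
    then have ev: "\<forall>\<^sub>F t in nhds (0::real). eta (x + t *\<^sub>R b) = 0" by eventually_elim (simp add: eta_def)
    then show ?thesis unfolding dder_def using False DERIV_cong_ev[OF refl ev refl] by (simp add: E_def)
   qed
  qed
 qed
 have [measurable]: "E \<in> borel_measurable borel" unfolding E_def[abs_def] by measurable
 have "0 = (LBINT x. v x * E x + D x * eta x)"
  by (rule integral_by_parts_llip[OF v _ d L _ _ _ de, where R=1, symmetric]) (auto simp: eta_def)
 also have "... = Bint (%x. (1 - (norm x)^2) * D x - 2 * ((x \<bullet> b) * v x))"
  unfolding Bint_def by (rule Bochner_Integration.integral_cong) (auto simp: E_def eta_def algebra_simps split: split_indicator)
 also have "... = Bint (%x. (1 - (norm x)^2) * D x) - Bint (%x. 2 * ((x \<bullet> b) * v x))"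
 proof (rule Bint_diff)
  show "Bi (%x. (1 - (norm x)^2) * D x)"
   by (rule Bi_mult_bounded[OF bD, where K=1]) (auto simp: power_le_one abs_square_le_1 abs_le_iff)
  show "Bi (%x. 2 * ((x \<bullet> b) * v x))" by (intro Bi_cmult llip_Bi llip_mult llip_inner v)
 qed
 finally show "Bint (%x. (1 - (norm x)^2) * D x) = 2 * Bint (%x. (x \<bullet> b) * v x)" by (simp add: Bint_cmult)
qed

text \<open>Divergence formula for the field v b + w c with divergence f. Testing with 1 - |x|^2
  avoids the flux through the sphere, and as f has degree 1 the weighted integral of f is 2/(n + 3)
  times the plain one.\<close>

lemma Bint_green:
 fixes v w :: "'a::euclidean_space => real"
 assumes v: "llip v" "D \<in> borel_measurable borel" "AE x in lborel. dder v b (D x) x"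
  and w: "llip w" "E \<in> borel_measurable borel" "AE x in lborel. dder w c (E x) x"
  and f: "f \<in> borel_measurable borel" "hom 1 f" "AE x in lborel. D x + E x = f x"
 shows "Bint f = (DIM('a) + 3) * Bint (%x. (x \<bullet> b) * v x + (x \<bullet> c) * w x)"
proof -
 note [measurable] = v(2) w(2) f(1)
 note A = Bint_quadratic_weight_ibp[OF v] and B = Bint_quadratic_weight_ibp[OF w]
 have m: "Bi (%x. (1 - (norm x)^2) * D x)" if "Bi D" "D \<in> borel_measurable borel" for D :: "'a => real"
  by (rule Bi_mult_bounded[OF that(1), where K=1]) (use that in \<open>auto simp: power_le_one abs_le_iff\<close>)
 have "Bi (%x. D x + E x)" using A(1) B(1) by (rule Bi_add)
 then have bf: "Bi f" 
  by (rule integrable_cong_AE_imp) (use f(3) in \<open>auto elim: eventually_mono\<close>)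
 have "Bint (%x. (1 - (norm x)^2) * f x) = Bint (%x. (1 - (norm x)^2) * D x + (1 - (norm x)^2) * E x)"
  by (rule Bint_cong_AE) (use f(3) in \<open>auto elim!: eventually_mono simp: distrib_left[symmetric]\<close>)
 also have "... = 2 * Bint (%x. (x \<bullet> b) * v x) + 2 * Bint (%x. (x \<bullet> c) * w x)"
  by (subst Bint_add[OF m[OF A(1)] m[OF B(1)]]) (auto simp: A(2) B(2))
 also have "... = 2 * Bint (%x. (x \<bullet> b) * v x + (x \<bullet> c) * w x)"
  by (subst Bint_add) (intro llip_Bi llip_mult llip_inner v w, intro llip_Bi llip_mult llip_inner v w, simp)
 also have "Bint (%x. (1 - (norm x)^2) * f x) = 2 / (1 + DIM('a) + 2) * Bint f"
  using layer_cake_quadratic[OF f(1) bf f(2)] by simp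
 finally show ?thesis by (simp add: field_simps)
qed

subsection \<open>The explicit homogeneous functions\<close>

declare csqrt.simps [simp del]

lemma quadrant_sum:
 assumes "Re a >= 0" "Im a >= 0" "Re b >= 0" "Im b >= 0"
 shows "cmod a <= cmod (a + b)"
proof -
 have "(Re a)^2 <= (Re a + Re b)^2" "(Im a)^2 <= (Im a + Im b)^2" using assms by (auto intro!: power_mono)
 then show ?thesis by (auto simp: cmod_def)
qed

text \<open>In the closed first quadrant |a| and |b| are both at most |a + b|, and a^2 - b^2 = (a -
  b)(a + b). For square roots a, b this says that the root is Lipschitz after multiplication by its
  modulus and that the 3/2 power is locally Lipschitz.\<close>

lemma quadrant_sqrt_lipschitz:
 assumes "Re a >= 0" "Im a >= 0" "Re b >= 0" "Im b >= 0"
 shows "cmod (a - b) * cmod b <= cmod (a\<^sup>2 - b\<^sup>2)"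
  and "cmod (a^3 - b^3) <= 3/2 * (cmod a + cmod b) * cmod (a\<^sup>2 - b\<^sup>2)"
proof -
 define m where "m = cmod (a + b)"
 have m: "cmod a <= m" "cmod b <= m" "0 <= m"
  using quadrant_sum[of a b] quadrant_sum[of b a] assms by (auto simp: m_def add.commute)
 have sq: "cmod (a\<^sup>2 - b\<^sup>2) = cmod (a - b) * m"
  unfolding m_def norm_mult[symmetric] by (simp add: power2_eq_square algebra_simps)
 show "cmod (a - b) * cmod b <= cmod (a\<^sup>2 - b\<^sup>2)" unfolding sq using m by (intro mult_left_mono) auto
 have "a^3 - b^3 = (a - b) * (a*a + a*b + b*b)" by (simp add: power3_eq_cube algebra_simps)
 then have "cmod (a^3 - b^3) = cmod (a - b) * cmod (a*a + a*b + b*b)" by (simp add: norm_mult)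
 also have "... <= cmod (a - b) * (3/2 * (cmod a + cmod b) * m)"
 proof (intro mult_left_mono norm_ge_zero)
  have "cmod (a*a + a*b + b*b) <= cmod a * cmod a + cmod a * cmod b + cmod b * cmod b"
   using norm_triangle_ineq[of "a*a + a*b" "b*b"] norm_triangle_ineq[of "a*a" "a*b"] by (simp add: norm_mult)
  also have "... <= cmod a * m + (cmod a * m + cmod b * m) / 2 + cmod b * m"
   using mult_left_mono[OF m(1) norm_ge_zero[of a]] mult_left_mono[OF m(2) norm_ge_zero[of a]]
    mult_left_mono[OF m(1) norm_ge_zero[of b]] mult_left_mono[OF m(2) norm_ge_zero[of b]] unfolding mult.commute[of "cmod b" "cmod a"] by argo
  also have "... = 3/2 * (cmod a + cmod b) * m" by (simp add: field_simps)
  finally show "cmod (a*a + a*b + b*b) <= 3/2 * (cmod a + cmod b) * m" .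
 qed
 finally show "cmod (a^3 - b^3) <= 3/2 * (cmod a + cmod b) * cmod (a\<^sup>2 - b\<^sup>2)" unfolding sq by (simp add: ac_simps)
qed

lemma sign_stable:
 assumes "x \<bullet> n ~= 0" shows "\<forall>\<^sub>F t in nhds (0::real). sgn ((x + t *\<^sub>R b) \<bullet> n) = sgn (x \<bullet> n)"
proof -
 have c: "((%t. (x + t *\<^sub>R b) \<bullet> n) \<longlongrightarrow> (x + 0 *\<^sub>R b) \<bullet> n) (nhds (0::real))"
  by (intro tendsto_intros filterlim_ident)
 show ?thesis
 proof (cases "x \<bullet> n > 0")
  case True
  then have "\<forall>\<^sub>F t in nhds (0::real). (x + t *\<^sub>R b) \<bullet> n > 0" using c by (intro order_tendstoD(1)) auto
  then show ?thesis by eventually_elim (use True in simp)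
 next
  case False
  then have "\<forall>\<^sub>F t in nhds (0::real). (x + t *\<^sub>R b) \<bullet> n < 0" using c assms by (intro order_tendstoD(2)) auto
  then show ?thesis by eventually_elim (use False assms in simp)
 qed
qed

text \<open>Off the hyperplane the sign of y . n is locally constant, so signs, positive parts and
  absolute values may be replaced by smooth expressions before differentiating.\<close>

lemma dder_sign_cong:
 assumes "x \<bullet> n ~= 0" "!!y. sgn (y \<bullet> n) = sgn (x \<bullet> n) ==> f y = g y" "dder g b D x"
 shows "dder f b D x"
proof -
 have "\<forall>\<^sub>F t in nhds (0::real). f (x + t *\<^sub>R b) = g (x + t *\<^sub>R b)"
  using sign_stable[OF assms(1), of b] by eventually_elim (rule assms(2))
 from DERIV_cong_ev[OF refl this refl] assms(3) show ?thesis by (simp add: dder_def)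
qed

lemma AE_inner_nonzero: "n ~= 0 ==> AE x in lborel. x \<bullet> (n::'a::euclidean_space) ~= 0"
proof -
 assume "n ~= 0"
 then have "negligible {x. n \<bullet> x = 0}" by (intro negligible_hyperplane) auto
 then have "{x. n \<bullet> x = 0} \<in> null_sets (completion lborel)" by (simp add: negligible_iff_null_sets)
 then have "{x. n \<bullet> x = 0} \<in> null_sets lborel" by (simp add: null_sets_completion_iff)
 from AE_not_in[OF this] show ?thesis by (auto simp: inner_commute)
qed

lemma Bint_pos:
 assumes "f \<in> borel_measurable borel" "Bi f" "!!x. norm x < 1 ==> f x >= 0" "open U" "U ~= {}" "U \<subseteq> ball 0 1" "!!x. x \<in> U ==> f x > 0"
 shows "Bint f > 0"
proof -
 have nn: "AE x in lborel. 0 <= indicator (ball 0 1) x * f x" using assms(3) by (auto split: split_indicator)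
 have "Bint f ~= 0"
 proof
  assume "Bint f = 0"
  then have "AE x in lborel. indicator (ball 0 1) x * f x = 0"
   using integral_nonneg_eq_0_iff_AE[OF assms(2) nn] by (simp add: Bint_def)
  then have "AE x in lborel. x \<notin> U"
   by eventually_elim (use assms(6,7) in \<open>fastforce split: split_indicator_asm\<close>)
  then have "U \<in> null_sets lborel" using assms(4) by (subst (asm) AE_iff_null_sets[symmetric]) auto
  then have "negligible U" by (simp add: negligible_iff_null_sets null_sets_completionI)
  then show False using open_not_negligible assms(4,5) by blast
 qed
 moreover have "Bint f >= 0" unfolding Bint_def by (rule integral_nonneg_AE[OF nn])
 ultimately show ?thesis by simp
qed

definition posn :: "'a::euclidean_space => 'a => real" where "posn n x = sqrt (max 0 (x \<bullet> n))"

text \<open>The function \<open>y\<^sub>+ powr (3/2)\<close> of \<open>y = x \<bullet> n\<close>.\<close>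

definition kf :: "'a::euclidean_space => 'a => real" where "kf n x = (posn n x) ^ 3"
definition kg :: "'a::euclidean_space => 'a => 'a" where "kg n x = (3/2 * posn n x) *\<^sub>R n"

lemma posn_borel [measurable]: "posn n \<in> borel_measurable borel" unfolding posn_def[abs_def] by measurable
lemma kf_borel [measurable]: "kf n \<in> borel_measurable borel" unfolding kf_def[abs_def] by measurable
lemma kg_borel [measurable]: "kg n \<in> borel_measurable borel" unfolding kg_def[abs_def] by measurable
lemma posn_nonneg: "posn n x >= 0" by (simp add: posn_def)
lemma posn_sq: "(posn n x)^2 = max 0 (x \<bullet> n)" by (simp add: posn_def)
lemma kf_nonneg: "kf n x >= 0" by (simp add: kf_def posn_nonneg)

lemma sqrt3_powr: "t > 0 ==> sqrt t ^ 3 = t powr (3/2)"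
 by (simp add: powr_half_sqrt[symmetric] powr_powr flip: powr_realpow)

lemma posn_scale: "t > 0 ==> posn n (t *\<^sub>R x) = sqrt t * posn n x"
 by (simp add: posn_def flip: real_sqrt_mult) (auto simp: max_def zero_le_mult_iff)

lemma kf_hom: "hom (3/2) (kf n)"
 by (rule hom_strict) (simp add: kf_def posn_scale power_mult_distrib sqrt3_powr)

lemma max0_sgn: "max 0 t = (if sgn t = 1 then t else 0)" for t :: real
 by (auto simp: sgn_if max_def)

lemma llip_max0: "llip (%x. max 0 (x \<bullet> n))"
 by (rule llip_compose[OF llip_inner]) auto

lemma posn_le: "posn n x <= 1 + norm x * norm n"
proof -
 have "(posn n x)^2 <= norm x * norm n"
  using Cauchy_Schwarz_ineq2[of x n] by (auto simp: posn_sq)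
 also have "... <= (1 + norm x * norm n)^2" by (simp add: power2_eq_square algebra_simps)
 finally show ?thesis by (rule power2_le_imp_le) simp
qed

lemma kf_llip: "llip (kf n)"
proof (rule llipI)
 fix R
 show "\<exists>K. \<forall>x y. norm x <= R --> norm y <= R --> abs (kf n x - kf n y) <= K * norm (x - y)"
 proof (intro exI allI impI)
  fix x y :: 'a assume x: "norm x <= R" and y: "norm y <= R"
  \<comment> \<open>The cubic estimate for the quadrant is reused for nonnegative reals; here the
    squares are the positive parts, which are Lipschitz.\<close>
  let ?a = "complex_of_real (posn n x)" and ?b = "complex_of_real (posn n y)"
  have "abs (kf n x - kf n y) = cmod (?a^3 - ?b^3)"
   unfolding of_real_power[symmetric] of_real_diff[symmetric] norm_of_real kf_def ..
  also have "... <= 3/2 * (cmod ?a + cmod ?b) * cmod (?a\<^sup>2 - ?b\<^sup>2)"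
   by (rule quadrant_sqrt_lipschitz) (auto simp: posn_nonneg)
  also have "cmod (?a\<^sup>2 - ?b\<^sup>2) = abs (max 0 (x \<bullet> n) - max 0 (y \<bullet> n))"
   unfolding of_real_power[symmetric] of_real_diff[symmetric] norm_of_real posn_sq ..
  also have "3/2 * (cmod ?a + cmod ?b) * ... <= 3/2 * ((1 + R * norm n) + (1 + R * norm n)) * (norm (x - y) * norm n)"
  proof (intro mult_mono add_mono order_refl)
   show "cmod ?a <= 1 + R * norm n" "cmod ?b <= 1 + R * norm n"
    using order_trans[OF posn_le, of x n] order_trans[OF posn_le, of y n] mult_right_mono[OF x norm_ge_zero[of n]]
     mult_right_mono[OF y norm_ge_zero[of n]] by (simp_all add: abs_of_nonneg[OF posn_nonneg])
   have "abs (max 0 (x \<bullet> n) - max 0 (y \<bullet> n)) <= abs ((x - y) \<bullet> n)" by (auto simp: inner_diff_left)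
   also have "... <= norm (x - y) * norm n" by (rule Cauchy_Schwarz_ineq2)
   finally show "abs (max 0 (x \<bullet> n) - max 0 (y \<bullet> n)) <= norm (x - y) * norm n" .
  qed (use order_trans[OF norm_ge_zero x] in \<open>auto intro!: mult_nonneg_nonneg add_nonneg_nonneg\<close>)
  finally show "abs (kf n x - kf n y) <= (3/2 * ((1 + R * norm n) + (1 + R * norm n)) * norm n) * norm (x - y)" by (simp add: ac_simps)
 qed
qed

lemma dder_inner: "dder (%x. x \<bullet> n) b (b \<bullet> n) x"
 unfolding dder_def by (auto intro!: derivative_eq_intros simp: inner_add_left)

lemma dder_kf: assumes "x \<bullet> n ~= 0" shows "dder (kf n) b (3/2 * posn n x * (b \<bullet> n)) x"
proof (cases "x \<bullet> n > 0")
 case True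
 show ?thesis
 proof (rule dder_sign_cong[OF assms, of _ "%x. sqrt (x \<bullet> n) ^ 3"])
  have s: "sqrt (x \<bullet> n) * sqrt (x \<bullet> n) = x \<bullet> n" using True by simp
  have "((%t. sqrt ((x + t *\<^sub>R b) \<bullet> n) ^ 3) has_real_derivative 3 * (b \<bullet> n * (inverse (sqrt (x \<bullet> n)) / 2) * (sqrt (x \<bullet> n))^2)) (at 0)"
   using True by (auto intro!: derivative_eq_intros simp: inner_add_left)
  also have "3 * (b \<bullet> n * (inverse (sqrt (x \<bullet> n)) / 2) * (sqrt (x \<bullet> n))^2) = 3/2 * posn n x * (b \<bullet> n)"
   using True by (simp add: posn_def max_def power2_eq_square field_simps flip: real_sqrt_mult)
  finally show "dder (%x. sqrt (x \<bullet> n) ^ 3) b (3/2 * posn n x * (b \<bullet> n)) x" by (simp add: dder_def)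
 qed (use True in \<open>auto simp: kf_def posn_def sgn_if max_def split: if_splits\<close>)
next
 case False
 show ?thesis
  by (rule dder_sign_cong[OF assms, of _ "%x. 0"])
    (use False assms in \<open>auto simp: kf_def posn_def sgn_if max_def dder_def split: if_splits\<close>)
qed

lemma kf_hsob: assumes "norm (n::'a::euclidean_space) = 1" shows "hsob (kf n) (kg n)"
 unfolding hsob_def
proof (intro conjI allI kf_hom sob_pair_llip kf_llip)
 have "n ~= 0" using assms by auto
 from AE_inner_nonzero[OF this] show "AE x in lborel. dder (kf n) b (kg n x \<bullet> b) x" for b
  by eventually_elim (drule dder_kf[of _ n b], simp add: kg_def inner_commute)
qed measurable

text \<open>The function k = y_+^(3/2) is subharmonic, which makes its energy nonpositive: the field
  k grad k = 3/2 y_+^2 n has divergence 3 y_+, whereas |grad k|^2 is only 9/4 y_+.\<close>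

lemma kf_energy:
 assumes n: "norm (n::'a::euclidean_space) = 1"
 shows "Bint (%x. (norm (kg n x))^2) <= 3/2 * (DIM('a) + 3) * Bint (%x. (kf n x)^2)"
proof -
 have n0: "n ~= 0" and nn: "n \<bullet> n = 1" using n by (auto simp: norm_eq_1)
 let ?m = "%x. max 0 (x \<bullet> n)"
 have "Bint (%x. 3 * ?m x) = (DIM('a) + 3) * Bint (%x. (x \<bullet> n) * (3/2 * (?m x * ?m x)) + (x \<bullet> 0) * 0)"
 proof (rule Bint_green)
  show "llip (%x. 3/2 * (?m x * ?m x))" by (intro llip_mult llip_const llip_max0)
  show "AE x in lborel. dder (%x. 3/2 * (?m x * ?m x)) n (3 * ?m x) x"
   using AE_inner_nonzero[OF n0]
  proof eventually_elim
   case (elim x)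
   show ?case
   proof (cases "x \<bullet> n > 0")
    case True
    have "dder (%x. 3/2 * ((x \<bullet> n) * (x \<bullet> n))) n (3 * ?m x) x"
     unfolding dder_def using True nn by (auto intro!: derivative_eq_intros simp: inner_add_left max_def)
    then show ?thesis
     by (rule dder_sign_cong[OF elim, rotated]) (use True in \<open>simp add: max0_sgn\<close>)
   next
    case False
    then have "sgn (x \<bullet> n) ~= 1" by (simp add: sgn_if)
    with False show ?thesis
     by (subst dder_sign_cong[OF elim, of _ "%x. 0"]) (simp_all add: max0_sgn dder_def)
   qed
  qed
  show "AE x in lborel. dder (%x. 0) 0 0 x" by (simp add: dder_def)
  show "hom 1 (%x. 3 * ?m x)" by (rule hom_strict) (auto simp: max_def zero_le_mult_iff)
 qed (auto simp: llip_const)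
 also have "(%x. (x \<bullet> n) * (3/2 * (?m x * ?m x)) + (x \<bullet> 0) * 0) = (%x. 3/2 * (kf n x)^2)"
 proof
  fix x
  have "(kf n x)^2 = ((posn n x)^2)^3" by (simp add: kf_def flip: power_mult)
  then show "(x \<bullet> n) * (3/2 * (?m x * ?m x)) + (x \<bullet> 0) * 0 = 3/2 * (kf n x)^2"
   by (auto simp: posn_sq power3_eq_cube max_def)
 qed
 finally have a: "Bint (%x. 3 * ?m x) = 3/2 * (DIM('a) + 3) * Bint (%x. (kf n x)^2)"
  unfolding Bint_cmult by (simp add: algebra_simps)
 have b: "Bi (%x. c * ?m x)" for c by (intro llip_Bi llip_mult llip_const llip_max0)
 have "Bint (%x. (norm (kg n x))^2) = Bint (%x. 9/4 * ?m x)"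
  using n by (intro Bint_cong) (simp add: kg_def abs_mult power_mult_distrib power_divide posn_sq)
 also have "... <= Bint (%x. 3 * ?m x)" by (intro Bint_mono b) auto
 finally show ?thesis using a by simp
qed

text \<open>\<open>hf e n x\<close> is the real part of \<open>(x \<bullet> e + \<i> abs (x \<bullet> n))\<close> to the power \<open>3/2\<close>, so the function \<open>h\<close> of the paper is \<open>hf\<close> for two coordinate directions.\<close>

definition zc :: "'a::euclidean_space => 'a => 'a => complex" where "zc e n x = Complex (x \<bullet> e) (abs (x \<bullet> n))"
definition qc :: "'a::euclidean_space => 'a => 'a => complex" where "qc e n x = csqrt (zc e n x)"
definition hf :: "'a::euclidean_space => 'a => 'a => real" where "hf e n x = Re (qc e n x ^ 3)"
definition hg :: "'a::euclidean_space => 'a => 'a => 'a" where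
 "hg e n x = (3/2 * Re (qc e n x)) *\<^sub>R e - (3/2 * Im (qc e n x) * sgn (x \<bullet> n)) *\<^sub>R n"

lemma qc_Re: "Re (qc e n x) = sqrt ((cmod (zc e n x) + x \<bullet> e) / 2)"
 by (simp add: qc_def csqrt.simps zc_def)

lemma qc_Im: "Im (qc e n x) = sqrt ((cmod (zc e n x) - x \<bullet> e) / 2)"
 by (auto simp: qc_def csqrt.simps zc_def)

lemma zc_norm: "cmod (zc e n x) = sqrt ((x \<bullet> e)^2 + (x \<bullet> n)^2)" by (simp add: zc_def cmod_def)

lemma qc_ge0: "Re (qc e n x) >= 0" "Im (qc e n x) >= 0"
proof -
 have "abs (x \<bullet> e) <= cmod (zc e n x)" unfolding zc_norm by (rule real_le_rsqrt) simp
 then show "Re (qc e n x) >= 0" "Im (qc e n x) >= 0" by (auto simp: qc_Re qc_Im)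
qed

lemma qc_sq: "(qc e n x)^2 = zc e n x" by (simp add: qc_def)

lemma qc_real:
 "(Re (qc e n x))^2 - (Im (qc e n x))^2 = x \<bullet> e" "2 * Re (qc e n x) * Im (qc e n x) = abs (x \<bullet> n)"
 "(Re (qc e n x))^2 + (Im (qc e n x))^2 = cmod (zc e n x)"
proof -
 have "Re ((qc e n x)^2) = x \<bullet> e" "Im ((qc e n x)^2) = abs (x \<bullet> n)" by (auto simp: qc_sq zc_def)
 then show "(Re (qc e n x))^2 - (Im (qc e n x))^2 = x \<bullet> e" "2 * Re (qc e n x) * Im (qc e n x) = abs (x \<bullet> n)"
  by (auto simp: power2_eq_square algebra_simps)
 show "(Re (qc e n x))^2 + (Im (qc e n x))^2 = cmod (zc e n x)"
  unfolding cmod_power2[symmetric] by (simp add: qc_def)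
qed

lemma hf_pq: "hf e n x = Re (qc e n x) * ((Re (qc e n x))^2 - 3 * (Im (qc e n x))^2)"
 by (simp add: hf_def power3_eq_cube power2_eq_square algebra_simps)

lemma hf_zq: "hf e n x = (x \<bullet> e) * Re (qc e n x) - abs (x \<bullet> n) * Im (qc e n x)"
 unfolding hf_pq qc_real(1)[of e n x, symmetric] qc_real(2)[of e n x, symmetric]
 by (simp add: power2_eq_square algebra_simps)

text \<open>On the thin space the number under the root is real, so the root is real or purely
  imaginary, and the real part of its cube is (Re q)^3 with Re q \<ge> 0.\<close>

lemma hf_thin: assumes "x \<bullet> n = 0" shows "hf e n x >= 0"
proof -
 have "Re (qc e n x) * Im (qc e n x) = 0" using qc_real(2)[of e n x] assms by simp
 then have "hf e n x = Re (qc e n x) * (Re (qc e n x))^2"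
  unfolding hf_pq by (auto simp: algebra_simps)
 then show ?thesis using qc_ge0[where x=x and e=e and n=n] by simp
qed

lemma zc_borel: "(%x. cmod (zc e n x)) \<in> borel_measurable borel" unfolding zc_norm by measurable
lemma qc_borel [measurable]: "(%x. Re (qc e n x)) \<in> borel_measurable borel" "(%x. Im (qc e n x)) \<in> borel_measurable borel"
 unfolding qc_Re qc_Im using zc_borel[of e n] by measurable

lemma hg_borel [measurable]: "hg e n \<in> borel_measurable borel"
 unfolding hg_def[abs_def] by measurable

lemma zc_scale: "t > 0 ==> cmod (zc e n (t *\<^sub>R x)) = t * cmod (zc e n x)"
 by (simp add: zc_norm power_mult_distrib real_sqrt_mult flip: distrib_left)

lemma qc_scale: "t > 0 ==> Re (qc e n (t *\<^sub>R x)) = sqrt t * Re (qc e n x)" "t > 0 ==> Im (qc e n (t *\<^sub>R x)) = sqrt t * Im (qc e n x)"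
 unfolding qc_Re qc_Im by (simp_all add: zc_scale flip: real_sqrt_mult) (simp_all add: algebra_simps)

lemma hf_hom: "hom (3/2) (hf e n)"
proof (rule hom_strict)
 fix t :: real and x :: 'a assume t: "t > 0"
 show "hf e n (t *\<^sub>R x) = t powr (3/2) *\<^sub>R hf e n x"
  unfolding hf_pq qc_scale[OF t] sqrt3_powr[OF t, symmetric] power_mult_distrib
  by (simp add: power2_eq_square power3_eq_cube algebra_simps del: real_sqrt_mult_self)
qed

section \<open>Regularity and energies of \<open>hf\<close> for an orthonormal pair\<close>

context
 fixes e n :: "'a::euclidean_space"
 assumes e: "norm e = 1" and n: "norm n = 1" and en: "e \<bullet> n = 0"
begin

lemma zc_lip: "cmod (zc e n x - zc e n y) <= 2 * norm (x - y)"
proof -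
 have "cmod (zc e n x - zc e n y) <= abs ((x - y) \<bullet> e) + abs ((abs (x \<bullet> n)) - abs (y \<bullet> n))"
  using cmod_le[of "zc e n x - zc e n y"] by (simp add: zc_def inner_diff_left)
 also have "... <= abs ((x - y) \<bullet> e) + abs ((x - y) \<bullet> n)" by (auto simp: inner_diff_left)
 also have "... <= 2 * norm (x - y)"
  using Cauchy_Schwarz_ineq2[of "x - y" e] Cauchy_Schwarz_ineq2[of "x - y" n] e n by simp
 finally show ?thesis .
qed

lemma qc_norm_le: "norm x <= R ==> cmod (qc e n x) <= sqrt (2 * R)"
 using zc_lip[of x 0] by (simp add: qc_def zc_def[of e n 0] zero_complex.code[symmetric])

lemma hf_llip: "llip (hf e n)"
proof (rule llipI)
 fix R
 show "\<exists>K. \<forall>x y. norm x <= R --> norm y <= R --> abs (hf e n x - hf e n y) <= K * norm (x - y)"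
 proof (intro exI allI impI)
  fix x y :: 'a assume x: "norm x <= R" and y: "norm y <= R"
  let ?a = "qc e n x" and ?b = "qc e n y"
  have "abs (hf e n x - hf e n y) <= cmod (?a^3 - ?b^3)"
   using abs_Re_le_cmod[of "?a^3 - ?b^3"] by (simp add: hf_def)
  also have "... <= 3/2 * (cmod ?a + cmod ?b) * cmod (?a\<^sup>2 - ?b\<^sup>2)"
   by (rule quadrant_sqrt_lipschitz) (auto simp: qc_ge0)
  also have "... <= 3/2 * (sqrt (2 * R) + sqrt (2 * R)) * (2 * norm (x - y))"
   using order_trans[OF norm_ge_zero x] unfolding qc_sq by (intro mult_mono add_mono qc_norm_le zc_lip x y) (auto intro: add_nonneg_nonneg)
  finally show "abs (hf e n x - hf e n y) <= (3/2 * (sqrt (2 * R) + sqrt (2 * R)) * 2) * norm (x - y)" by (simp add: ac_simps)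
 qed
qed

text \<open>The root \<open>qc\<close> itself is not Lipschitz near z = 0. The factor
  \<open>kf n\<close> is at most \<open>posn n\<close> squared times |q|, and multiplication by |q|
  is exactly what the quadrant estimate requires.\<close>

lemma kf_qc_llip:
 assumes F: "!!a b. abs (F a - F b) <= cmod (a - b)" and F0: "F 0 = (0::real)"
 shows "llip (%x. kf n x * F (qc e n x))"
proof (rule llipI)
 fix R
 obtain K where K: "K-lipschitz_on (cball 0 R) (kf n)" using kf_llip by (auto simp: llip_def)
 show "\<exists>K. \<forall>x y. norm x <= R --> norm y <= R --> abs (kf n x * F (qc e n x) - kf n y * F (qc e n y)) <= K * norm (x - y)"
 proof (intro exI allI impI)
  fix x y :: 'a assume x: "norm x <= R" and y: "norm y <= R"
  have R: "R >= 0" using x norm_ge_zero[of x] by linarith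
  let ?a = "qc e n x" and ?b = "qc e n y"
  have "abs (kf n x * F ?a - kf n y * F ?b) <= abs (kf n x - kf n y) * abs (F ?a) + kf n y * abs (F ?a - F ?b)"
   using abs_triangle_ineq[of "(kf n x - kf n y) * F ?a" "kf n y * (F ?a - F ?b)"] kf_nonneg[of n y]
   unfolding abs_mult abs_of_nonneg[OF kf_nonneg[of n y]] by (simp add: algebra_simps)
  also have "... <= (K * norm (x - y)) * sqrt (2 * R) + R * (2 * norm (x - y))"
  proof (rule add_mono)
   show "abs (kf n x - kf n y) * abs (F ?a) <= (K * norm (x - y)) * sqrt (2 * R)"
    using lipschitz_onD[OF K, of x y] x y F[of ?a 0] F0 qc_norm_le[OF x] lipschitz_on_nonneg[OF K]
    by (intro mult_mono) (auto simp: dist_norm)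
   have p: "posn n y <= cmod ?b"
   proof (rule power2_le_imp_le)
    show "(posn n y)^2 <= (cmod ?b)^2"
     unfolding posn_sq norm_power[symmetric] qc_sq using abs_Im_le_cmod[of "zc e n y"] by (auto simp: zc_def)
   qed simp
   have "kf n y * abs (F ?a - F ?b) <= ((posn n y)^2 * cmod ?b) * cmod (?a - ?b)"
    unfolding kf_def power3_eq_cube power2_eq_square by (intro mult_mono F p mult_nonneg_nonneg posn_nonneg order_refl) auto
   also have "... = (posn n y)^2 * (cmod (?a - ?b) * cmod ?b)" by simp
   also have "... <= R * (2 * norm (x - y))"
   proof (rule mult_mono)
    show "(posn n y)^2 <= R" using Cauchy_Schwarz_ineq2[of y n] n y R by (auto simp: posn_sq)
    have "cmod (?a - ?b) * cmod ?b <= cmod (?a\<^sup>2 - ?b\<^sup>2)" by (rule quadrant_sqrt_lipschitz) (auto simp: qc_ge0)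
    then show "cmod (?a - ?b) * cmod ?b <= 2 * norm (x - y)" using zc_lip[of x y] by (simp add: qc_sq)
   qed (use R in auto)
   finally show "kf n y * abs (F ?a - F ?b) <= R * (2 * norm (x - y))" .
  qed
  finally show "abs (kf n x * F ?a - kf n y * F ?b) <= (K * sqrt (2 * R) + R * 2) * norm (x - y)" by (simp add: algebra_simps)
 qed
qed

text \<open>Off the hyperplane z has positive imaginary part, so the principal root is holomorphic
  there and the chain rule gives z'/(2 q).\<close>

lemma qc_deriv:
 assumes "x \<bullet> n ~= 0"
 shows "((%t. qc e n (x + t *\<^sub>R b)) has_vector_derivative Complex (b \<bullet> e) (sgn (x \<bullet> n) * (b \<bullet> n)) / (2 * qc e n x)) (at 0)"
proof -
 have a: "((%t. abs ((x + t *\<^sub>R b) \<bullet> n)) has_real_derivative sgn (x \<bullet> n) * (b \<bullet> n)) (at 0)"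
 proof -
  have "dder (%y. sgn (x \<bullet> n) * (y \<bullet> n)) b (sgn (x \<bullet> n) * (b \<bullet> n)) x"
   unfolding dder_def by (auto intro!: derivative_eq_intros simp: inner_add_left)
  then have "dder (%y. abs (y \<bullet> n)) b (sgn (x \<bullet> n) * (b \<bullet> n)) x"
   by (rule dder_sign_cong[OF assms, rotated]) (simp add: abs_sgn mult.commute)
  then show ?thesis by (simp add: dder_def)
 qed
 have b: "((%t. zc e n (x + t *\<^sub>R b)) has_vector_derivative Complex (b \<bullet> e) (sgn (x \<bullet> n) * (b \<bullet> n))) (at 0)"
  unfolding has_vector_derivative_complex_iff zc_def using a dder_inner[of e b x] by (simp add: dder_def)
 have "zc e n (x + 0 *\<^sub>R b) \<notin> \<real>\<^sub>\<le>\<^sub>0" using assms by (auto simp: zc_def complex_nonpos_Reals_iff)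
 from field_vector_diff_chain_at[OF b has_field_derivative_csqrt[OF this]]
 show ?thesis unfolding o_def qc_def[symmetric] divide_inverse scaleR_zero_left add_0_right .
qed

lemma dder_qc:
 assumes "x \<bullet> n ~= 0"
 shows "dder (%x. Re (qc e n x)) e (Re (qc e n x) / (2 * cmod (zc e n x))) x"
  and "dder (%x. Im (qc e n x)) n (sgn (x \<bullet> n) * Re (qc e n x) / (2 * cmod (zc e n x))) x"
  and "dder (hf e n) b (hg e n x \<bullet> b) x"
proof -
 define q where "q = qc e n x"
 have q0: "q ~= 0" using qc_real(2)[of e n x] assms by (auto simp: q_def)
 \<comment> \<open>From |q|^2 = |z|; it turns the complex quotient z'/(2 q) into real and imaginary
   parts over the real number 2 |z|.\<close>
 have i: "inverse q = cnj q / cmod (zc e n x)"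
 proof -
  have "q * cnj q = cmod (zc e n x)" unfolding complex_norm_square[symmetric] q_def norm_power[symmetric] qc_sq ..
  moreover have "cmod (zc e n x) ~= 0" using q0 qc_real(3)[of e n x]
   unfolding q_def complex_eq_iff by (metis sum_power2_eq_zero_iff zero_complex.sel)
  ultimately show ?thesis using q0 by (simp add: field_simps)
 qed
 have ee: "e \<bullet> e = 1" "n \<bullet> n = 1" "n \<bullet> e = 0" using e n en by (auto simp: norm_eq_1 inner_commute)
 have D: "Complex u v / (2 * q) = Complex u v * cnj q / (2 * cmod (zc e n x))" for u v
 proof -
  have "Complex u v / (2 * q) = Complex u v * inverse q / 2" by (simp only: divide_inverse inverse_mult_distrib mult.assoc mult.commute[of "inverse 2"])
  also have "... = Complex u v * cnj q / (2 * cmod (zc e n x))" unfolding i times_divide_eq_right divide_divide_eq_left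
   by (simp only: of_real_mult of_real_numeral mult.commute[of _ 2])
  finally show ?thesis .
 qed
 show "dder (%x. Re (qc e n x)) e (Re (qc e n x) / (2 * cmod (zc e n x))) x"
  using has_field_derivative_Re[OF qc_deriv[OF assms, of e]]
  unfolding q_def[symmetric] D Re_divide_of_real dder_def by (simp add: ee en q_def)
 show "dder (%x. Im (qc e n x)) n (sgn (x \<bullet> n) * Re (qc e n x) / (2 * cmod (zc e n x))) x"
  using has_field_derivative_Im[OF qc_deriv[OF assms, of n]]
  unfolding q_def[symmetric] D Im_divide_of_real dder_def by (simp add: ee en q_def)
 have "((%t. qc e n (x + t *\<^sub>R b) ^ 3) has_vector_derivative Complex (b \<bullet> e) (sgn (x \<bullet> n) * (b \<bullet> n)) / (2 * q) * (3 * q\<^sup>2)) (at 0)"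
 proof -
  have "((%z. z ^ 3) has_field_derivative 3 * q\<^sup>2) (at (qc e n (x + 0 *\<^sub>R b)))"
   by (auto intro!: derivative_eq_intros simp: q_def)
  from field_vector_diff_chain_at[OF qc_deriv[OF assms, of b] this] show ?thesis unfolding o_def q_def .
 qed
 also have "Complex (b \<bullet> e) (sgn (x \<bullet> n) * (b \<bullet> n)) / (2 * q) * (3 * q\<^sup>2) = 3/2 * (Complex (b \<bullet> e) (sgn (x \<bullet> n) * (b \<bullet> n)) * q)"
  using q0 by (simp add: power2_eq_square)
 finally have "((%t. hf e n (x + t *\<^sub>R b)) has_real_derivative Re (3/2 * (Complex (b \<bullet> e) (sgn (x \<bullet> n) * (b \<bullet> n)) * q))) (at 0)"
  unfolding hf_def by (rule has_field_derivative_Re)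
 also have "Re (3/2 * (Complex (b \<bullet> e) (sgn (x \<bullet> n) * (b \<bullet> n)) * q)) = hg e n x \<bullet> b"
  unfolding hg_def q_def inner_diff_left inner_scaleR_left inner_commute[of e b] inner_commute[of n b] by (simp add: field_simps)
 finally show "dder (hf e n) b (hg e n x \<bullet> b) x" unfolding dder_def .
qed

lemma n_nonzero: "n ~= 0" using n by auto

lemma hf_hsob: "hsob (hf e n) (hg e n)"
 unfolding hsob_def
proof (intro conjI allI hf_hom sob_pair_llip hf_llip)
 from AE_inner_nonzero[OF n_nonzero] show "AE x in lborel. dder (hf e n) b (hg e n x \<bullet> b) x" for b
  by eventually_elim (rule dder_qc(3))
qed measurable

text \<open>Green's formula for the field hf grad hf: off the hyperplane \<open>hf\<close> is
  harmonic, so the divergence is |grad hf|^2, and across the hyperplane the normal component is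
  continuous because hf times the normal derivative vanishes there. The Euler identity then
  evaluates the radial part as 3/2 hf^2.\<close>

lemma hf_energy: "Bint (%x. (norm (hg e n x))^2) = 3/2 * (DIM('a) + 3) * Bint (%x. (hf e n x)^2)"
proof -
 note [measurable] = llip_borel[OF hf_llip] zc_borel
 let ?s = "%x. cmod (zc e n x)" and ?p = "%x. Re (qc e n x)" and ?q = "%x. Im (qc e n x)"
 have ee: "e \<bullet> e = 1" "n \<bullet> n = 1" "n \<bullet> e = 0" using e n en by (auto simp: norm_eq_1 inner_commute)
 have ls: "llip ?s"
  by (rule llipI, rule exI[of _ 2]) (use zc_lip norm_triangle_ineq3 order_trans in blast)
 have sp: "(?p x)^2 = (?s x + x \<bullet> e) / 2" "(?q x)^2 = (?s x - x \<bullet> e) / 2" for x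
  using qc_real(1,3)[of e n x] by auto
 \<comment> \<open>Products of two half-integer powers are expressed through x . e, x . n and |z|,
   so both field components are visibly locally Lipschitz, also across the hyperplane.\<close>
 have hp: "3/2 * (hf e n x * ?p x) = 3/4 * ((?s x + x \<bullet> e) * (2 * (x \<bullet> e) - ?s x))" for x
 proof -
  have "hf e n x * ?p x = (?p x)^2 * ((?p x)^2 - 3 * (?q x)^2)" by (simp add: hf_pq power2_eq_square)
  then show ?thesis unfolding sp by (simp add: field_simps)
 qed
 have hq: "- (3/2) * (hf e n x * (sgn (x \<bullet> n) * ?q x)) = - (3/4) * ((x \<bullet> n) * (2 * (x \<bullet> e) - ?s x))" for x
 proof -
  have "hf e n x * ?q x = (?p x * ?q x) * ((?p x)^2 - 3 * (?q x)^2)" by (simp add: hf_pq)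
  also have "... = abs (x \<bullet> n) / 2 * (2 * (x \<bullet> e) - ?s x)"
   unfolding sp qc_real(2)[of e n x, symmetric] by (simp add: field_simps)
  finally show ?thesis by (auto simp: sgn_if abs_if)
 qed
 let ?D = "%x. 3/2 * (hf e n x * (?p x / (2 * ?s x)) + (3/2 * ?p x) * ?p x)"
 let ?E = "%x. - (3/2) * (hf e n x * (?p x / (2 * ?s x)) + (- (3/2) * ?q x * sgn (x \<bullet> n)) * (sgn (x \<bullet> n) * ?q x))"
 have "Bint (%x. 9/4 * ?s x) = (DIM('a) + 3) * Bint (%x. (x \<bullet> e) * (3/2 * (hf e n x * ?p x)) + (x \<bullet> n) * (- (3/2) * (hf e n x * (sgn (x \<bullet> n) * ?q x))))"
 proof (rule Bint_green[where D="?D" and E="?E"])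
  show "llip (%x. 3/2 * (hf e n x * ?p x))" unfolding hp by (intro llip_mult llip_const llip_add llip_diff llip_inner ls)
  show "llip (%x. - (3/2) * (hf e n x * (sgn (x \<bullet> n) * ?q x)))" unfolding hq by (intro llip_mult llip_const llip_add llip_diff llip_inner ls)
  show "AE x in lborel. dder (%x. 3/2 * (hf e n x * ?p x)) e (?D x) x"
   using AE_inner_nonzero[OF n_nonzero]
  proof eventually_elim
   case (elim x)
   have "dder (%x. hf e n x * ?p x) e (hf e n x * (?p x / (2 * ?s x)) + (hg e n x \<bullet> e) * ?p x) x"
    by (intro dder_mult dder_qc elim)
   also have "hg e n x \<bullet> e = 3/2 * ?p x" using ee en by (simp add: hg_def inner_diff_left)
   finally show ?case unfolding dder_def by (rule DERIV_cmult)
  qed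
  show "AE x in lborel. dder (%x. - (3/2) * (hf e n x * (sgn (x \<bullet> n) * ?q x))) n (?E x) x"
   using AE_inner_nonzero[OF n_nonzero]
  proof eventually_elim
   case (elim x)
   have ss: "sgn (x \<bullet> n) * sgn (x \<bullet> n) = 1" using elim by (auto simp: sgn_if)
   have "dder (%y. sgn (x \<bullet> n) * ?q y) n (sgn (x \<bullet> n) * (sgn (x \<bullet> n) * ?p x / (2 * ?s x))) x"
    using dder_qc(2)[OF elim] unfolding dder_def by (rule DERIV_cmult)
   also have "sgn (x \<bullet> n) * (sgn (x \<bullet> n) * ?p x / (2 * ?s x)) = ?p x / (2 * ?s x)"
    unfolding mult.assoc[symmetric] times_divide_eq_right ss by simp
   finally have "dder (%y. sgn (y \<bullet> n) * ?q y) n (?p x / (2 * ?s x)) x"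
    by (rule dder_sign_cong[OF elim, rotated]) simp
   then have "dder (%x. hf e n x * (sgn (x \<bullet> n) * ?q x)) n (hf e n x * (?p x / (2 * ?s x)) + (hg e n x \<bullet> n) * (sgn (x \<bullet> n) * ?q x)) x"
    by (intro dder_mult dder_qc elim)
   also have "hg e n x \<bullet> n = - (3/2) * ?q x * sgn (x \<bullet> n)" using ee en by (simp add: hg_def inner_diff_left)
   finally show ?case unfolding dder_def by (rule DERIV_cmult)
  qed
  show "AE x in lborel. ?D x + ?E x = 9/4 * ?s x"
   using AE_inner_nonzero[OF n_nonzero]
  proof eventually_elim
   case (elim x)
   have ss: "sgn (x \<bullet> n) * sgn (x \<bullet> n) = 1" using elim by (auto simp: sgn_if)
   have "?D x + ?E x = 9/4 * ((?p x)^2 + (?q x)^2 * (sgn (x \<bullet> n) * sgn (x \<bullet> n)))"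
    by (simp add: power2_eq_square algebra_simps)
   then show ?case unfolding ss qc_real(3)[of e n x, symmetric] by simp
  qed
  show "hom 1 (%x. 9/4 * ?s x)" by (rule hom_strict) (simp add: zc_scale)
 qed measurable
 also have "(%x. (x \<bullet> e) * (3/2 * (hf e n x * ?p x)) + (x \<bullet> n) * (- (3/2) * (hf e n x * (sgn (x \<bullet> n) * ?q x)))) = (%x. 3/2 * (hf e n x)^2)"
 proof
  fix x
  have a: "(x \<bullet> n) * sgn (x \<bullet> n) = abs (x \<bullet> n)" by (simp add: abs_sgn)
  have "(x \<bullet> e) * (3/2 * (hf e n x * ?p x)) + (x \<bullet> n) * (- (3/2) * (hf e n x * (sgn (x \<bullet> n) * ?q x)))
   = 3/2 * hf e n x * ((x \<bullet> e) * ?p x - ((x \<bullet> n) * sgn (x \<bullet> n)) * ?q x)" by (simp add: algebra_simps)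
  then show "(x \<bullet> e) * (3/2 * (hf e n x * ?p x)) + (x \<bullet> n) * (- (3/2) * (hf e n x * (sgn (x \<bullet> n) * ?q x))) = 3/2 * (hf e n x)^2"
   unfolding a hf_zq[symmetric] by (simp add: power2_eq_square)
 qed
 also have "Bint (%x. 9/4 * ?s x) = Bint (%x. (norm (hg e n x))^2)"
 proof (rule Bint_cong_AE)
  show "AE x in lborel. norm x < 1 --> 9/4 * ?s x = (norm (hg e n x))^2"
   using AE_inner_nonzero[OF n_nonzero]
  proof eventually_elim
   case (elim x)
   have ss: "sgn (x \<bullet> n) * sgn (x \<bullet> n) = 1" using elim by (auto simp: sgn_if)
   have "(norm (hg e n x))^2 = 9/4 * ((?p x)^2 + (?q x)^2 * (sgn (x \<bullet> n) * sgn (x \<bullet> n)))"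
    unfolding power2_norm_eq_inner hg_def using ee en
    by (simp add: inner_diff_left inner_diff_right power2_eq_square algebra_simps)
   then show ?case unfolding ss qc_real(3)[of e n x, symmetric] by simp
  qed
 qed measurable
 finally show ?thesis unfolding Bint_cmult by simp
qed

text \<open>Green's formula for the field kf grad hf. As \<open>hf\<close> is harmonic where
  \<open>kf\<close> lives and \<open>kf\<close> vanishes on the hyperplane, the divergence is grad
  kf . grad hf with no jump, and the radial component is 3/2 kf hf.\<close>

lemma kf_hf_energy: "Bint (%x. hg e n x \<bullet> kg n x) = 3/2 * (DIM('a) + 3) * Bint (%x. hf e n x * kf n x)"
proof -
 note [measurable] = llip_borel[OF hf_llip] zc_borel
 let ?s = "%x. cmod (zc e n x)" and ?p = "%x. Re (qc e n x)" and ?q = "%x. Im (qc e n x)"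
 have ee: "e \<bullet> e = 1" "n \<bullet> n = 1" "n \<bullet> e = 0" using e n en by (auto simp: norm_eq_1 inner_commute)
 have hk: "hg e n x \<bullet> kg n x = - (9/4) * (posn n x * ?q x)" for x
  using ee en by (cases "x \<bullet> n > 0") (auto simp: hg_def kg_def inner_diff_left posn_def max_def)
 let ?D = "%x. 3/2 * (kf n x * (?p x / (2 * ?s x)))"
 let ?E = "%x. - (3/2) * (kf n x * (?p x / (2 * ?s x)) + (3/2 * posn n x) * ?q x)"
 have "Bint (%x. - (9/4) * (posn n x * ?q x)) = (DIM('a) + 3) * Bint (%x. (x \<bullet> e) * (3/2 * (kf n x * ?p x)) + (x \<bullet> n) * (- (3/2) * (kf n x * ?q x)))"
 proof (rule Bint_green[where D="?D" and E="?E"])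
  show "llip (%x. 3/2 * (kf n x * ?p x))"
   by (intro llip_mult[OF llip_const] kf_qc_llip) (use abs_Re_le_cmod[of "_ - _"] in auto)
  show "llip (%x. - (3/2) * (kf n x * ?q x))"
   by (intro llip_mult[OF llip_const] kf_qc_llip) (use abs_Im_le_cmod[of "_ - _"] in auto)
  show "AE x in lborel. dder (%x. 3/2 * (kf n x * ?p x)) e (?D x) x"
   using AE_inner_nonzero[OF n_nonzero]
  proof eventually_elim
   case (elim x)
   have "dder (%x. kf n x * ?p x) e (kf n x * (?p x / (2 * ?s x)) + (3/2 * posn n x * (e \<bullet> n)) * ?p x) x"
    by (intro dder_mult dder_qc dder_kf elim)
   also have "kf n x * (?p x / (2 * ?s x)) + (3/2 * posn n x * (e \<bullet> n)) * ?p x = kf n x * (?p x / (2 * ?s x))" using en by simp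
   finally show ?case unfolding dder_def by (rule DERIV_cmult)
  qed
  show "AE x in lborel. dder (%x. - (3/2) * (kf n x * ?q x)) n (?E x) x"
   using AE_inner_nonzero[OF n_nonzero]
  proof eventually_elim
   case (elim x)
   have "dder (%x. kf n x * ?q x) n (kf n x * (sgn (x \<bullet> n) * ?p x / (2 * ?s x)) + (3/2 * posn n x * (n \<bullet> n)) * ?q x) x"
    by (intro dder_mult dder_qc dder_kf elim)
   also have "kf n x * (sgn (x \<bullet> n) * ?p x / (2 * ?s x)) = kf n x * (?p x / (2 * ?s x))"
    using elim by (cases "x \<bullet> n > 0") (auto simp: kf_def posn_def max_def)
   finally show ?case unfolding dder_def ee mult_1_right by (rule DERIV_cmult)
  qed
  show "AE x in lborel. ?D x + ?E x = - (9/4) * (posn n x * ?q x)" by (simp add: algebra_simps)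
  show "hom 1 (%x. - (9/4) * (posn n x * ?q x))"
  proof (rule hom_strict)
   fix t :: real and x :: 'a assume t: "t > 0"
   have "sqrt t * sqrt t = t" using t by simp
   then show "- (9/4) * (posn n (t *\<^sub>R x) * ?q (t *\<^sub>R x)) = t powr 1 *\<^sub>R (- (9/4) * (posn n x * ?q x))"
    unfolding posn_scale[OF t] qc_scale[OF t] using t by (simp add: algebra_simps)
  qed
 qed measurable
 also have "(%x. (x \<bullet> e) * (3/2 * (kf n x * ?p x)) + (x \<bullet> n) * (- (3/2) * (kf n x * ?q x))) = (%x. 3/2 * (hf e n x * kf n x))"
 proof
  fix x
  have "kf n x * (x \<bullet> n) = kf n x * abs (x \<bullet> n)" by (cases "x \<bullet> n > 0") (auto simp: kf_def posn_def max_def)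
  then have "kf n x * (x \<bullet> n) * ?q x = kf n x * abs (x \<bullet> n) * ?q x" by simp
  then show "(x \<bullet> e) * (3/2 * (kf n x * ?p x)) + (x \<bullet> n) * (- (3/2) * (kf n x * ?q x)) = 3/2 * (hf e n x * kf n x)"
   unfolding hf_zq by (auto simp: algebra_simps)
 qed
 finally show ?thesis unfolding hk Bint_cmult by simp
qed

text \<open>Integrating by parts with the weight 1 - |x|^2 rewrites twice the moment as a weighted
  integral of the derivative of \<open>hf\<close> along e, which is 3/2 Re q and positive off the
  hyperplane.\<close>

lemma hf_moment_pos: "Bint (%x. (x \<bullet> e) * hf e n x) > 0"
proof -
 have ee: "e \<bullet> e = 1" "n \<bullet> n = 1" "n \<bullet> e = 0" using e n en by (auto simp: norm_eq_1 inner_commute)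
 have d: "AE x in lborel. dder (hf e n) e (3/2 * Re (qc e n x)) x"
  using AE_inner_nonzero[OF n_nonzero]
 proof eventually_elim
  case (elim x)
  have "hg e n x \<bullet> e = 3/2 * Re (qc e n x)" using ee by (simp add: hg_def inner_diff_left)
  then show ?case using dder_qc(3)[OF elim, of e] by (simp only:)
 qed
 have m: "(%x. 3/2 * Re (qc e n x)) \<in> borel_measurable borel" by measurable
 note A = Bint_quadratic_weight_ibp[OF hf_llip m d]
 have "Bint (%x. (1 - (norm x)^2) * (3/2 * Re (qc e n x))) > 0"
 proof (rule Bint_pos[where U="ball 0 1 \<inter> {x. x \<bullet> n > 0}"])
  show "Bi (%x. (1 - (norm x)^2) * (3/2 * Re (qc e n x)))"
   by (rule Bi_mult_bounded[OF A(1), where K=1]) (auto simp: power_le_one abs_le_iff)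
  show "0 <= (1 - (norm x)^2) * (3/2 * Re (qc e n x))" if "norm x < 1" for x
   using that qc_ge0(1)[of e n x] by (intro mult_nonneg_nonneg) (auto simp: power_le_one)
  show "open (ball 0 1 \<inter> {x. x \<bullet> n > 0})" by (intro open_Int open_ball open_Collect_less continuous_intros)
  show "ball 0 1 \<inter> {x. x \<bullet> n > 0} ~= {}" using n ee by (intro ex_in_conv[THEN iffD1] exI[of _ "(1/2) *\<^sub>R n"]) auto
  show "0 < (1 - (norm x)^2) * (3/2 * Re (qc e n x))" if "x \<in> ball 0 1 \<inter> {x. x \<bullet> n > 0}" for x
  proof -
   have "Re (qc e n x) ~= 0" using qc_real(2)[of e n x] that by auto
   then have "Re (qc e n x) > 0" using qc_ge0(1)[of e n x] by simp
   moreover have "(norm x)^2 < 1" using that by (simp add: power_less_one_iff abs_square_less_1)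
   ultimately show ?thesis by simp
  qed
 qed (use m in auto)
 then show ?thesis unfolding A(2) by simp
qed

end

subsection \<open>The comparison function\<close>

lemma hsob_Bi:
 assumes "hsob v g" "hsob w k"
 shows "Bi (%x. v x * w x)" "Bi (%x. g x \<bullet> k x)" "Bi v" "Bi (%x. (x \<bullet> b) * v x)"
proof -
 have p: "sob_pair 1 v g" and r: "sob_pair 1 w k" using assms by (auto simp: hsob_def)
 note [measurable] = sob_pairD(1,2)[OF p] sob_pairD(1,2)[OF r]
 have am: "abs (s * t) <= s\<^sup>2 + t\<^sup>2" for s t :: real
  using zero_le_power2[of "abs s - abs t"] zero_le_power2[of s] zero_le_power2[of t] unfolding power2_diff abs_mult power2_abs
  by linarith
 show "Bi (%x. v x * w x)"
  by (rule Bi_bound[OF Bi_add[OF Bi_sq(1)[OF p] Bi_sq(1)[OF r]]]) (auto intro: am)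
 show "Bi (%x. g x \<bullet> k x)"
  by (rule Bi_bound[OF Bi_add[OF Bi_sq(2)[OF p] Bi_sq(2)[OF r]]])
    (auto intro: order_trans[OF Cauchy_Schwarz_ineq2] order_trans[OF abs_ge_self am])
 show bv: "Bi v"
  by (rule Bi_bound[OF Bi_add[OF Bi_sq(1)[OF p] Bi_bounded[of "%x. 1\<^sup>2" 1]]]) (use am[of _ 1] in auto)
 show "Bi (%x. (x \<bullet> b) * v x)"
 proof (rule Bi_mult_bounded[OF bv, where K="norm b"])
  fix x :: 'a assume "norm x < 1"
  then have "norm x * norm b <= 1 * norm b" by (intro mult_right_mono) auto
  then show "abs (x \<bullet> b) <= norm b" using Cauchy_Schwarz_ineq2[of x b] by linarith
 qed auto
qed

text \<open>For \<open>3/2\<close>-homogeneous functions, \<open>bf v g v g\<close> is the boundary adjusted energy: the integral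
 of \<open>v\<^sup>2\<close> over the sphere is \<open>DIM('a) + 3\<close> times that over the ball.\<close>

definition bf :: "('a::euclidean_space => real) => ('a => 'a) => ('a => real) => ('a => 'a) => real" where
 "bf v g w k = Bint (%x. g x \<bullet> k x) - 3/2 * (DIM('a) + 3) * Bint (%x. v x * w x)"

lemma bf_sym: "bf v g w k = bf w k v g"
 by (simp add: bf_def inner_commute mult.commute)

lemma bf_self: "bf v g v g = Bint (%x. (norm (g x))^2) - 3/2 * (DIM('a) + 3) * Bint (%x. (v (x::'a::euclidean_space))^2)"
 by (simp only: bf_def power2_norm_eq_inner power2_eq_square[of "v _"])

lemma bf_lin:
 assumes "hsob v g" "hsob v' g'" "hsob w k"
 shows "bf (%x. a * v x + c * v' x) (%x. a *\<^sub>R g x + c *\<^sub>R g' x) w k = a * bf v g w k + c * bf v' g' w k"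
proof -
 have "Bint (%x. (a *\<^sub>R g x + c *\<^sub>R g' x) \<bullet> k x) = a * Bint (%x. g x \<bullet> k x) + c * Bint (%x. g' x \<bullet> k x)"
  unfolding inner_add_left inner_scaleR_left
  by (subst Bint_add[OF Bi_cmult[OF hsob_Bi(2)[OF assms(1,3)]] Bi_cmult[OF hsob_Bi(2)[OF assms(2,3)]]]) (simp only: Bint_cmult)
 moreover have "Bint (%x. (a * v x + c * v' x) * w x) = a * Bint (%x. v x * w x) + c * Bint (%x. v' x * w x)"
  unfolding distrib_right mult.assoc
  by (subst Bint_add[OF Bi_cmult[OF hsob_Bi(1)[OF assms(1,3)]] Bi_cmult[OF hsob_Bi(1)[OF assms(2,3)]]]) (simp only: Bint_cmult)
 ultimately show ?thesis by (simp add: bf_def algebra_simps)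
qed

lemma bf_lin_right:
 assumes "hsob v g" "hsob v' g'" "hsob w k"
 shows "bf w k (%x. a * v x + c * v' x) (%x. a *\<^sub>R g x + c *\<^sub>R g' x) = a * bf w k v g + c * bf w k v' g'"
 using bf_lin[OF assms] by (simp add: bf_sym)

lemma moment_lincomb:
 assumes "hsob v g" "hsob v' g'"
 shows "Bint (%x. (x \<bullet> b) * (a * v x + c * v' x)) = a * Bint (%x. (x \<bullet> b) * v x) + c * Bint (%x. (x \<bullet> b) * v' x)"
  "Bint (%x. a * v x + c * v' x) = a * Bint v + c * Bint v'"
proof -
 have "(%x. (x \<bullet> b) * (a * v x + c * v' x)) = (%x. a * ((x \<bullet> b) * v x) + c * ((x \<bullet> b) * v' x))"
  by (simp add: algebra_simps)
 then show "Bint (%x. (x \<bullet> b) * (a * v x + c * v' x)) = a * Bint (%x. (x \<bullet> b) * v x) + c * Bint (%x. (x \<bullet> b) * v' x)"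
  using Bint_add[OF Bi_cmult[OF hsob_Bi(4)[OF assms(1,2)]] Bi_cmult[OF hsob_Bi(4)[OF assms(2,1)]]] by (simp add: Bint_cmult)
 show "Bint (%x. a * v x + c * v' x) = a * Bint v + c * Bint v'"
  using Bint_add[OF Bi_cmult[OF hsob_Bi(3)[OF assms(1,2)]] Bi_cmult[OF hsob_Bi(3)[OF assms(2,1)]]] by (simp add: Bint_cmult)
qed

text \<open>First moments depend linearly on the direction, hence come from a vector. This allows
  decomposing them along an adapted orthonormal pair instead of the coordinate basis.\<close>

lemma moment_vector:
 fixes v :: "'a::euclidean_space => real"
 assumes h: "hsob v g"
 shows "\<exists>M. \<forall>w. Bint (%x. (x \<bullet> w) * v x) = M \<bullet> w"
proof (intro exI allI)
 fix w
 have "Bint (%x. (x \<bullet> w) * v x) = (LBINT x. (\<Sum>b\<in>Basis. (b \<bullet> w) * (indicator (ball 0 1) x * ((x \<bullet> b) * v x))))"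
  unfolding Bint_def
 proof (rule Bochner_Integration.integral_cong[OF refl])
  fix x :: 'a
  have "x \<bullet> w = (\<Sum>b\<in>Basis. (b \<bullet> w) * (x \<bullet> b))" 
   unfolding euclidean_inner[of x w] by (simp add: inner_commute mult.commute)
  then show "indicator (ball 0 1) x * ((x \<bullet> w) * v x) = (\<Sum>b\<in>Basis. (b \<bullet> w) * (indicator (ball 0 1) x * ((x \<bullet> b) * v x)))"
   by (simp add: sum_distrib_left sum_distrib_right ac_simps)
 qed
 also have "... = (\<Sum>b\<in>Basis. (b \<bullet> w) * Bint (%x. (x \<bullet> b) * v x))"
  unfolding Bint_def by (subst Bochner_Integration.integral_sum) (auto intro!: integrable_mult_right hsob_Bi(4)[OF h h])
 finally show "Bint (%x. (x \<bullet> w) * v x) = (\<Sum>b\<in>Basis. Bint (%x. (x \<bullet> b) * v x) *\<^sub>R b) \<bullet> w"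
  by (simp add: inner_sum_left mult.commute)
qed

lemma moment_add: 
 assumes h: "hsob v g"
 shows "Bint (%x. (x \<bullet> (s *\<^sub>R a + t *\<^sub>R b + c)) * v x) =
  s * Bint (%x. (x \<bullet> a) * v x) + t * Bint (%x. (x \<bullet> b) * v x) + Bint (%x. (x \<bullet> c) * v x)"
proof -
 obtain M where M: "!!w. Bint (%x. (x \<bullet> w) * v x) = M \<bullet> w" using moment_vector[OF h] by blast
 show ?thesis unfolding M by (simp only: inner_add_right inner_scaleR_right)
qed

text \<open>A function that does not vary in the direction b has no first moment in that direction:
  the quadratic weight identity holds with derivative 0.\<close>

lemma moment_zero:
 assumes v: "llip v" and d: "AE x in lborel. dder v b 0 x" shows "Bint (%x. (x \<bullet> b) * v x) = 0"
 using Bint_quadratic_weight_ibp(2)[OF v _ d] by (simp add: Bint_def)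

lemma kf_moment_zero:
 assumes "norm (n::'a::euclidean_space) = 1" "n \<bullet> b = 0" shows "Bint (%x. (x \<bullet> b) * kf n x) = 0"
proof (rule moment_zero[OF kf_llip])
 have "n ~= 0" using assms by auto
 from AE_inner_nonzero[OF this] show "AE x in lborel. dder (kf n) b 0 x"
  by eventually_elim (drule dder_kf[of _ n b], simp add: assms(2) inner_commute[of b n])
qed

lemma kf_pos:
 fixes n :: "'a::euclidean_space" assumes "norm n = 1"
 shows "Bint (kf n) > 0" "Bint (%x. (x \<bullet> n) * kf n x) > 0"
proof -
 let ?U = "ball 0 1 \<inter> {x. x \<bullet> n > 0}"
 have o: "open ?U" by (intro open_Int open_ball open_Collect_less continuous_intros)
 have "n \<bullet> n > 0" using assms by auto
 then have "(1/2) *\<^sub>R n \<in> ?U" using assms by simp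
 then have ne: "?U ~= {}" by blast
 show "Bint (kf n) > 0"
  by (rule Bint_pos[OF _ llip_Bi[OF kf_llip] _ o ne]) (auto simp: kf_nonneg kf_def posn_def)
 show "Bint (%x. (x \<bullet> n) * kf n x) > 0"
 proof (rule Bint_pos[OF _ llip_Bi[OF llip_mult[OF llip_inner kf_llip]] _ o ne])
  show "0 <= (x \<bullet> n) * kf n x" for x by (cases "x \<bullet> n > 0") (auto simp: kf_def posn_def max_def)
 qed (auto simp: kf_def posn_def)
qed

text \<open>The tangential moment of \<open>v\<close> dictates the direction \<open>e\<close> and a
  coefficient C \<ge> 0 for \<open>hf\<close>. The functions \<open>kf n\<close> and
  \<open>kf (- n)\<close> vanish on the thin space, so their coefficients are free to solve two
  linear equations, for the mean and the normal moment. In this basis \<open>bf\<close> is diagonal,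
  with entries 0 for \<open>hf\<close> and at most 0 for the other two.\<close>

lemma comparison_exists:
 fixes v :: "'a::euclidean_space => real" and n e0 :: 'a
 assumes n: "norm n = 1" and e0: "norm e0 = 1" "e0 \<bullet> n = 0" and v: "hsob v g"
 shows "\<exists>H G. hsob H G \<and> continuous_on UNIV H \<and> (\<forall>x. x \<bullet> n = 0 --> H x >= 0) \<and> bf H G H G <= 0 \<and>
   Bint (%x. v x - H x) = 0 \<and> (\<forall>b\<in>Basis. Bint (%x. (x \<bullet> b) * (v x - H x)) = 0)"
proof -
 obtain M where Mv: "!!w. Bint (%x. (x \<bullet> w) * v x) = M \<bullet> w" using moment_vector[OF v] by blast
 define M' where "M' = M - (M \<bullet> n) *\<^sub>R n"
 \<comment> \<open>If the tangential moment vanishes, the coefficient \<open>C\<close> will be 0 and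
   any unit direction orthogonal to \<open>n\<close> will do.\<close>
 define e where "e = (if M' = 0 then e0 else M' /\<^sub>R norm M')"
 have nn: "n \<bullet> n = 1" using n by (simp add: norm_eq_1)
 have e: "norm e = 1" "e \<bullet> n = 0" "M' = norm M' *\<^sub>R e"
  using e0 nn by (auto simp: e_def M'_def inner_diff_left)
 have ee: "e \<bullet> e = 1" using e by (simp add: norm_eq_1)
 have n': "norm (- n) = 1" "e \<bullet> (- n) = 0" using n e by auto
 \<comment> \<open>The function depends on |x . n| only, so the identities proved for the pair (e,
   n) apply to (e, -n) as well.\<close>
 have h': "hf e (- n) = hf e n" "hg e (- n) = hg e n"
  by (auto simp: hf_def hg_def qc_def zc_def fun_eq_iff sgn_minus)
 note hh = hf_hsob[OF e(1) n e(2)] and hk = kf_hsob[OF n] and hk' = kf_hsob[OF n'(1)]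
 define m where "m = Bint (%x. (x \<bullet> e) * hf e n x)"
 have m: "m > 0" unfolding m_def by (rule hf_moment_pos[OF e(1) n e(2)])
 define C where "C = norm M' / m"
 have C: "C >= 0" using m by (simp add: C_def)
 define I0 I0' I1 I1' where "I0 = Bint (kf n)" and "I0' = Bint (kf (- n))" and
  "I1 = Bint (%x. (x \<bullet> n) * kf n x)" and "I1' = Bint (%x. (x \<bullet> (- n)) * kf (- n) x)"
 note I_def = I0_def I0'_def I1_def I1'_def
 have I: "I0 > 0" "I0' > 0" "I1 > 0" "I1' > 0" unfolding I_def using kf_pos[OF n] kf_pos[OF n'(1)] by auto
 define A B where "A = Bint v - C * Bint (hf e n)" and
  "B = Bint (%x. (x \<bullet> n) * v x) - C * Bint (%x. (x \<bullet> n) * hf e n x)"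
 \<comment> \<open>Up to sign the determinant of the system a I0 + b I0' = A, a I1 - b I1' = B.
   Positivity of the four moments makes it nonzero, and Cramer's rule gives a and b.\<close>
 define D where "D = I0 * I1' + I0' * I1"
 have D: "D > 0" unfolding D_def using I by (simp add: add_pos_pos)
 define a b where "a = (A * I1' + B * I0') / D" and "b = (A * I1 - B * I0) / D"
 have ab: "a * I0 + b * I0' = A" "a * I1 - b * I1' = B"
 proof -
  have "a * I0 + b * I0' = A * D / D" "a * I1 - b * I1' = B * D / D"
   unfolding a_def b_def D_def by (simp_all add: add_divide_distrib[symmetric] diff_divide_distrib[symmetric] algebra_simps)
  then show "a * I0 + b * I0' = A" "a * I1 - b * I1' = B" using D by auto
 qed
 define U where "U x = a * kf n x + b * kf (- n) x" for x
 define Ug where "Ug x = a *\<^sub>R kg n x + b *\<^sub>R kg (- n) x" for x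
 define H where "H x = C * hf e n x + 1 * U x" for x
 define G where "G x = C *\<^sub>R hg e n x + 1 *\<^sub>R Ug x" for x
 have hU: "hsob U Ug" unfolding U_def[abs_def] Ug_def[abs_def] by (rule hsob_lincomb[OF hk hk'])
 have hH: "hsob H G" unfolding H_def[abs_def] G_def[abs_def] by (rule hsob_lincomb[OF hh hU])
 have cont: "continuous_on UNIV H"
  unfolding H_def[abs_def] U_def by (intro continuous_intros llip_continuous hf_llip[OF e(1) n e(2)] kf_llip)
 have thin: "H x >= 0" if "x \<bullet> n = 0" for x
  using hf_thin[OF that, of e] C that by (auto simp: H_def U_def kf_def posn_def)
 have Q: "bf H G H G <= 0"
 proof -
  have bhh: "bf (hf e n) (hg e n) (hf e n) (hg e n) = 0"
   using hf_energy[OF e(1) n e(2)] by (simp add: bf_self)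
  have bhk: "bf (hf e n) (hg e n) (kf n) (kg n) = 0"
   using kf_hf_energy[OF e(1) n e(2)] by (simp add: bf_def)
  have bhk': "bf (hf e n) (hg e n) (kf (- n)) (kg (- n)) = 0"
   using kf_hf_energy[OF e(1) n'] by (simp add: bf_def h')
  have bkk: "bf (kf n) (kg n) (kf n) (kg n) <= 0"
   using kf_energy[OF n] by (simp add: bf_self)
  have bkk': "bf (kf (- n)) (kg (- n)) (kf (- n)) (kg (- n)) <= 0"
   using kf_energy[OF n'(1)] by (simp add: bf_self)
  \<comment> \<open>The two one-sided functions live on opposite sides of the hyperplane, so their
    mixed energy vanishes pointwise.\<close>
  have pz: "posn n x * posn (- n) x = 0" for x by (simp add: posn_def max_def)
  have "kf n x * kf (- n) x = (posn n x * posn (- n) x) ^ 3" "kg n x \<bullet> kg (- n) x = - (9/4) * (posn n x * posn (- n) x)" for x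
   by (auto simp: kf_def kg_def power_mult_distrib nn)
  then have "kf n x * kf (- n) x = 0" "kg n x \<bullet> kg (- n) x = 0" for x unfolding pz by auto
  then have bk0: "bf (kf n) (kg n) (kf (- n)) (kg (- n)) = 0" unfolding bf_def by (simp only: Bint_def mult_zero_right Bochner_Integration.integral_zero diff_self)
  have bhU: "bf (hf e n) (hg e n) U Ug = 0"
   unfolding U_def[abs_def] Ug_def[abs_def] by (simp add: bf_lin_right[OF hk hk' hh] bhk bhk')
  have bUU: "bf U Ug U Ug = a * a * bf (kf n) (kg n) (kf n) (kg n) + b * b * bf (kf (- n)) (kg (- n)) (kf (- n)) (kg (- n))"
  proof -
   have "bf U Ug U Ug = a * bf (kf n) (kg n) U Ug + b * bf (kf (- n)) (kg (- n)) U Ug"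
    using bf_lin[OF hk hk' hU, of a b] by (simp add: U_def[abs_def] Ug_def[abs_def])
   also have "bf (kf n) (kg n) U Ug = a * bf (kf n) (kg n) (kf n) (kg n) + b * 0"
    using bf_lin_right[OF hk hk' hk, of a b] by (simp add: U_def[abs_def] Ug_def[abs_def] bk0)
   also have "bf (kf (- n)) (kg (- n)) U Ug = a * 0 + b * bf (kf (- n)) (kg (- n)) (kf (- n)) (kg (- n))"
    using bf_lin_right[OF hk hk' hk', of a b] bk0 by (simp add: U_def[abs_def] Ug_def[abs_def] bf_sym[of "kf (- n)" _ "kf n"])
   finally show ?thesis by simp
  qed
  have "bf H G H G = C * bf (hf e n) (hg e n) H G + 1 * bf U Ug H G"
   using bf_lin[OF hh hU hH, of C 1] by (simp add: H_def[abs_def] G_def[abs_def])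
  also have "bf (hf e n) (hg e n) H G = 0"
   using bf_lin_right[OF hh hU hh, of C 1] by (simp add: H_def[abs_def] G_def[abs_def] bhh bhU)
  also have "bf U Ug H G = bf U Ug U Ug"
   using bf_lin_right[OF hh hU hU, of C 1] by (simp add: H_def[abs_def] G_def[abs_def] bhU bf_sym[of U Ug "hf e n"])
  finally have "bf H G H G = bf U Ug U Ug" by simp
  moreover have "a * a * bf (kf n) (kg n) (kf n) (kg n) <= 0" "b * b * bf (kf (- n)) (kg (- n)) (kf (- n)) (kg (- n)) <= 0"
   using bkk bkk' by (auto intro!: mult_nonneg_nonpos)
  ultimately show ?thesis unfolding bUU by linarith
 qed
 have hm: "Bint (%x. (x \<bullet> w) * H x) = C * Bint (%x. (x \<bullet> w) * hf e n x) + a * Bint (%x. (x \<bullet> w) * kf n x) + b * Bint (%x. (x \<bullet> w) * kf (- n) x)" for w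
  unfolding H_def[abs_def] moment_lincomb(1)[OF hh hU] unfolding U_def[abs_def] moment_lincomb(1)[OF hk hk'] by simp
 have h1: "Bint H = C * Bint (hf e n) + a * I0 + b * I0'"
  unfolding H_def[abs_def] moment_lincomb(2)[OF hh hU] unfolding U_def[abs_def] moment_lincomb(2)[OF hk hk'] I_def by simp
 define f where "f x = 1 * v x + (- 1) * H x" for x
 have hf: "hsob f (%x. 1 *\<^sub>R g x + (- 1) *\<^sub>R G x)" unfolding f_def[abs_def] by (rule hsob_lincomb[OF v hH])
 have fv: "(%x. v x - H x) = f" by (simp add: f_def fun_eq_iff)
 have f0: "Bint f = 0"
  unfolding f_def[abs_def] moment_lincomb(2)[OF v hH] h1 using ab(1) by (simp add: A_def)
 have fm: "Bint (%x. (x \<bullet> w) * f x) = M \<bullet> w - Bint (%x. (x \<bullet> w) * H x)" for w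
  unfolding f_def[abs_def] moment_lincomb(1)[OF v hH] by (simp add: Mv)
 have fn: "Bint (%x. (x \<bullet> n) * f x) = 0"
 proof -
  have "Bint (%x. (x \<bullet> n) * kf (- n) x) = - I1'"
   using Bint_cmult[of "-1" "%x. (x \<bullet> n) * kf (- n) x"] by (simp add: I_def)
  then show ?thesis unfolding fm hm using ab(2) by (simp add: B_def I1_def Mv)
 qed
 have M: "M \<bullet> w = norm M' * (e \<bullet> w) + (M \<bullet> n) * (n \<bullet> w)" for w
 proof -
  have "M = norm M' *\<^sub>R e + (M \<bullet> n) *\<^sub>R n" using e(3) by (simp add: M'_def)
  then show ?thesis by (metis inner_add_left inner_scaleR_left)
 qed
 \<comment> \<open>Along e the coefficient \<open>C\<close> was chosen to match the tangential
   moment; along directions orthogonal to both e and n all three building blocks are constant and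
   \<open>v\<close> has no moment either.\<close>
 have fw: "Bint (%x. (x \<bullet> w) * f x) = 0" if "n \<bullet> w = 0" "w = e \<or> e \<bullet> w = 0" for w
 proof -
  have k0: "Bint (%x. (x \<bullet> w) * kf n x) = 0" "Bint (%x. (x \<bullet> w) * kf (- n) x) = 0"
   using kf_moment_zero[OF n, of w] kf_moment_zero[OF n'(1), of w] that by auto
  have "C * Bint (%x. (x \<bullet> w) * hf e n x) = norm M' * (e \<bullet> w)"
  proof (cases "w = e")
   case True
   then show ?thesis using m ee by (simp add: C_def m_def)
  next
   case False
   then have w: "e \<bullet> w = 0" using that by simp
   have "Bint (%x. (x \<bullet> w) * hf e n x) = 0"
   proof (rule moment_zero[OF hf_llip[OF e(1) n e(2)]])
    have "n ~= 0" using n by auto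
    from AE_inner_nonzero[OF this] show "AE x in lborel. dder (hf e n) w 0 x"
    proof eventually_elim
     case (elim x)
     have "hg e n x \<bullet> w = 0" using w that by (simp add: hg_def inner_diff_left)
     then show ?case using dder_qc(3)[OF e(1) n e(2) elim, of w] by simp
    qed
   qed
   then show ?thesis using w by simp
  qed
  then show ?thesis unfolding fm hm k0 using M[of w] that by simp
 qed
 have "Bint (%x. (x \<bullet> w) * f x) = 0" for w
 proof -
  \<comment> \<open>Every direction is a combination of e, n and a remainder orthogonal to both, and
    each of these has been treated.\<close>
  define r where "r = w - (w \<bullet> e) *\<^sub>R e - (w \<bullet> n) *\<^sub>R n"
  have en: "n \<bullet> e = 0" using e by (simp add: inner_commute)
  have r: "n \<bullet> r = 0" "e \<bullet> r = 0" unfolding r_def using ee nn en e by (auto simp: inner_diff_right inner_commute)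
  have "w = (w \<bullet> e) *\<^sub>R e + (w \<bullet> n) *\<^sub>R n + r" by (simp add: r_def)
  then have "Bint (%x. (x \<bullet> w) * f x) = (w \<bullet> e) * Bint (%x. (x \<bullet> e) * f x) + (w \<bullet> n) * Bint (%x. (x \<bullet> n) * f x) + Bint (%x. (x \<bullet> r) * f x)"
   using moment_add[OF hf, of "w \<bullet> e" e "w \<bullet> n" n r] by simp
  then show ?thesis using fn fw[of e] fw[of r] r en by simp
 qed
 then show ?thesis using hH cont thin Q f0 unfolding fv[symmetric] by blast
qed

subsection \<open>The competitor\<close>

lemma AE_sphere_measure: "AE x in (unit_sphere_measure :: 'a::euclidean_space measure). norm x = 1"
proof -
 let ?f = "%x::'a. if norm x = 1 then 0 else 1 :: real"
 have "(\<integral>\<^sup>+x. ennreal (?f x) \<partial>(unit_sphere_measure :: 'a measure)) = of_nat DIM('a) * (\<integral>\<^sup>+x. ennreal (indicator (ball 0 1) x * ?f (sgn x)) \<partial>lborel)"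
  by (rule sphere_measure_nn_integral) auto
 also have "(\<integral>\<^sup>+x. ennreal (indicator (ball 0 1) x * ?f (sgn x)) \<partial>lborel) = (\<integral>\<^sup>+x. 0 \<partial>(lborel :: 'a measure))"
  by (rule nn_integral_cong_AE) (use AE_lborel_singleton[of "0::'a"] in \<open>auto elim!: eventually_mono simp: norm_sgn\<close>)
 finally have "(\<integral>\<^sup>+x. ennreal (?f x) \<partial>(unit_sphere_measure :: 'a measure)) = 0" by simp
 then have "AE x in (unit_sphere_measure :: 'a measure). ennreal (?f x) = 0"
  by (subst (asm) nn_integral_0_iff_AE) auto
 then show ?thesis by eventually_elim (simp split: if_splits)
qed

lemma AE_thin_measure: "AE x in (thin_ball_measure :: ((real^'m) \<times> real) measure). norm x < 1 \<and> snd x = 0"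
proof -
 let ?f = "%x::(real^'m) \<times> real. if norm x < 1 \<and> snd x = 0 then 0 else 1 :: real"
 have m: "?f \<in> borel_measurable borel"
 proof (rule measurable_If)
  show "{x \<in> space borel. norm x < 1 \<and> snd x = 0} \<in> sets (borel :: ((real^'m) \<times> real) measure)"
  proof -
   have "open {x :: (real^'m) \<times> real. norm x < 1}" "closed {x :: (real^'m) \<times> real. snd x = 0}"
    by (intro open_Collect_less closed_Collect_eq continuous_intros)+
   then have "{x :: (real^'m) \<times> real. norm x < 1} \<inter> {x. snd x = 0} \<in> sets borel" by (intro sets.Int borel_open borel_closed)
   then show ?thesis by (simp add: Collect_conj_eq)
  qed
 qed auto
 have "(\<integral>\<^sup>+x. ennreal (?f x) \<partial>thin_ball_measure) = (\<integral>\<^sup>+x. ennreal (?f (x, 0)) * indicator (ball 0 1) x \<partial>lborel)"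
  by (rule thin_measure_nn_integral[OF m])
 also have "... = (\<integral>\<^sup>+x. 0 \<partial>(lborel :: (real^'m) measure))"
  by (rule nn_integral_cong) (auto simp: norm_Pair split: split_indicator)
 finally have "(\<integral>\<^sup>+x. ennreal (?f x) \<partial>thin_ball_measure) = 0" by simp
 then have "AE x in (thin_ball_measure :: ((real^'m) \<times> real) measure). ennreal (?f x) = 0"
  by (subst (asm) nn_integral_0_iff_AE) (use m in \<open>auto cong: measurable_cong_sets\<close>)
 then show ?thesis by eventually_elim (simp split: if_splits)
qed

text \<open>The constant depends on \<open>f\<close> alone, so approximation in the Sobolev norm
  survives multiplication by a fixed smooth function.\<close>

lemma pair_norm2_mult_smooth:
 fixes f :: "'a::euclidean_space => real"
 assumes s: "smooth f"
 shows "\<exists>K. \<forall>v g. sob_pair 1 v g --> pair_norm2 (%x. f x * v x) (%x. f x *\<^sub>R g x + v x *\<^sub>R grad f x) <= K * pair_norm2 v g"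
proof -
 obtain K where K: "K > 0" "!!x. x \<in> cball 0 1 ==> abs (f x) <= K" "!!x. x \<in> cball 0 1 ==> norm (grad f x) <= K"
  using smooth_bounded_on_ball[OF s, of 1] by blast
 show ?thesis
 proof (intro exI allI impI)
  fix v :: "'a => real" and g assume p: "sob_pair 1 v g"
  note q = sob_pair_mult_smooth[OF p s]
  have "Bint (%x. (f x * v x)^2) <= Bint (%x. K\<^sup>2 * (v x)^2)"
  proof (rule Bint_mono[OF Bi_sq(1)[OF q] Bi_cmult[OF Bi_sq(1)[OF p]]])
   fix x :: 'a assume x: "norm x < 1"
   have "(abs (f x))\<^sup>2 <= K\<^sup>2" using K(2)[of x] x by (intro power_mono) auto
   then show "(f x * v x)^2 <= K\<^sup>2 * (v x)^2" by (simp add: power_mult_distrib mult_right_mono)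
  qed
  moreover have "Bint (%x. (norm (f x *\<^sub>R g x + v x *\<^sub>R grad f x))^2) <= Bint (%x. (2 * K\<^sup>2) * (norm (g x))^2 + (2 * K\<^sup>2) * (v x)^2)"
  proof (rule Bint_mono[OF Bi_sq(2)[OF q] Bi_add[OF Bi_cmult[OF Bi_sq(2)[OF p]] Bi_cmult[OF Bi_sq(1)[OF p]]]])
   fix x :: 'a assume x: "norm x < 1"
   have "norm (f x *\<^sub>R g x + v x *\<^sub>R grad f x) <= abs (f x) * norm (g x) + abs (v x) * norm (grad f x)"
    by (rule order_trans[OF norm_triangle_ineq]) simp
   also have "... <= K * norm (g x) + abs (v x) * K"
    using K(2,3)[of x] x by (intro add_mono mult_mono) auto
   finally have "(norm (f x *\<^sub>R g x + v x *\<^sub>R grad f x))^2 <= (K * norm (g x) + abs (v x) * K)^2"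
    by (intro power_mono) auto
   also have "... = K\<^sup>2 * (norm (g x) + abs (v x))^2" by (simp add: algebra_simps flip: power_mult_distrib)
   also have "... <= K\<^sup>2 * (2 * (norm (g x))^2 + 2 * (abs (v x))\<^sup>2)"
    using zero_le_power2[of "norm (g x) - abs (v x)"] unfolding power2_diff power2_sum by (intro mult_left_mono) auto
   finally show "(norm (f x *\<^sub>R g x + v x *\<^sub>R grad f x))^2 <= (2 * K\<^sup>2) * (norm (g x))^2 + (2 * K\<^sup>2) * (v x)^2"
    by (simp add: algebra_simps)
  qed
  moreover have "Bint (%x. (2 * K\<^sup>2) * (norm (g x))^2 + (2 * K\<^sup>2) * (v x)^2) = 2 * K\<^sup>2 * Bint (%x. (norm (g x))^2) + 2 * K\<^sup>2 * Bint (%x. (v x)^2)"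
   by (subst Bint_add[OF Bi_cmult[OF Bi_sq(2)[OF p]] Bi_cmult[OF Bi_sq(1)[OF p]]]) (simp only: Bint_cmult)
  moreover have "0 <= K\<^sup>2 * Bint (%x. (norm (g x))^2)" by (intro mult_nonneg_nonneg Bint_nonneg) auto
  ultimately show "pair_norm2 (%x. f x * v x) (%x. f x *\<^sub>R g x + v x *\<^sub>R grad f x) <= (3 * K\<^sup>2) * pair_norm2 v g"
   unfolding pair_norm2_def Bint_cmult by (simp add: algebra_simps)
 qed
qed

lemma sob_pair_smooth_comb:
 assumes "sob_pair R v g" "sob_pair R u k" "smooth f" "smooth h"
 shows "sob_pair R (%x. f x * v x + h x * u x) (%x. (f x *\<^sub>R g x + v x *\<^sub>R grad f x) + (h x *\<^sub>R k x + u x *\<^sub>R grad h x))"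
 using sob_pair_lincomb[OF sob_pair_mult_smooth[OF assms(1,3)] sob_pair_mult_smooth[OF assms(2,4)], of 1 1] by simp

text \<open>If phi and psi approximate the two functions, then f phi + h psi approximates the
  combination, in the Sobolev norm and in L2 of \<open>M\<close>, since f and h are bounded on the
  closed unit ball.\<close>

lemma has_trace_smooth_comb:
 fixes f h :: "'a::euclidean_space => real"
 assumes M: "trace_measure M C" and AE: "AE x in M. norm x <= 1" and p: "sob_pair 1 v g" and q: "sob_pair 1 u k"
  and t: "has_trace (ball 0 1) M v \<gamma>" "has_trace (ball 0 1) M u eta" and s: "smooth f" "smooth h"
 shows "has_trace (ball 0 1) M (%x. f x * v x + h x * u x) (%x. f x * \<gamma> x + h x * eta x)"
proof -
 obtain phi where phi: "!!j. smooth (phi j)" "(%j. pair_norm2 (%x. phi j x - v x) (%x. grad (phi j) x - g x)) \<longlonglongrightarrow> 0"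
  "(%j. \<integral>x. (phi j x - \<gamma> x)^2 \<partial>M) \<longlonglongrightarrow> 0" and \<gamma>: "\<gamma> \<in> L2 M"
  using t(1) unfolding has_trace_iff[OF sob_rep_self[OF p]] by blast
 obtain psi where psi: "!!j. smooth (psi j)" "(%j. pair_norm2 (%x. psi j x - u x) (%x. grad (psi j) x - k x)) \<longlonglongrightarrow> 0"
  "(%j. \<integral>x. (psi j x - eta x)^2 \<partial>M) \<longlonglongrightarrow> 0" and eta: "eta \<in> L2 M"
  using t(2) unfolding has_trace_iff[OF sob_rep_self[OF q]] by blast
 have sm: "smooth a ==> a \<in> L2 M" for a using M by (simp add: trace_measure_def)
 have mult: "\<exists>K. \<forall>b\<in>L2 M. (%x. a x * b x) \<in> L2 M \<and> (\<integral>x. (a x * b x)^2 \<partial>M) <= K * (\<integral>x. (b x)^2 \<partial>M)" if a: "smooth a" for a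
 proof -
  obtain K where K: "!!x. norm x <= 1 ==> abs (a x) <= K" using smooth_bounded_on_ball[OF a, of 1] by (metis mem_cball_0)
  have "(%x. a x * b x) \<in> L2 M \<and> (\<integral>x. (a x * b x)^2 \<partial>M) <= K\<^sup>2 * (\<integral>x. (b x)^2 \<partial>M)" if b: "b \<in> L2 M" for b
  proof -
   have [measurable]: "a \<in> borel_measurable M" "b \<in> borel_measurable M" using sm[OF a] b by (auto simp: L2_real_iff)
   have ib: "integrable M (%x. K\<^sup>2 * (b x)^2)" using b by (auto simp: L2_real_iff)
   have le: "AE x in M. (a x * b x)^2 <= K\<^sup>2 * (b x)^2"
    using AE by eventually_elim (use power_mono[OF K, of _ 2] in \<open>auto simp: power_mult_distrib intro!: mult_right_mono\<close>)
   have i: "integrable M (%x. (a x * b x)^2)"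
    by (rule Bochner_Integration.integrable_bound[OF ib]) (use le in \<open>auto elim!: eventually_mono\<close>)
   then show ?thesis using integral_mono_AE[OF i ib le] by (simp add: L2_real_iff)
  qed
  then show ?thesis by blast
 qed
 obtain Kf where Kf: "!!b. b \<in> L2 M ==> (%x. f x * b x) \<in> L2 M" "!!b. b \<in> L2 M ==> (\<integral>x. (f x * b x)^2 \<partial>M) <= Kf * (\<integral>x. (b x)^2 \<partial>M)"
  using mult[OF s(1)] by blast
 obtain Kh where Kh: "!!b. b \<in> L2 M ==> (%x. h x * b x) \<in> L2 M" "!!b. b \<in> L2 M ==> (\<integral>x. (h x * b x)^2 \<partial>M) <= Kh * (\<integral>x. (b x)^2 \<partial>M)"
  using mult[OF s(2)] by blast
 define \<omega> where "\<omega> j x = f x * phi j x + h x * psi j x" for j x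
 have so: "smooth (\<omega> j)" for j unfolding \<omega>_def[abs_def] by (intro smooth_add smooth_mult s phi psi)
 have go: "grad (\<omega> j) x = (f x *\<^sub>R grad (phi j) x + phi j x *\<^sub>R grad f x) + (h x *\<^sub>R grad (psi j) x + psi j x *\<^sub>R grad h x)" for j x
  unfolding \<omega>_def[abs_def] by (simp add: grad_add grad_mult smooth_mult s phi psi)
 obtain A where A: "!!v g. sob_pair 1 v g ==> pair_norm2 (%x. f x * v x) (%x. f x *\<^sub>R g x + v x *\<^sub>R grad f x) <= A * pair_norm2 v g"
  using pair_norm2_mult_smooth[OF s(1)] by blast
 obtain B where B: "!!v g. sob_pair 1 v g ==> pair_norm2 (%x. h x * v x) (%x. h x *\<^sub>R g x + v x *\<^sub>R grad h x) <= B * pair_norm2 v g"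
  using pair_norm2_mult_smooth[OF s(2)] by blast
 let ?G = "%x. (f x *\<^sub>R g x + v x *\<^sub>R grad f x) + (h x *\<^sub>R k x + u x *\<^sub>R grad h x)"
 have l1: "(%j. pair_norm2 (%x. \<omega> j x - (f x * v x + h x * u x)) (%x. grad (\<omega> j) x - ?G x)) \<longlonglongrightarrow> 0"
 proof (rule tendsto_sandwich[OF _ _ tendsto_const])
  let ?N = "%j. pair_norm2 (%x. phi j x - v x) (%x. grad (phi j) x - g x)" and ?N' = "%j. pair_norm2 (%x. psi j x - u x) (%x. grad (psi j) x - k x)"
  show "\<forall>\<^sub>F j in sequentially. 0 <= pair_norm2 (%x. \<omega> j x - (f x * v x + h x * u x)) (%x. grad (\<omega> j) x - ?G x)"
   by (simp add: pair_norm2_nonneg)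
  have "(%j. 2 * (A * ?N j) + 2 * (B * ?N' j)) \<longlonglongrightarrow> 2 * (A * 0) + 2 * (B * 0)" by (intro tendsto_intros phi psi)
  then show "(%j. 2 * (A * ?N j) + 2 * (B * ?N' j)) \<longlonglongrightarrow> 0" by simp
  show "\<forall>\<^sub>F j in sequentially. pair_norm2 (%x. \<omega> j x - (f x * v x + h x * u x)) (%x. grad (\<omega> j) x - ?G x) <= 2 * (A * ?N j) + 2 * (B * ?N' j)"
  proof (intro always_eventually allI)
   fix j
   have d: "sob_pair 1 (%x. phi j x - v x) (%x. grad (phi j) x - g x)" "sob_pair 1 (%x. psi j x - u x) (%x. grad (psi j) x - k x)"
    using sob_pair_lincomb[OF sob_pair_smooth[OF phi(1)] p, where a=1 and c="-1"] sob_pair_lincomb[OF sob_pair_smooth[OF psi(1)] q, where a=1 and c="-1"] by auto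
   have "pair_norm2 (%x. \<omega> j x - (f x * v x + h x * u x)) (%x. grad (\<omega> j) x - ?G x) =
    pair_norm2 (%x. f x * (phi j x - v x) + h x * (psi j x - u x))
     (%x. (f x *\<^sub>R (grad (phi j) x - g x) + (phi j x - v x) *\<^sub>R grad f x) + (h x *\<^sub>R (grad (psi j) x - k x) + (psi j x - u x) *\<^sub>R grad h x))"
    by (simp add: go \<omega>_def algebra_simps)
   also have "... <= 2 * pair_norm2 (%x. f x * (phi j x - v x)) (%x. f x *\<^sub>R (grad (phi j) x - g x) + (phi j x - v x) *\<^sub>R grad f x)
     + 2 * pair_norm2 (%x. h x * (psi j x - u x)) (%x. h x *\<^sub>R (grad (psi j) x - k x) + (psi j x - u x) *\<^sub>R grad h x)"
    by (rule pair_norm2_triangle[OF sob_pair_mult_smooth[OF d(1) s(1)] sob_pair_mult_smooth[OF d(2) s(2)]])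
   also have "... <= 2 * (A * ?N j) + 2 * (B * ?N' j)" by (intro add_mono mult_left_mono A B d) auto
   finally show "pair_norm2 (%x. \<omega> j x - (f x * v x + h x * u x)) (%x. grad (\<omega> j) x - ?G x) <= 2 * (A * ?N j) + 2 * (B * ?N' j)" .
  qed
 qed
 have l2: "(%j. \<integral>x. (\<omega> j x - (f x * \<gamma> x + h x * eta x))^2 \<partial>M) \<longlonglongrightarrow> 0"
 proof (rule tendsto_sandwich[OF _ _ tendsto_const])
  let ?N = "%j. \<integral>x. (phi j x - \<gamma> x)^2 \<partial>M" and ?N' = "%j. \<integral>x. (psi j x - eta x)^2 \<partial>M"
  show "\<forall>\<^sub>F j in sequentially. 0 <= (\<integral>x. (\<omega> j x - (f x * \<gamma> x + h x * eta x))^2 \<partial>M)" by simp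
  have "(%j. 2 * (Kf * ?N j) + 2 * (Kh * ?N' j)) \<longlonglongrightarrow> 2 * (Kf * 0) + 2 * (Kh * 0)" by (intro tendsto_intros phi psi)
  then show "(%j. 2 * (Kf * ?N j) + 2 * (Kh * ?N' j)) \<longlonglongrightarrow> 0" by simp
  show "\<forall>\<^sub>F j in sequentially. (\<integral>x. (\<omega> j x - (f x * \<gamma> x + h x * eta x))^2 \<partial>M) <= 2 * (Kf * ?N j) + 2 * (Kh * ?N' j)"
  proof (intro always_eventually allI)
   fix j
   have d: "(%x. phi j x - \<gamma> x) \<in> L2 M" "(%x. psi j x - eta x) \<in> L2 M" by (intro L2_diff sm phi(1) psi(1) \<gamma> eta)+
   have "(\<integral>x. (\<omega> j x - (f x * \<gamma> x + h x * eta x))^2 \<partial>M) = (\<integral>x. (f x * (phi j x - \<gamma> x) + h x * (psi j x - eta x))^2 \<partial>M)"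
    by (simp add: \<omega>_def algebra_simps)
   also have "... <= 2 * (\<integral>x. (f x * (phi j x - \<gamma> x))^2 \<partial>M) + 2 * (\<integral>x. (h x * (psi j x - eta x))^2 \<partial>M)"
    by (intro L2_sum_le Kf Kh d)
   also have "... <= 2 * (Kf * ?N j) + 2 * (Kh * ?N' j)" by (intro add_mono mult_left_mono Kf Kh d) auto
   finally show "(\<integral>x. (\<omega> j x - (f x * \<gamma> x + h x * eta x))^2 \<partial>M) <= 2 * (Kf * ?N j) + 2 * (Kh * ?N' j)" .
  qed
 qed
 have "(%x. f x * \<gamma> x + h x * eta x) \<in> L2 M" by (intro L2_add Kf Kh \<gamma> eta)
 then show ?thesis
  unfolding has_trace_iff[OF sob_rep_self[OF sob_pair_smooth_comb[OF p q s]]] using so l1 l2 by blast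
qed

text \<open>Mollifications of a continuous function converge uniformly on the open unit ball, which
  carries \<open>M\<close>. On the thin ball this turns the pointwise sign of the comparison
  function into the sign of its trace.\<close>

lemma has_trace_continuous:
 fixes v :: "'a::euclidean_space => real"
 assumes M: "trace_measure M C" and b: "sets M = sets borel" and AE: "AE x in M. norm x < 1" and p: "!!R. sob_pair R v g" and c: "continuous_on UNIV v"
 shows "has_trace (ball 0 1) M v v"
proof -
 interpret finite_measure M using M by (simp add: trace_measure_def)
 obtain phi where phi: "!!j. smooth (phi j)" "(%j. pair_norm2 (%x. phi j x - v x) (%x. grad (phi j) x - g x)) \<longlonglongrightarrow> 0"
  and u: "!!e. e > 0 ==> \<forall>\<^sub>F j in sequentially. \<forall>x. norm x < 1 --> abs (phi j x - v x) <= e"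
  using smooth_approx[OF p] c by blast
 have mb: "f \<in> borel_measurable M" if "f \<in> borel_measurable borel" for f :: "'a => real"
  using that b by (simp cong: measurable_cong_sets)
 have [measurable]: "v \<in> borel_measurable M" using sob_pairD(1)[OF p] mb by blast
 have "compact (v ` cball 0 1)" by (intro compact_continuous_image continuous_on_subset[OF c]) auto
 then have "bounded (v ` cball 0 1)" by (rule compact_imp_bounded)
 then obtain K where "\<forall>y\<in>v ` cball 0 1. norm y <= K" unfolding bounded_iff by blast
 then have K: "norm x <= 1 ==> abs (v x) <= K" for x by auto
 have "integrable M (%x. (v x)^2)"
 proof (rule integrable_const_bound[where B="K\<^sup>2"])
  show "AE x in M. norm ((v x)^2) <= K\<^sup>2"
   using AE by eventually_elim (use power_mono[OF K, of _ 2] in auto)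
 qed measurable
 then have L: "v \<in> L2 M" by (simp add: L2_real_iff)
 have "(%j. \<integral>x. (phi j x - v x)^2 \<partial>M) \<longlonglongrightarrow> 0"
 proof (rule order_tendstoI)
  fix a :: real assume a: "a > 0"
  \<comment> \<open>Chosen so that e^2 times the total mass is below \<open>a\<close>; the summand 1
    covers a measure of mass 0.\<close>
  define e where "e = sqrt (a / (2 * (1 + measure M (space M))))"
  have m: "measure M (space M) >= 0" by simp
  have e: "e > 0" "e\<^sup>2 = a / (2 * (1 + measure M (space M)))" unfolding e_def using a m by (auto simp: add_pos_nonneg)
  show "\<forall>\<^sub>F j in sequentially. (\<integral>x. (phi j x - v x)^2 \<partial>M) < a"
   using u[OF e(1)]
  proof eventually_elim
   case (elim j)
   have "(%x. phi j x - v x) \<in> L2 M" using M phi(1) L by (intro L2_diff) (auto simp: trace_measure_def)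
   then have i: "integrable M (%x. (phi j x - v x)^2)" by (simp add: L2_real_iff)
   have "(\<integral>x. (phi j x - v x)^2 \<partial>M) <= (\<integral>x. e\<^sup>2 \<partial>M)"
   proof (rule integral_mono_AE[OF i])
    show "AE x in M. (phi j x - v x)^2 <= e\<^sup>2"
     using AE
    proof eventually_elim
     case (elim x)
     then have "abs (phi j x - v x) <= e" using \<open>\<forall>x. norm x < 1 --> abs (phi j x - v x) <= e\<close> by blast
     from power_mono[OF this, of 2] show ?case by simp
    qed
   qed simp
   also have "... = measure M (space M) * (a / (2 * (1 + measure M (space M))))" using e by simp
   also have "... < a" using a m by (simp add: field_simps add_pos_nonneg)
   finally show ?case .
  qed
 next
  fix a :: real assume "a < 0"
  then show "\<forall>\<^sub>F j in sequentially. a < (\<integral>x. (phi j x - v x)^2 \<partial>M)"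
   by (intro always_eventually allI) (meson Bochner_Integration.integral_nonneg less_le_trans zero_le_power2)
 qed
 then show ?thesis unfolding has_trace_iff[OF sob_rep_self[OF sob_pair_mono[OF p order_refl]]] using L phi by blast
qed

text \<open>Euler's identity turns the radial term -2 u (g . x) into -3 v u, and the layer-cake
  formula for degree 1 turns the weight into 2/(n + 3). The two fit together because 3 = 2/(n + 3) *
  3/2 (n + 3).\<close>

lemma hsob_radial_test:
 fixes v :: "'a::euclidean_space => real"
 assumes v: "hsob v g" and u: "hsob u k"
 shows "Bint (%x. g x \<bullet> ((1 - (norm x)^2) *\<^sub>R k x - (2 * u x) *\<^sub>R x)) = 2 / (DIM('a) + 3) * bf v g u k"
proof -
 have p: "sob_pair R v g" "sob_pair R u k" for R using v u by (auto simp: hsob_def)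
 note [measurable] = sob_pairD(1,2)[OF p(1)] sob_pairD(1,2)[OF p(2)]
 have h: "hom 1 (%x. g x \<bullet> k x)" using hom_inner[OF hsob_hom_grad[OF v] hsob_hom_grad[OF u]] by simp
 have i: "Bi (%x. g x \<bullet> k x)" by (rule hsob_Bi[OF v u])
 have i1: "Bi (%x. (1 - (norm x)^2) * (g x \<bullet> k x))"
  by (rule Bi_mult_bounded[OF i, where K=1]) (auto simp: power_le_one abs_le_iff)
 have "Bint (%x. g x \<bullet> ((1 - (norm x)^2) *\<^sub>R k x - (2 * u x) *\<^sub>R x)) = Bint (%x. (1 - (norm x)^2) * (g x \<bullet> k x) - 3 * (v x * u x))"
  by (rule Bint_cong_AE) (use hsob_euler[OF v] in \<open>auto elim!: eventually_mono simp: inner_diff_right\<close>)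
 also have "... = Bint (%x. (1 - (norm x)^2) * (g x \<bullet> k x)) - 3 * Bint (%x. v x * u x)"
  by (subst Bint_diff[OF i1 Bi_cmult[OF hsob_Bi(1)[OF v u]]]) (simp only: Bint_cmult)
 also have "Bint (%x. (1 - (norm x)^2) * (g x \<bullet> k x)) = 2 / (DIM('a) + 3) * Bint (%x. g x \<bullet> k x)"
  using layer_cake_quadratic[OF _ i h] by (simp add: algebra_simps)
 finally show ?thesis by (simp add: bf_def field_simps)
qed

text \<open>The competitor's energy is a quadratic polynomial in \<epsilon>. Polarization splits the
  linear term into a gain proportional to the energies of v and of v - H and a term of favourable
  sign from H; the spectral gap for v - H pays for the quadratic term.\<close>

lemma competitor_energy:
 fixes v :: "'a::euclidean_space => real"
 assumes v: "hsob v g" and H: "hsob H G" and Q: "bf H G H G <= 0"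
  and z: "Bint (%x. v x - H x) = 0" "!!b. b \<in> Basis ==> Bint (%x. (x \<bullet> b) * (v x - H x)) = 0"
  and e: "\<epsilon> = 1 / (6 * (DIM('a) + 3))" and s: "!!x. \<sigma> x = \<epsilon> * (1 - (norm x)^2)"
 defines "Z \<equiv> %x. ((1 - \<sigma> x) *\<^sub>R g x + v x *\<^sub>R grad (%x. 1 - \<sigma> x) x) + (\<sigma> x *\<^sub>R G x + H x *\<^sub>R grad \<sigma> x)"
 shows "Bint (%x. (norm (Z x))^2) - 3/2 * (DIM('a) + 3) * Bint (%x. (v x)^2) <= (1 - 2 * \<epsilon> / (DIM('a) + 3)) * bf v g v g"
proof -
 let ?d = "real DIM('a) + 3"
 have d: "?d >= 4" using DIM_positive[where 'a='a] by linarith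
 have e0: "\<epsilon> > 0" using d unfolding e by simp
 define f where "f x = 1 * v x + (- 1) * H x" for x
 define k where "k x = 1 *\<^sub>R g x + (- 1) *\<^sub>R G x" for x
 have f: "hsob f k" unfolding f_def[abs_def] k_def[abs_def] by (rule hsob_lincomb[OF v H])
 have p: "sob_pair R v g" "sob_pair R f k" for R using v f by (auto simp: hsob_def)
 note [measurable] = sob_pairD(1,2)[OF p(1)] sob_pairD(1,2)[OF p(2)]
 have ss: "\<sigma> = (%x. \<epsilon> * (1 - (norm x)^2))" by (rule ext) (rule s)
 have s1: "smooth (%x::'a. 1 - (norm x)^2)" by (intro smooth_diff smooth_const smooth_norm2)
 have gs: "grad \<sigma> x = (- 2 * \<epsilon>) *\<^sub>R x" for x
  unfolding ss by (simp add: grad_scale[OF s1] grad_diff[OF smooth_const smooth_norm2] grad_norm2)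
 have sm: "smooth \<sigma>" unfolding ss by (intro smooth_mult smooth_const s1)
 have gs': "grad (%x. 1 - \<sigma> x) x = (2 * \<epsilon>) *\<^sub>R x" for x
  by (simp add: grad_diff[OF smooth_const sm] gs)
 \<comment> \<open>The gradient of (1 - |x|^2) f with f = v - H, so that the competitor has gradient
   g - \<epsilon> Y.\<close>
 define Y where "Y x = (1 - (norm x)^2) *\<^sub>R k x - (2 * f x) *\<^sub>R x" for x
 have [measurable]: "Y \<in> borel_measurable borel" unfolding Y_def[abs_def] by measurable
 have ZY: "Z x = g x - \<epsilon> *\<^sub>R Y x" for x
  unfolding Z_def gs gs' unfolding s Y_def f_def k_def by (simp add: algebra_simps)
 have bk: "Bi (%x. (norm (k x))^2)" and bff: "Bi (%x. (f x)^2)" and bg: "Bi (%x. (norm (g x))^2)"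
  using Bi_sq[OF p(1)] Bi_sq[OF p(2)] by auto
 have Yb: "(norm (Y x))^2 <= 2 * (norm (k x))^2 + 8 * (f x)^2" if x: "norm x < 1" for x
 proof -
  have "norm (Y x) <= abs (1 - (norm x)^2) * norm (k x) + abs (2 * f x) * norm x"
   unfolding Y_def by (rule order_trans[OF norm_triangle_ineq4]) simp
  also have "... <= 1 * norm (k x) + abs (2 * f x) * 1"
   using x by (intro add_mono mult_mono) (auto simp: power_le_one abs_le_iff)
  finally have "(norm (Y x))^2 <= (norm (k x) + abs (2 * f x))^2" by (intro power_mono) auto
  also have "... <= 2 * (norm (k x))^2 + 2 * (abs (2 * f x))\<^sup>2"
   using zero_le_power2[of "norm (k x) - abs (2 * f x)"] unfolding power2_diff power2_sum by linarith
  finally show ?thesis by (simp add: power_mult_distrib)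
 qed
 have bb: "Bi (%x. 2 * (norm (k x))^2 + 8 * (f x)^2)" by (intro Bi_add Bi_cmult bk bff)
 have bY: "Bi (%x. (norm (Y x))^2)" by (rule Bi_bound[OF bb]) (use Yb in auto)
 have bgY: "Bi (%x. g x \<bullet> Y x)"
 proof (rule Bi_bound[OF Bi_add[OF bg bY]])
  fix x
  have "abs (g x \<bullet> Y x) <= norm (g x) * norm (Y x)" by (rule Cauchy_Schwarz_ineq2)
  also have "... <= (norm (g x))^2 + (norm (Y x))^2"
   using zero_le_power2[of "norm (g x) - norm (Y x)"] mult_nonneg_nonneg[OF norm_ge_zero[of "g x"] norm_ge_zero[of "Y x"]]
   unfolding power2_diff by linarith
  finally show "abs (g x \<bullet> Y x) <= (norm (g x))^2 + (norm (Y x))^2" .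
 qed measurable
 have "Bint (%x. (norm (Z x))^2) = Bint (%x. (norm (g x))^2 + ((- 2 * \<epsilon>) * (g x \<bullet> Y x) + \<epsilon>\<^sup>2 * (norm (Y x))^2))"
  unfolding ZY by (rule Bint_cong) (simp add: power2_norm_eq_inner inner_diff_left inner_diff_right inner_commute[of "Y _" "g _"] power2_eq_square[of \<epsilon>] algebra_simps)
 also have "... = Bint (%x. (norm (g x))^2) + ((- 2 * \<epsilon>) * Bint (%x. g x \<bullet> Y x) + \<epsilon>\<^sup>2 * Bint (%x. (norm (Y x))^2))"
  by (simp only: Bint_add[OF bg Bi_add[OF Bi_cmult[OF bgY] Bi_cmult[OF bY]]] Bint_add[OF Bi_cmult[OF bgY] Bi_cmult[OF bY]] Bint_cmult)
 also have "Bint (%x. g x \<bullet> Y x) = 2 / ?d * bf v g f k"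
  using hsob_radial_test[OF v f] by (simp add: Y_def)
 finally have E: "Bint (%x. (norm (Z x))^2) - 3/2 * (DIM('a) + 3) * Bint (%x. (v x)^2)
   = bf v g v g - 4 * \<epsilon> / ?d * bf v g f k + \<epsilon>\<^sup>2 * Bint (%x. (norm (Y x))^2)"
  by (simp add: bf_self algebra_simps)
 have B2: "bf v g f k = bf v g v g - bf v g H G"
  using bf_lin_right[OF v H v, of 1 "-1"] by (simp add: f_def[abs_def] k_def[abs_def])
 have B3: "bf f k f k = bf v g v g - 2 * bf v g H G + bf H G H G"
  using bf_lin[OF v H f, of 1 "-1"] bf_lin_right[OF v H v, of 1 "-1"] bf_lin_right[OF v H H, of 1 "-1"]
  by (simp add: f_def[abs_def] k_def[abs_def] bf_sym[of H G v g])
 have gap: "2 * ?d * Bint (%x. (f x)^2) <= Bint (%x. (norm (k x))^2)"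
 proof -
  have "f = (%x. v x - H x)" by (simp add: f_def fun_eq_iff)
  then show ?thesis using hsob_gap[OF f] z by simp
 qed
 define K where "K = Bint (%x. (norm (k x))^2)"
 define F where "F = Bint (%x. (f x)^2)"
 have K0: "K >= 0" "F >= 0" unfolding K_def F_def by (auto intro: Bint_nonneg)
 have gap': "2 * (?d * F) <= K" using gap unfolding K_def F_def mult.assoc .
 have "Bint (%x. (norm (Y x))^2) <= Bint (%x. 2 * (norm (k x))^2 + 8 * (f x)^2)" by (rule Bint_mono[OF bY bb Yb])
 also have "... = 2 * K + 8 * F"
  unfolding K_def F_def by (simp only: Bint_add[OF Bi_cmult[OF bk] Bi_cmult[OF bff]] Bint_cmult)
 \<comment> \<open>As n + 3 \<ge> 4, the gap 2 (n + 3) F \<le> K contains 8 F \<le> K.\<close>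
 also have "... <= 3 * K"
  using gap' mult_right_mono[OF d K0(2)] by linarith
 finally have Y3: "Bint (%x. (norm (Y x))^2) <= 3 * K" .
 \<comment> \<open>The gap gives 3/2 (n + 3) F \<le> 3/4 K, so a quarter of the Dirichlet energy
   survives in \<open>bf\<close>.\<close>
 have fk: "bf f k f k >= K / 4"
  using gap' unfolding bf_self K_def[symmetric] F_def[symmetric] of_nat_add of_nat_numeral mult.assoc by linarith
 define c where "c = 2 * \<epsilon> / ?d"
 have c0: "c > 0" using e0 d by (simp add: c_def)
 \<comment> \<open>The origin of \<epsilon>: the error 3 \<epsilon>^2 K and the gain c K/4 balance
   exactly when \<epsilon> = 1/(6 (n + 3)).\<close>
 have ec: "3 * \<epsilon>\<^sup>2 = c / 4"
 proof -
  have "3 * (1 / (6 * D))^2 = 2 * (1 / (6 * D)) / D / 4" if "D > 0" for D :: real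
   using that by (simp add: power2_eq_square)
  from this[of ?d] show ?thesis using d unfolding c_def e by simp
 qed
 have "4 * \<epsilon> / ?d * bf v g f k = c * (2 * bf v g f k)" by (simp add: c_def)
 \<comment> \<open>Polarization with f = v - H: twice the mixed form is the form of v plus that of f
   minus that of H.\<close>
 also have "2 * bf v g f k = bf v g v g + bf f k f k - bf H G H G" using B2 B3 by simp
 finally have "bf v g v g - 4 * \<epsilon> / ?d * bf v g f k + \<epsilon>\<^sup>2 * Bint (%x. (norm (Y x))^2)
  = (1 - c) * bf v g v g - c * bf f k f k + c * bf H G H G + \<epsilon>\<^sup>2 * Bint (%x. (norm (Y x))^2)"
  by (simp add: algebra_simps)
 also have "... <= (1 - c) * bf v g v g - c * (K / 4) + 0 + \<epsilon>\<^sup>2 * (3 * K)"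
  using c0 by (intro add_mono diff_mono mult_left_mono fk Y3 order_refl mult_nonneg_nonpos Q) auto
 also have "\<epsilon>\<^sup>2 * (3 * K) = c / 4 * K" unfolding ec[symmetric] by simp
 finally show ?thesis unfolding E c_def by simp
qed

theorem theorem6p3:
  fixes i :: "'m::finite"
  shows "\<exists>\<kappa>::real. \<exists>\<theta>::real. 0 < \<kappa> \<and> \<kappa> < 1 \<and> 0 < \<theta> \<and> \<theta> < 1 \<and>
    (\<forall>w :: (real^'m) \<times> real \<Rightarrow> real.
       w \<in> W12 B1 \<longrightarrow>
       homogeneous_on_B1 (3/2) w \<longrightarrow>
       (AE x in thin_ball_measure. sobolev_trace B1 thin_ball_measure w x \<ge> 0) \<longrightarrow>
       W12_norm B1 (\<lambda>x. w x - h_fun i x) \<le> \<theta> \<longrightarrow>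
       (\<exists>\<zeta> \<in> W12 B1.
          (AE x in S1_measure. sobolev_trace B1 S1_measure \<zeta> x = sobolev_trace B1 S1_measure w x) \<and>
          (AE x in thin_ball_measure. sobolev_trace B1 thin_ball_measure \<zeta> x \<ge> 0) \<and>
          W_energy \<zeta> \<le> (1 - \<kappa>) * W_energy w))"
proof -
 let ?d = "real DIM((real^'m) \<times> real) + 3"
 have d: "?d >= 4" using DIM_positive[where 'a="(real^'m) \<times> real"] by linarith
 \<comment> \<open>The constants are fixed before \<open>w\<close> is introduced; \<kappa> is the
   factor \<open>c\<close> of the energy estimate, with \<open>?d\<close> equal to n + 3 for the
   ambient dimension n.\<close>
 define \<epsilon> where "\<epsilon> = 1 / (6 * ?d)"
 define \<kappa> where "\<kappa> = 2 * \<epsilon> / ?d"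
 have e0: "0 < \<epsilon>" "\<epsilon> < 1" using d by (auto simp: \<epsilon>_def divide_less_eq)
 have k0: "0 < \<kappa>" "\<kappa> < 1" using d e0 by (auto simp: \<kappa>_def divide_less_eq)
 have "\<exists>\<zeta> \<in> W12 B1.
     (AE x in S1_measure. sobolev_trace B1 S1_measure \<zeta> x = sobolev_trace B1 S1_measure w x) \<and>
     (AE x in thin_ball_measure. sobolev_trace B1 thin_ball_measure \<zeta> x >= 0) \<and>
     W_energy \<zeta> <= (1 - \<kappa>) * W_energy w"
  if w: "w \<in> W12 B1" and hw: "homogeneous_on_B1 (3/2) w"
   and pos: "AE x in thin_ball_measure. sobolev_trace B1 thin_ball_measure w x >= 0" for w :: "(real^'m) \<times> real => real"
 proof -
  let ?S = "S1_measure :: ((real^'m) \<times> real) measure" and ?T = "thin_ball_measure :: ((real^'m) \<times> real) measure"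
  obtain v0 g0 where "sob_rep w v0 g0" using W12_imp_sob_rep[OF w] by blast
  from homogeneous_extension[OF this hw[unfolded homogeneous_on_B1_def]]
  obtain v g where v: "hsob v g" and r: "sob_rep w v g" by blast
  have pv: "sob_pair R v g" for R using v by (simp add: hsob_def)
  define n :: "(real^'m) \<times> real" where "n = (0, 1)"
  \<comment> \<open>Only a fallback unit vector in the thin space, for the case that the tangential
    moment of \<open>v\<close> vanishes.\<close>
  define e :: "(real^'m) \<times> real" where "e = (axis i 1, 0)"
  have ne: "norm n = 1" "norm e = 1" "e \<bullet> n = 0" by (auto simp: n_def e_def norm_Pair norm_axis_1)
  obtain H G where H: "hsob H G" "continuous_on UNIV H" "!!x. x \<bullet> n = 0 ==> H x >= 0" "bf H G H G <= 0"
   "Bint (%x. v x - H x) = 0" "!!b. b \<in> Basis ==> Bint (%x. (x \<bullet> b) * (v x - H x)) = 0"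
   using comparison_exists[OF ne(1) ne(2) ne(3) v] by blast
  have pH: "sob_pair R H G" for R using H(1) by (simp add: hsob_def)
  define \<sigma> where "\<sigma> x = \<epsilon> * (1 - (norm x)^2)" for x :: "(real^'m) \<times> real"
  have s: "smooth \<sigma>" "smooth (%x. 1 - \<sigma> x)"
   unfolding \<sigma>_def[abs_def] by (intro smooth_diff smooth_mult smooth_const smooth_norm2)+
  define \<zeta> where "\<zeta> x = (1 - \<sigma> x) * v x + \<sigma> x * H x" for x
  define Z where "Z x = ((1 - \<sigma> x) *\<^sub>R g x + v x *\<^sub>R grad (%x. 1 - \<sigma> x) x) + (\<sigma> x *\<^sub>R G x + H x *\<^sub>R grad \<sigma> x)" for x
  have p\<zeta>: "sob_pair R \<zeta> Z" for R unfolding \<zeta>_def[abs_def] Z_def[abs_def] by (rule sob_pair_smooth_comb[OF pv pH s(2,1)])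
  have r\<zeta>: "sob_rep \<zeta> \<zeta> Z" by (rule sob_rep_self[OF p\<zeta>])
  have ex: "has_trace B1 M u (sobolev_trace B1 M u)" if "trace_measure M C" "sob_rep u a b" "!!R. sob_pair R a b"
   for M :: "((real^'m) \<times> real) measure" and C u a b
   using smooth_approx[OF that(3)] trace_exists[OF that(1,2)] by blast
  have tr: "has_trace B1 M v \<gamma>" if "has_trace B1 M w \<gamma>" for M \<gamma>
   using that unfolding has_trace_iff[OF r] has_trace_iff[OF sob_rep_self[OF pv]] .
  \<comment> \<open>Taking traces commutes with the smooth coefficients 1 - \<sigma> and \<sigma>;
    one statement serves the sphere, where \<sigma> = 0, and the thin ball.\<close>
  have comb: "AE x in M. sobolev_trace B1 M \<zeta> x = (1 - \<sigma> x) * sobolev_trace B1 M w x + \<sigma> x * eta x"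
   if M: "trace_measure M C" and AE: "AE x in M. norm x <= 1" and eta: "has_trace B1 M H eta" for M C eta
  proof (rule trace_unique[OF M r\<zeta> ex[OF M r\<zeta> p\<zeta>]])
   show "has_trace B1 M \<zeta> (%x. (1 - \<sigma> x) * sobolev_trace B1 M w x + \<sigma> x * eta x)"
    unfolding \<zeta>_def[abs_def] by (rule has_trace_smooth_comb[OF M AE pv pH tr[OF ex[OF M r pv]] eta s(2,1)])
  qed
  have S1: "AE x in ?S. norm x <= 1" using AE_sphere_measure by eventually_elim simp
  have T1: "AE x in ?T. norm x <= 1" using AE_thin_measure by eventually_elim simp
  have T2: "AE x in ?T. norm x < 1" using AE_thin_measure by eventually_elim simp
  have trS: "AE x in ?S. sobolev_trace B1 ?S \<zeta> x = sobolev_trace B1 ?S w x"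
   using comb[OF sphere_trace_measure S1 ex[OF sphere_trace_measure sob_rep_self[OF pH] pH]] AE_sphere_measure
   by eventually_elim (simp add: \<sigma>_def)
  moreover have "AE x in ?T. sobolev_trace B1 ?T \<zeta> x >= 0"
   using comb[OF thin_trace_measure T1 has_trace_continuous[OF thin_trace_measure sets_thin_measure T2 pH H(2)]] AE_thin_measure pos
  proof eventually_elim
   case (elim x)
   have n1: "(norm x)^2 <= 1" using elim by (simp add: power_le_one)
   \<comment> \<open>On the thin ball the weights 1 - \<sigma> and \<sigma> lie in [0, 1], so the
     trace is a convex combination of two nonnegative values.\<close>
   have "0 <= \<sigma> x" unfolding \<sigma>_def using n1 e0 by (intro mult_nonneg_nonneg) auto
   moreover have "\<sigma> x <= 1 * 1" unfolding \<sigma>_def using n1 e0 by (intro mult_mono) auto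
   moreover have "H x >= 0" using elim by (intro H(3)) (simp add: n_def inner_prod_def)
   ultimately show ?case using elim by simp
  qed
  moreover have "W_energy \<zeta> <= (1 - \<kappa>) * W_energy w"
  proof -
   have tw: "has_trace B1 ?S w (sobolev_trace B1 ?S w)" by (rule ex[OF sphere_trace_measure r pv])
   have t\<zeta>: "has_trace B1 ?S \<zeta> (sobolev_trace B1 ?S \<zeta>)" by (rule ex[OF sphere_trace_measure r\<zeta> p\<zeta>])
   have Iw: "(\<integral>x. (sobolev_trace B1 ?S w x)^2 \<partial>?S) = ?d * Bint (%x. (v x)^2)"
    using hsob_sphere_trace[OF v r tw] by simp
   \<comment> \<open>The competitor is not homogeneous, so its boundary integral is taken from
     \<open>w\<close>, whose trace it shares and for which the sphere identity is available.\<close>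
   have "(\<integral>x. (sobolev_trace B1 ?S \<zeta> x)^2 \<partial>?S) = (\<integral>x. (sobolev_trace B1 ?S w x)^2 \<partial>?S)"
   proof (rule integral_cong_AE)
    show "(%x. (sobolev_trace B1 ?S \<zeta> x)^2) \<in> borel_measurable ?S" "(%x. (sobolev_trace B1 ?S w x)^2) \<in> borel_measurable ?S"
     using tw t\<zeta> unfolding has_trace_def L2_real_iff by (auto intro: borel_measurable_power)
   qed (use trS in \<open>auto elim: eventually_mono\<close>)
   then have W\<zeta>: "W_energy \<zeta> = Bint (%x. (norm (Z x))^2) - 3/2 * ?d * Bint (%x. (v x)^2)"
    unfolding W_energy_def sob_rep_W12(3)[OF r\<zeta>] Iw by (simp add: Bint_def)
   have Ww: "W_energy w = bf v g v g"
    unfolding W_energy_def sob_rep_W12(3)[OF r] Iw bf_self by (simp add: Bint_def)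
   show ?thesis unfolding W\<zeta> Ww \<kappa>_def
    using competitor_energy[OF v H(1) H(4) H(5) H(6) _ \<sigma>_def, folded Z_def] by (simp add: \<epsilon>_def)
  qed
  ultimately show ?thesis using sob_rep_W12(1)[OF r\<zeta>] by blast
 qed
 then show ?thesis using k0 by (intro exI[of _ \<kappa>] exI[of _ "1/2"]) auto
qed

end
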